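(* Let $(\mathcal{Y},\mathcal{B}_{\mathcal{Y}})$ be a measurable space, $S=\mathcal{Y}\times(0,\infty)$, $\mathcal{B}=\mathcal{B}_{\mathcal{Y}}\otimes\mathcal{B}_+$ with $\mathcal{B}_+$ the Borel $\sigma$-field on $(0,\infty)$, and let $X_n=(Y_n,Z_n)$ be the $n$th canonical projection on $(S^\infty,\mathcal{B}^\infty)$. Let $P$ be a probability on $\mathcal{B}^\infty$ such that, for some constant $\alpha>0$ and all $B\in\mathcal{B}_{\mathcal{Y}}$, $C\in\mathcal{B}_+$, $$P(Y_{n+1}\in B\mid\mathcal{G}_n)=\frac{\alpha P(Y_1\in B)+\sum_{i=1}^n Z_i I_B(Y_i)}{\alpha+\sum_{i=1}^n Z_i}\quad\text{a.s., } n\ge1,$$ $$P(Z_{n+1}\in C\mid X_1,\ldots,X_n,Y_{n+1})=P(Z_1\in C)\quad\text{a.s., } n\ge0,$$ and such that $a\le Z_1\le b$ a.s. for some constants $0<a<b$. Let $B_1,B_2,\ldots\in\mathcal{B}_{\mathcal{Y}}$ be pairwise disjoint and $\mathcal{D}=\{B_k\times(0,\infty):k\ge1\}$. Then $$\sup_n E\|W_n\|^2\le c\,\sqrt{P\Big(Y_1\in\bigcup_k B_k\Big)}$$ for some constant $c$ independent of the $B_k$, and $C_n\to M$ stably in the metric space $l^\infty(\mathcal{D})$. In particular, $\|C_n\|\to N$ stably. Here $M$ and $N$ are the random probability measures on $l^\infty(\mathcal{D})$ and on $\mathbb{R}$, respectively, defined in the context.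
   Context: $\mathcal{G}_n=\sigma(X_1,\ldots,X_n)$, and $E$, $\mathrm{var}$ refer to $P$. For $B\in\mathcal{B}_{\mathcal{Y}}$, a quantity evaluated at $B$ means the quantity evaluated at $B\times(0,\infty)$: $\mu_n(B)=\frac1n\sum_{i=1}^n I_B(Y_i)$; $a_n(B)=P(Y_{n+1}\in B\mid\mathcal{G}_n)$, taken to be the version given by the explicit formula in the hypothesis; $\mu(B)=\limsup_n\mu_n(B)$; $W_n(B)=\sqrt{n}\{\mu_n(B)-\mu(B)\}$; $C_n(B)=\sqrt{n}\{\mu_n(B)-a_n(B)\}$. $\|W_n\|=\sup_{k}|W_n(B_k)|$ and $\|C_n\|=\sup_k|C_n(B_k)|$. $l^\infty(\mathcal{D})$ is the space of bounded real functions on $\mathcal{D}$ with the uniform distance, and $C_n$ is regarded as a map $S^\infty\to l^\infty(\mathcal{D})$. Definition of $M$ and $N$. Let $T_0=0$, $T_k=\sum_{i=1}^k\mu(B_i)$ (for $P$-almost every $\omega$, $T_k(\omega)\in[0,1]$ for all $k$; the definitions below may be made arbitrarily on the exceptional null set). Let $G$ be a standard Brownian bridge on $[0,1]$ with continuous paths, on some probability space $(\Omega_0,\mathcal{A}_0,P_0)$. For fixed $\omega\in S^\infty$, let $$L(\omega,B_k)=\frac{\sqrt{\mathrm{var}(Z_1)}}{EZ_1}\{G(T_k(\omega))-G(T_{k-1}(\omega))\},$$ a real random variable on $(\Omega_0,\mathcal{A}_0,P_0)$; $L(\omega,B_k)\to0$ as $k\to\infty$. Let $L(\omega)=(L(\omega,B_1),L(\omega,B_2),\ldots)$,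 viewed as a random element of $l^\infty(\mathcal{D})$. Define $M(\omega,A)=P_0(L(\omega)\in A)$ for Borel $A\subset l^\infty(\mathcal{D})$ and $N(\omega,A)=P_0(\sup_{k\ge1}|L(\omega,B_k)|\in A)$ for Borel $A\subset\mathbb{R}$. Stable convergence: for a metric space $T$ and a random probability measure $K$ on $T$ defined on $(\Omega,\mathcal{A},P)$ (i.e. $K(\omega,\cdot)$ is a Borel probability on $T$ for each $\omega$ and $K(\cdot,A)$ is $\mathcal{A}$-measurable for each Borel $A$), $T$-valued random variables $V_n$ converge stably to $K$ if $P(V_n\in\cdot\mid H)\to E(K(\cdot)\mid H)$ weakly for every $H\in\mathcal{A}$ with $P(H)>0$. *)

theory Defs
  imports "HOL-Probability.Probability"
begin

definition metric_borel :: "'a metric \<Rightarrow> 'a measure" where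
  "metric_borel m = sigma (mspace m) {U. openin (mtopology_of m) U}"

lemma space_metric_borel [simp]: "space (metric_borel m) = mspace m"
  unfolding metric_borel_def by (rule space_measure_of) (use openin_subset in fastforce)

lemma sets_metric_borel_euclidean: "sets (metric_borel euclidean_metric) = sets borel"
  by (simp add: metric_borel_def borel_def)

text \<open>The library's \<open>weak_conv\<close> is for the real line only.\<close>

definition weak_conv_metric :: "'a metric \<Rightarrow> (nat \<Rightarrow> 'a measure) \<Rightarrow> 'a measure \<Rightarrow> bool" where
  "weak_conv_metric m Q R \<longleftrightarrow>
     (\<forall>f. continuous_map (mtopology_of m) euclideanreal f \<and> bounded (f ` mspace m)
        \<longrightarrow> (\<lambda>n. \<integral>x. f x \<partial>(Q n)) \<longlonglongrightarrow> (\<integral>x. f x \<partial>R))"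

text \<open>Measurability into \<^const>\<open>prob_algebra\<close> says exactly that every \<open>K \<omega>\<close> is a Borel probability
  measure and that \<open>\<omega> \<mapsto> K \<omega> A\<close> is measurable for every Borel set \<open>A\<close>.\<close>

definition random_prob :: "'a measure \<Rightarrow> 'b metric \<Rightarrow> ('a \<Rightarrow> 'b measure) \<Rightarrow> bool" where
  "random_prob P m K \<longleftrightarrow> K \<in> P \<rightarrow>\<^sub>M prob_algebra (metric_borel m)"

text \<open>Here \<^term>\<open>uniform_measure P H\<close> is \<open>P(\<cdot> | H)\<close>, and
  \<^term>\<open>uniform_measure P H \<bind> K\<close> is the averaged measure \<open>A \<mapsto> E(K(A) | H)\<close>.
  The random variables and the random probability measure are required to be such.\<close>

definition stable_conv ::
    "'b metric \<Rightarrow> 'a measure \<Rightarrow> (nat \<Rightarrow> 'a \<Rightarrow> 'b) \<Rightarrow> ('a \<Rightarrow> 'b measure) \<Rightarrow> bool" where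
  "stable_conv m P V K \<longleftrightarrow>
     (\<forall>n. V n \<in> P \<rightarrow>\<^sub>M metric_borel m) \<and>
     random_prob P m K \<and>
     (\<forall>H\<in>sets P. measure P H > 0 \<longrightarrow>
        weak_conv_metric m
          (\<lambda>n. distr (uniform_measure P H) (metric_borel m) (V n))
          (uniform_measure P H \<bind> K))"

lemma random_prob_iff:
  "random_prob P m K \<longleftrightarrow>
    (\<forall>\<omega>\<in>space P. prob_space (K \<omega>) \<and> sets (K \<omega>) = sets (metric_borel m)) \<and>
    (\<forall>A\<in>sets (metric_borel m). (\<lambda>\<omega>. measure (K \<omega>) A) \<in> borel_measurable P)"
proof (intro iffI conjI ballI; (elim conjE)?)
  assume "random_prob P m K"
  then have K: "K \<in> P \<rightarrow>\<^sub>M prob_algebra (metric_borel m)" by (simp add: random_prob_def)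
  show "prob_space (K \<omega>)" "sets (K \<omega>) = sets (metric_borel m)" if "\<omega> \<in> space P" for \<omega>
    using measurable_space[OF K that] by (auto simp: space_prob_algebra)
  show "(\<lambda>\<omega>. measure (K \<omega>) A) \<in> borel_measurable P" if "A \<in> sets (metric_borel m)" for A
    using measurable_compose[OF K measurable_measure_prob_algebra[OF that]] .
next
  assume *: "\<forall>\<omega>\<in>space P. prob_space (K \<omega>) \<and> sets (K \<omega>) = sets (metric_borel m)"
    and **: "\<forall>A\<in>sets (metric_borel m). (\<lambda>\<omega>. measure (K \<omega>) A) \<in> borel_measurable P"
  have "K \<in> P \<rightarrow>\<^sub>M subprob_algebra (metric_borel m)"
  proof (rule measurable_subprob_algebra)
    fix A assume "A \<in> sets (metric_borel m)"
    then have "(\<lambda>\<omega>. ennreal (measure (K \<omega>) A)) \<in> borel_measurable P" using ** by simp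
    moreover have "ennreal (measure (K \<omega>) A) = emeasure (K \<omega>) A" if "\<omega> \<in> space P" for \<omega>
      using * that by (simp add: finite_measure.emeasure_eq_measure prob_space.finite_measure)
    ultimately show "(\<lambda>\<omega>. emeasure (K \<omega>) A) \<in> borel_measurable P"
      by (simp cong: measurable_cong)
  qed (use * in \<open>auto intro: prob_space_imp_subprob_space\<close>)
  then show "random_prob P m K"
    unfolding random_prob_def using * by (intro measurable_prob_algebraI) auto
qed

definition linf :: "'c set \<Rightarrow> ('c \<Rightarrow> real) metric" where
  "linf D = metric (Metric_space.fspace UNIV dist D, Metric_space.fdist UNIV dist D)"

lemma mspace_linf: "mspace (linf D) = {f \<in> extensional D. bounded (f ` D)}"
  unfolding linf_def Metric_space.mspace_metric[OF Met_TC.Metric_space_funspace]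
  by (auto simp: Met_TC.fspace_def)

lemma mdist_linf:
  assumes "f \<in> mspace (linf D)" "g \<in> mspace (linf D)" "D \<noteq> {}"
  shows "mdist (linf D) f g = (SUP x\<in>D. \<bar>f x - g x\<bar>)"
  using assms unfolding linf_def Metric_space.mspace_metric[OF Met_TC.Metric_space_funspace]
    Metric_space.mdist_metric[OF Met_TC.Metric_space_funspace]
  by (simp add: Met_TC.fdist_def dist_real_def)

text \<open>Constants count as (degenerate) Gaussian variables.\<close>

definition gaussian_var :: "'w measure \<Rightarrow> ('w \<Rightarrow> real) \<Rightarrow> bool" where
  "gaussian_var Q V \<longleftrightarrow> V \<in> borel_measurable Q \<and>
     (\<exists>m. (AE w in Q. V w = m) \<or>
          (\<exists>s>0. distributed Q lborel V (\<lambda>x. ennreal (normal_density m s x))))"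

definition brownian_bridge :: "'w measure \<Rightarrow> (real \<Rightarrow> 'w \<Rightarrow> real) \<Rightarrow> bool" where
  "brownian_bridge Q G \<longleftrightarrow>
     (\<forall>t\<in>{0..1}. G t \<in> borel_measurable Q) \<and>
     (\<forall>F c. finite F \<and> F \<subseteq> {0..1} \<longrightarrow> gaussian_var Q (\<lambda>w. \<Sum>t\<in>F. c t * G t w)) \<and>
     (\<forall>t\<in>{0..1}. (\<integral>w. G t w \<partial>Q) = 0) \<and>
     (\<forall>s\<in>{0..1}. \<forall>t\<in>{0..1}. (\<integral>w. G s w * G t w \<partial>Q) = min s t - s * t) \<and>
     (\<forall>w\<in>space Q. continuous_on {0..1} (\<lambda>t. G t w))"

type_synonym 'y traj = "nat \<Rightarrow> 'y \<times> real"

text \<open>The sequences are indexed by \<open>1, 2, \<dots>\<close>.\<close>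

definition state_space :: "'y measure \<Rightarrow> ('y \<times> real) measure" where
  "state_space MY = MY \<Otimes>\<^sub>M restrict_space borel {0<..}"

definition traj_space :: "'y measure \<Rightarrow> 'y traj measure" where
  "traj_space MY = (\<Pi>\<^sub>M i\<in>{1..}. state_space MY)"

definition X :: "nat \<Rightarrow> 'y traj \<Rightarrow> 'y \<times> real" where "X n \<omega> = \<omega> n"
definition Y :: "nat \<Rightarrow> 'y traj \<Rightarrow> 'y" where "Y n \<omega> = fst (X n \<omega>)"
definition Z :: "nat \<Rightarrow> 'y traj \<Rightarrow> real" where "Z n \<omega> = snd (X n \<omega>)"

definition past_events :: "'y measure \<Rightarrow> nat \<Rightarrow> 'y traj set set" where
  "past_events MY n =
     (\<Union>i\<in>{1..n}. {X i -` A \<inter> space (traj_space MY) | A. A \<in> sets (state_space MY)})"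

text \<open>\<open>\<sigma>(X\<^sub>1, \<dots>, X\<^sub>n)\<close> and \<open>\<sigma>(X\<^sub>1, \<dots>, X\<^sub>n, Y\<^sub>n\<^sub>+\<^sub>1)\<close>; \<open>n = 0\<close> is allowed.\<close>

definition past :: "'y measure \<Rightarrow> nat \<Rightarrow> 'y traj measure" where
  "past MY n = sigma (space (traj_space MY)) (past_events MY n)"

definition past_Y :: "'y measure \<Rightarrow> nat \<Rightarrow> 'y traj measure" where
  "past_Y MY n = sigma (space (traj_space MY))
     (past_events MY n \<union> {Y (Suc n) -` B \<inter> space (traj_space MY) | B. B \<in> sets MY})"

lemma measurable_X [measurable]: "n \<ge> 1 \<Longrightarrow> X n \<in> traj_space MY \<rightarrow>\<^sub>M state_space MY"
  unfolding X_def traj_space_def by measurable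

lemma measurable_Y [measurable]: "n \<ge> 1 \<Longrightarrow> Y n \<in> traj_space MY \<rightarrow>\<^sub>M MY"
  unfolding Y_def using measurable_compose[OF measurable_X, of n fst MY MY]
  by (simp add: state_space_def)

lemma past_events_sets: "past_events MY n \<subseteq> sets (traj_space MY)"
  by (auto simp: past_events_def intro: measurable_sets[OF measurable_X])

lemma subalgebra_past:
  assumes "sets P = sets (traj_space MY)"
  shows "subalgebra P (past MY n)" and "subalgebra P (past_Y MY n)"
proof -
  have sp: "space P = space (traj_space MY)" using assms by (rule sets_eq_imp_space_eq)
  have Ysub: "{Y (Suc n) -` B \<inter> space (traj_space MY) | B. B \<in> sets MY} \<subseteq> sets (traj_space MY)"
    by (auto intro: measurable_sets[OF measurable_Y])
  note E = past_events_sets[of MY n]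
  note Pow = E[THEN subset_trans, OF sets.space_closed] 
     Ysub[THEN subset_trans, OF sets.space_closed]
  show "subalgebra P (past MY n)"
    unfolding subalgebra_def past_def sp assms using Pow
    by (simp add: sets.sigma_sets_subset[OF E])
  show "subalgebra P (past_Y MY n)"
    unfolding subalgebra_def past_Y_def sp assms using Pow E Ysub
    by (simp add: sets.sigma_sets_subset)
qed

text \<open>The quantities below are evaluated at \<open>B \<subseteq> \<Y>\<close>, standing for \<open>B \<times> (0,\<infinity>)\<close>.\<close>

definition emp :: "nat \<Rightarrow> 'y set \<Rightarrow> 'y traj \<Rightarrow> real" where
  "emp n B \<omega> = (\<Sum>i=1..n. indicator B (Y i \<omega>)) / real n"

definition pred :: "real \<Rightarrow> 'y traj measure \<Rightarrow> nat \<Rightarrow> 'y set \<Rightarrow> 'y traj \<Rightarrow> real" where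
  "pred \<alpha> P n B \<omega> =
     (\<alpha> * measure P {\<omega>'\<in>space P. Y 1 \<omega>' \<in> B} + (\<Sum>i=1..n. Z i \<omega> * indicator B (Y i \<omega>)))
     / (\<alpha> + (\<Sum>i=1..n. Z i \<omega>))"

text \<open>The upper limit is finite, as the empirical frequencies lie in \<open>[0,1]\<close>.\<close>

definition emp_lim :: "'y set \<Rightarrow> 'y traj \<Rightarrow> real" where
  "emp_lim B \<omega> = real_of_ereal (limsup (\<lambda>n. ereal (emp n B \<omega>)))"

definition W :: "nat \<Rightarrow> 'y set \<Rightarrow> 'y traj \<Rightarrow> real" where
  "W n B \<omega> = sqrt (real n) * (emp n B \<omega> - emp_lim B \<omega>)"

definition C :: "real \<Rightarrow> 'y traj measure \<Rightarrow> nat \<Rightarrow> 'y set \<Rightarrow> 'y traj \<Rightarrow> real" where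
  "C \<alpha> P n B \<omega> = sqrt (real n) * (emp n B \<omega> - pred \<alpha> P n B \<omega>)"

definition W_norm :: "(nat \<Rightarrow> 'y set) \<Rightarrow> nat \<Rightarrow> 'y traj \<Rightarrow> real" where
  "W_norm B n \<omega> = (SUP k\<in>{1..}. \<bar>W n (B k) \<omega>\<bar>)"

definition C_norm :: "real \<Rightarrow> 'y traj measure \<Rightarrow> (nat \<Rightarrow> 'y set) \<Rightarrow> nat \<Rightarrow> 'y traj \<Rightarrow> real" where
  "C_norm \<alpha> P B n \<omega> = (SUP k\<in>{1..}. \<bar>C \<alpha> P n (B k) \<omega>\<bar>)"

definition cylinders :: "(nat \<Rightarrow> 'y set) \<Rightarrow> ('y \<times> real) set set" where
  "cylinders B = (\<lambda>k. B k \<times> {0<..}) ` {1..}"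

text \<open>For \<open>D = A \<times> (0,\<infinity>)\<close> the set \<open>A\<close> is recovered as \<^term>\<open>fst ` D\<close>.\<close>

definition C_proc ::
    "real \<Rightarrow> 'y traj measure \<Rightarrow> (nat \<Rightarrow> 'y set) \<Rightarrow> nat \<Rightarrow> 'y traj \<Rightarrow> ('y \<times> real) set \<Rightarrow> real" where
  "C_proc \<alpha> P B n \<omega> = (\<lambda>D\<in>cylinders B. C \<alpha> P n (fst ` D) \<omega>)"

text \<open>For pairwise disjoint \<open>B\<^sub>i\<close>, the partial sums are at most 1 almost surely; truncating them
  at 1 fixes the definition on the exceptional null set, in a measurable way.\<close>

definition T :: "(nat \<Rightarrow> 'y set) \<Rightarrow> nat \<Rightarrow> 'y traj \<Rightarrow> real" where
  "T B k \<omega> = min 1 (\<Sum>i=1..k. emp_lim (B i) \<omega>)"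

definition L ::
    "'y traj measure \<Rightarrow> (nat \<Rightarrow> 'y set) \<Rightarrow> (real \<Rightarrow> 'w \<Rightarrow> real) \<Rightarrow> 'y traj \<Rightarrow> nat \<Rightarrow> 'w \<Rightarrow> real" where
  "L P B G \<omega> k w =
     sqrt (prob_space.variance P (Z 1)) / prob_space.expectation P (Z 1)
     * (G (T B k \<omega>) w - G (T B (k - 1) \<omega>) w)"

text \<open>A cylinder determines its index unless it is empty. If several \<open>B\<^sub>k\<close> are empty, then
  \<open>T\<^sub>k = T\<^sub>k\<^sub>-\<^sub>1\<close> and \<open>L(\<omega>, B\<^sub>k) = 0\<close> for each of them, so that the choice of index is immaterial.\<close>

definition L_proc ::
    "'y traj measure \<Rightarrow> (nat \<Rightarrow> 'y set) \<Rightarrow> (real \<Rightarrow> 'w \<Rightarrow> real) \<Rightarrow> 'y traj \<Rightarrow> 'w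
       \<Rightarrow> ('y \<times> real) set \<Rightarrow> real" where
  "L_proc P B G \<omega> w =
     (\<lambda>D\<in>cylinders B. L P B G \<omega> (inv_into {1..} (\<lambda>k. B k \<times> {0<..}) D) w)"

definition M_kernel ::
    "'y traj measure \<Rightarrow> (nat \<Rightarrow> 'y set) \<Rightarrow> 'w measure \<Rightarrow> (real \<Rightarrow> 'w \<Rightarrow> real) \<Rightarrow> 'y traj
       \<Rightarrow> (('y \<times> real) set \<Rightarrow> real) measure" where
  "M_kernel P B P0 G \<omega> = distr P0 (metric_borel (linf (cylinders B))) (L_proc P B G \<omega>)"

definition N_kernel ::
    "'y traj measure \<Rightarrow> (nat \<Rightarrow> 'y set) \<Rightarrow> 'w measure \<Rightarrow> (real \<Rightarrow> 'w \<Rightarrow> real) \<Rightarrow> 'y traj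
       \<Rightarrow> real measure" where
  "N_kernel P B P0 G \<omega> = distr P0 borel (\<lambda>w. SUP k\<in>{1..}. \<bar>L P B G \<omega> k w\<bar>)"

lemma emp_lim_empty: "emp_lim {} \<omega> = 0"
  by (simp add: emp_lim_def emp_def Limsup_const zero_ereal_def[symmetric])

lemma L_proc_cylinder:
  assumes "disjoint_family_on B {1..}" and "k \<ge> 1"
  shows "L_proc P B G \<omega> w (B k \<times> {0<..}) = L P B G \<omega> k w"
proof -
  let ?h = "\<lambda>k. B k \<times> {0::real<..}"
  let ?j = "inv_into {1..} ?h (?h k)"
  have "?h k \<in> ?h ` {1..}" using assms(2) by auto
  then have j: "?j \<in> {1..}" "?h ?j = ?h k"
    by (rule inv_into_into, rule f_inv_into_f)
  have ne: "{0::real<..} \<noteq> {}" by (simp add: greaterThan_non_empty)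
  from j(2) have eq: "B ?j = B k" using ne by (metis times_eq_iff Times_empty)
  have zero: "L P B G \<omega> i w = 0" if "B i = {}" "i \<ge> 1" for i
  proof -
    from that obtain i' where i: "i = Suc i'" by (cases i) auto
    have "T B (Suc i') \<omega> = T B i' \<omega>"
      using that unfolding i T_def by (simp add: emp_lim_empty)
    then show ?thesis by (simp add: L_def i)
  qed
  have "L P B G \<omega> ?j w = L P B G \<omega> k w"
  proof (cases "?j = k")
    case False
    with assms j have "B ?j \<inter> B k = {}" by (auto simp: disjoint_family_on_def)
    with eq have "B ?j = {}" "B k = {}" by auto
    with zero j(1) assms(2) show ?thesis by auto
  qed simp
  then show ?thesis using assms(2) by (auto simp: L_proc_def cylinders_def)
qed

end

theory Submission
  imports Defs
begin

text \<open>Let \<open>I\<close> be the indicator that draw \<open>l + 1\<close> has a colour in \<open>B\<close>, and \<open>q\<close> its prediction after \<open>l\<close>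
  draws; call \<open>I - q\<close> the surprise. With \<open>S\<close> the total weight (including \<open>\<alpha>\<close>) after draw \<open>l + 1\<close> and
  \<open>z\<close> its weight, the prediction moves by \<open>z / S * (I - q)\<close>, and \<open>n * (emp n B - pred n B)\<close> is the sum over
  \<open>l < n\<close> of \<open>(1 - (l + 1) * z / S) * (I - q)\<close>. The weight \<open>z\<close> is independent of the past and of the colour
  drawn with it, so a surprise stays centred when multiplied by a function of the past and of \<open>z\<close>, and both
  expressions are sums of orthogonal terms. As a surprise has second moment at most \<open>prior B\<close>, the prior
  probability of \<open>B\<close>, this bounds frequencies minus predictions and the increments of both in mean square by
  a multiple of \<open>prior B / n\<close>, see \<open>surprise_sum_second_moment\<close>. Along fourth powers the increments are
  summable, so the frequencies converge almost surely (\<open>emp_converges\<close>).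

  These bounds are linear in \<open>prior B\<close>. Since the square of a supremum is at most the sum of the squares,
  and prior probabilities of disjoint sets add up, the second moment of \<open>W_norm\<close> is at most a constant times
  the prior probability of the union (\<open>W_norm_second_moment\<close>), hence times its square root. In the same way
  the suprema of the \<open>C\<close> over late sets are small uniformly in \<open>n\<close> (\<open>C_tails\<close>).

  For the limit law, \<open>S\<close> is close to \<open>m * (l + 1)\<close> with \<open>m\<close> the mean weight, so the coefficient of a
  surprise is close to \<open>- (z - m) / m\<close>, and up to a small error in mean square (\<open>C_linearization\<close>) a linear
  combination of the \<open>C\<close> is a normalized sum of centred weights multiplied by factors that are known before
  the weights are drawn. Such sums satisfy a stable central limit theorem whose random variance is the limit of the
  averaged squared factors (\<open>stable_clt\<close>, \<open>quadratic_variation\<close>). That limit is the variance of the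
  corresponding combination of increments of a Brownian bridge, run over consecutive time intervals whose
  lengths are the limiting frequencies (\<open>increments_cosine\<close>).

  It remains to pass from linear combinations to paths. All paths are null sequences and thus lie in a separable
  part of \<open>l^\<infinity>\<close>, which settles measurability. Weak convergence can be tested on Lipschitz functions; by
  the uniform tails these may be replaced by functions of finitely many coordinates, and those, after folding
  them into periodic functions, by sums of cosines (\<open>stable_conv_linf\<close>). The norm is a continuous image of
  the path.\<close>

section \<open>Weak convergence on metric spaces\<close>

lemma borel_measurable_metric_borel:
  assumes "continuous_map (mtopology_of m) euclideanreal f"
  shows "f \<in> borel_measurable (metric_borel m)"
proof (rule borel_measurableI)
  fix S :: "real set" assume "open S"
  then have "openin (mtopology_of m) {x \<in> mspace m. f x \<in> S}"
    using openin_continuous_map_preimage[OF assms] by simp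
  then have "{x \<in> mspace m. f x \<in> S} \<in> sets (metric_borel m)"
    unfolding metric_borel_def by (intro in_measure_of) (use openin_subset in fastforce)+
  moreover have "f -` S \<inter> space (metric_borel m) = {x \<in> mspace m. f x \<in> S}" by auto
  ultimately show "f -` S \<inter> space (metric_borel m) \<in> sets (metric_borel m)" by simp
qed

lemma openin_mtopology_of:
  "openin (mtopology_of m) U \<longleftrightarrow> U \<subseteq> mspace m \<and> (\<forall>x\<in>U. \<exists>r>0. mball_of m x r \<subseteq> U)"
  using Metric_space.openin_mtopology[OF Metric_space_mspace_mdist, of m U]
  by (auto simp: mtopology_of_def mball_of_def)

lemma continuous_map_of_Lipschitz:
  fixes f :: "'b \<Rightarrow> real"
  assumes "\<And>x y. x \<in> mspace m \<Longrightarrow> y \<in> mspace m \<Longrightarrow> \<bar>f x - f y\<bar> \<le> K * mdist m x y"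
  shows "continuous_map (mtopology_of m) euclideanreal f"
proof -
  have "Lipschitz_continuous_map m euclidean_metric f"
    unfolding Lipschitz_continuous_map_def by (auto simp: dist_real_def intro!: exI[of _ K] assms)
  then have "continuous_map (mtopology_of m) (mtopology_of euclidean_metric) f"
    by (rule Lipschitz_continuous_imp_continuous_map)
  then show ?thesis by simp
qed

lemma bounded_integrable_metric_borel:
  assumes "prob_space Q" "sets Q = sets (metric_borel m)"
    and "continuous_map (mtopology_of m) euclideanreal f" "\<And>x. x \<in> mspace m \<Longrightarrow> \<bar>f x\<bar> \<le> c"
  shows "integrable Q f"
proof -
  interpret prob_space Q by fact
  have "space Q = mspace m" using sets_eq_imp_space_eq[OF assms(2)] by simp
  then show ?thesis
    using borel_measurable_metric_borel[OF assms(3)] assms(4)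
    by (intro integrable_const_bound[of _ c])
       (auto simp: measurable_cong_sets[OF assms(2) refl])
qed

text \<open>A bounded continuous \<open>f\<close> is the increasing pointwise limit of the Lipschitz functions
  \<open>g j x = (INF y. f y + j * mdist m x y)\<close>. Hence some \<open>g j\<close> has an integral under the limit law
  close to that of \<open>f\<close>, and as \<open>g j \<le> f\<close> the integrals of \<open>f\<close> are eventually not much smaller
  than their limit. The reverse inequality is the same statement for \<open>- f\<close>.\<close>

lemma weak_conv_metric_from_Lipschitz:
  fixes m :: "'b metric"
  assumes Q: "\<And>n. prob_space (Q n)" "\<And>n. sets (Q n) = sets (metric_borel m)"
    and R: "prob_space R" "sets R = sets (metric_borel m)"
    and lip: "\<And>f c K. (\<And>x. x \<in> mspace m \<Longrightarrow> \<bar>f x\<bar> \<le> c) \<Longrightarrow> 0 \<le> K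
       \<Longrightarrow> (\<And>x y. x \<in> mspace m \<Longrightarrow> y \<in> mspace m \<Longrightarrow> \<bar>f x - f y\<bar> \<le> K * mdist m x y)
       \<Longrightarrow> (\<lambda>n. \<integral>x. f x \<partial>Q n) \<longlonglongrightarrow> (\<integral>x. f x \<partial>R)"
  shows "weak_conv_metric m Q R"
proof -
  interpret R: prob_space R by fact
  have spR: "space R = mspace m" using sets_eq_imp_space_eq[OF R(2)] by simp
  have ne: "mspace m \<noteq> {}" using R.not_empty spR by simp
  have lower: "\<forall>\<^sub>F n in sequentially. (\<integral>x. f x \<partial>R) - e < (\<integral>x. f x \<partial>Q n)"
    if cont: "continuous_map (mtopology_of m) euclideanreal f"
      and bd: "\<And>x. x \<in> mspace m \<Longrightarrow> \<bar>f x\<bar> \<le> c" and e: "e > 0"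
    for f :: "'b \<Rightarrow> real" and c e
  proof -
    define g where "g j x = (INF y\<in>mspace m. f y + real j * mdist m x y)" for j x
    have c0: "c \<ge> 0" using ne bd by fastforce
    have lb: "- c \<le> f y + real j * mdist m x y" if "y \<in> mspace m" for j x y
      using bd[OF that] by (smt (verit) mdist_nonneg mult_nonneg_nonneg of_nat_0_le_iff)
    have bdd: "bdd_below ((\<lambda>y. f y + real j * mdist m x y) ` mspace m)" for j x
      by (rule bdd_belowI2[of _ "- c"]) (rule lb)
    have g_le: "g j x \<le> f y + real j * mdist m x y" if "y \<in> mspace m" for j x y
      unfolding g_def by (rule cINF_lower[OF bdd that])
    have g_ge: "- c \<le> g j x" for j x
      unfolding g_def by (rule cINF_greatest[OF ne lb])
    have g_f: "g j x \<le> f x" if "x \<in> mspace m" for j x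
      using g_le[OF that, of j x] mdist_zero[OF that that] by simp
    have g_bd: "\<bar>g j x\<bar> \<le> c" if "x \<in> mspace m" for j x
      using g_f[OF that, of j] g_ge[of j x] bd[OF that] by linarith
    have half: "g j x \<le> g j y + real j * mdist m x y" if "x \<in> mspace m" "y \<in> mspace m" for j x y
    proof -
      have "g j x - real j * mdist m x y \<le> f z + real j * mdist m y z" if z: "z \<in> mspace m" for z
      proof -
        have "real j * mdist m x z \<le> real j * (mdist m x y + mdist m y z)"
          using mdist_triangle[OF \<open>x \<in> mspace m\<close> \<open>y \<in> mspace m\<close> z] by (simp add: mult_left_mono)
        then show ?thesis using g_le[OF z, of j x] by (simp add: algebra_simps)
      qed
      then have "g j x - real j * mdist m x y \<le> g j y"
        unfolding g_def[of j y] by (rule cINF_greatest[OF ne])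
      then show ?thesis by simp
    qed
    have g_lip: "\<bar>g j x - g j y\<bar> \<le> real j * mdist m x y" if "x \<in> mspace m" "y \<in> mspace m" for j x y
      using half[OF that, of j] half[OF that(2,1), of j] by (simp add: mdist_commute)
    have g_conv: "(\<lambda>j. g j x) \<longlonglongrightarrow> f x" if x: "x \<in> mspace m" for x
    proof (rule LIMSEQ_I)
      fix r :: real assume r: "r > 0"
      obtain d where d: "d > 0" "\<And>y. y \<in> mspace m \<Longrightarrow> mdist m x y < d \<Longrightarrow> \<bar>f y - f x\<bar> < r / 2"
      proof -
        have "openin (mtopology_of m) {y \<in> mspace m. f y \<in> ball (f x) (r / 2)}"
          using openin_continuous_map_preimage[OF cont, of "ball (f x) (r / 2)"] by simp
        then obtain d where "d > 0" "mball_of m x d \<subseteq> {y \<in> mspace m. f y \<in> ball (f x) (r / 2)}"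
          using x r unfolding openin_mtopology_of by auto
        then show thesis using x
          by (intro that[of d]) (auto simp: dist_real_def abs_minus_commute subset_iff)
      qed
      \<comment> \<open>from here on, points at distance at least \<open>d\<close> cost more than the oscillation \<open>2 * c\<close> of \<open>f\<close>\<close>
      obtain N :: nat where N: "real N > 2 * c / d" using reals_Archimedean2 by blast
      have "norm (g j x - f x) < r" if j: "j \<ge> N" for j
      proof -
        have "f x - r / 2 \<le> f y + real j * mdist m x y" if y: "y \<in> mspace m" for y
        proof (cases "mdist m x y < d")
          case True
          then show ?thesis using d(2)[OF y True]
            by (smt (verit) mdist_nonneg mult_nonneg_nonneg of_nat_0_le_iff)
        next
          case False
          have "2 * c < real N * d" using N d(1) by (simp add: pos_divide_less_eq)
          also have "\<dots> \<le> real j * d" using j d(1) by simp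
          also have "\<dots> \<le> real j * mdist m x y" using False by (simp add: mult_left_mono)
          finally show ?thesis using bd[OF x] bd[OF y] r by linarith
        qed
        then have "f x - r / 2 \<le> g j x" unfolding g_def by (rule cINF_greatest[OF ne])
        then show ?thesis using g_f[OF x, of j] r by simp
      qed
      then show "\<exists>no. \<forall>n\<ge>no. norm (g n x - f x) < r" by blast
    qed
    have g_cont: "continuous_map (mtopology_of m) euclideanreal (g j)" for j
      by (rule continuous_map_of_Lipschitz[OF g_lip])
    have "(\<lambda>j. \<integral>x. g j x \<partial>R) \<longlonglongrightarrow> (\<integral>x. f x \<partial>R)"
    proof (rule integral_dominated_convergence[where w="\<lambda>_. c"])
      show "f \<in> borel_measurable R" "\<And>j. g j \<in> borel_measurable R"
        using borel_measurable_metric_borel[OF cont] borel_measurable_metric_borel[OF g_cont]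
        by (auto simp: measurable_cong_sets[OF R(2) refl])
    qed (use g_conv g_bd spR in auto)
    then have "\<forall>\<^sub>F j in sequentially. (\<integral>x. f x \<partial>R) - e / 2 < (\<integral>x. g j x \<partial>R)"
      using e by (intro order_tendstoD(1)) auto
    then obtain j where j: "(\<integral>x. f x \<partial>R) - e / 2 < (\<integral>x. g j x \<partial>R)"
      using eventually_happens by force
    have "(\<lambda>n. \<integral>x. g j x \<partial>Q n) \<longlonglongrightarrow> (\<integral>x. g j x \<partial>R)"
      by (rule lip[of _ c "real j"]) (use g_bd g_lip in auto)
    then have "\<forall>\<^sub>F n in sequentially. (\<integral>x. g j x \<partial>R) - e / 2 < (\<integral>x. g j x \<partial>Q n)"
      using e by (intro order_tendstoD(1)) auto
    then show ?thesis
    proof eventually_elim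
      case (elim n)
      have sp: "space (Q n) = mspace m" using sets_eq_imp_space_eq[OF Q(2)] by simp
      have "(\<integral>x. g j x \<partial>Q n) \<le> (\<integral>x. f x \<partial>Q n)"
        using bounded_integrable_metric_borel[OF Q cont bd]
          bounded_integrable_metric_borel[OF Q g_cont g_bd]
        by (intro integral_mono) (auto simp: sp g_f)
      then show ?case using elim j by linarith
    qed
  qed
  show ?thesis
    unfolding weak_conv_metric_def
  proof (intro allI impI; elim conjE)
    fix f :: "'b \<Rightarrow> real"
    assume cont: "continuous_map (mtopology_of m) euclideanreal f" and "bounded (f ` mspace m)"
    then obtain c where c: "\<And>x. x \<in> mspace m \<Longrightarrow> \<bar>f x\<bar> \<le> c"
      unfolding bounded_iff by auto
    show "(\<lambda>n. \<integral>x. f x \<partial>Q n) \<longlonglongrightarrow> (\<integral>x. f x \<partial>R)"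
    proof (rule order_tendstoI)
      fix a assume "a < (\<integral>x. f x \<partial>R)"
      then show "\<forall>\<^sub>F n in sequentially. a < (\<integral>x. f x \<partial>Q n)"
        using lower[OF cont c, of "(\<integral>x. f x \<partial>R) - a"] by simp
    next
      fix a assume "(\<integral>x. f x \<partial>R) < a"
      moreover have "continuous_map (mtopology_of m) euclideanreal (\<lambda>x. - f x)"
        using cont by (rule continuous_map_minus)
      ultimately show "\<forall>\<^sub>F n in sequentially. (\<integral>x. f x \<partial>Q n) < a"
        using lower[of "\<lambda>x. - f x" c "a - (\<integral>x. f x \<partial>R)"] c by simp
    qed
  qed
qed

text \<open>In a nonseparable space an open set need not be a countable union of balls. When all values of
  \<open>u\<close> are limits of points of one countable set, the preimage of an open set still is the countable
  union of the preimages of the balls around those points with rational radii.\<close>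

lemma measurable_into_separable_part:
  assumes u: "\<And>\<omega>. \<omega> \<in> space M \<Longrightarrow> u \<omega> \<in> mspace m"
    and D: "countable D" "D \<subseteq> mspace m"
    and dense: "\<And>\<omega> e. \<omega> \<in> space M \<Longrightarrow> e > 0 \<Longrightarrow> \<exists>q\<in>D. mdist m (u \<omega>) q < e"
    and dist: "\<And>q. q \<in> D \<Longrightarrow> (\<lambda>\<omega>. mdist m (u \<omega>) q) \<in> borel_measurable M"
  shows "u \<in> M \<rightarrow>\<^sub>M metric_borel m"
  unfolding metric_borel_def
proof (rule measurable_measure_of)
  show "{U. openin (mtopology_of m) U} \<subseteq> Pow (mspace m)" using openin_subset by fastforce
  show "u \<in> space M \<rightarrow> mspace m" using u by auto
next
  fix U assume "U \<in> {U. openin (mtopology_of m) U}"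
  then have U: "U \<subseteq> mspace m" "\<And>x. x \<in> U \<Longrightarrow> \<exists>r>0. mball_of m x r \<subseteq> U"
    by (auto simp: openin_mtopology_of)
  define I where "I = {(q, r). q \<in> D \<and> r \<in> \<rat> \<and> mball_of m q r \<subseteq> U}"
  have I: "countable I"
    by (rule countable_subset[of _ "D \<times> \<rat>"]) (auto simp: I_def D countable_rat)
  have "u -` U \<inter> space M = (\<Union>(q, r)\<in>I. {\<omega>\<in>space M. mdist m (u \<omega>) q < r})"
  proof (intro equalityI subsetI)
    fix \<omega> assume "\<omega> \<in> u -` U \<inter> space M"
    then have \<omega>: "\<omega> \<in> space M" "u \<omega> \<in> U" by auto
    then obtain r where r: "r > 0" "mball_of m (u \<omega>) r \<subseteq> U" using U by blast
    obtain s where s: "s \<in> \<rat>" "0 < s" "s < r / 2" using r(1) Rats_dense_in_real[of 0 "r / 2"] by auto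
    obtain q where q: "q \<in> D" "mdist m (u \<omega>) q < s" using dense[OF \<omega>(1) s(2)] by blast
    have "mball_of m q s \<subseteq> mball_of m (u \<omega>) r"
    proof
      fix y assume "y \<in> mball_of m q s"
      then have y: "y \<in> mspace m" "q \<in> mspace m" "mdist m q y < s" by auto
      have "mdist m (u \<omega>) y \<le> mdist m (u \<omega>) q + mdist m q y"
        using u[OF \<omega>(1)] y by (intro mdist_triangle)
      then show "y \<in> mball_of m (u \<omega>) r" using y q s u[OF \<omega>(1)] by simp
    qed
    then have "(q, s) \<in> I" using r q s by (auto simp: I_def)
    then show "\<omega> \<in> (\<Union>(q, r)\<in>I. {\<omega>\<in>space M. mdist m (u \<omega>) q < r})" using q \<omega> by auto
  next
    fix \<omega> assume "\<omega> \<in> (\<Union>(q, r)\<in>I. {\<omega>\<in>space M. mdist m (u \<omega>) q < r})"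
    then obtain q r where *: "(q, r) \<in> I" "\<omega> \<in> space M" "mdist m (u \<omega>) q < r" by auto
    then have "u \<omega> \<in> mball_of m q r"
      using D u by (auto simp: I_def mdist_commute)
    then show "\<omega> \<in> u -` U \<inter> space M" using * unfolding I_def by blast
  qed
  moreover have "(\<Union>(q, r)\<in>I. {\<omega>\<in>space M. mdist m (u \<omega>) q < r}) \<in> sets M"
    using I dist by (intro sets.countable_UN') (auto simp: I_def)
  ultimately show "u -` U \<inter> space M \<in> sets M" by simp
qed

section \<open>Trigonometric polynomials determine limits\<close>

text \<open>Each wave depends on finitely many coordinates. The phase makes constants and sines waves too,
  and by the addition theorems products of waves are sums of waves.\<close>

inductive trig_poly :: "((nat \<Rightarrow> real) \<Rightarrow> real) \<Rightarrow> bool" where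
  wave: "trig_poly (\<lambda>x. c * cos ((\<Sum>k<K. t k * x k) + \<theta>))"
| add: "trig_poly p \<Longrightarrow> trig_poly q \<Longrightarrow> trig_poly (\<lambda>x. p x + q x)"

lemma trig_poly_wave_mult_wave:
  "trig_poly (\<lambda>x. (c * cos ((\<Sum>k<K. t k * x k) + \<theta>)) * (d * cos ((\<Sum>k<J. s k * x k) + \<phi>)))"
proof -
  define N where "N = max K J"
  define t' where "t' k = (if k < K then t k else 0)" for k
  define s' where "s' k = (if k < J then s k else 0)" for k
  have t: "(\<Sum>k<K. t k * x k) = (\<Sum>k<N. t' k * x k)" for x :: "nat \<Rightarrow> real"
    unfolding N_def t'_def by (rule sum.mono_neutral_cong_left) auto
  have s: "(\<Sum>k<J. s k * x k) = (\<Sum>k<N. s' k * x k)" for x :: "nat \<Rightarrow> real"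
    unfolding N_def s'_def by (rule sum.mono_neutral_cong_left) auto
  have "trig_poly (\<lambda>x. c * d / 2 * cos ((\<Sum>k<N. (t' k - s' k) * x k) + (\<theta> - \<phi>))
                     + c * d / 2 * cos ((\<Sum>k<N. (t' k + s' k) * x k) + (\<theta> + \<phi>)))"
    by (intro trig_poly.intros)
  also have "(\<lambda>x. c * d / 2 * cos ((\<Sum>k<N. (t' k - s' k) * x k) + (\<theta> - \<phi>))
                     + c * d / 2 * cos ((\<Sum>k<N. (t' k + s' k) * x k) + (\<theta> + \<phi>)))
     = (\<lambda>x. (c * cos ((\<Sum>k<K. t k * x k) + \<theta>)) * (d * cos ((\<Sum>k<J. s k * x k) + \<phi>)))"
  proof
    fix x
    define A where "A = (\<Sum>k<N. t' k * x k) + \<theta>"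
    define B where "B = (\<Sum>k<N. s' k * x k) + \<phi>"
    have AB: "(\<Sum>k<N. (t' k - s' k) * x k) + (\<theta> - \<phi>) = A - B"
      "(\<Sum>k<N. (t' k + s' k) * x k) + (\<theta> + \<phi>) = A + B"
      by (simp_all add: A_def B_def algebra_simps sum.distrib sum_subtractf)
    show "c * d / 2 * cos ((\<Sum>k<N. (t' k - s' k) * x k) + (\<theta> - \<phi>))
                     + c * d / 2 * cos ((\<Sum>k<N. (t' k + s' k) * x k) + (\<theta> + \<phi>))
       = (c * cos ((\<Sum>k<K. t k * x k) + \<theta>)) * (d * cos ((\<Sum>k<J. s k * x k) + \<phi>))"
      unfolding AB t s A_def[symmetric] B_def[symmetric] cos_diff cos_add by (simp add: field_simps)
  qed
  finally show ?thesis .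
qed

lemma trig_poly_mult:
  assumes "trig_poly p" "trig_poly q"
  shows "trig_poly (\<lambda>x. p x * q x)"
  using assms(1)
proof induction
  case (wave c t K \<theta>)
  show ?case using assms(2)
  proof induction
    case (wave d s J \<phi>)
    show ?case by (rule trig_poly_wave_mult_wave)
  next
    case (add p q)
    then show ?case using trig_poly.add[OF add.IH] by (simp add: distrib_left)
  qed
next
  case (add p q)
  then show ?case using trig_poly.add[OF add.IH] by (simp add: distrib_right)
qed

lemma trig_poly_const: "trig_poly (\<lambda>x. c)"
  using trig_poly.wave[of c "\<lambda>_. 0" 0 0] by simp

lemma trig_poly_sine: "trig_poly (\<lambda>x. sin (c * x k))"
proof -
  have "(\<Sum>j<Suc k. (if j = k then c else 0) * x j) = c * x k" for x :: "nat \<Rightarrow> real"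
  proof -
    have "(\<Sum>j<Suc k. (if j = k then c else 0) * x j) = (\<Sum>j<Suc k. if k = j then c * x j else 0)"
      by (intro sum.cong) auto
    then show ?thesis by simp
  qed
  then show ?thesis
    using trig_poly.wave[of 1 "\<lambda>j. if j = k then c else 0" "Suc k" "- (pi / 2)"]
    by (simp add: sin_cos_eq cos_minus[of "pi / 2 - _", symmetric] del: cos_minus sum.lessThan_Suc)
qed

text \<open>A triangular wave of period \<open>4 * r\<close>: it is the identity on \<open>[-r, r]\<close> and a continuous function
  of a sine.\<close>

definition fold_wave :: "real \<Rightarrow> real \<Rightarrow> real" where
  "fold_wave r y = 2 * r / pi * arcsin (sin (pi / (2 * r) * y))"

lemma fold_wave_id:
  assumes "r > 0" "\<bar>y\<bar> \<le> r"
  shows "fold_wave r y = y"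
proof -
  have "\<bar>pi / (2 * r) * y\<bar> \<le> pi / 2"
    using assms by (simp add: abs_mult field_simps)
  then have "arcsin (sin (pi / (2 * r) * y)) = pi / (2 * r) * y"
    by (intro arcsin_sin) linarith+
  then show ?thesis using assms by (simp add: fold_wave_def)
qed

text \<open>After folding, \<open>F\<close> is a continuous function \<open>G\<close> of the sines of the coordinates, which vary
  in a compact cube \<open>S\<close>. By the Stone-Weierstrass theorem \<open>G\<close> is a uniform limit of polynomials on
  the cube, and a polynomial in sines is a trigonometric polynomial.\<close>

lemma trig_poly_approximates_fold:
  fixes F :: "(nat \<Rightarrow> real) \<Rightarrow> real"
  assumes F: "continuous_on UNIV F" and e: "e > 0"
  shows "\<exists>p. trig_poly p \<and> (\<forall>x. \<bar>F (\<lambda>k. fold_wave r (x k)) - p x\<bar> < e)"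
proof -
  define S where "S = {u :: nat \<Rightarrow> real. \<forall>k. u k \<in> {-1..1}}"
  define sines where "sines x = (\<lambda>k::nat. sin (pi / (2 * r) * x k))" for x
  define G where "G u = F (\<lambda>k. 2 * r / pi * arcsin (u k))" for u
  define P where "P g \<longleftrightarrow> continuous_on S g \<and> trig_poly (\<lambda>x. g (sines x))" for g
  have "compactin (product_topology (\<lambda>_::nat. euclideanreal) UNIV) (PiE UNIV (\<lambda>_. {-1..1}))"
    by (simp add: compactin_PiE)
  moreover have "PiE UNIV (\<lambda>_::nat. {-1..1::real}) = S" by (auto simp: S_def PiE_def)
  ultimately have S: "compact S" by (simp add: euclidean_product_topology)
  have coord: "continuous_on S (\<lambda>u. u k)" for k
    by (rule continuous_on_subset[OF continuous_on_product_coordinates]) auto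
  have "continuous_on S (\<lambda>u. (\<lambda>k. 2 * r / pi * arcsin (u k)))"
    by (intro continuous_on_coordinatewise_then_product continuous_intros coord)
       (auto simp: S_def)
  then have "continuous_on S G"
    unfolding G_def using F by (intro continuous_on_compose2[OF F]) auto
  then have "\<exists>g. P g \<and> (\<forall>u\<in>S. \<bar>G u - g u\<bar> < e)"
  proof (intro Stone_Weierstrass_HOL[OF S] e)
    show "P (\<lambda>x. c)" for c by (auto simp: P_def trig_poly_const)
    show "P f \<and> P g \<Longrightarrow> P (\<lambda>x. f x + g x)" for f g
      by (simp add: P_def continuous_on_add trig_poly.add)
    show "P f \<and> P g \<Longrightarrow> P (\<lambda>x. f x * g x)" for f g
      by (simp add: P_def continuous_on_mult trig_poly_mult)
    fix u v assume "u \<in> S \<and> v \<in> S \<and> u \<noteq> v"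
    then obtain k where "u k \<noteq> v k" by auto
    moreover have "P (\<lambda>u. u k)" 
      using coord trig_poly_sine[of "pi / (2 * r)" k] by (simp add: P_def sines_def)
    ultimately show "\<exists>f. P f \<and> f u \<noteq> f v" by blast
  qed (auto simp: P_def)
  then obtain g where g: "P g" "\<And>u. u \<in> S \<Longrightarrow> \<bar>G u - g u\<bar> < e" by blast
  have "G (sines x) = F (\<lambda>k. fold_wave r (x k))" "sines x \<in> S" for x
    by (auto simp: G_def sines_def fold_wave_def S_def)
  then have "\<bar>F (\<lambda>k. fold_wave r (x k)) - g (sines x)\<bar> < e" for x
    using g(2)[of "sines x"] by simp
  then show ?thesis using g(1) unfolding P_def by blast
qed

lemma trig_poly_bounded_measurable:
  assumes "trig_poly p"
  shows "\<exists>c. \<forall>x. \<bar>p x\<bar> \<le> c" and "p \<in> borel_measurable borel"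
proof -
  show "\<exists>c. \<forall>x. \<bar>p x\<bar> \<le> c" using assms
  proof induction
    case (wave c t K \<theta>)
    have "\<bar>c * cos y\<bar> \<le> \<bar>c\<bar>" for y
      using mult_left_mono[OF abs_cos_le_one, of "\<bar>c\<bar>" y] by (simp add: abs_mult)
    then show ?case by blast
  next
    case (add p q)
    then obtain c d where "\<forall>x. \<bar>p x\<bar> \<le> c" "\<forall>x. \<bar>q x\<bar> \<le> d" by blast
    then have "\<forall>x. \<bar>p x + q x\<bar> \<le> c + d" by (meson abs_triangle_ineq add_mono order_trans)
    then show ?case by blast
  qed
  have [measurable]: "(\<lambda>x :: nat \<Rightarrow> real. x k) \<in> borel_measurable borel" for k
    by (intro borel_measurable_continuous_onI continuous_on_product_coordinates)
  show "p \<in> borel_measurable borel" using assms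
  proof induction
    case (wave c t K \<theta>)
    show ?case by measurable
  next
    case (add p q)
    then show ?case by (intro borel_measurable_add)
  qed
qed

text \<open>A form of the continuity theorem for characteristic functions. Folding the coordinates at a
  level \<open>r\<close> changes \<open>F\<close> only where some coordinate exceeds \<open>r\<close>; by Markov's inequality the
  probability of this is small uniformly in \<open>n\<close>. The folded function is uniformly close to a
  trigonometric polynomial, whose expectations converge by assumption.\<close>

lemma expectation_tendsto_of_waves:
  fixes U :: "nat \<Rightarrow> 'a \<Rightarrow> nat \<Rightarrow> real" and V :: "'b \<Rightarrow> nat \<Rightarrow> real"
    and F :: "(nat \<Rightarrow> real) \<Rightarrow> real" and c :: real
  assumes A: "prob_space A" and B: "prob_space B"
    and U[measurable]: "\<And>n k. (\<lambda>w. U n w k) \<in> borel_measurable A"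
    and V[measurable]: "\<And>k. (\<lambda>w. V w k) \<in> borel_measurable B"
    and moment: "\<And>k. \<exists>c. \<forall>n. integrable A (\<lambda>w. U n w k) \<and> (\<integral>w. \<bar>U n w k\<bar> \<partial>A) \<le> c"
    and waves: "\<And>K t \<theta>. (\<lambda>n. \<integral>w. cos ((\<Sum>k<K. t k * U n w k) + \<theta>) \<partial>A)
                   \<longlonglongrightarrow> (\<integral>w. cos ((\<Sum>k<K. t k * V w k) + \<theta>) \<partial>B)"
    and F: "continuous_on UNIV F" "\<And>x. \<bar>F x\<bar> \<le> c"
    and dep: "\<And>x y. (\<And>k. k < K \<Longrightarrow> x k = y k) \<Longrightarrow> F x = F y"
  shows "(\<lambda>n. \<integral>w. F (U n w) \<partial>A) \<longlonglongrightarrow> (\<integral>w. F (V w) \<partial>B)"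
proof -
  interpret A: prob_space A by fact
  interpret B: prob_space B by fact
  have Fm [measurable]: "F \<in> borel_measurable borel"
    using F(1) by (rule borel_measurable_continuous_onI)
  have Um [measurable]: "U n \<in> borel_measurable A" for n
    by (rule measurable_coordinatewise_then_product) (rule U)
  have Vm [measurable]: "V \<in> borel_measurable B"
    by (rule measurable_coordinatewise_then_product) (rule V)
  have c0: "c \<ge> 0" using F(2)[of undefined] by simp
  have intA: "integrable A (\<lambda>w. f (U n w))"
    if "f \<in> borel_measurable borel" "\<And>x. \<bar>f x\<bar> \<le> d" for f :: "(nat \<Rightarrow> real) \<Rightarrow> real" and n d
    using measurable_compose[OF Um that(1)] that(2)
    by (intro A.integrable_const_bound[of _ d] AE_I2) simp_all
  have intB: "integrable B (\<lambda>w. f (V w))"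
    if "f \<in> borel_measurable borel" "\<And>x. \<bar>f x\<bar> \<le> d" for f :: "(nat \<Rightarrow> real) \<Rightarrow> real" and d
    using measurable_compose[OF Vm that(1)] that(2)
    by (intro B.integrable_const_bound[of _ d] AE_I2) simp_all
  have trig: "(\<lambda>n. \<integral>w. p (U n w) \<partial>A) \<longlonglongrightarrow> (\<integral>w. p (V w) \<partial>B)" if "trig_poly p" for p
    using that
  proof induction
    case (wave c t K \<theta>)
    have "(\<lambda>n. c * (\<integral>w. cos ((\<Sum>k<K. t k * U n w k) + \<theta>) \<partial>A))
        \<longlonglongrightarrow> c * (\<integral>w. cos ((\<Sum>k<K. t k * V w k) + \<theta>) \<partial>B)"
      by (intro tendsto_mult_left waves)
    then show ?case by simp
  next
    case (add p q)
    obtain d d' where d: "\<And>x. \<bar>p x\<bar> \<le> d" "\<And>x. \<bar>q x\<bar> \<le> d'"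
      using trig_poly_bounded_measurable(1) add.hyps by meson
    note p = intA[OF trig_poly_bounded_measurable(2)[OF add.hyps(1)] d(1)]
      intB[OF trig_poly_bounded_measurable(2)[OF add.hyps(1)] d(1)]
    note q = intA[OF trig_poly_bounded_measurable(2)[OF add.hyps(2)] d(2)]
      intB[OF trig_poly_bounded_measurable(2)[OF add.hyps(2)] d(2)]
    show ?case using tendsto_add[OF add.IH] p q by simp
  qed
  \<comment> \<open>dominates the indicator of the event that folding at level \<open>r\<close> matters\<close>
  define out where "out r x = (\<Sum>k<K. indicator {y. \<bar>y\<bar> > r} (x k) :: real)" for r and x :: "nat \<Rightarrow> real"
  have fold_F: "\<bar>F x - F (\<lambda>k. fold_wave r (x k))\<bar> \<le> 2 * c * out r x" if r: "r > 0" for r x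
  proof (cases "\<exists>k<K. \<bar>x k\<bar> > r")
    case True
    then obtain k where k: "k < K" "\<bar>x k\<bar> > r" by blast
    have "1 \<le> out r x"
      unfolding out_def using k member_le_sum[of k "{..<K}" "\<lambda>k. indicator {y. \<bar>y\<bar> > r} (x k) :: real"]
      by simp
    then have "2 * c * 1 \<le> 2 * c * out r x" using c0 by (intro mult_left_mono) auto
    then show ?thesis using F(2)[of x] F(2)[of "\<lambda>k. fold_wave r (x k)"] by linarith
  next
    case False
    then have "\<bar>x k\<bar> \<le> r" if "k < K" for k using that by (meson not_less)
    then have "F x = F (\<lambda>k. fold_wave r (x k))" using r by (intro dep fold_wave_id[symmetric]) auto
    moreover have "out r x \<ge> 0" unfolding out_def by (intro sum_nonneg) auto
    ultimately show ?thesis using c0 by simp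
  qed
  obtain d where d: "\<And>k n. integrable A (\<lambda>w. U n w k)" "\<And>k n. (\<integral>w. \<bar>U n w k\<bar> \<partial>A) \<le> d k"
    using moment by metis
  have outU: "(\<integral>w. out r (U n w) \<partial>A) \<le> (\<Sum>k<K. d k) / r" if r: "r > 0" for r n
  proof -
    have "(\<integral>w. indicator {y. \<bar>y\<bar> > r} (U n w k) \<partial>A) \<le> d k / r" for k
    proof -
      have "(\<integral>w. indicator {y. \<bar>y\<bar> > r} (U n w k) \<partial>A) \<le> (\<integral>w. \<bar>U n w k\<bar> / r \<partial>A)"
      proof (rule integral_mono)
        show "integrable A (\<lambda>w. indicator {y. \<bar>y\<bar> > r} (U n w k) :: real)"
          by (rule A.integrable_const_bound[of _ 1]) auto
        show "integrable A (\<lambda>w. \<bar>U n w k\<bar> / r)" using d(1) by (intro integrable_divide) auto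
        show "indicator {y. \<bar>y\<bar> > r} (U n w k) \<le> \<bar>U n w k\<bar> / r" for w
          using r by (auto split: split_indicator simp: field_simps)
      qed
      also have "\<dots> \<le> d k / r" using d(2)[of n k] r by (simp add: divide_right_mono)
      finally show ?thesis .
    qed
    moreover have "integrable A (\<lambda>w. indicator {y. \<bar>y\<bar> > r} (U n w k) :: real)" for k
      by (rule A.integrable_const_bound[of _ 1]) auto
    ultimately show ?thesis
      unfolding out_def by (simp add: sum_divide_distrib sum_mono)
  qed
  have outV: "(\<lambda>j. \<integral>w. out (real j) (V w) \<partial>B) \<longlonglongrightarrow> (\<integral>w. 0 \<partial>B)"
  proof (rule integral_dominated_convergence[where w="\<lambda>_. real K"])
    show "(\<lambda>w. out (real i) (V w)) \<in> borel_measurable B" for i unfolding out_def by measurable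
    have "out r x \<le> (\<Sum>k<K. 1)" "0 \<le> out r x" for r x
      unfolding out_def by (intro sum_mono sum_nonneg, simp split: split_indicator)+
    then show "AE x in B. norm (out (real i) (V x)) \<le> real K" for i by simp
    have "(\<lambda>i. out (real i) x) \<longlonglongrightarrow> 0" for x
      unfolding out_def
    proof (intro tendsto_null_sum)
      fix k
      obtain N :: nat where "real N \<ge> \<bar>x k\<bar>" using real_arch_simple by blast
      then have "\<forall>\<^sub>F i in sequentially. indicator {y. \<bar>y\<bar> > real i} (x k) = (0::real)"
        by (intro eventually_sequentiallyI[of N]) (auto split: split_indicator)
      then show "(\<lambda>i. indicator {y. \<bar>y\<bar> > real i} (x k) :: real) \<longlonglongrightarrow> 0"
        by (rule tendsto_eventually)
    qed
    then show "AE x in B. (\<lambda>i. out (real i) (V x)) \<longlonglongrightarrow> 0" by simp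
  qed auto
  have out_int: "integrable A (\<lambda>w. out r (U n w))" "integrable B (\<lambda>w. out r (V w))" for r n
    unfolding out_def
    by (intro Bochner_Integration.integrable_sum A.integrable_const_bound[of _ 1]
        B.integrable_const_bound[of _ 1]; simp)+
  show ?thesis
  proof (rule LIMSEQ_I)
    fix e :: real assume e: "e > 0"
    \<comment> \<open>the two replacements cost \<open>2 * e'\<close> each and the convergence of the polynomial \<open>e'\<close>\<close>
    define e' where "e' = e / 6"
    have e': "e' > 0" using e by (simp add: e'_def)
    have "(\<lambda>j. (\<Sum>k<K. d k) / real j) \<longlonglongrightarrow> 0"
      by (rule tendsto_divide_0[OF tendsto_const]) (auto simp: filterlim_real_sequentially filterlim_at_top_imp_at_infinity)
    from order_tendstoD(2)[OF tendsto_mult_right_zero[OF this] e']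
    have "\<forall>\<^sub>F j in sequentially. 2 * c * ((\<Sum>k<K. d k) / real j) < e'" .
    moreover from outV have "(\<lambda>j. \<integral>w. out (real j) (V w) \<partial>B) \<longlonglongrightarrow> 0" by simp
    from order_tendstoD(2)[OF tendsto_mult_right_zero[OF this] e']
    have "\<forall>\<^sub>F j in sequentially. 2 * c * (\<integral>w. out (real j) (V w) \<partial>B) < e'" .
    moreover have "\<forall>\<^sub>F j in sequentially. j \<ge> (1::nat)" by (rule eventually_ge_at_top)
    ultimately have "\<forall>\<^sub>F j in sequentially. j \<ge> 1 \<and> 2 * c * ((\<Sum>k<K. d k) / real j) < e'
        \<and> 2 * c * (\<integral>w. out (real j) (V w) \<partial>B) < e'"
      by eventually_elim simp
    then obtain j where j: "j \<ge> 1" "2 * c * ((\<Sum>k<K. d k) / real j) < e'"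
        "2 * c * (\<integral>w. out (real j) (V w) \<partial>B) < e'"
      using eventually_happens'[OF sequentially_bot] by blast
    define r where "r = real j"
    have r: "r > 0" using j by (simp add: r_def)
    obtain p where p: "trig_poly p" "\<And>x. \<bar>F (\<lambda>k. fold_wave r (x k)) - p x\<bar> < e'"
      using trig_poly_approximates_fold[OF F(1) e'] by blast
    obtain q where q: "\<And>x. \<bar>p x\<bar> \<le> q" using trig_poly_bounded_measurable(1)[OF p(1)] by blast
    have [measurable]: "p \<in> borel_measurable borel" by (rule trig_poly_bounded_measurable(2)[OF p(1)])
    have near: "\<bar>F x - p x\<bar> \<le> 2 * c * out r x + e'" for x
      using fold_F[OF r, of x] p(2)[of x] by linarith
    note intA = intA[OF Fm F(2)] intA[OF trig_poly_bounded_measurable(2)[OF p(1)] q]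
    note intB = intB[OF Fm F(2)] intB[OF trig_poly_bounded_measurable(2)[OF p(1)] q]
    have U_close: "\<bar>(\<integral>w. F (U n w) \<partial>A) - (\<integral>w. p (U n w) \<partial>A)\<bar> \<le> 2 * e'" for n
    proof -
      have "\<bar>(\<integral>w. F (U n w) \<partial>A) - (\<integral>w. p (U n w) \<partial>A)\<bar> = \<bar>\<integral>w. F (U n w) - p (U n w) \<partial>A\<bar>"
        using intA by simp
      also have "\<dots> \<le> (\<integral>w. \<bar>F (U n w) - p (U n w)\<bar> \<partial>A)" by (rule integral_abs_bound)
      also have "\<dots> \<le> (\<integral>w. 2 * c * out r (U n w) + e' \<partial>A)"
        using near intA out_int by (intro integral_mono) auto
      also have "\<dots> = 2 * c * (\<integral>w. out r (U n w) \<partial>A) + e'"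
        using out_int by (simp add: A.prob_space)
      also have "2 * c * (\<integral>w. out r (U n w) \<partial>A) \<le> 2 * c * ((\<Sum>k<K. d k) / real j)"
        using outU[OF r] c0 unfolding r_def by (intro mult_left_mono) auto
      finally show ?thesis using j(2) by linarith
    qed
    have V_close: "\<bar>(\<integral>w. F (V w) \<partial>B) - (\<integral>w. p (V w) \<partial>B)\<bar> \<le> 2 * e'"
    proof -
      have "\<bar>(\<integral>w. F (V w) \<partial>B) - (\<integral>w. p (V w) \<partial>B)\<bar> = \<bar>\<integral>w. F (V w) - p (V w) \<partial>B\<bar>"
        using intB by simp
      also have "\<dots> \<le> (\<integral>w. \<bar>F (V w) - p (V w)\<bar> \<partial>B)" by (rule integral_abs_bound)
      also have "\<dots> \<le> (\<integral>w. 2 * c * out r (V w) + e' \<partial>B)"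
        using near intB out_int by (intro integral_mono) auto
      also have "\<dots> = 2 * c * (\<integral>w. out r (V w) \<partial>B) + e'"
        using out_int by (simp add: B.prob_space)
      finally show ?thesis using j(3) unfolding r_def by linarith
    qed
    obtain N where N: "\<And>n. n \<ge> N \<Longrightarrow> \<bar>(\<integral>w. p (U n w) \<partial>A) - (\<integral>w. p (V w) \<partial>B)\<bar> < e'"
      using LIMSEQ_D[OF trig[OF p(1)] e'] unfolding real_norm_def by blast
    have "norm ((\<integral>w. F (U n w) \<partial>A) - (\<integral>w. F (V w) \<partial>B)) < e" if "n \<ge> N" for n
      using U_close[of n] V_close N[OF that] unfolding e'_def real_norm_def by linarith
    then show "\<exists>no. \<forall>n\<ge>no. norm ((\<integral>w. F (U n w) \<partial>A) - (\<integral>w. F (V w) \<partial>B)) < e"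
      by (intro exI[of _ N] allI impI)
  qed
qed

section \<open>Stable convergence of null sequences\<close>

text \<open>Paths are studied as null sequences; the points of \<open>D\<close> only serve as names of coordinates, and
  several of them may name the same one.\<close>

definition reindex :: "'c set \<Rightarrow> ('c \<Rightarrow> nat) \<Rightarrow> (nat \<Rightarrow> real) \<Rightarrow> 'c \<Rightarrow> real" where
  "reindex D idx v = (\<lambda>d\<in>D. v (idx d))"

lemma null_sequence_bounded:
  fixes v :: "nat \<Rightarrow> real"
  assumes "v \<longlonglongrightarrow> 0"
  obtains c where "c > 0" "\<And>k. \<bar>v k\<bar> \<le> c"
proof -
  have "Bseq v" using assms by (intro convergent_imp_Bseq) (auto simp: convergent_def)
  then show thesis using that unfolding Bseq_def real_norm_def by blast
qed

lemma reindex_in_linf: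
  assumes "v \<longlonglongrightarrow> 0"
  shows "reindex D idx v \<in> mspace (linf D)"
proof -
  obtain c where "\<And>k. \<bar>v k\<bar> \<le> c" using null_sequence_bounded[OF assms] by blast
  then show ?thesis unfolding mspace_linf reindex_def bounded_iff by auto
qed

lemma mdist_reindex:
  assumes "v \<longlonglongrightarrow> 0" "w \<longlonglongrightarrow> 0" "D \<noteq> {}"
  shows "mdist (linf D) (reindex D idx v) (reindex D idx w) = (SUP k\<in>idx ` D. \<bar>v k - w k\<bar>)"
  using assms by (simp add: mdist_linf reindex_in_linf) (simp add: reindex_def image_image)

lemma mdist_reindex_le:
  assumes "v \<longlonglongrightarrow> 0" "w \<longlonglongrightarrow> 0" "D \<noteq> {}" "\<And>k. \<bar>v k - w k\<bar> \<le> c"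
  shows "mdist (linf D) (reindex D idx v) (reindex D idx w) \<le> c"
  unfolding mdist_reindex[OF assms(1-3)] using assms(3,4) by (intro cSUP_least) auto

text \<open>The null sequences with finitely many nonzero entries, all of them rational, are dense among the
  null sequences. Hence measurable coordinates give a Borel map although \<open>linf D\<close> is not separable.\<close>

lemma measurable_reindex:
  assumes u: "\<And>k. (\<lambda>\<omega>. u \<omega> k) \<in> borel_measurable M"
    and null: "\<And>\<omega>. \<omega> \<in> space M \<Longrightarrow> u \<omega> \<longlonglongrightarrow> 0" and D: "D \<noteq> {}"
  shows "(\<lambda>\<omega>. reindex D idx (u \<omega>)) \<in> M \<rightarrow>\<^sub>M metric_borel (linf D)"
proof -
  define seq where "seq l k = (if k < length l then l ! k else 0)" for l :: "real list" and k
  define Q where "Q = seq ` lists \<rat>"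
  have Q0: "q \<longlonglongrightarrow> 0" if q: "q \<in> Q" for q
  proof -
    obtain l where l: "q = seq l" using q by (auto simp: Q_def)
    show ?thesis unfolding l seq_def
      by (rule tendsto_eventually, rule eventually_sequentiallyI[of "length l"]) simp
  qed
  show ?thesis
  proof (rule measurable_into_separable_part)
    show "countable (reindex D idx ` Q)" unfolding Q_def by (intro countable_image countable_lists countable_rat)
    show "reindex D idx ` Q \<subseteq> mspace (linf D)" using Q0 reindex_in_linf by blast
    show "reindex D idx (u \<omega>) \<in> mspace (linf D)" if "\<omega> \<in> space M" for \<omega>
      by (intro reindex_in_linf null that)
  next
    fix \<omega> and e :: real assume \<omega>: "\<omega> \<in> space M" and e: "e > 0"
    obtain K where K: "\<And>k. k \<ge> K \<Longrightarrow> \<bar>u \<omega> k\<bar> < e / 2"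
      using LIMSEQ_D[OF null[OF \<omega>], of "e / 2"] e by auto
    have "\<exists>r\<in>\<rat>. \<bar>u \<omega> k - r\<bar> < e / 2" for k
    proof -
      have "u \<omega> k - e / 2 < u \<omega> k + e / 2" using e by simp
      from Rats_dense_in_real[OF this] obtain r where "r \<in> \<rat>" "u \<omega> k - e / 2 < r" "r < u \<omega> k + e / 2"
        by blast
      then show ?thesis by (intro bexI[of _ r]) (simp_all only: abs_less_iff, linarith)
    qed
    then obtain r where r: "\<And>k. r k \<in> \<rat>" "\<And>k. \<bar>u \<omega> k - r k\<bar> < e / 2" by metis
    define q where "q = seq (map r [0..<K])"
    have "map r [0..<K] \<in> lists \<rat>" using r(1) by auto
    then have q: "q \<in> Q" unfolding Q_def q_def by (rule imageI)
    have "\<bar>u \<omega> k - q k\<bar> \<le> e / 2" for k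
      using r(2)[of k] K[of k] by (auto simp: q_def seq_def)
    then have "mdist (linf D) (reindex D idx (u \<omega>)) (reindex D idx q) \<le> e / 2"
      by (intro mdist_reindex_le null \<omega> Q0 q D)
    then show "\<exists>x\<in>reindex D idx ` Q. mdist (linf D) (reindex D idx (u \<omega>)) x < e"
      using q e by (intro bexI[of _ "reindex D idx q"]) auto
  next
    fix x assume "x \<in> reindex D idx ` Q"
    then obtain q where q: "q \<in> Q" "x = reindex D idx q" by blast
    have "(\<lambda>\<omega>. SUP k\<in>idx ` D. \<bar>u \<omega> k - q k\<bar>) \<in> borel_measurable M"
    proof (rule borel_measurable_cSUP)
      fix \<omega> assume \<omega>: "\<omega> \<in> space M"
      obtain c where c: "\<And>k. \<bar>u \<omega> k\<bar> \<le> c" using null_sequence_bounded[OF null[OF \<omega>]] by blast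
      obtain d where d: "\<And>k. \<bar>q k\<bar> \<le> d" using null_sequence_bounded[OF Q0[OF q(1)]] by blast
      have "\<bar>u \<omega> k - q k\<bar> \<le> c + d" for k using c[of k] d[of k] by linarith
      then show "bdd_above ((\<lambda>k. \<bar>u \<omega> k - q k\<bar>) ` idx ` D)" by (intro bdd_aboveI2[of _ _ "c + d"])
    qed (use u in auto)
    moreover have eq: "mdist (linf D) (reindex D idx (u \<omega>)) x = (SUP k\<in>idx ` D. \<bar>u \<omega> k - q k\<bar>)"
      if "\<omega> \<in> space M" for \<omega>
      unfolding q(2) by (intro mdist_reindex null that Q0 q(1) D)
    ultimately show "(\<lambda>\<omega>. mdist (linf D) (reindex D idx (u \<omega>)) x) \<in> borel_measurable M"
      by (subst measurable_cong[OF eq])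
  qed
qed

text \<open>Setting the coordinates from \<open>K\<close> on to zero moves a path by at most its tail supremum, which
  has small expectation uniformly in \<open>n\<close>. What is left of a Lipschitz function depends on finitely
  many coordinates, where waves determine the limit.\<close>

lemma expectation_tendsto_of_waves_linf:
  fixes U :: "nat \<Rightarrow> 'a \<Rightarrow> nat \<Rightarrow> real" and V :: "'b \<Rightarrow> nat \<Rightarrow> real" and f :: "('c \<Rightarrow> real) \<Rightarrow> real"
  assumes A: "prob_space A" and B: "prob_space B"
    and U: "\<And>n k. (\<lambda>w. U n w k) \<in> borel_measurable A" "\<And>n w. w \<in> space A \<Longrightarrow> U n w \<longlonglongrightarrow> 0"
    and V: "\<And>k. (\<lambda>w. V w k) \<in> borel_measurable B" "\<And>w. w \<in> space B \<Longrightarrow> V w \<longlonglongrightarrow> 0"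
    and moment: "\<And>k. \<exists>c. \<forall>n. integrable A (\<lambda>w. U n w k) \<and> (\<integral>w. \<bar>U n w k\<bar> \<partial>A) \<le> c"
    and tails: "\<And>e. e > 0 \<Longrightarrow> \<exists>K. \<forall>n. \<exists>S. integrable A S \<and> (\<integral>w. S w \<partial>A) \<le> e \<and>
                  (\<forall>w\<in>space A. \<forall>k\<ge>K. \<bar>U n w k\<bar> \<le> S w)"
    and waves: "\<And>K t \<theta>. (\<lambda>n. \<integral>w. cos ((\<Sum>k<K. t k * U n w k) + \<theta>) \<partial>A)
                   \<longlonglongrightarrow> (\<integral>w. cos ((\<Sum>k<K. t k * V w k) + \<theta>) \<partial>B)"
    and D: "D \<noteq> {}"
    and f: "\<And>x. x \<in> mspace (linf D) \<Longrightarrow> \<bar>f x\<bar> \<le> c" "l \<ge> 0"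
       "\<And>x y. x \<in> mspace (linf D) \<Longrightarrow> y \<in> mspace (linf D) \<Longrightarrow> \<bar>f x - f y\<bar> \<le> l * mdist (linf D) x y"
  shows "(\<lambda>n. \<integral>w. f (reindex D idx (U n w)) \<partial>A) \<longlonglongrightarrow> (\<integral>w. f (reindex D idx (V w)) \<partial>B)"
proof -
  interpret A: prob_space A by fact
  interpret B: prob_space B by fact
  \<comment> \<open>keeps the first \<open>K\<close> coordinates\<close>
  define cut where "cut K v = (\<lambda>k. if k < K then v k else 0 :: real)" for K :: nat and v
  define F where "F K v = f (reindex D idx (cut K v))" for K v
  have cut0: "cut K v \<longlonglongrightarrow> 0" for K v
    unfolding cut_def by (rule tendsto_eventually, rule eventually_sequentiallyI[of K]) simp
  have fm: "f \<in> borel_measurable (metric_borel (linf D))"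
    by (rule borel_measurable_metric_borel[OF continuous_map_of_Lipschitz[OF f(3)]])
  have F_bd: "\<bar>F K v\<bar> \<le> c" for K v
    unfolding F_def by (intro f(1) reindex_in_linf cut0)
  have F_near: "\<bar>f (reindex D idx v) - F K v\<bar> \<le> l * s"
    if "v \<longlonglongrightarrow> 0" "\<And>k. k \<ge> K \<Longrightarrow> \<bar>v k\<bar> \<le> s" "s \<ge> 0" for v K s
  proof -
    have "\<bar>f (reindex D idx v) - F K v\<bar> \<le> l * mdist (linf D) (reindex D idx v) (reindex D idx (cut K v))"
      unfolding F_def by (intro f(3) reindex_in_linf cut0 that)
    also have "\<dots> \<le> l * s"
      using that by (intro mult_left_mono f(2) mdist_reindex_le cut0 D) (auto simp: cut_def)
    finally show ?thesis .
  qed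
  have F_cont: "continuous_on UNIV (F K)" for K
    unfolding continuous_on_def
  proof
    fix v :: "nat \<Rightarrow> real"
    have bound: "\<bar>F K w - F K v\<bar> \<le> l * (\<Sum>k<K. \<bar>w k - v k\<bar>)" for w
    proof -
      have "\<bar>F K w - F K v\<bar> \<le> l * mdist (linf D) (reindex D idx (cut K w)) (reindex D idx (cut K v))"
        unfolding F_def by (intro f(3) reindex_in_linf cut0)
      also have "\<dots> \<le> l * (\<Sum>k<K. \<bar>w k - v k\<bar>)"
      proof (intro mult_left_mono f(2) mdist_reindex_le cut0 D)
        fix k
        show "\<bar>cut K w k - cut K v k\<bar> \<le> (\<Sum>k<K. \<bar>w k - v k\<bar>)"
          using member_le_sum[of k "{..<K}" "\<lambda>k. \<bar>w k - v k\<bar>"]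
          by (auto simp: cut_def sum_nonneg)
      qed
      finally show ?thesis .
    qed
    have "((\<lambda>w. l * (\<Sum>k<K. \<bar>w k - v k\<bar>)) \<longlongrightarrow> l * (\<Sum>k<K. \<bar>v k - v k\<bar>)) (at v within UNIV)"
    proof (intro tendsto_intros)
      fix k
      have "continuous_on UNIV (\<lambda>w :: nat \<Rightarrow> real. w k)" by (rule continuous_on_product_coordinates)
      then show "((\<lambda>w :: nat \<Rightarrow> real. w k) \<longlongrightarrow> v k) (at v within UNIV)" by (simp add: continuous_on_def)
    qed
    then have "((\<lambda>w. l * (\<Sum>k<K. \<bar>w k - v k\<bar>)) \<longlongrightarrow> 0) (at v within UNIV)" by simp
    moreover have "\<forall>\<^sub>F w in at v within UNIV. norm (F K w - F K v) \<le> l * (\<Sum>k<K. \<bar>w k - v k\<bar>)"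
      unfolding real_norm_def by (intro always_eventually allI bound)
    ultimately have "((\<lambda>w. F K w - F K v) \<longlongrightarrow> 0) (at v within UNIV)"
      by (rule Lim_null_comparison[rotated])
    then show "(F K \<longlongrightarrow> F K v) (at v within UNIV)" by (rule LIM_zero_cancel)
  qed
  have F_dep: "F K x = F K y" if "\<And>k. k < K \<Longrightarrow> x k = y k" for K x y
  proof -
    have "cut K x = cut K y" using that by (auto simp: cut_def)
    then show ?thesis by (simp add: F_def)
  qed
  have F_conv: "(\<lambda>n. \<integral>w. F K (U n w) \<partial>A) \<longlonglongrightarrow> (\<integral>w. F K (V w) \<partial>B)" for K
  proof (rule expectation_tendsto_of_waves[OF A B U(1) V(1) moment waves F_cont F_bd])
    show "F K x = F K y" if "\<And>k. k < K \<Longrightarrow> x k = y k" for x y using that by (rule F_dep)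
  qed
  have cut_meas: "(\<lambda>w. cut K (u w) k) \<in> borel_measurable M" if "\<And>k. (\<lambda>w. u w k) \<in> borel_measurable M"
    for M :: "'d measure" and u K k using that by (simp add: cut_def)
  have meas: "(\<lambda>w. f (reindex D idx (u w))) \<in> borel_measurable M" "(\<lambda>w. F K (u w)) \<in> borel_measurable M"
    if "\<And>k. (\<lambda>w. u w k) \<in> borel_measurable M" "\<And>w. w \<in> space M \<Longrightarrow> u w \<longlonglongrightarrow> 0"
    for M :: "'d measure" and u K
    unfolding F_def
    by (rule measurable_compose[OF measurable_reindex fm], fact, fact, fact)
       (rule measurable_compose[OF measurable_reindex fm], rule cut_meas, fact, rule cut0, fact)
  have intA: "integrable A (\<lambda>w. f (reindex D idx (U n w)))" for n
    using meas(1)[OF U(1) U(2)] f(1)[OF reindex_in_linf[OF U(2)]]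
    by (intro A.integrable_const_bound[of _ c] AE_I2) auto
  have intA': "integrable A (\<lambda>w. F K (U n w))" for n K
    using meas(2)[OF U(1) U(2)] F_bd by (intro A.integrable_const_bound[of _ c] AE_I2) auto
  note intA = intA intA'
  note measB = meas[OF V(1) V(2)]
  have "(\<lambda>K. \<integral>w. F K (V w) \<partial>B) \<longlonglongrightarrow> (\<integral>w. f (reindex D idx (V w)) \<partial>B)"
  proof (rule integral_dominated_convergence[where w="\<lambda>_. c"])
    show "AE w in B. (\<lambda>K. F K (V w)) \<longlonglongrightarrow> f (reindex D idx (V w))"
    proof (rule AE_I2, rule LIMSEQ_I)
      fix w and e :: real assume w: "w \<in> space B" and e: "e > 0"
      define s where "s = e / (l + 1)"
      have s0: "s > 0" using e f(2) unfolding s_def by (intro divide_pos_pos) linarith+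
      have "s * (l + 1) = e" using f(2) by (simp add: s_def)
      then have s: "s > 0" "l * s < e" using s0 by (simp_all add: distrib_left mult.commute)
      obtain K0 where K0: "\<And>k. k \<ge> K0 \<Longrightarrow> \<bar>V w k\<bar> < s"
        using LIMSEQ_D[OF V(2)[OF w] s(1)] by auto
      have "norm (F K (V w) - f (reindex D idx (V w))) < e" if "K \<ge> K0" for K
      proof -
        have "\<bar>f (reindex D idx (V w)) - F K (V w)\<bar> \<le> l * s"
          using K0 \<open>K \<ge> K0\<close> s(1) by (intro F_near V(2) w) (auto intro: less_imp_le)
        then show ?thesis using s(2) unfolding real_norm_def by linarith
      qed
      then show "\<exists>no. \<forall>n\<ge>no. norm (F n (V w) - f (reindex D idx (V w))) < e" by blast
    qed
  qed (use measB F_bd in auto)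
  note V_conv = LIMSEQ_D[OF this, unfolded real_norm_def]
  show ?thesis
  proof (rule LIMSEQ_I)
    fix e :: real assume e: "e > 0"
    then have e3: "e / 3 > 0" by simp
    define s where "s = e / 3 / (l + 1)"
    have s0: "s > 0" using e3 f(2) unfolding s_def by (intro divide_pos_pos) linarith+
    have "s * (l + 1) = e / 3" using f(2) by (simp add: s_def del: divide_divide_eq_left)
    then have s: "s > 0" "l * s < e / 3" using s0 by (simp_all add: distrib_left mult.commute)
    obtain K0 where K0: "\<And>n. \<exists>S. integrable A S \<and> (\<integral>w. S w \<partial>A) \<le> s \<and>
        (\<forall>w\<in>space A. \<forall>k\<ge>K0. \<bar>U n w k\<bar> \<le> S w)"
      using tails[OF s(1)] by blast
    obtain K1 where K1: "\<And>K. K \<ge> K1 \<Longrightarrow> \<bar>(\<integral>w. F K (V w) \<partial>B) - (\<integral>w. f (reindex D idx (V w)) \<partial>B)\<bar> < e / 3"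
      using V_conv[OF e3] by blast
    define K where "K = max K0 K1"
    have U_close: "\<bar>(\<integral>w. f (reindex D idx (U n w)) \<partial>A) - (\<integral>w. F K (U n w) \<partial>A)\<bar> < e / 3" for n
    proof -
      obtain S where S: "integrable A S" "(\<integral>w. S w \<partial>A) \<le> s" "\<And>w k. w \<in> space A \<Longrightarrow> k \<ge> K0 \<Longrightarrow> \<bar>U n w k\<bar> \<le> S w"
        using K0[of n] by blast
      have "\<bar>(\<integral>w. f (reindex D idx (U n w)) \<partial>A) - (\<integral>w. F K (U n w) \<partial>A)\<bar>
          = \<bar>\<integral>w. f (reindex D idx (U n w)) - F K (U n w) \<partial>A\<bar>"
        using intA by simp
      also have "\<dots> \<le> (\<integral>w. \<bar>f (reindex D idx (U n w)) - F K (U n w)\<bar> \<partial>A)" by (rule integral_abs_bound)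
      also have "\<dots> \<le> (\<integral>w. l * S w \<partial>A)"
      proof (intro integral_mono)
        fix w assume w: "w \<in> space A"
        have "0 \<le> S w" using S(3)[OF w order_refl] by linarith
        then show "\<bar>f (reindex D idx (U n w)) - F K (U n w)\<bar> \<le> l * S w"
          using S(3)[OF w] by (intro F_near U(2) w) (auto simp: K_def)
      qed (use intA S in auto)
      also have "\<dots> \<le> l * s" using S(2) f(2) by (simp add: mult_left_mono)
      finally show ?thesis using s by linarith
    qed
    have K1': "\<bar>(\<integral>w. F K (V w) \<partial>B) - (\<integral>w. f (reindex D idx (V w)) \<partial>B)\<bar> < e / 3"
      by (rule K1) (simp add: K_def)
    obtain N where N: "\<And>n. n \<ge> N \<Longrightarrow> \<bar>(\<integral>w. F K (U n w) \<partial>A) - (\<integral>w. F K (V w) \<partial>B)\<bar> < e / 3"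
      using LIMSEQ_D[OF F_conv[of K] e3] unfolding real_norm_def by blast
    have "norm ((\<integral>w. f (reindex D idx (U n w)) \<partial>A) - (\<integral>w. f (reindex D idx (V w)) \<partial>B)) < e"
      if "n \<ge> N" for n
      using U_close[of n] N[OF that] K1' unfolding real_norm_def by linarith
    then show "\<exists>no. \<forall>n\<ge>no. norm ((\<integral>w. f (reindex D idx (U n w)) \<partial>A) - (\<integral>w. f (reindex D idx (V w)) \<partial>B)) < e"
      by (intro exI[of _ N] allI impI)
  qed
qed

lemma integral_uniform_measure:
  fixes f :: "'a \<Rightarrow> real"
  assumes "prob_space P" "H \<in> sets P" "measure P H > 0" "f \<in> borel_measurable P"
  shows "(\<integral>w. f w \<partial>uniform_measure P H) = (\<integral>w. indicator H w * f w \<partial>P) / measure P H"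
    and "integrable P f \<Longrightarrow> integrable (uniform_measure P H) f"
proof -
  interpret prob_space P by fact
  have *: "uniform_measure P H = density P (\<lambda>w. ennreal (indicator H w / measure P H))"
    using assms by (auto simp: uniform_measure_def emeasure_eq_measure divide_ennreal ennreal_indicator[symmetric]
        simp del: ennreal_indicator split: split_indicator)
  show "(\<integral>w. f w \<partial>uniform_measure P H) = (\<integral>w. indicator H w * f w \<partial>P) / measure P H"
    unfolding * using assms by (subst integral_density) auto
  assume "integrable P f"
  then have "integrable P (\<lambda>w. indicator H w * f w / measure P H)"
    using assms(2) integrable_real_mult_indicator[of H P f] by (simp add: mult.commute)
  then show "integrable (uniform_measure P H) f"
    unfolding * using assms by (subst integrable_density) auto
qed


text \<open>Conditioning on \<open>H\<close> multiplies the moment and tail bounds by at most \<open>1 / measure P H\<close>, so the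
  criterion for expectations applies to the conditional laws. The limit is the law of \<open>V\<close> on the
  product of the conditioned space with \<open>P0\<close>, which by Fubini's theorem is the averaged kernel.\<close>

lemma stable_conv_linf:
  fixes U :: "nat \<Rightarrow> 'a \<Rightarrow> nat \<Rightarrow> real" and V :: "'a \<Rightarrow> 'w \<Rightarrow> nat \<Rightarrow> real"
    and D :: "'c set" and idx :: "'c \<Rightarrow> nat"
  assumes P: "prob_space P" and P0: "prob_space P0"
    and U: "\<And>n k. (\<lambda>\<omega>. U n \<omega> k) \<in> borel_measurable P" "\<And>n \<omega>. \<omega> \<in> space P \<Longrightarrow> U n \<omega> \<longlonglongrightarrow> 0"
    and V: "\<And>k. (\<lambda>x. V (fst x) (snd x) k) \<in> borel_measurable (P \<Otimes>\<^sub>M P0)"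
      "\<And>\<omega> w. \<omega> \<in> space P \<Longrightarrow> w \<in> space P0 \<Longrightarrow> V \<omega> w \<longlonglongrightarrow> 0"
    and moment: "\<And>k. \<exists>c. \<forall>n. integrable P (\<lambda>\<omega>. U n \<omega> k) \<and> (\<integral>\<omega>. \<bar>U n \<omega> k\<bar> \<partial>P) \<le> c"
    and tails: "\<And>e. e > 0 \<Longrightarrow> \<exists>K. \<forall>n. \<exists>S. integrable P S \<and> (\<integral>\<omega>. S \<omega> \<partial>P) \<le> e \<and>
                  (\<forall>\<omega>\<in>space P. \<forall>k\<ge>K. \<bar>U n \<omega> k\<bar> \<le> S \<omega>)"
    and waves: "\<And>H K t \<theta>. H \<in> sets P \<Longrightarrow>
        (\<lambda>n. \<integral>\<omega>. indicator H \<omega> * cos ((\<Sum>k<K. t k * U n \<omega> k) + \<theta>) \<partial>P)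
        \<longlonglongrightarrow> (\<integral>\<omega>. indicator H \<omega> * (\<integral>w. cos ((\<Sum>k<K. t k * V \<omega> w k) + \<theta>) \<partial>P0) \<partial>P)"
    and D: "D \<noteq> {}"
  shows "stable_conv (linf D) P (\<lambda>n \<omega>. reindex D idx (U n \<omega>))
           (\<lambda>\<omega>. distr P0 (metric_borel (linf D)) (\<lambda>w. reindex D idx (V \<omega> w)))"
proof -
  interpret P: prob_space P by fact
  interpret P0: prob_space P0 by fact
  define B where "B = metric_borel (linf D)"
  define K where "K \<omega> = distr P0 B (\<lambda>w. reindex D idx (V \<omega> w))" for \<omega>
  have Um: "(\<lambda>\<omega>. reindex D idx (U n \<omega>)) \<in> P \<rightarrow>\<^sub>M B" for n
    unfolding B_def by (rule measurable_reindex[OF U D])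
  have Vm: "(\<lambda>x. reindex D idx (V (fst x) (snd x))) \<in> P \<Otimes>\<^sub>M P0 \<rightarrow>\<^sub>M B"
    unfolding B_def by (rule measurable_reindex[OF V(1) V(2) D]) (auto simp: space_pair_measure)
  have V\<omega>: "(\<lambda>w. reindex D idx (V \<omega> w)) \<in> P0 \<rightarrow>\<^sub>M B" if "\<omega> \<in> space P" for \<omega>
    using measurable_compose[OF measurable_Pair1'[OF that] Vm] by simp
  have K_prob: "prob_space (K \<omega>)" "sets (K \<omega>) = sets B" if "\<omega> \<in> space P" for \<omega>
    unfolding K_def using V\<omega>[OF that] by (auto intro: P0.prob_space_distr)
  have random: "random_prob P (linf D) K"
    unfolding random_prob_iff B_def[symmetric]
  proof (intro conjI ballI)
    fix A assume A: "A \<in> sets B"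
    let ?G = "(\<lambda>x. reindex D idx (V (fst x) (snd x))) -` A \<inter> space (P \<Otimes>\<^sub>M P0)"
    have G: "?G \<in> sets (P \<Otimes>\<^sub>M P0)" by (rule measurable_sets[OF Vm A])
    have "(\<lambda>\<omega>. measure P0 (Pair \<omega> -` ?G)) \<in> borel_measurable P"
      unfolding measure_def by (rule borel_measurable_enn2real[OF P0.measurable_emeasure_Pair[OF G]])
    moreover have "measure (K \<omega>) A = measure P0 (Pair \<omega> -` ?G)" if "\<omega> \<in> space P" for \<omega>
    proof -
      have "measure (K \<omega>) A = measure P0 ((\<lambda>w. reindex D idx (V \<omega> w)) -` A \<inter> space P0)"
        unfolding K_def by (rule measure_distr[OF V\<omega>[OF that] A])
      also have "(\<lambda>w. reindex D idx (V \<omega> w)) -` A \<inter> space P0 = Pair \<omega> -` ?G"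
        using that by (auto simp: space_pair_measure)
      finally show ?thesis .
    qed
    ultimately show "(\<lambda>\<omega>. measure (K \<omega>) A) \<in> borel_measurable P"
      by (subst measurable_cong[where g="\<lambda>\<omega>. measure P0 (Pair \<omega> -` ?G)"])
  qed (use K_prob in auto)
  have K_meas: "K \<in> P \<rightarrow>\<^sub>M subprob_algebra B"
    using random unfolding random_prob_def B_def by (rule measurable_prob_algebraD)
  have main: "weak_conv_metric (linf D) (\<lambda>n. distr (uniform_measure P H) B (\<lambda>\<omega>. reindex D idx (U n \<omega>)))
        (uniform_measure P H \<bind> K)" if H: "H \<in> sets P" "measure P H > 0" for H
  proof -
    define A where "A = uniform_measure P H"
    have sA: "sets A = sets P" "space A = space P" by (simp_all add: A_def)
    have "prob_space A"
      unfolding A_def using H by (intro prob_space_uniform_measure) (auto simp: P.emeasure_eq_measure)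
    then interpret A: prob_space A .
    interpret AP: pair_prob_space A P0 ..
    have meas_A: "f \<in> borel_measurable A" if "f \<in> borel_measurable P" for f :: "'a \<Rightarrow> real"
      using that by (simp add: measurable_cong_sets[OF sA(1) refl])
    have int_A: "(\<integral>\<omega>. f \<omega> \<partial>A) = (\<integral>\<omega>. indicator H \<omega> * f \<omega> \<partial>P) / measure P H"
      if "f \<in> borel_measurable P" for f :: "'a \<Rightarrow> real"
      unfolding A_def by (rule integral_uniform_measure(1)[OF P H that])
    have integrable_A: "integrable A f" if "integrable P f" for f :: "'a \<Rightarrow> real"
      unfolding A_def using that by (intro integral_uniform_measure(2)[OF P H]) auto
    have int_A_le: "(\<integral>\<omega>. f \<omega> \<partial>A) \<le> (\<integral>\<omega>. f \<omega> \<partial>P) / measure P H"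
      if f: "integrable P f" "\<And>\<omega>. \<omega> \<in> space P \<Longrightarrow> 0 \<le> f \<omega>" for f :: "'a \<Rightarrow> real"
    proof -
      have "(\<integral>\<omega>. indicator H \<omega> * f \<omega> \<partial>P) \<le> (\<integral>\<omega>. f \<omega> \<partial>P)"
        using integrable_real_mult_indicator[OF H(1) f(1)] f
        by (intro integral_mono) (auto split: split_indicator simp: mult.commute)
      then show ?thesis using f(1) H(2) by (subst int_A) (auto simp: divide_right_mono)
    qed
    have KA: "K \<in> A \<rightarrow>\<^sub>M subprob_algebra B"
      using K_meas by (simp add: measurable_cong_sets[OF sA(1) refl])
    have UA: "(\<lambda>\<omega>. reindex D idx (U n \<omega>)) \<in> A \<rightarrow>\<^sub>M B" for n
      using Um by (simp add: measurable_cong_sets[OF sA(1) refl])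
    have sAP: "sets (A \<Otimes>\<^sub>M P0) = sets (P \<Otimes>\<^sub>M P0)" by (rule sets_pair_measure_cong[OF sA(1) refl])
    have VA: "(\<lambda>x. V (fst x) (snd x) k) \<in> borel_measurable (A \<Otimes>\<^sub>M P0)" for k
      using V(1) by (simp add: measurable_cong_sets[OF sAP refl])
    have VA0: "V (fst x) (snd x) \<longlonglongrightarrow> 0" if "x \<in> space (A \<Otimes>\<^sub>M P0)" for x
      using that by (intro V(2)) (auto simp: space_pair_measure sA)
    show ?thesis
      unfolding A_def[symmetric]
    proof (rule weak_conv_metric_from_Lipschitz)
      show "prob_space (distr A B (\<lambda>\<omega>. reindex D idx (U n \<omega>)))" for n
        by (rule A.prob_space_distr[OF UA])
      show "prob_space (A \<bind> K)"
        using K_prob by (intro A.prob_space_bind[OF _ KA] AE_I2) (simp add: sA)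
      show "sets (A \<bind> K) = sets (metric_borel (linf D))"
        using sets_bind_measurable[OF KA A.not_empty] by (simp add: B_def)
    next
      fix f :: "('c \<Rightarrow> real) \<Rightarrow> real" and c l
      assume f: "\<And>x. x \<in> mspace (linf D) \<Longrightarrow> \<bar>f x\<bar> \<le> c" "0 \<le> l"
        "\<And>x y. x \<in> mspace (linf D) \<Longrightarrow> y \<in> mspace (linf D) \<Longrightarrow> \<bar>f x - f y\<bar> \<le> l * mdist (linf D) x y"
      have fm: "f \<in> borel_measurable B"
        unfolding B_def by (rule borel_measurable_metric_borel[OF continuous_map_of_Lipschitz[OF f(3)]])
      have fbd: "\<bar>f x\<bar> \<le> c" if "x \<in> space B" for x using f(1) that by (simp add: B_def)
      have lim: "(\<lambda>n. \<integral>\<omega>. f (reindex D idx (U n \<omega>)) \<partial>A)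
          \<longlonglongrightarrow> (\<integral>x. f (reindex D idx (V (fst x) (snd x))) \<partial>(A \<Otimes>\<^sub>M P0))"
      proof (rule expectation_tendsto_of_waves_linf[OF A.prob_space_axioms AP.prob_space_axioms
            meas_A[OF U(1)] U(2)[folded sA(2)] VA VA0 _ _ _ D f(1) f(2) f(3)])
        fix k
        obtain d where d: "\<And>n. integrable P (\<lambda>\<omega>. U n \<omega> k)" "\<And>n. (\<integral>\<omega>. \<bar>U n \<omega> k\<bar> \<partial>P) \<le> d"
          using moment by blast
        have "(\<integral>\<omega>. \<bar>U n \<omega> k\<bar> \<partial>A) \<le> d / measure P H" for n
        proof -
          have "(\<integral>\<omega>. \<bar>U n \<omega> k\<bar> \<partial>A) \<le> (\<integral>\<omega>. \<bar>U n \<omega> k\<bar> \<partial>P) / measure P H"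
            using d(1) by (intro int_A_le integrable_abs) auto
          also have "\<dots> \<le> d / measure P H" using d(2) by (intro divide_right_mono) auto
          finally show ?thesis .
        qed
        then show "\<exists>c. \<forall>n. integrable A (\<lambda>w. U n w k) \<and> (\<integral>w. \<bar>U n w k\<bar> \<partial>A) \<le> c"
          using integrable_A[OF d(1)] by blast
      next
        fix e :: real assume "e > 0"
        then have "e * measure P H > 0" using H by simp
        from tails[OF this] obtain K where K: "\<forall>n. \<exists>S. integrable P S \<and> (\<integral>\<omega>. S \<omega> \<partial>P) \<le> e * measure P H \<and>
                  (\<forall>\<omega>\<in>space P. \<forall>k\<ge>K. \<bar>U n \<omega> k\<bar> \<le> S \<omega>)" by blast
        have "\<exists>S. integrable A S \<and> (\<integral>w. S w \<partial>A) \<le> e \<and> (\<forall>w\<in>space A. \<forall>k\<ge>K. \<bar>U n w k\<bar> \<le> S w)" for n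
        proof -
          obtain S where S: "integrable P S" "(\<integral>\<omega>. S \<omega> \<partial>P) \<le> e * measure P H"
            "\<forall>\<omega>\<in>space P. \<forall>k\<ge>K. \<bar>U n \<omega> k\<bar> \<le> S \<omega>" using K by blast
          have "0 \<le> S \<omega>" if "\<omega> \<in> space P" for \<omega>
            using S(3) that by (meson abs_ge_zero order_refl order_trans)
          then have "(\<integral>w. S w \<partial>A) \<le> (\<integral>\<omega>. S \<omega> \<partial>P) / measure P H" by (intro int_A_le S(1))
          also have "\<dots> \<le> e" using S(2) H(2) by (simp add: pos_divide_le_eq)
          finally show ?thesis using integrable_A[OF S(1)] S(3) sA(2) by auto
        qed
        then show "\<exists>K. \<forall>n. \<exists>S. integrable A S \<and> (\<integral>w. S w \<partial>A) \<le> e \<and> (\<forall>w\<in>space A. \<forall>k\<ge>K. \<bar>U n w k\<bar> \<le> S w)"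
          by blast
      next
        fix K :: nat and t :: "nat \<Rightarrow> real" and \<theta> :: real
        let ?g = "\<lambda>n \<omega>. cos ((\<Sum>k<K. t k * U n \<omega> k) + \<theta>)"
        let ?h = "\<lambda>x. cos ((\<Sum>k<K. t k * V (fst x) (snd x) k) + \<theta>)"
        have hm: "?h \<in> borel_measurable (P \<Otimes>\<^sub>M P0)" using V(1) by simp
        have "(\<lambda>n. (\<integral>\<omega>. indicator H \<omega> * ?g n \<omega> \<partial>P) / measure P H)
            \<longlonglongrightarrow> (\<integral>\<omega>. indicator H \<omega> * (\<integral>w. ?h (\<omega>, w) \<partial>P0) \<partial>P) / measure P H"
          using waves[OF H(1), where K=K and t=t and \<theta>=\<theta>] H(2) by (intro tendsto_divide tendsto_const) auto
        also have "(\<lambda>n. (\<integral>\<omega>. indicator H \<omega> * ?g n \<omega> \<partial>P) / measure P H) = (\<lambda>n. \<integral>\<omega>. ?g n \<omega> \<partial>A)"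
          using U(1) by (subst int_A) auto
        also have "(\<integral>\<omega>. indicator H \<omega> * (\<integral>w. ?h (\<omega>, w) \<partial>P0) \<partial>P) / measure P H
            = (\<integral>\<omega>. (\<integral>w. ?h (\<omega>, w) \<partial>P0) \<partial>A)"
          by (rule int_A[symmetric], rule P0.borel_measurable_lebesgue_integral) (use hm in simp)
        also have "\<dots> = (\<integral>x. ?h x \<partial>(A \<Otimes>\<^sub>M P0))"
        proof (rule AP.integral_fst')
          show "integrable (A \<Otimes>\<^sub>M P0) ?h"
            using hm by (intro AP.integrable_const_bound[of _ 1]) (auto simp: measurable_cong_sets[OF sAP refl])
        qed
        finally show "(\<lambda>n. \<integral>\<omega>. ?g n \<omega> \<partial>A) \<longlonglongrightarrow> (\<integral>x. ?h x \<partial>(A \<Otimes>\<^sub>M P0))" .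
      qed
      have "(\<integral>x. f x \<partial>(A \<bind> K)) = (\<integral>\<omega>. (\<integral>x. f x \<partial>K \<omega>) \<partial>A)"
      proof (rule integral_bind[OF fm fbd KA A.finite_measure_axioms])
        show "AE \<omega> in A. emeasure (K \<omega>) (space (K \<omega>)) \<le> ennreal 1"
          using K_prob by (intro AE_I2) (simp add: sA prob_space.emeasure_space_1)
      qed
      also have "\<dots> = (\<integral>\<omega>. (\<integral>w. f (reindex D idx (V \<omega> w)) \<partial>P0) \<partial>A)"
        unfolding K_def using V\<omega> fm by (intro Bochner_Integration.integral_cong refl) (simp add: sA integral_distr)
      also have "\<dots> = (\<integral>x. f (reindex D idx (V (fst x) (snd x))) \<partial>(A \<Otimes>\<^sub>M P0))"
      proof -
        have "integrable (A \<Otimes>\<^sub>M P0) (\<lambda>x. f (reindex D idx (V (fst x) (snd x))))"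
        proof (rule AP.integrable_const_bound[of _ c])
          show "(\<lambda>x. f (reindex D idx (V (fst x) (snd x)))) \<in> borel_measurable (A \<Otimes>\<^sub>M P0)"
            using measurable_compose[OF Vm fm] by (simp add: measurable_cong_sets[OF sAP refl])
          show "AE x in A \<Otimes>\<^sub>M P0. norm (f (reindex D idx (V (fst x) (snd x)))) \<le> c"
            using f(1)[OF reindex_in_linf[OF VA0]] by (intro AE_I2) simp
        qed
        from AP.integral_fst'[OF this] show ?thesis by simp
      qed
      finally have "(\<integral>x. f x \<partial>(A \<bind> K)) = (\<integral>x. f (reindex D idx (V (fst x) (snd x))) \<partial>(A \<Otimes>\<^sub>M P0))" .
      moreover have "(\<integral>x. f x \<partial>distr A B (\<lambda>\<omega>. reindex D idx (U n \<omega>))) = (\<integral>\<omega>. f (reindex D idx (U n \<omega>)) \<partial>A)" for n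
        by (rule integral_distr[OF UA fm])
      ultimately show "(\<lambda>n. \<integral>x. f x \<partial>distr A B (\<lambda>\<omega>. reindex D idx (U n \<omega>))) \<longlonglongrightarrow> (\<integral>x. f x \<partial>(A \<bind> K))"
        using lim by simp
    qed (simp_all add: B_def)
  qed
  show ?thesis
    unfolding stable_conv_def B_def[symmetric] K_def[symmetric]
    using Um random main by (auto simp: B_def)
qed

lemma stable_conv_continuous_image:
  assumes conv: "stable_conv m P V K" and P: "prob_space P"
    and \<phi>: "continuous_map (mtopology_of m) (mtopology_of m') \<phi>"
  shows "stable_conv m' P (\<lambda>n \<omega>. \<phi> (V n \<omega>)) (\<lambda>\<omega>. distr (K \<omega>) (metric_borel m') \<phi>)"
proof -
  interpret P: prob_space P by fact
  have \<phi>m: "\<phi> \<in> metric_borel m \<rightarrow>\<^sub>M metric_borel m'"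
    unfolding metric_borel_def[of m']
  proof (rule measurable_measure_of)
    show "{U. openin (mtopology_of m') U} \<subseteq> Pow (mspace m')" using openin_subset by fastforce
    show "\<phi> \<in> space (metric_borel m) \<rightarrow> mspace m'"
      using continuous_map_image_subset_topspace[OF \<phi>] by auto
    fix U assume "U \<in> {U. openin (mtopology_of m') U}"
    then have "openin (mtopology_of m) {x \<in> mspace m. \<phi> x \<in> U}"
      using openin_continuous_map_preimage[OF \<phi>] by simp
    then have "{x \<in> mspace m. \<phi> x \<in> U} \<in> sets (metric_borel m)"
      unfolding metric_borel_def by (intro in_measure_of) (use openin_subset in fastforce)+
    moreover have "\<phi> -` U \<inter> space (metric_borel m) = {x \<in> mspace m. \<phi> x \<in> U}" by auto
    ultimately show "\<phi> -` U \<inter> space (metric_borel m) \<in> sets (metric_borel m)" by simp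
  qed
  have V: "V n \<in> P \<rightarrow>\<^sub>M metric_borel m" for n using conv by (simp add: stable_conv_def)
  have K: "K \<in> P \<rightarrow>\<^sub>M prob_algebra (metric_borel m)"
    using conv by (simp add: stable_conv_def random_prob_def)
  show ?thesis
    unfolding stable_conv_def
  proof (intro conjI allI ballI impI)
    show "(\<lambda>\<omega>. \<phi> (V n \<omega>)) \<in> P \<rightarrow>\<^sub>M metric_borel m'" for n by (rule measurable_compose[OF V \<phi>m])
    show "random_prob P m' (\<lambda>\<omega>. distr (K \<omega>) (metric_borel m') \<phi>)"
      unfolding random_prob_def by (rule measurable_compose[OF K measurable_distr_prob_space[OF \<phi>m]])
    fix H assume H: "H \<in> sets P" "measure P H > 0"
    define A where "A = uniform_measure P H"
    have sA: "sets A = sets P" "space A = space P" by (simp_all add: A_def)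
    have ne: "space A \<noteq> {}" using P.not_empty sA by simp
    have KA: "K \<in> A \<rightarrow>\<^sub>M subprob_algebra (metric_borel m)"
      using measurable_prob_algebraD[OF K] by (simp add: measurable_cong_sets[OF sA(1) refl])
    have VA: "V n \<in> A \<rightarrow>\<^sub>M metric_borel m" for n
      using V by (simp add: measurable_cong_sets[OF sA(1) refl])
    have lim: "weak_conv_metric m (\<lambda>n. distr A (metric_borel m) (V n)) (A \<bind> K)"
      using conv H unfolding stable_conv_def A_def by blast
    show "weak_conv_metric m' (\<lambda>n. distr (uniform_measure P H) (metric_borel m') (\<lambda>\<omega>. \<phi> (V n \<omega>)))
        (uniform_measure P H \<bind> (\<lambda>\<omega>. distr (K \<omega>) (metric_borel m') \<phi>))"
      unfolding A_def[symmetric] weak_conv_metric_def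
    proof (intro allI impI; elim conjE)
      fix f :: "'c \<Rightarrow> real"
      assume f: "continuous_map (mtopology_of m') euclideanreal f" "bounded (f ` mspace m')"
      have fm: "f \<in> borel_measurable (metric_borel m')" by (rule borel_measurable_metric_borel[OF f(1)])
      have cont: "continuous_map (mtopology_of m) euclideanreal (\<lambda>x. f (\<phi> x))"
        using continuous_map_compose[OF \<phi> f(1)] by (simp add: o_def)
      have "(\<lambda>x. f (\<phi> x)) ` mspace m \<subseteq> f ` mspace m'"
        using continuous_map_image_subset_topspace[OF \<phi>] by auto
      then have "bounded ((\<lambda>x. f (\<phi> x)) ` mspace m)" using f(2) bounded_subset by blast
      then have "(\<lambda>n. \<integral>x. f (\<phi> x) \<partial>distr A (metric_borel m) (V n)) \<longlonglongrightarrow> (\<integral>x. f (\<phi> x) \<partial>(A \<bind> K))"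
        using lim cont unfolding weak_conv_metric_def by blast
      moreover have "(\<integral>x. f (\<phi> x) \<partial>distr A (metric_borel m) (V n))
          = (\<integral>x. f x \<partial>distr A (metric_borel m') (\<lambda>\<omega>. \<phi> (V n \<omega>)))" for n
        using measurable_compose[OF \<phi>m fm] measurable_compose[OF VA \<phi>m] VA fm by (simp add: integral_distr)
      moreover have "(\<integral>x. f (\<phi> x) \<partial>(A \<bind> K)) = (\<integral>x. f x \<partial>(A \<bind> (\<lambda>\<omega>. distr (K \<omega>) (metric_borel m') \<phi>)))"
      proof -
        have "\<phi> \<in> (A \<bind> K) \<rightarrow>\<^sub>M metric_borel m'"
          using \<phi>m by (simp add: measurable_cong_sets[OF sets_bind_measurable[OF KA ne] refl])
        from integral_distr[OF this fm] show ?thesis unfolding distr_bind[OF KA ne \<phi>m] by simp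
      qed
      ultimately show "(\<lambda>n. \<integral>x. f x \<partial>distr A (metric_borel m') (\<lambda>\<omega>. \<phi> (V n \<omega>)))
          \<longlonglongrightarrow> (\<integral>x. f x \<partial>(A \<bind> (\<lambda>\<omega>. distr (K \<omega>) (metric_borel m') \<phi>)))" by simp
    qed
  qed
qed

section \<open>The urn and its information structure\<close>

abbreviation weights :: "real measure" where "weights \<equiv> restrict_space borel {0<..}"

lemma space_weights: "space weights = {0<..}"
  by (simp add: space_restrict_space)

lemma traj_in_state_space:
  "\<omega> \<in> space (traj_space MY) \<Longrightarrow> i \<ge> 1 \<Longrightarrow> X i \<omega> \<in> space (state_space MY)"
  using measurable_space[OF measurable_X] by blast

lemma measurable_X_past:
  assumes "1 \<le> i" "i \<le> n"
  shows "X i \<in> past MY n \<rightarrow>\<^sub>M state_space MY" and "X i \<in> past_Y MY n \<rightarrow>\<^sub>M state_space MY"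
proof -
  have sp: "past_events MY n \<subseteq> Pow (space (traj_space MY))"
    using past_events_sets sets.space_closed by blast
  have ev: "X i -` A \<inter> space (traj_space MY) \<in> past_events MY n" if "A \<in> sets (state_space MY)" for A
    unfolding past_events_def using assms that by (intro UN_I[of i]) auto
  have "space (past MY n) = space (traj_space MY)" "space (past_Y MY n) = space (traj_space MY)"
    unfolding past_def past_Y_def using sp by (auto intro!: space_measure_of)
  moreover have "X i -` A \<inter> space (traj_space MY) \<in> sets (past MY n)"
      "X i -` A \<inter> space (traj_space MY) \<in> sets (past_Y MY n)" if "A \<in> sets (state_space MY)" for A
    unfolding past_def past_Y_def using sp ev[OF that] by (auto intro!: in_measure_of)
  ultimately show "X i \<in> past MY n \<rightarrow>\<^sub>M state_space MY" "X i \<in> past_Y MY n \<rightarrow>\<^sub>M state_space MY"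
    using assms by (auto intro!: measurableI traj_in_state_space)
qed

lemma space_past [simp]:
  "space (past MY n) = space (traj_space MY)" "space (past_Y MY n) = space (traj_space MY)"
proof -
  have sp: "past_events MY n \<subseteq> Pow (space (traj_space MY))"
    using past_events_sets sets.space_closed by blast
  then show "space (past MY n) = space (traj_space MY)" "space (past_Y MY n) = space (traj_space MY)"
    unfolding past_def past_Y_def by (auto intro!: space_measure_of)
qed

lemma measurable_YZ_of_X:
  assumes "X i \<in> N \<rightarrow>\<^sub>M state_space MY"
  shows "Y i \<in> N \<rightarrow>\<^sub>M MY" and "Z i \<in> N \<rightarrow>\<^sub>M weights" and "Z i \<in> borel_measurable N"
proof -
  show "Y i \<in> N \<rightarrow>\<^sub>M MY"
    unfolding Y_def using measurable_compose[OF assms, of fst MY] by (simp add: state_space_def)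
  show Z: "Z i \<in> N \<rightarrow>\<^sub>M weights"
    unfolding Z_def using measurable_compose[OF assms, of snd weights] by (simp add: state_space_def)
  show "Z i \<in> borel_measurable N"
    using measurable_compose[OF Z, of "\<lambda>x. x" borel] by (simp add: measurable_restrict_space1)
qed

lemmas measurable_Y_past = measurable_YZ_of_X(1)[OF measurable_X_past(1)]
lemmas measurable_Z_past = measurable_YZ_of_X(2,3)[OF measurable_X_past(1)]

lemma measurable_Y_past_Y: "Y (Suc n) \<in> past_Y MY n \<rightarrow>\<^sub>M MY"
proof (rule measurableI)
  fix A assume "A \<in> sets MY"
  moreover have "past_events MY n \<union> {Y (Suc n) -` B \<inter> space (traj_space MY) | B. B \<in> sets MY}
      \<subseteq> Pow (space (traj_space MY))"
    using past_events_sets[of MY n] sets.space_closed[of "traj_space MY"] by blast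
  ultimately show "Y (Suc n) -` A \<inter> space (past_Y MY n) \<in> sets (past_Y MY n)"
    unfolding space_past unfolding past_Y_def by (intro in_measure_of) auto
qed (use measurable_space[OF measurable_Y[of "Suc n" MY]] in auto)

lemma past_events_mono: "m \<le> n \<Longrightarrow> past_events MY m \<subseteq> past_events MY n"
  unfolding past_events_def by (intro UN_mono) auto

lemma sets_past_subset:
  "m \<le> n \<Longrightarrow> sets (past MY m) \<subseteq> sets (past MY n)" "sets (past MY n) \<subseteq> sets (past_Y MY n)"
  "sets (past_Y MY n) \<subseteq> sets (past MY (Suc n))"
proof -
  have sp: "past_events MY n \<subseteq> Pow (space (traj_space MY))" for n
    using past_events_sets sets.space_closed by blast
  have sY: "{Y (Suc n) -` B \<inter> space (traj_space MY) | B. B \<in> sets MY} \<subseteq> Pow (space (traj_space MY))"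
    by auto
  have ss: "sets (past MY n) = sigma_sets (space (traj_space MY)) (past_events MY n)"
     "sets (past_Y MY n) = sigma_sets (space (traj_space MY))
        (past_events MY n \<union> {Y (Suc n) -` B \<inter> space (traj_space MY) | B. B \<in> sets MY})" for n
    unfolding past_def past_Y_def using sp by (auto intro!: sets_measure_of)
  show "m \<le> n \<Longrightarrow> sets (past MY m) \<subseteq> sets (past MY n)"
    unfolding ss by (intro sigma_sets_mono' past_events_mono)
  show "sets (past MY n) \<subseteq> sets (past_Y MY n)"
    unfolding ss by (intro sigma_sets_mono') auto
  have "Y (Suc n) -` B \<inter> space (traj_space MY) \<in> sets (past MY (Suc n))" if "B \<in> sets MY" for B
    using measurable_sets[OF measurable_Y_past that, of "Suc n" "Suc n"] by simp
  moreover have "past_events MY n \<subseteq> sets (past MY (Suc n))"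
    unfolding ss(1) by (rule order_trans[OF past_events_mono[of n "Suc n"]]) (auto intro: sigma_sets.Basic)
  ultimately show "sets (past_Y MY n) \<subseteq> sets (past MY (Suc n))"
    unfolding ss(2) space_past(1)[of MY "Suc n", symmetric]
    by (intro sets.sigma_sets_subset) auto
qed

lemma subalgebra_past_mono:
  "m \<le> n \<Longrightarrow> subalgebra (past MY n) (past MY m)" "subalgebra (past_Y MY n) (past MY n)"
  "subalgebra (past MY (Suc n)) (past_Y MY n)"
  using sets_past_subset(1)[of m n MY] sets_past_subset(2,3)[of MY n] by (auto simp: subalgebra_def)

locale reinforced_urn = prob_space P
  for P :: "(nat \<Rightarrow> 'y \<times> real) measure" +
  fixes MY :: "'y measure" and \<alpha> a b :: real
  assumes sets_P: "sets P = sets (traj_space MY)"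
    and \<alpha>: "\<alpha> > 0"
    and colour_law: "\<And>n B. n \<ge> 1 \<Longrightarrow> B \<in> sets MY \<Longrightarrow>
      AE \<omega> in P. real_cond_exp P (past MY n) (\<lambda>\<omega>. indicator B (Y (Suc n) \<omega>)) \<omega> = pred \<alpha> P n B \<omega>"
    and weight_law: "\<And>n A. A \<in> sets weights \<Longrightarrow>
      AE \<omega> in P. real_cond_exp P (past_Y MY n) (\<lambda>\<omega>. indicator A (Z (Suc n) \<omega>)) \<omega>
                 = measure P {\<omega>\<in>space P. Z 1 \<omega> \<in> A}"
    and a: "0 < a" and ab: "a < b" and weight_bounds: "AE \<omega> in P. a \<le> Z 1 \<omega> \<and> Z 1 \<omega> \<le> b"
begin

lemma space_P: "space P = space (traj_space MY)"
  using sets_P by (rule sets_eq_imp_space_eq)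

lemma sub_past: "subalgebra P (past MY n)" "subalgebra P (past_Y MY n)"
  using subalgebra_past[OF sets_P] by auto

lemma measurable_X_P: "i \<ge> 1 \<Longrightarrow> X i \<in> P \<rightarrow>\<^sub>M state_space MY"
  using measurable_X by (simp add: measurable_cong_sets[OF sets_P refl])

lemmas measurable_Y_P = measurable_YZ_of_X(1)[OF measurable_X_P]
  and measurable_Z_P = measurable_YZ_of_X(2,3)[OF measurable_X_P]

lemma weight_pos: "\<omega> \<in> space P \<Longrightarrow> i \<ge> 1 \<Longrightarrow> Z i \<omega> > 0"
  using measurable_space[OF measurable_Z_P(1)] by (auto simp: space_weights)

definition hit :: "'y set \<Rightarrow> nat \<Rightarrow> 'y traj \<Rightarrow> real" where
  "hit B i \<omega> = indicator B (Y i \<omega>)"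

lemma hit_bounds: "0 \<le> hit B i \<omega>" "hit B i \<omega> \<le> 1"
  by (auto simp: hit_def split: split_indicator)

lemma measurable_hit: "Y i \<in> N \<rightarrow>\<^sub>M MY \<Longrightarrow> B \<in> sets MY \<Longrightarrow> hit B i \<in> borel_measurable N"
  unfolding hit_def using measurable_compose[of "Y i" N MY "indicator B" borel] by auto

definition total :: "nat \<Rightarrow> 'y traj \<Rightarrow> real" where
  "total n \<omega> = \<alpha> + (\<Sum>i=1..n. Z i \<omega>)"

abbreviation prior :: "'y set \<Rightarrow> real" where
  "prior B \<equiv> measure P {\<omega>\<in>space P. Y 1 \<omega> \<in> B}"

lemma total_pos: "\<omega> \<in> space P \<Longrightarrow> total n \<omega> > 0"
  unfolding total_def using \<alpha> weight_pos by (intro add_pos_nonneg sum_nonneg) (auto intro: less_imp_le)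

lemma total_Suc: "total (Suc n) \<omega> = total n \<omega> + Z (Suc n) \<omega>"
  by (simp add: total_def)

lemma measurable_total: "total n \<in> borel_measurable (past MY n)"
  unfolding total_def using measurable_Z_past(2) by (intro borel_measurable_add borel_measurable_sum) auto

lemma pred_eq: "pred \<alpha> P n B \<omega> = (\<alpha> * prior B + (\<Sum>i=1..n. Z i \<omega> * hit B i \<omega>)) / total n \<omega>"
  by (simp add: pred_def total_def hit_def)

lemma measurable_pred: "B \<in> sets MY \<Longrightarrow> pred \<alpha> P n B \<in> borel_measurable (past MY n)"
  unfolding pred_eq
  using measurable_Z_past(2) measurable_hit[OF measurable_Y_past] measurable_total
  by (intro borel_measurable_divide borel_measurable_add borel_measurable_sum borel_measurable_times) auto

lemma pred_bounds:
  assumes "\<omega> \<in> space P"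
  shows "0 \<le> pred \<alpha> P n B \<omega>" "pred \<alpha> P n B \<omega> \<le> 1"
proof -
  have nn: "0 \<le> Z i \<omega> * hit B i \<omega>" "Z i \<omega> * hit B i \<omega> \<le> Z i \<omega>" if "i \<in> {1..n}" for i
    using weight_pos[OF assms, of i] that hit_bounds[of B i \<omega>] by (auto simp: mult_left_le)
  have "\<alpha> * prior B \<le> \<alpha>" using \<alpha> by (simp add: mult_left_le)
  then have "\<alpha> * prior B + (\<Sum>i=1..n. Z i \<omega> * hit B i \<omega>) \<le> total n \<omega>"
    unfolding total_def using nn by (intro add_mono sum_mono) auto
  then show "pred \<alpha> P n B \<omega> \<le> 1"
    unfolding pred_eq using total_pos[OF assms, of n] by simp
  show "0 \<le> pred \<alpha> P n B \<omega>"
    unfolding pred_eq using nn \<alpha> total_pos[OF assms, of n]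
    by (intro divide_nonneg_pos add_nonneg_nonneg sum_nonneg) auto
qed

lemma pred_0: "pred \<alpha> P 0 B \<omega> = prior B"
  using \<alpha> by (simp add: pred_def)

text \<open>A draw pulls the prediction towards the observed indicator, by the share of the new weight in the
  new total.\<close>

lemma pred_Suc:
  assumes "\<omega> \<in> space P"
  shows "pred \<alpha> P (Suc n) B \<omega> - pred \<alpha> P n B \<omega>
    = Z (Suc n) \<omega> / (total n \<omega> + Z (Suc n) \<omega>) * (hit B (Suc n) \<omega> - pred \<alpha> P n B \<omega>)"
proof -
  define N where "N = \<alpha> * prior B + (\<Sum>i=1..n. Z i \<omega> * hit B i \<omega>)"
  define s z where "s = total n \<omega>" and "z = Z (Suc n) \<omega>"
  have pos: "s > 0" "z > 0" using assms total_pos weight_pos by (auto simp: s_def z_def)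
  have "pred \<alpha> P (Suc n) B \<omega> = (N + z * hit B (Suc n) \<omega>) / (s + z)"
    by (simp add: pred_eq total_Suc N_def s_def z_def)
  moreover have "pred \<alpha> P n B \<omega> = N / s" by (simp add: pred_eq N_def s_def)
  moreover have "(N + z * h) / (s + z) - N / s = z / (s + z) * (h - N / s)" for h
    using pos by (simp add: field_simps)
  ultimately show ?thesis by (simp add: s_def z_def)
qed

text \<open>By \<open>weight_law\<close> the next weight is independent of the past and of the colour drawn with it. It may
  therefore be replaced by an independent copy of the first weight, which turns conditioning into
  integration over a product.\<close>

lemma integral_over_weight:
  fixes F :: "'y traj \<times> real \<Rightarrow> 'c :: {banach, second_countable_topology}"
  assumes F: "F \<in> borel_measurable (past_Y MY n \<Otimes>\<^sub>M weights)"
    and bd: "\<And>\<omega> z. \<omega> \<in> space P \<Longrightarrow> z > 0 \<Longrightarrow> norm (F (\<omega>, z)) \<le> c"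
  shows "(\<integral>\<omega>. F (\<omega>, Z (Suc n) \<omega>) \<partial>P) = (\<integral>\<omega>. (\<integral>\<omega>'. F (\<omega>, Z 1 \<omega>') \<partial>P) \<partial>P)"
proof -
  define M1 where "M1 = distr P (past_Y MY n) (\<lambda>\<omega>. \<omega>)"
  define M2 where "M2 = distr P weights (Z 1)"
  define J where "J = distr P (past_Y MY n \<Otimes>\<^sub>M weights) (\<lambda>\<omega>. (\<omega>, Z (Suc n) \<omega>))"
  have id: "(\<lambda>\<omega>. \<omega>) \<in> P \<rightarrow>\<^sub>M past_Y MY n"
    by (rule measurable_from_subalg[OF sub_past(2)[of n]]) (rule measurable_ident_sets[OF refl])
  have Z1: "Z 1 \<in> P \<rightarrow>\<^sub>M weights" and Zn: "Z (Suc n) \<in> P \<rightarrow>\<^sub>M weights"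
    using measurable_Z_P(1) by auto
  have idZ: "(\<lambda>\<omega>. (\<omega>, Z (Suc n) \<omega>)) \<in> P \<rightarrow>\<^sub>M past_Y MY n \<Otimes>\<^sub>M weights"
    using id Zn by (rule measurable_Pair)
  interpret M1: prob_space M1 unfolding M1_def using id by (rule prob_space_distr)
  interpret M2: prob_space M2 unfolding M2_def using Z1 by (rule prob_space_distr)
  interpret M12: pair_prob_space M1 M2 ..
  have sM: "sets (M1 \<Otimes>\<^sub>M M2) = sets (past_Y MY n \<Otimes>\<^sub>M weights)"
    by (rule sets_pair_measure_cong) (simp_all add: M1_def M2_def)
  have eq: "M1 \<Otimes>\<^sub>M M2 = J"
  proof (rule pair_measure_eqI)
    show "sigma_finite_measure M1" "sigma_finite_measure M2" by unfold_locales
    show "sets (M1 \<Otimes>\<^sub>M M2) = sets J" by (simp add: sM J_def)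
    fix A B assume "A \<in> sets M1" "B \<in> sets M2"
    then have A: "A \<in> sets (past_Y MY n)" and B: "B \<in> sets weights" by (simp_all add: M1_def M2_def)
    have AP: "A \<in> sets P" using A sub_past(2) by (auto simp: subalgebra_def)
    interpret finite_measure_subalgebra P "past_Y MY n" by unfold_locales (rule sub_past(2))
    have int: "integrable P (\<lambda>\<omega>. indicator B (Z (Suc n) \<omega>) :: real)"
      using measurable_compose[OF Zn borel_measurable_indicator[OF B]]
      by (intro integrable_const_bound[of _ 1] AE_I2) (simp_all split: split_indicator)
    have "measure P (A \<inter> (Z (Suc n) -` B \<inter> space P)) = (\<integral>\<omega>. indicator A \<omega> * indicator B (Z (Suc n) \<omega>) \<partial>P)"
    proof -
      have "A \<inter> (Z (Suc n) -` B \<inter> space P) \<in> sets P" using AP measurable_sets[OF Zn B] by auto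
      then have "measure P (A \<inter> (Z (Suc n) -` B \<inter> space P))
         = (\<integral>\<omega>. indicator (A \<inter> (Z (Suc n) -` B \<inter> space P)) \<omega> \<partial>P)" by simp
      also have "\<dots> = (\<integral>\<omega>. indicator A \<omega> * indicator B (Z (Suc n) \<omega>) \<partial>P)"
        by (intro Bochner_Integration.integral_cong) (auto split: split_indicator)
      finally show ?thesis .
    qed
    also have "\<dots> = (\<integral>\<omega>. indicator A \<omega> * real_cond_exp P (past_Y MY n) (\<lambda>\<omega>. indicator B (Z (Suc n) \<omega>)) \<omega> \<partial>P)"
      using real_cond_exp_intA[OF int A] by (simp add: set_lebesgue_integral_def)
    also have "\<dots> = (\<integral>\<omega>. indicator A \<omega> * measure P {\<omega>\<in>space P. Z 1 \<omega> \<in> B} \<partial>P)"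
    proof (rule integral_cong_AE)
      show "AE \<omega> in P. indicator A \<omega> * real_cond_exp P (past_Y MY n) (\<lambda>\<omega>. indicator B (Z (Suc n) \<omega>)) \<omega>
          = indicator A \<omega> * measure P {\<omega>\<in>space P. Z 1 \<omega> \<in> B}"
        using weight_law[OF B, of n] by eventually_elim simp
    qed (intro borel_measurable_times borel_measurable_indicator AP borel_measurable_cond_exp2 borel_measurable_const)+
    also have "\<dots> = measure P A * measure P {\<omega>\<in>space P. Z 1 \<omega> \<in> B}"
      using AP by simp
    finally have *: "measure P (A \<inter> (Z (Suc n) -` B \<inter> space P)) = measure P A * measure P {\<omega>\<in>space P. Z 1 \<omega> \<in> B}" .
    have "emeasure M1 A = ennreal (measure P A)"
      unfolding M1_def using emeasure_distr[OF id A] AP sets.sets_into_space[OF AP]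
      by (simp add: emeasure_eq_measure Int_absorb2)
    moreover have "emeasure M2 B = ennreal (measure P {\<omega>\<in>space P. Z 1 \<omega> \<in> B})"
      unfolding M2_def using emeasure_distr[OF Z1 B]
      by (simp add: emeasure_eq_measure vimage_def Int_def conj_commute)
    moreover have "emeasure J (A \<times> B) = ennreal (measure P (A \<inter> (Z (Suc n) -` B \<inter> space P)))"
    proof -
      have "emeasure J (A \<times> B) = emeasure P ((\<lambda>\<omega>. (\<omega>, Z (Suc n) \<omega>)) -` (A \<times> B) \<inter> space P)"
        unfolding J_def using A B by (intro emeasure_distr[OF idZ]) auto
      also have "(\<lambda>\<omega>. (\<omega>, Z (Suc n) \<omega>)) -` (A \<times> B) \<inter> space P = A \<inter> (Z (Suc n) -` B \<inter> space P)" by auto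
      finally show ?thesis by (simp add: emeasure_eq_measure)
    qed
    ultimately show "emeasure M1 A * emeasure M2 B = emeasure J (A \<times> B)"
      unfolding * by (simp add: ennreal_mult)
  qed
  have Fm: "F \<in> borel_measurable (M1 \<Otimes>\<^sub>M M2)" using F by (simp add: measurable_cong_sets[OF sM refl])
  have "(\<integral>\<omega>. F (\<omega>, Z (Suc n) \<omega>) \<partial>P) = (\<integral>x. F x \<partial>J)"
    unfolding J_def by (rule integral_distr[OF idZ F, symmetric])
  also have "\<dots> = (\<integral>x. F x \<partial>(M1 \<Otimes>\<^sub>M M2))" by (simp add: eq)
  also have "\<dots> = (\<integral>\<omega>. (\<integral>z. F (\<omega>, z) \<partial>M2) \<partial>M1)"
  proof (rule M12.integral_fst'[symmetric])
    show "integrable (M1 \<Otimes>\<^sub>M M2) F"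
    proof (rule M12.integrable_const_bound[of _ c])
      show "AE x in M1 \<Otimes>\<^sub>M M2. norm (F x) \<le> c"
        using bd by (intro AE_I2) (auto simp: space_pair_measure M1_def M2_def space_weights space_P)
    qed (rule Fm)
  qed
  also have "\<dots> = (\<integral>\<omega>. (\<integral>z. F (\<omega>, z) \<partial>M2) \<partial>P)"
    unfolding M1_def
  proof (rule integral_distr[OF id])
    have "sets (past_Y MY n \<Otimes>\<^sub>M M2) = sets (past_Y MY n \<Otimes>\<^sub>M weights)"
      by (rule sets_pair_measure_cong) (simp_all add: M2_def)
    from measurable_cong_sets[OF this refl] have F2: "F \<in> borel_measurable (past_Y MY n \<Otimes>\<^sub>M M2)"
      using F by blast
    show "(\<lambda>\<omega>. \<integral>z. F (\<omega>, z) \<partial>M2) \<in> borel_measurable (past_Y MY n)"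
      by (rule M2.borel_measurable_lebesgue_integral) (simp add: F2)
  qed
  also have "\<dots> = (\<integral>\<omega>. (\<integral>\<omega>'. F (\<omega>, Z 1 \<omega>') \<partial>P) \<partial>P)"
  proof (rule Bochner_Integration.integral_cong[OF refl])
    fix \<omega> assume "\<omega> \<in> space P"
    then have "(\<lambda>z. F (\<omega>, z)) \<in> borel_measurable weights"
      using F by (simp add: space_P measurable_Pair2')
    then show "(\<integral>z. F (\<omega>, z) \<partial>M2) = (\<integral>\<omega>'. F (\<omega>, Z 1 \<omega>') \<partial>P)"
      unfolding M2_def by (rule integral_distr[OF Z1])
  qed
  finally show ?thesis .
qed

end

section \<open>Orthogonality of surprises\<close>

lemma measurable_pair_subalgebra:
  assumes "subalgebra M F" and f: "f \<in> borel_measurable (F \<Otimes>\<^sub>M N)"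
  shows "f \<in> borel_measurable (M \<Otimes>\<^sub>M N)"
proof -
  have id: "(\<lambda>x. x) \<in> M \<rightarrow>\<^sub>M F"
    by (rule measurable_from_subalg[OF assms(1)]) (rule measurable_ident_sets[OF refl])
  have "(\<lambda>x. (fst x, snd x)) \<in> M \<Otimes>\<^sub>M N \<rightarrow>\<^sub>M F \<Otimes>\<^sub>M N"
    by (intro measurable_Pair measurable_compose[OF measurable_fst id] measurable_snd)
  from measurable_compose[OF this f] show ?thesis by simp
qed

lemma measurable_snd_weights: "snd \<in> borel_measurable (M \<Otimes>\<^sub>M weights)"
  using measurable_compose[OF measurable_snd, of "\<lambda>x. x" weights borel M]
  by (simp add: measurable_restrict_space1)

context reinforced_urn
begin

lemma bounded_integrable:
  fixes f :: "'y traj \<Rightarrow> real"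
  assumes "f \<in> borel_measurable P" "\<And>\<omega>. \<omega> \<in> space P \<Longrightarrow> \<bar>f \<omega>\<bar> \<le> c"
  shows "integrable P f"
  using assms by (intro integrable_const_bound[of _ c] AE_I2) auto

lemma measurable_hit_P: "i \<ge> 1 \<Longrightarrow> B \<in> sets MY \<Longrightarrow> hit B i \<in> borel_measurable P"
  by (rule measurable_hit[OF measurable_Y_P])

lemma measurable_pred_P: "B \<in> sets MY \<Longrightarrow> pred \<alpha> P n B \<in> borel_measurable P"
  by (rule measurable_from_subalg[OF sub_past(1) measurable_pred])

lemma past_0_constant:
  assumes V: "V \<in> borel_measurable (past MY 0)" and "\<omega>0 \<in> space P" "\<omega> \<in> space P"
  shows "V \<omega> = (V \<omega>0 :: real)"
proof -
  have s: "sets (past MY 0) = {{}, space P}"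
    unfolding past_def past_events_def space_P
    by (simp add: sets_measure_of sigma_sets_empty_eq)
  have "V -` {V \<omega>0} \<inter> space P \<in> sets (past MY 0)"
    using measurable_sets[OF V, of "{V \<omega>0}"] by (simp add: space_P)
  moreover have "\<omega>0 \<in> V -` {V \<omega>0} \<inter> space P" using assms by auto
  ultimately have "V -` {V \<omega>0} \<inter> space P = space P" unfolding s by blast
  then show ?thesis using assms by auto
qed

text \<open>At time 0, about which \<open>colour_law\<close> says nothing, the past is trivial and the prediction is the
  prior probability.\<close>

lemma expectation_hit_pred:
  assumes B: "B \<in> sets MY" and V: "V \<in> borel_measurable (past MY n)"
    and bd: "\<And>\<omega>. \<omega> \<in> space P \<Longrightarrow> \<bar>V \<omega>\<bar> \<le> c"
  shows "(\<integral>\<omega>. V \<omega> * hit B (Suc n) \<omega> \<partial>P) = (\<integral>\<omega>. V \<omega> * pred \<alpha> P n B \<omega> \<partial>P)"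
proof (cases "n = 0")
  case True
  obtain \<omega>0 where \<omega>0: "\<omega>0 \<in> space P" using not_empty by blast
  have V0: "V \<omega> = V \<omega>0" if "\<omega> \<in> space P" for \<omega>
    using past_0_constant[OF _ \<omega>0 that] V True by simp
  have "(\<integral>\<omega>. hit B 1 \<omega> \<partial>P) = (\<integral>\<omega>. indicator {\<omega>\<in>space P. Y 1 \<omega> \<in> B} \<omega> \<partial>P)"
    by (intro Bochner_Integration.integral_cong) (auto simp: hit_def split: split_indicator)
  also have "\<dots> = prior B"
    using measurable_sets[OF measurable_Y_P[of 1] B] by (simp add: vimage_def Int_def conj_commute)
  finally have h: "(\<integral>\<omega>. hit B 1 \<omega> \<partial>P) = prior B" .
  have "(\<integral>\<omega>. V \<omega> * hit B (Suc n) \<omega> \<partial>P) = (\<integral>\<omega>. V \<omega>0 * hit B 1 \<omega> \<partial>P)"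
    using V0 True by (intro Bochner_Integration.integral_cong) auto
  also have "\<dots> = V \<omega>0 * prior B" by (simp only: integral_mult_right_zero h)
  also have "\<dots> = (\<integral>\<omega>. V \<omega>0 * prior B \<partial>P)" by (simp add: prob_space)
  also have "\<dots> = (\<integral>\<omega>. V \<omega> * pred \<alpha> P n B \<omega> \<partial>P)"
    unfolding True pred_0 by (intro Bochner_Integration.integral_cong refl) (simp add: V0)
  finally show ?thesis .
next
  case False
  then have n: "n \<ge> 1" by simp
  interpret finite_measure_subalgebra P "past MY n" by unfold_locales (rule sub_past(1))
  have VP: "V \<in> borel_measurable P" by (rule measurable_from_subalg[OF sub_past(1) V])
  have hm: "hit B (Suc n) \<in> borel_measurable P" using B by (intro measurable_hit_P) auto
  have "integrable P (\<lambda>\<omega>. V \<omega> * hit B (Suc n) \<omega>)"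
  proof (rule bounded_integrable[of _ c])
    show "\<bar>V \<omega> * hit B (Suc n) \<omega>\<bar> \<le> c" if "\<omega> \<in> space P" for \<omega>
      using bd[OF that] hit_bounds[of B "Suc n" \<omega>] mult_mono[of "\<bar>V \<omega>\<bar>" c "hit B (Suc n) \<omega>" 1]
      by (simp add: abs_mult)
  qed (intro borel_measurable_times VP hm)
  then have "(\<integral>\<omega>. V \<omega> * hit B (Suc n) \<omega> \<partial>P)
     = (\<integral>\<omega>. V \<omega> * real_cond_exp P (past MY n) (hit B (Suc n)) \<omega> \<partial>P)"
    using real_cond_exp_intg(2)[OF _ V hm] by auto
  also have "\<dots> = (\<integral>\<omega>. V \<omega> * pred \<alpha> P n B \<omega> \<partial>P)"
  proof (rule integral_cong_AE)
    show "AE \<omega> in P. V \<omega> * real_cond_exp P (past MY n) (hit B (Suc n)) \<omega> = V \<omega> * pred \<alpha> P n B \<omega>"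
      using colour_law[OF n B] unfolding hit_def by eventually_elim simp
  qed (intro borel_measurable_times VP borel_measurable_cond_exp2 measurable_pred_P B)+
  finally show ?thesis .
qed

text \<open>The new weight is independent of the new colour, so a factor depending on the past and on the new
  weight may first be averaged over the weight. The average is known before the draw, and against such
  factors the surprise integrates to zero.\<close>

lemma expectation_weighted_surprise:
  assumes B: "B \<in> sets MY" and \<Psi>: "\<Psi> \<in> borel_measurable (past MY n \<Otimes>\<^sub>M weights)"
    and bd: "\<And>\<omega> z. \<omega> \<in> space P \<Longrightarrow> z > 0 \<Longrightarrow> \<bar>\<Psi> (\<omega>, z)\<bar> \<le> c"
  shows "(\<integral>\<omega>. \<Psi> (\<omega>, Z (Suc n) \<omega>) * (hit B (Suc n) \<omega> - pred \<alpha> P n B \<omega>) \<partial>P) = 0"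
proof -
  define F where "F x = \<Psi> x * (hit B (Suc n) (fst x) - pred \<alpha> P n B (fst x))" for x
  define V where "V \<omega> = (\<integral>\<omega>'. \<Psi> (\<omega>, Z 1 \<omega>') \<partial>P)" for \<omega>
  have c: "c \<ge> 0" using bd[of _ 1] not_empty by (meson abs_ge_zero ex_in_conv order_trans zero_less_one)
  have F: "F \<in> borel_measurable (past_Y MY n \<Otimes>\<^sub>M weights)"
  proof -
    have "(\<lambda>x. hit B (Suc n) (fst x)) \<in> borel_measurable (past_Y MY n \<Otimes>\<^sub>M weights)"
      by (rule measurable_compose[OF measurable_fst measurable_hit[OF measurable_Y_past_Y B]])
    moreover have "(\<lambda>x. pred \<alpha> P n B (fst x)) \<in> borel_measurable (past_Y MY n \<Otimes>\<^sub>M weights)"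
      by (rule measurable_pair_subalgebra[OF subalgebra_past_mono(2)],
          rule measurable_compose[OF measurable_fst measurable_pred[OF B]])
    moreover have "\<Psi> \<in> borel_measurable (past_Y MY n \<Otimes>\<^sub>M weights)"
      by (rule measurable_pair_subalgebra[OF subalgebra_past_mono(2) \<Psi>])
    ultimately show ?thesis unfolding F_def by (intro borel_measurable_times borel_measurable_diff)
  qed
  have Fbd: "norm (F (\<omega>, z)) \<le> c" if "\<omega> \<in> space P" "z > 0" for \<omega> z
  proof -
    have "\<bar>hit B (Suc n) \<omega> - pred \<alpha> P n B \<omega>\<bar> \<le> 1"
      using hit_bounds[of B "Suc n" \<omega>] pred_bounds[OF that(1), of n B] by linarith
    then have "\<bar>\<Psi> (\<omega>, z)\<bar> * \<bar>hit B (Suc n) \<omega> - pred \<alpha> P n B \<omega>\<bar> \<le> c * 1"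
      using bd[OF that] c by (intro mult_mono) auto
    then show ?thesis by (simp add: F_def abs_mult)
  qed
  have V: "V \<in> borel_measurable (past MY n)"
    unfolding V_def
  proof (rule borel_measurable_lebesgue_integral)
    have "(\<lambda>x. (fst x, Z 1 (snd x))) \<in> past MY n \<Otimes>\<^sub>M P \<rightarrow>\<^sub>M past MY n \<Otimes>\<^sub>M weights"
      by (intro measurable_Pair measurable_fst measurable_compose[OF measurable_snd measurable_Z_P(1)]) simp
    from measurable_compose[OF this \<Psi>]
    show "(\<lambda>(\<omega>, \<omega>'). \<Psi> (\<omega>, Z 1 \<omega>')) \<in> borel_measurable (past MY n \<Otimes>\<^sub>M P)"
      by (simp add: case_prod_beta)
  qed
  have Vbd: "\<bar>V \<omega>\<bar> \<le> c" if \<omega>: "\<omega> \<in> space P" for \<omega>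
  proof -
    have "\<bar>V \<omega>\<bar> \<le> (\<integral>\<omega>'. \<bar>\<Psi> (\<omega>, Z 1 \<omega>')\<bar> \<partial>P)" unfolding V_def by (rule integral_abs_bound)
    also have "\<dots> \<le> (\<integral>\<omega>'. c \<partial>P)"
    proof (rule integral_mono')
      show "\<bar>\<Psi> (\<omega>, Z 1 \<omega>')\<bar> \<le> c" if "\<omega>' \<in> space P" for \<omega>'
        using bd[OF \<omega> weight_pos[OF that, of 1]] by simp
    qed (use c in auto)
    finally show ?thesis by (simp add: prob_space)
  qed
  have "(\<integral>\<omega>. \<Psi> (\<omega>, Z (Suc n) \<omega>) * (hit B (Suc n) \<omega> - pred \<alpha> P n B \<omega>) \<partial>P)
      = (\<integral>\<omega>. (\<integral>\<omega>'. F (\<omega>, Z 1 \<omega>') \<partial>P) \<partial>P)"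
    using integral_over_weight[OF F Fbd] by (simp add: F_def)
  also have "\<dots> = (\<integral>\<omega>. V \<omega> * hit B (Suc n) \<omega> - V \<omega> * pred \<alpha> P n B \<omega> \<partial>P)"
    unfolding F_def fst_conv integral_mult_left_zero V_def unfolding right_diff_distrib by (rule refl)
  also have "\<dots> = (\<integral>\<omega>. V \<omega> * hit B (Suc n) \<omega> \<partial>P) - (\<integral>\<omega>. V \<omega> * pred \<alpha> P n B \<omega> \<partial>P)"
  proof (rule Bochner_Integration.integral_diff)
    have VP: "V \<in> borel_measurable P" by (rule measurable_from_subalg[OF sub_past(1) V])
    show "integrable P (\<lambda>\<omega>. V \<omega> * hit B (Suc n) \<omega>)"
    proof (rule bounded_integrable[of _ c])
      show "\<bar>V \<omega> * hit B (Suc n) \<omega>\<bar> \<le> c" if "\<omega> \<in> space P" for \<omega>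
        using Vbd[OF that] hit_bounds[of B "Suc n" \<omega>] mult_mono[of "\<bar>V \<omega>\<bar>" c "hit B (Suc n) \<omega>" 1] c
        by (simp add: abs_mult)
    qed (intro borel_measurable_times VP measurable_hit_P B, simp)
    show "integrable P (\<lambda>\<omega>. V \<omega> * pred \<alpha> P n B \<omega>)"
    proof (rule bounded_integrable[of _ c])
      show "\<bar>V \<omega> * pred \<alpha> P n B \<omega>\<bar> \<le> c" if "\<omega> \<in> space P" for \<omega>
        using Vbd[OF that] pred_bounds[OF that, of n B] mult_mono[of "\<bar>V \<omega>\<bar>" c "pred \<alpha> P n B \<omega>" 1] c
        by (simp add: abs_mult)
    qed (intro borel_measurable_times VP measurable_pred_P B)
  qed
  also have "\<dots> = 0" using expectation_hit_pred[OF B V Vbd] by simp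
  finally show ?thesis .
qed

text \<open>The step size of the prediction. The new weight is a separate argument because
  \<open>integral_over_weight\<close> averages over it.\<close>

definition drift :: "nat \<Rightarrow> 'y traj \<times> real \<Rightarrow> real" where
  "drift n x = snd x / (total n (fst x) + snd x)"

lemma measurable_drift: "drift n \<in> borel_measurable (past MY n \<Otimes>\<^sub>M weights)"
  unfolding drift_def
  by (intro borel_measurable_divide borel_measurable_add measurable_snd_weights
      measurable_compose[OF measurable_fst measurable_total])

lemma drift_bounds:
  assumes "\<omega> \<in> space P" "z > 0"
  shows "0 \<le> drift n (\<omega>, z)" "drift n (\<omega>, z) \<le> 1"
  using total_pos[OF assms(1), of n] assms(2) by (auto simp: drift_def)

lemma pred_step:
  "\<omega> \<in> space P \<Longrightarrow> pred \<alpha> P (Suc n) B \<omega> - pred \<alpha> P n B \<omega>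
    = drift n (\<omega>, Z (Suc n) \<omega>) * (hit B (Suc n) \<omega> - pred \<alpha> P n B \<omega>)"
  by (simp add: pred_Suc drift_def)

lemma integrable_hit: "i \<ge> 1 \<Longrightarrow> B \<in> sets MY \<Longrightarrow> integrable P (hit B i)"
  using hit_bounds by (intro bounded_integrable[of _ 1] measurable_hit_P) auto

lemma integrable_pred: "B \<in> sets MY \<Longrightarrow> integrable P (pred \<alpha> P n B)"
  using pred_bounds by (intro bounded_integrable[of _ 1] measurable_pred_P) auto

lemma expectation_pred:
  assumes B: "B \<in> sets MY"
  shows "(\<integral>\<omega>. pred \<alpha> P n B \<omega> \<partial>P) = prior B"
proof (induction n)
  case 0
  show ?case by (simp add: pred_0 prob_space)
next
  case (Suc n)
  have "(\<integral>\<omega>. pred \<alpha> P (Suc n) B \<omega> \<partial>P) - (\<integral>\<omega>. pred \<alpha> P n B \<omega> \<partial>P)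
      = (\<integral>\<omega>. pred \<alpha> P (Suc n) B \<omega> - pred \<alpha> P n B \<omega> \<partial>P)"
    using integrable_pred[OF B] by simp
  also have "\<dots> = (\<integral>\<omega>. drift n (\<omega>, Z (Suc n) \<omega>) * (hit B (Suc n) \<omega> - pred \<alpha> P n B \<omega>) \<partial>P)"
    by (intro Bochner_Integration.integral_cong refl pred_step)
  also have "\<dots> = 0"
    using drift_bounds by (intro expectation_weighted_surprise[OF B measurable_drift, of _ 1]) auto
  finally show ?case using Suc.IH by simp
qed

lemma expectation_hit:
  assumes B: "B \<in> sets MY"
  shows "(\<integral>\<omega>. hit B (Suc n) \<omega> \<partial>P) = prior B"
  using expectation_hit_pred[OF B, of "\<lambda>_. 1" n 1] expectation_pred[OF B] by simp

text \<open>With \<open>I\<close> the indicator and \<open>q\<close> its prediction, \<open>I^2 = I\<close> and \<open>E(q * I) = E(q^2)\<close>, so the second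
  moment is \<open>E(I) - E(q^2)\<close>. It matters that the bound is linear in the prior probability: such bounds
  can be summed over disjoint sets.\<close>

lemma expectation_surprise_squared:
  assumes B: "B \<in> sets MY"
  shows "integrable P (\<lambda>\<omega>. (hit B (Suc n) \<omega> - pred \<alpha> P n B \<omega>)\<^sup>2)"
    and "(\<integral>\<omega>. (hit B (Suc n) \<omega> - pred \<alpha> P n B \<omega>)\<^sup>2 \<partial>P) \<le> prior B"
proof -
  have m: "hit B (Suc n) \<in> borel_measurable P" "pred \<alpha> P n B \<in> borel_measurable P"
    using B by (auto intro: measurable_hit_P measurable_pred_P)
  define ph where "ph \<omega> = pred \<alpha> P n B \<omega> * hit B (Suc n) \<omega>" for \<omega>
  define pp where "pp \<omega> = pred \<alpha> P n B \<omega> * pred \<alpha> P n B \<omega>" for \<omega>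
  have sq: "(hit B (Suc n) \<omega> - pred \<alpha> P n B \<omega>)\<^sup>2 = hit B (Suc n) \<omega> - ph \<omega> + (pp \<omega> - ph \<omega>)" for \<omega>
    by (auto simp: ph_def pp_def hit_def power2_eq_square algebra_simps split: split_indicator)
  show int: "integrable P (\<lambda>\<omega>. (hit B (Suc n) \<omega> - pred \<alpha> P n B \<omega>)\<^sup>2)"
  proof (rule bounded_integrable[of _ 1])
    fix \<omega> assume "\<omega> \<in> space P"
    then have "\<bar>hit B (Suc n) \<omega> - pred \<alpha> P n B \<omega>\<bar> \<le> 1"
      using hit_bounds[of B "Suc n" \<omega>] pred_bounds[of \<omega> n B] by linarith
    then show "\<bar>(hit B (Suc n) \<omega> - pred \<alpha> P n B \<omega>)\<^sup>2\<bar> \<le> 1" by (simp add: abs_square_le_1)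
  qed (intro borel_measurable_power borel_measurable_diff m)
  have prod: "\<bar>x * y\<bar> \<le> 1" if "0 \<le> x" "x \<le> 1" "0 \<le> y" "y \<le> 1" for x y :: real
    using that mult_mono[of x 1 y 1] by (simp add: abs_mult)
  have i1: "integrable P ph"
    unfolding ph_def by (rule bounded_integrable[of _ 1], intro borel_measurable_times m)
       (intro prod pred_bounds hit_bounds)
  have i2: "integrable P pp"
    unfolding pp_def by (rule bounded_integrable[of _ 1], intro borel_measurable_times m)
       (intro prod pred_bounds)
  have eq: "(\<integral>\<omega>. ph \<omega> \<partial>P) = (\<integral>\<omega>. pp \<omega> \<partial>P)"
    unfolding ph_def pp_def using pred_bounds
    by (intro expectation_hit_pred[where c=1, OF B measurable_pred[OF B]]) auto
  have "(\<integral>\<omega>. (hit B (Suc n) \<omega> - pred \<alpha> P n B \<omega>)\<^sup>2 \<partial>P) = prior B - (\<integral>\<omega>. ph \<omega> \<partial>P)"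
    unfolding sq using i1 i2 integrable_hit[OF _ B, of "Suc n"] eq expectation_hit[OF B, of n] by simp
  also have "\<dots> \<le> prior B"
  proof -
    have "0 \<le> (\<integral>\<omega>. ph \<omega> \<partial>P)"
      unfolding ph_def by (intro integral_nonneg_AE AE_I2 mult_nonneg_nonneg pred_bounds hit_bounds)
    then show ?thesis by simp
  qed
  finally show "(\<integral>\<omega>. (hit B (Suc n) \<omega> - pred \<alpha> P n B \<omega>)\<^sup>2 \<partial>P) \<le> prior B" .
qed

text \<open>A partial sum is known before the next surprise, so the cross terms vanish.\<close>

lemma surprise_sum_orthogonal:
  assumes B: "B \<in> sets MY"
    and \<Psi>: "\<And>l. \<Psi> l \<in> borel_measurable (past MY l \<Otimes>\<^sub>M weights)"
    and bd: "\<And>l \<omega> z. \<omega> \<in> space P \<Longrightarrow> z > 0 \<Longrightarrow> \<bar>\<Psi> l (\<omega>, z)\<bar> \<le> c l"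
    and jn: "j \<le> n"
  defines "M \<equiv> \<lambda>n \<omega>. \<Sum>l=j..<n. \<Psi> l (\<omega>, Z (Suc l) \<omega>) * (hit B (Suc l) \<omega> - pred \<alpha> P l B \<omega>)"
  shows "integrable P (\<lambda>\<omega>. (\<Psi> l (\<omega>, Z (Suc l) \<omega>) * (hit B (Suc l) \<omega> - pred \<alpha> P l B \<omega>))\<^sup>2)"
    and "integrable P (\<lambda>\<omega>. (M n \<omega>)\<^sup>2)"
    and "(\<integral>\<omega>. (M n \<omega>)\<^sup>2 \<partial>P)
       = (\<Sum>l=j..<n. \<integral>\<omega>. (\<Psi> l (\<omega>, Z (Suc l) \<omega>) * (hit B (Suc l) \<omega> - pred \<alpha> P l B \<omega>))\<^sup>2 \<partial>P)"
proof -
  define D where "D l \<omega> = \<Psi> l (\<omega>, Z (Suc l) \<omega>) * (hit B (Suc l) \<omega> - pred \<alpha> P l B \<omega>)" for l \<omega>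
  have M: "M n \<omega> = (\<Sum>l=j..<n. D l \<omega>)" for n \<omega> by (simp add: M_def D_def)
  have D_past: "D l \<in> borel_measurable (past MY (Suc l))" for l
  proof -
    have id: "(\<lambda>\<omega>. \<omega>) \<in> past MY (Suc l) \<rightarrow>\<^sub>M past MY l"
      by (rule measurable_from_subalg[OF subalgebra_past_mono(1)[of l]]) (simp_all add: measurable_ident_sets)
    have "(\<lambda>\<omega>. (\<omega>, Z (Suc l) \<omega>)) \<in> past MY (Suc l) \<rightarrow>\<^sub>M past MY l \<Otimes>\<^sub>M weights"
      by (intro measurable_Pair id measurable_Z_past(1)) auto
    from measurable_compose[OF this \<Psi>] measurable_compose[OF id measurable_pred[OF B]]
    show ?thesis unfolding D_def using measurable_hit[OF measurable_Y_past B, of "Suc l" "Suc l"]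
      by (intro borel_measurable_times borel_measurable_diff) auto
  qed
  have D_bd: "\<bar>D l \<omega>\<bar> \<le> c l" if "\<omega> \<in> space P" for l \<omega>
  proof -
    have z: "Z (Suc l) \<omega> > 0" using weight_pos[OF that] by simp
    have "\<bar>hit B (Suc l) \<omega> - pred \<alpha> P l B \<omega>\<bar> \<le> 1"
      using hit_bounds[of B "Suc l" \<omega>] pred_bounds[OF that, of l B] by linarith
    then have "\<bar>\<Psi> l (\<omega>, Z (Suc l) \<omega>)\<bar> * \<bar>hit B (Suc l) \<omega> - pred \<alpha> P l B \<omega>\<bar> \<le> c l * 1"
      using bd[OF that z, of l] by (intro mult_mono) (auto intro: order_trans[OF abs_ge_zero])
    then show ?thesis by (simp add: D_def abs_mult)
  qed
  have M_past: "M n \<in> borel_measurable (past MY n)" for n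
    unfolding M
  proof (rule borel_measurable_sum)
    fix l assume "l \<in> {j..<n}"
    then show "D l \<in> borel_measurable (past MY n)"
      by (intro measurable_from_subalg[OF subalgebra_past_mono(1)[of "Suc l" n]] D_past) auto
  qed
  have M_bd: "\<bar>M n \<omega>\<bar> \<le> (\<Sum>l=j..<n. c l)" if "\<omega> \<in> space P" for n \<omega>
    unfolding M by (rule order_trans[OF sum_abs]) (intro sum_mono D_bd that)
  have MP: "M n \<in> borel_measurable P" for n by (rule measurable_from_subalg[OF sub_past(1) M_past])
  have DP: "D l \<in> borel_measurable P" for l by (rule measurable_from_subalg[OF sub_past(1) D_past])
  have sq_bd: "\<bar>x\<^sup>2\<bar> \<le> d\<^sup>2" if "\<bar>x\<bar> \<le> d" for x d :: real
    using that abs_le_square_iff[of x d] by simp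
  have M2: "integrable P (\<lambda>\<omega>. (M n \<omega>)\<^sup>2)" for n
    by (rule bounded_integrable[of _ "(\<Sum>l=j..<n. c l)\<^sup>2"], intro borel_measurable_power MP) (intro sq_bd M_bd)
  then show "integrable P (\<lambda>\<omega>. (M n \<omega>)\<^sup>2)" .
  have D2: "integrable P (\<lambda>\<omega>. (D l \<omega>)\<^sup>2)" for l
    by (rule bounded_integrable[of _ "(c l)\<^sup>2"], intro borel_measurable_power DP) (intro sq_bd D_bd)
  from this[of l] show "integrable P (\<lambda>\<omega>. (\<Psi> l (\<omega>, Z (Suc l) \<omega>) * (hit B (Suc l) \<omega> - pred \<alpha> P l B \<omega>))\<^sup>2)"
    by (simp add: D_def)
  have cross_int: "integrable P (\<lambda>\<omega>. M n \<omega> * D n \<omega>)" for n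
  proof (rule bounded_integrable)
    fix \<omega> assume \<omega>: "\<omega> \<in> space P"
    show "\<bar>M n \<omega> * D n \<omega>\<bar> \<le> (\<Sum>l=j..<n. c l) * c n"
      unfolding abs_mult using M_bd[OF \<omega>, of n] D_bd[OF \<omega>, of n]
      by (intro mult_mono) (auto intro: order_trans[OF abs_ge_zero])
  qed (intro borel_measurable_times MP DP)
  have cross: "(\<integral>\<omega>. M n \<omega> * D n \<omega> \<partial>P) = 0" for n
  proof -
    have "(\<integral>\<omega>. (M n (fst (\<omega>, Z (Suc n) \<omega>)) * \<Psi> n (\<omega>, Z (Suc n) \<omega>)) * (hit B (Suc n) \<omega> - pred \<alpha> P n B \<omega>) \<partial>P) = 0"
    proof (rule expectation_weighted_surprise[where \<Psi>="\<lambda>x. M n (fst x) * \<Psi> n x" and c="(\<Sum>l=j..<n. c l) * c n", OF B])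
      show "(\<lambda>x. M n (fst x) * \<Psi> n x) \<in> borel_measurable (past MY n \<Otimes>\<^sub>M weights)"
        by (intro borel_measurable_times \<Psi> measurable_compose[OF measurable_fst M_past])
      fix \<omega> and z :: real assume "\<omega> \<in> space P" "z > 0"
      then show "\<bar>M n (fst (\<omega>, z)) * \<Psi> n (\<omega>, z)\<bar> \<le> (\<Sum>l=j..<n. c l) * c n"
        unfolding abs_mult fst_conv using M_bd[of \<omega> n] bd[of \<omega> z n]
        by (intro mult_mono) (auto intro: order_trans[OF abs_ge_zero])
    qed
    then show ?thesis by (simp add: D_def mult.assoc)
  qed
  have "(\<integral>\<omega>. (M n \<omega>)\<^sup>2 \<partial>P) = (\<Sum>l=j..<n. \<integral>\<omega>. (D l \<omega>)\<^sup>2 \<partial>P)"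
    using jn
  proof (induction n rule: dec_induct)
    case base
    show ?case by (simp add: M)
  next
    case (step n)
    have "(M (Suc n) \<omega>)\<^sup>2 = (M n \<omega>)\<^sup>2 + 2 * (M n \<omega> * D n \<omega>) + (D n \<omega>)\<^sup>2" for \<omega>
      using step.hyps by (simp add: M power2_sum algebra_simps)
    then have "(\<integral>\<omega>. (M (Suc n) \<omega>)\<^sup>2 \<partial>P) = (\<integral>\<omega>. (M n \<omega>)\<^sup>2 \<partial>P) + (\<integral>\<omega>. (D n \<omega>)\<^sup>2 \<partial>P)"
      using M2[of n] D2[of n] cross_int[of n] cross[of n] by simp
    then show ?case using step.IH step.hyps by simp
  qed
  then show "(\<integral>\<omega>. (M n \<omega>)\<^sup>2 \<partial>P)
       = (\<Sum>l=j..<n. \<integral>\<omega>. (\<Psi> l (\<omega>, Z (Suc l) \<omega>) * (hit B (Suc l) \<omega> - pred \<alpha> P l B \<omega>))\<^sup>2 \<partial>P)"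
    by (simp add: D_def)
qed

text \<open>The pointwise bounds \<open>c\<close> provide integrability and may grow with \<open>l\<close>; the sharp bounds \<open>q\<close> are
  needed almost surely only, where all weights lie between \<open>a\<close> and \<open>b\<close>.\<close>

lemma surprise_sum_second_moment:
  assumes B: "B \<in> sets MY"
    and \<Psi>: "\<And>l. \<Psi> l \<in> borel_measurable (past MY l \<Otimes>\<^sub>M weights)"
    and bd: "\<And>l \<omega> z. \<omega> \<in> space P \<Longrightarrow> z > 0 \<Longrightarrow> \<bar>\<Psi> l (\<omega>, z)\<bar> \<le> c l"
    and q: "\<And>l. AE \<omega> in P. \<bar>\<Psi> l (\<omega>, Z (Suc l) \<omega>)\<bar> \<le> q l"
    and jn: "j \<le> n"
  shows "(\<integral>\<omega>. (\<Sum>l=j..<n. \<Psi> l (\<omega>, Z (Suc l) \<omega>) * (hit B (Suc l) \<omega> - pred \<alpha> P l B \<omega>))\<^sup>2 \<partial>P)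
     \<le> (\<Sum>l=j..<n. (q l)\<^sup>2) * prior B"
proof -
  define D where "D l \<omega> = \<Psi> l (\<omega>, Z (Suc l) \<omega>) * (hit B (Suc l) \<omega> - pred \<alpha> P l B \<omega>)" for l \<omega>
  note orth = surprise_sum_orthogonal[where \<Psi>=\<Psi>, OF B \<Psi> bd jn, folded D_def]
  have "(\<integral>\<omega>. (D l \<omega>)\<^sup>2 \<partial>P) \<le> (q l)\<^sup>2 * prior B" for l
  proof -
    have "(\<integral>\<omega>. (D l \<omega>)\<^sup>2 \<partial>P) \<le> (\<integral>\<omega>. (q l)\<^sup>2 * (hit B (Suc l) \<omega> - pred \<alpha> P l B \<omega>)\<^sup>2 \<partial>P)"
    proof (rule integral_mono_AE[OF orth(1)])
      show "integrable P (\<lambda>\<omega>. (q l)\<^sup>2 * (hit B (Suc l) \<omega> - pred \<alpha> P l B \<omega>)\<^sup>2)"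
        using expectation_surprise_squared(1)[OF B] by simp
      show "AE \<omega> in P. (D l \<omega>)\<^sup>2 \<le> (q l)\<^sup>2 * (hit B (Suc l) \<omega> - pred \<alpha> P l B \<omega>)\<^sup>2"
        using q[of l]
      proof eventually_elim
        case (elim \<omega>)
        then show ?case unfolding D_def power_mult_distrib
          using power_mono[OF elim, of 2] by (intro mult_right_mono) auto
      qed
    qed
    also have "\<dots> \<le> (q l)\<^sup>2 * prior B"
      using expectation_surprise_squared(2)[OF B, of l] by (simp add: mult_left_mono)
    finally show ?thesis .
  qed
  then have "(\<Sum>l=j..<n. \<integral>\<omega>. (D l \<omega>)\<^sup>2 \<partial>P) \<le> (\<Sum>l=j..<n. (q l)\<^sup>2) * prior B"
    unfolding sum_distrib_right by (intro sum_mono)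
  then show ?thesis using orth(3) by (simp add: D_def)
qed

end

section \<open>Limiting frequencies and their speed of convergence\<close>

lemma sum_inverse_squares_le:
  assumes "1 \<le> j" "j \<le> n"
  shows "(\<Sum>l=j..<n. 1 / (real l + 1)\<^sup>2) \<le> 1 / real j - 1 / real n"
  using assms(2)
proof (induction n rule: dec_induct)
  case base
  show ?case by simp
next
  case (step n)
  have n: "real n > 0" using step assms by simp
  have "1 / (real n + 1)\<^sup>2 \<le> 1 / real n - 1 / (real n + 1)"
  proof -
    have "1 / real n - 1 / (real n + 1) = 1 / (real n * (real n + 1))" using n by (simp add: field_simps)
    moreover have "1 / (real n + 1)\<^sup>2 \<le> 1 / (real n * (real n + 1))"
      unfolding power2_eq_square using n by (intro divide_left_mono mult_right_mono mult_pos_pos) auto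
    ultimately show ?thesis by simp
  qed
  then show ?case using step by (simp add: add.commute)
qed

text \<open>Only \<open>i - k\<close> of the first \<open>i\<close> terms are new, and old and new averages lie in \<open>[0, 1]\<close>.\<close>

lemma running_mean_gap:
  fixes x :: "nat \<Rightarrow> real"
  assumes x: "\<And>i. 0 \<le> x i" "\<And>i. x i \<le> 1" and k: "1 \<le> k" "k \<le> i"
  shows "\<bar>(\<Sum>j=1..i. x j) / real i - (\<Sum>j=1..k. x j) / real k\<bar> \<le> (real i - real k) / real k"
proof -
  define s where "s n = (\<Sum>j=1..n. x j)" for n
  define d where "d = (\<Sum>j=Suc k..i. x j)"
  have si: "s i = s k + d"
    unfolding s_def d_def using k sum.ub_add_nat[of 1 k x "i - k"] by simp
  have d: "0 \<le> d" "d \<le> real i - real k"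
  proof -
    show "0 \<le> d" unfolding d_def using x by (intro sum_nonneg) auto
    have "d \<le> (\<Sum>j=Suc k..i. 1)" unfolding d_def using x by (intro sum_mono) auto
    then show "d \<le> real i - real k" using k by (simp add: of_nat_diff)
  qed
  have sk: "0 \<le> s k" "s k \<le> real k"
  proof -
    show "0 \<le> s k" unfolding s_def using x by (intro sum_nonneg) auto
    have "s k \<le> (\<Sum>j=1..k. 1)" unfolding s_def using x by (intro sum_mono) auto
    then show "s k \<le> real k" by simp
  qed
  have pos: "real k > 0" "real i > 0" using k by auto
  have "(s k + d) / real i - s k / real k = (d * real k - s k * (real i - real k)) / (real i * real k)"
    using pos by (simp add: field_simps)
  then have eq: "\<bar>(s k + d) / real i - s k / real k\<bar> = \<bar>d * real k - s k * (real i - real k)\<bar> / (real i * real k)"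
    by (simp only: abs_divide abs_mult[of "real i"] abs_of_nat)
  have "\<bar>d * real k - s k * (real i - real k)\<bar> \<le> (real i - real k) * real k"
  proof -
    have "d * real k \<le> (real i - real k) * real k" "s k * (real i - real k) \<le> real k * (real i - real k)"
      using d sk k by (auto intro: mult_right_mono)
    moreover have "0 \<le> d * real k" "0 \<le> s k * (real i - real k)" using d sk k by auto
    ultimately show ?thesis by (simp add: abs_le_iff mult.commute)
  qed
  then have "\<bar>(s k + d) / real i - s k / real k\<bar> \<le> (real i - real k) * real k / (real i * real k)"
    unfolding eq by (rule divide_right_mono) simp
  also have "\<dots> = (real i - real k) / real i" using pos by simp
  also have "\<dots> \<le> (real i - real k) / real k" using pos k by (intro divide_left_mono) auto
  finally show ?thesis unfolding si[symmetric] by (simp add: s_def)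
qed

text \<open>Fourth powers are sparse enough for increments of order \<open>1 / sqrt n\<close> to be summable along them, yet
  the quotients of successive fourth powers tend to 1, so that a running mean barely moves in between.\<close>

lemma running_mean_convergent:
  fixes x :: "nat \<Rightarrow> real"
  assumes x: "\<And>i. 0 \<le> x i" "\<And>i. x i \<le> 1"
  defines "m \<equiv> \<lambda>n. (\<Sum>j=1..n. x j) / real n"
  assumes sub: "summable (\<lambda>j. \<bar>m ((j + 2) ^ 4) - m ((j + 1) ^ 4)\<bar>)"
  shows "convergent m"
proof -
  define s where "s j = m ((j + 1) ^ 4)" for j
  have "summable (\<lambda>j. s (Suc j) - s j)"
    using summable_rabs_cancel[OF sub] by (simp add: s_def)
  then have "convergent (\<lambda>n. \<Sum>j<n. s (Suc j) - s j)" by (simp only: summable_iff_convergent)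
  then have "convergent (\<lambda>n. s n - s 0)" by (simp add: sum_lessThan_telescope)
  then have "convergent (\<lambda>n. s n - s 0 + s 0)" by (rule convergent_add) (rule convergent_const)
  then obtain l where l: "s \<longlonglongrightarrow> l" by (auto simp: convergent_def)
  define g where "g j = (real ((j + 2) ^ 4) - real ((j + 1) ^ 4)) / real ((j + 1) ^ 4)" for j :: nat
  have "g = (\<lambda>j. (1 + inverse (real (Suc j))) ^ 4 - 1)"
  proof
    fix j
    have "1 + inverse (real (Suc j)) = real (j + 2) / real (j + 1)" by (simp add: field_simps)
    then show "g j = (1 + inverse (real (Suc j))) ^ 4 - 1" unfolding g_def of_nat_power by (simp add: power_divide diff_divide_distrib)
  qed
  moreover have "(\<lambda>j. (1 + inverse (real (Suc j))) ^ 4 - 1) \<longlonglongrightarrow> (1 + 0) ^ 4 - 1"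
    by (intro tendsto_intros LIMSEQ_inverse_real_of_nat)
  ultimately have g: "g \<longlonglongrightarrow> 0" by simp
  have "m \<longlonglongrightarrow> l"
  proof (rule LIMSEQ_I)
    fix e :: real assume "e > 0"
    then have e2: "e / 2 > 0" by simp
    obtain J1 where J1: "\<And>j. j \<ge> J1 \<Longrightarrow> \<bar>s j - l\<bar> < e / 2"
      using LIMSEQ_D[OF l e2] unfolding real_norm_def by blast
    obtain J2 where J2: "\<And>j. j \<ge> J2 \<Longrightarrow> \<bar>g j\<bar> < e / 2"
      using LIMSEQ_D[OF g e2] unfolding real_norm_def by auto
    define J where "J = max J1 J2"
    have "norm (m i - l) < e" if i: "i \<ge> (J + 1) ^ 4" for i
    proof -
      \<comment> \<open>\<open>i\<close> lies between the fourth powers of \<open>j + 1\<close> and \<open>j + 2\<close>\<close>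
      define j where "j = (LEAST j. i < (j + 2) ^ 4)"
      have "i < (i + 2) ^ 4"
        by (rule order.strict_trans2[of _ "i + 2"]) (simp_all add: self_le_power)
      then have j: "i < (j + 2) ^ 4" unfolding j_def by (rule LeastI)
      have "J \<le> j"
      proof (rule ccontr)
        assume "\<not> J \<le> j"
        then have "(j + 2) ^ 4 \<le> (J + 1) ^ 4" by (intro power_mono) auto
        then show False using i j by linarith
      qed
      have lower: "(j + 1) ^ 4 \<le> i"
      proof (cases j)
        case 0
        have "0 < (J + 1) ^ 4" by simp
        then have "1 \<le> i" using i by linarith
        then show ?thesis using 0 by simp
      next
        case (Suc j')
        then have "\<not> i < (j' + 2) ^ 4" unfolding j_def by (intro not_less_Least) simp
        then show ?thesis using Suc by simp
      qed
      have "\<bar>m i - s j\<bar> \<le> (real i - real ((j + 1) ^ 4)) / real ((j + 1) ^ 4)"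
        unfolding m_def s_def by (rule running_mean_gap[OF x _ lower]) simp
      also have "\<dots> \<le> g j"
      proof -
        have "real i \<le> real ((j + 2) ^ 4)" using j by (simp only: of_nat_le_iff less_imp_le)
        then show ?thesis unfolding g_def by (intro divide_right_mono diff_right_mono) auto
      qed
      finally have "\<bar>m i - s j\<bar> \<le> g j" .
      moreover have "J1 \<le> j" "J2 \<le> j" using \<open>J \<le> j\<close> by (auto simp: J_def)
      then have "\<bar>s j - l\<bar> < e / 2" "\<bar>g j\<bar> < e / 2" using J1 J2 by blast+
      ultimately show ?thesis unfolding real_norm_def by linarith
    qed
    then show "\<exists>no. \<forall>n\<ge>no. norm (m n - l) < e" by (intro exI[of _ "(J + 1) ^ 4"] allI impI)
  qed
  then show ?thesis by (auto simp: convergent_def)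
qed

lemma sum_squares_bound3: "(x + y + z)\<^sup>2 \<le> 3 * (x\<^sup>2 + y\<^sup>2 + z\<^sup>2)" for x y z :: real
proof -
  have "3 * (x\<^sup>2 + y\<^sup>2 + z\<^sup>2) - (x + y + z)\<^sup>2 = (x - y)\<^sup>2 + (y - z)\<^sup>2 + (x - z)\<^sup>2"
    by (simp add: power2_eq_square algebra_simps)
  then show ?thesis using zero_le_power2[of "x - y"] zero_le_power2[of "y - z"] zero_le_power2[of "x - z"]
    by linarith
qed

lemma abs_one_minus_le: "0 \<le> x \<Longrightarrow> x \<le> y \<Longrightarrow> \<bar>1 - x\<bar> \<le> 1 + y" for x y :: real
  by linarith

context reinforced_urn
begin

lemma expectation_weight:
  fixes g :: "real \<Rightarrow> 'c :: {banach, second_countable_topology}"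
  assumes g: "g \<in> borel_measurable weights" and bd: "\<And>z. z > 0 \<Longrightarrow> norm (g z) \<le> c"
  shows "(\<integral>\<omega>. g (Z (Suc n) \<omega>) \<partial>P) = (\<integral>\<omega>. g (Z 1 \<omega>) \<partial>P)"
proof -
  have "(\<lambda>x. g (snd x)) \<in> borel_measurable (past_Y MY n \<Otimes>\<^sub>M weights)"
    by (rule measurable_compose[OF measurable_snd g])
  then have "(\<integral>\<omega>. g (snd (\<omega>, Z (Suc n) \<omega>)) \<partial>P) = (\<integral>\<omega>. (\<integral>\<omega>'. g (snd (\<omega>, Z 1 \<omega>')) \<partial>P) \<partial>P)"
    by (rule integral_over_weight[where c=c]) (simp add: bd)
  then show ?thesis by (simp add: prob_space)
qed

text \<open>The bounds are assumed for the first weight only; as all weights have its distribution, they hold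
  for all weights simultaneously almost surely.\<close>

definition ordinary :: "'y traj \<Rightarrow> bool" where
  "ordinary \<omega> \<longleftrightarrow> (\<forall>n. a \<le> Z (Suc n) \<omega> \<and> Z (Suc n) \<omega> \<le> b)"

lemma AE_ordinary: "AE \<omega> in P. ordinary \<omega>"
  unfolding ordinary_def AE_all_countable
proof
  fix n
  define g :: "real \<Rightarrow> real" where "g = indicator (- {a..b})"
  have g: "g \<in> borel_measurable weights" unfolding g_def by (intro measurable_restrict_space1) simp
  have gZ: "(\<lambda>\<omega>. g (Z (Suc n) \<omega>)) \<in> borel_measurable P"
    by (rule measurable_compose[OF measurable_Z_P(1) g]) simp
  have "(\<integral>\<omega>. g (Z (Suc n) \<omega>) \<partial>P) = (\<integral>\<omega>. g (Z 1 \<omega>) \<partial>P)"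
    by (rule expectation_weight[OF g, of 1]) (simp add: g_def)
  also have "\<dots> = (\<integral>\<omega>. 0 \<partial>P)"
  proof (rule integral_cong_AE)
    show "(\<lambda>\<omega>. g (Z 1 \<omega>)) \<in> borel_measurable P" by (rule measurable_compose[OF measurable_Z_P(1) g]) simp
    show "AE \<omega> in P. g (Z 1 \<omega>) = 0" using weight_bounds by eventually_elim (simp add: g_def)
  qed simp
  finally have "(\<integral>\<omega>. g (Z (Suc n) \<omega>) \<partial>P) = 0" by simp
  moreover have "integrable P (\<lambda>\<omega>. g (Z (Suc n) \<omega>))"
    by (rule bounded_integrable[OF gZ, of 1]) (simp add: g_def)
  ultimately have "AE \<omega> in P. g (Z (Suc n) \<omega>) = 0"
    by (subst (asm) integral_nonneg_eq_0_iff_AE) (auto simp: g_def)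
  then show "AE \<omega> in P. a \<le> Z (Suc n) \<omega> \<and> Z (Suc n) \<omega> \<le> b"
    by eventually_elim (auto simp: g_def split: split_indicator_asm)
qed

lemma total_ordinary: "ordinary \<omega> \<Longrightarrow> a * real n \<le> total n \<omega>"
proof (induction n)
  case 0
  then show ?case using \<alpha> by (simp add: total_def)
next
  case (Suc n)
  then have "a * real n \<le> total n \<omega>" "a \<le> Z (Suc n) \<omega>" by (auto simp: ordinary_def)
  then show ?case by (simp add: total_Suc distrib_left)
qed

lemma drift_ordinary:
  assumes "ordinary \<omega>" "\<omega> \<in> space P"
  shows "drift n (\<omega>, Z (Suc n) \<omega>) \<le> b / (a * real (Suc n))"
    "real (Suc n) * drift n (\<omega>, Z (Suc n) \<omega>) \<le> b / a"
proof -
  have z: "0 < Z (Suc n) \<omega>" "Z (Suc n) \<omega> \<le> b" using assms weight_pos by (auto simp: ordinary_def)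
  have t: "a * real (Suc n) \<le> total n \<omega> + Z (Suc n) \<omega>"
    using total_ordinary[OF assms(1), of "Suc n"] by (simp add: total_Suc)
  have "drift n (\<omega>, Z (Suc n) \<omega>) \<le> b / (a * real (Suc n))"
    unfolding drift_def fst_conv snd_conv using z t a by (intro frac_le) auto
  then show "drift n (\<omega>, Z (Suc n) \<omega>) \<le> b / (a * real (Suc n))" .
  then have "real (Suc n) * drift n (\<omega>, Z (Suc n) \<omega>) \<le> real (Suc n) * (b / (a * real (Suc n)))"
    by (rule mult_left_mono) simp
  also have "\<dots> = b / a" using a by (simp del: of_nat_Suc)
  finally show "real (Suc n) * drift n (\<omega>, Z (Suc n) \<omega>) \<le> b / a" .
qed

lemma emp_eq: "emp n B \<omega> = (\<Sum>i=1..n. hit B i \<omega>) / real n"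
  by (simp add: emp_def hit_def)

lemma emp_bounds:
  fixes B :: "'y set"
  shows "0 \<le> emp n B \<omega>" "emp n B \<omega> \<le> 1"
proof -
  have "(\<Sum>i=1..n. hit B i \<omega>) \<le> (\<Sum>i=1..n. 1)" by (intro sum_mono hit_bounds)
  then show "emp n B \<omega> \<le> 1" by (simp add: emp_eq divide_le_eq)
  show "0 \<le> emp n B \<omega>" unfolding emp_eq by (intro divide_nonneg_nonneg sum_nonneg hit_bounds) simp
qed

lemma measurable_emp: "B \<in> sets MY \<Longrightarrow> emp n B \<in> borel_measurable P"
  unfolding emp_eq by (intro borel_measurable_divide borel_measurable_sum measurable_hit_P borel_measurable_const) auto

text \<open>Multiplied by \<open>n\<close>, frequency and prediction both change by multiples of the newest surprise. So
  their difference is a sum to which orthogonality applies, with coefficients that stay bounded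
  because \<open>drift l\<close> is of order \<open>1 / l\<close>.\<close>

lemma emp_minus_pred:
  assumes "\<omega> \<in> space P"
  shows "real n * (emp n B \<omega> - pred \<alpha> P n B \<omega>)
    = (\<Sum>l=0..<n. (1 - real (Suc l) * drift l (\<omega>, Z (Suc l) \<omega>)) * (hit B (Suc l) \<omega> - pred \<alpha> P l B \<omega>))"
proof (induction n)
  case (Suc n)
  define h where "h = hit B (Suc n) \<omega>"
  define p where "p = pred \<alpha> P n B \<omega>"
  define d where "d = drift n (\<omega>, Z (Suc n) \<omega>)"
  have e: "real k * emp k B \<omega> = (\<Sum>i=1..k. hit B i \<omega>)" for k by (simp add: emp_eq)
  have ps: "pred \<alpha> P (Suc n) B \<omega> = p + d * (h - p)"
    using pred_step[OF assms, of n B] by (simp add: h_def p_def d_def)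
  have es: "real (Suc n) * emp (Suc n) B \<omega> = real n * emp n B \<omega> + h"
    unfolding e by (simp add: h_def)
  have "real (Suc n) * (emp (Suc n) B \<omega> - pred \<alpha> P (Suc n) B \<omega>)
      = real n * emp n B \<omega> + h - real (Suc n) * (p + d * (h - p))"
    unfolding right_diff_distrib[of "real (Suc n)" "emp (Suc n) B \<omega>"] ps es by (rule refl)
  also have "\<dots> = real n * (emp n B \<omega> - p) + (1 - real (Suc n) * d) * (h - p)"
    by (simp add: algebra_simps)
  finally show ?case using Suc by (simp add: h_def p_def d_def)
qed simp

lemma expectation_emp_minus_pred:
  assumes B: "B \<in> sets MY"
  shows "(\<integral>\<omega>. (real n * (emp n B \<omega> - pred \<alpha> P n B \<omega>))\<^sup>2 \<partial>P) \<le> real n * (1 + b / a)\<^sup>2 * prior B"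
proof -
  let ?\<Psi> = "\<lambda>l x. 1 - real (Suc l) * drift l x"
  have "(\<integral>\<omega>. (\<Sum>l=0..<n. ?\<Psi> l (\<omega>, Z (Suc l) \<omega>) * (hit B (Suc l) \<omega> - pred \<alpha> P l B \<omega>))\<^sup>2 \<partial>P)
     \<le> (\<Sum>l=0..<n. (1 + b / a)\<^sup>2) * prior B"
  proof (rule surprise_sum_second_moment[OF B])
    show "?\<Psi> l \<in> borel_measurable (past MY l \<Otimes>\<^sub>M weights)" for l
      by (intro borel_measurable_diff borel_measurable_times borel_measurable_const measurable_drift)
    show "\<bar>?\<Psi> l (\<omega>, z)\<bar> \<le> 1 + real (Suc l)" if "\<omega> \<in> space P" "z > 0" for l \<omega> z
    proof -
      have "0 \<le> real (Suc l) * drift l (\<omega>, z)" "real (Suc l) * drift l (\<omega>, z) \<le> real (Suc l) * 1"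
        using drift_bounds[OF that, of l] by (auto intro: mult_left_mono simp del: of_nat_Suc)
      then show ?thesis by (simp only: abs_one_minus_le mult_1_right)
    qed
    show "AE \<omega> in P. \<bar>?\<Psi> l (\<omega>, Z (Suc l) \<omega>)\<bar> \<le> 1 + b / a" for l
      using AE_ordinary AE_space
    proof eventually_elim
      case (elim \<omega>)
      have "0 \<le> real (Suc l) * drift l (\<omega>, Z (Suc l) \<omega>)"
        using drift_bounds(1)[OF elim(2) weight_pos[OF elim(2)]] by (simp del: of_nat_Suc)
      then show ?case using drift_ordinary(2)[OF elim, of l] by (rule abs_one_minus_le)
    qed
  qed simp
  moreover have "(\<integral>\<omega>. (real n * (emp n B \<omega> - pred \<alpha> P n B \<omega>))\<^sup>2 \<partial>P)
     = (\<integral>\<omega>. (\<Sum>l=0..<n. ?\<Psi> l (\<omega>, Z (Suc l) \<omega>) * (hit B (Suc l) \<omega> - pred \<alpha> P l B \<omega>))\<^sup>2 \<partial>P)"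
    by (intro Bochner_Integration.integral_cong refl) (simp only: emp_minus_pred)
  ultimately show ?thesis by simp
qed

lemma expectation_C_squared:
  assumes B: "B \<in> sets MY"
  shows "(\<integral>\<omega>. (C \<alpha> P n B \<omega>)\<^sup>2 \<partial>P) \<le> (1 + b / a)\<^sup>2 * prior B"
proof (cases "n = 0")
  case False
  then have n: "real n > 0" by simp
  have "real n * (C \<alpha> P n B \<omega>)\<^sup>2 = (real n * (emp n B \<omega> - pred \<alpha> P n B \<omega>))\<^sup>2" for \<omega>
    using n by (simp add: C_def power_mult_distrib power2_eq_square[of "real n"])
  then have "real n * (\<integral>\<omega>. (C \<alpha> P n B \<omega>)\<^sup>2 \<partial>P) \<le> real n * ((1 + b / a)\<^sup>2 * prior B)"
    using expectation_emp_minus_pred[OF B, of n] by (simp flip: integral_mult_right_zero add: mult.assoc)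
  then show ?thesis using n by simp
qed (simp add: C_def)

text \<open>The increment is a sum of surprises with coefficients of order \<open>1 / l\<close>, whose squares sum to
  order \<open>1 / j\<close> from \<open>j\<close> on.\<close>

lemma expectation_pred_increment:
  assumes B: "B \<in> sets MY" and j: "1 \<le> j" "j \<le> n"
  shows "(\<integral>\<omega>. (pred \<alpha> P n B \<omega> - pred \<alpha> P j B \<omega>)\<^sup>2 \<partial>P) \<le> (b / a)\<^sup>2 * prior B / real j"
proof -
  have bound: "(\<integral>\<omega>. (\<Sum>l=j..<n. drift l (\<omega>, Z (Suc l) \<omega>) * (hit B (Suc l) \<omega> - pred \<alpha> P l B \<omega>))\<^sup>2 \<partial>P)
     \<le> (\<Sum>l=j..<n. (b / (a * real (Suc l)))\<^sup>2) * prior B"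
  proof (rule surprise_sum_second_moment[OF B measurable_drift _ _ j(2)])
    show "\<bar>drift l (\<omega>, z)\<bar> \<le> 1" if "\<omega> \<in> space P" "z > 0" for l \<omega> z
      using drift_bounds[OF that, of l] by simp
    show "AE \<omega> in P. \<bar>drift l (\<omega>, Z (Suc l) \<omega>)\<bar> \<le> b / (a * real (Suc l))" for l
      using AE_ordinary AE_space
    proof eventually_elim
      case (elim \<omega>)
      have "0 \<le> drift l (\<omega>, Z (Suc l) \<omega>)"
        using drift_bounds(1)[OF elim(2) weight_pos[OF elim(2)]] by simp
      then show ?case using drift_ordinary(1)[OF elim, of l] by linarith
    qed
  qed
  have "(\<Sum>l=j..<n. (b / (a * real (Suc l)))\<^sup>2) = (b / a)\<^sup>2 * (\<Sum>l=j..<n. 1 / (real l + 1)\<^sup>2)"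
    unfolding sum_distrib_left by (intro sum.cong refl) (simp add: power_divide power_mult_distrib add.commute)
  also have "\<dots> \<le> (b / a)\<^sup>2 * (1 / real j)"
  proof (rule mult_left_mono)
    have "0 \<le> 1 / real n" by simp
    then show "(\<Sum>l=j..<n. 1 / (real l + 1)\<^sup>2) \<le> 1 / real j"
      using sum_inverse_squares_le[OF j] by linarith
  qed simp
  finally have "(\<Sum>l=j..<n. (b / (a * real (Suc l)))\<^sup>2) * prior B \<le> (b / a)\<^sup>2 * (1 / real j) * prior B"
    by (rule mult_right_mono) simp
  note order_trans[OF bound this]
  moreover have "pred \<alpha> P n B \<omega> - pred \<alpha> P j B \<omega>
     = (\<Sum>l=j..<n. drift l (\<omega>, Z (Suc l) \<omega>) * (hit B (Suc l) \<omega> - pred \<alpha> P l B \<omega>))" if "\<omega> \<in> space P" for \<omega>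
    unfolding pred_step[OF that, symmetric] using sum_Suc_diff'[OF j(2), of "\<lambda>l. pred \<alpha> P l B \<omega>"] by simp
  then have "(\<integral>\<omega>. (pred \<alpha> P n B \<omega> - pred \<alpha> P j B \<omega>)\<^sup>2 \<partial>P)
     = (\<integral>\<omega>. (\<Sum>l=j..<n. drift l (\<omega>, Z (Suc l) \<omega>) * (hit B (Suc l) \<omega> - pred \<alpha> P l B \<omega>))\<^sup>2 \<partial>P)"
    by (intro Bochner_Integration.integral_cong refl) simp
  ultimately show ?thesis by simp
qed

text \<open>One constant for all second moment bounds. An increment of the frequencies splits into three
  parts, each contributing \<open>(1 + b / a)^2\<close>, and squaring a sum of three terms costs another factor 3.\<close>

definition rate :: real where "rate = 9 * (1 + b / a)\<^sup>2"

lemma rate_pos: "rate > 0"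
  using a ab unfolding rate_def by (intro mult_pos_pos zero_less_power) (auto intro: add_pos_pos)

lemma integrable_square_diff:
  fixes f g :: "'y traj \<Rightarrow> real"
  assumes "f \<in> borel_measurable P" "g \<in> borel_measurable P"
    "\<And>\<omega>. \<omega> \<in> space P \<Longrightarrow> 0 \<le> f \<omega> \<and> f \<omega> \<le> 1" "\<And>\<omega>. \<omega> \<in> space P \<Longrightarrow> 0 \<le> g \<omega> \<and> g \<omega> \<le> 1"
  shows "integrable P (\<lambda>\<omega>. (f \<omega> - g \<omega>)\<^sup>2)" "integrable P (\<lambda>\<omega>. \<bar>f \<omega> - g \<omega>\<bar>)"
proof -
  have le: "\<bar>f \<omega> - g \<omega>\<bar> \<le> 1" if "\<omega> \<in> space P" for \<omega>
    using assms(3,4)[OF that] by linarith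
  show "integrable P (\<lambda>\<omega>. (f \<omega> - g \<omega>)\<^sup>2)"
    using le assms(1,2) by (intro bounded_integrable[of _ 1]) (auto simp: abs_square_le_1)
  show "integrable P (\<lambda>\<omega>. \<bar>f \<omega> - g \<omega>\<bar>)"
    using le assms(1,2) by (intro bounded_integrable[of _ 1]) auto
qed

lemma expectation_emp_pred_distance:
  assumes B: "B \<in> sets MY" and n: "n \<ge> 1"
  shows "(\<integral>\<omega>. (emp n B \<omega> - pred \<alpha> P n B \<omega>)\<^sup>2 \<partial>P) \<le> (1 + b / a)\<^sup>2 * prior B / real n"
proof -
  have "real n * (real n * (\<integral>\<omega>. (emp n B \<omega> - pred \<alpha> P n B \<omega>)\<^sup>2 \<partial>P))
     \<le> real n * ((1 + b / a)\<^sup>2 * prior B)"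
    using expectation_emp_minus_pred[OF B, of n]
    by (simp add: power_mult_distrib power2_eq_square[of "real n"] mult.assoc)
  then show ?thesis using n by (simp add: pos_le_divide_eq mult.commute)
qed

text \<open>The frequencies are compared through the predictions at the two times.\<close>

lemma expectation_emp_increment:
  assumes B: "B \<in> sets MY" and j: "1 \<le> j" "j \<le> n"
  shows "(\<integral>\<omega>. (emp n B \<omega> - emp j B \<omega>)\<^sup>2 \<partial>P) \<le> rate * prior B / real j"
proof -
  let ?e = "\<lambda>n \<omega>. emp n B \<omega>" and ?p = "\<lambda>n \<omega>. pred \<alpha> P n B \<omega>"
  define q where "q = (1 + b / a)\<^sup>2 * prior B / real j"
  have em: "?e n \<in> borel_measurable P" "?p n \<in> borel_measurable P" for n
    using B by (auto intro: measurable_emp measurable_pred_P)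
  note int = integrable_square_diff(1)[OF em(1) em(2)] integrable_square_diff(1)[OF em(1) em(1)]
     integrable_square_diff(1)[OF em(2) em(2)]
  have i: "integrable P (\<lambda>\<omega>. (?e n \<omega> - ?p n \<omega>)\<^sup>2)" "integrable P (\<lambda>\<omega>. (?p n \<omega> - ?p j \<omega>)\<^sup>2)"
    "integrable P (\<lambda>\<omega>. (?e j \<omega> - ?p j \<omega>)\<^sup>2)" "integrable P (\<lambda>\<omega>. (?e n \<omega> - ?e j \<omega>)\<^sup>2)"
    by (rule int; use emp_bounds pred_bounds in blast)+
  have "(?e n \<omega> - ?e j \<omega>)\<^sup>2 \<le> 3 * ((?e n \<omega> - ?p n \<omega>)\<^sup>2 + (?p n \<omega> - ?p j \<omega>)\<^sup>2 + (?e j \<omega> - ?p j \<omega>)\<^sup>2)" for \<omega>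
    using sum_squares_bound3[of "?e n \<omega> - ?p n \<omega>" "?p n \<omega> - ?p j \<omega>" "?p j \<omega> - ?e j \<omega>"]
    by (simp add: power2_commute[of "?p j \<omega>"])
  then have "(\<integral>\<omega>. (?e n \<omega> - ?e j \<omega>)\<^sup>2 \<partial>P)
     \<le> (\<integral>\<omega>. 3 * ((?e n \<omega> - ?p n \<omega>)\<^sup>2 + (?p n \<omega> - ?p j \<omega>)\<^sup>2 + (?e j \<omega> - ?p j \<omega>)\<^sup>2) \<partial>P)"
    using i by (intro integral_mono) auto
  also have "\<dots> = 3 * ((\<integral>\<omega>. (?e n \<omega> - ?p n \<omega>)\<^sup>2 \<partial>P) + (\<integral>\<omega>. (?p n \<omega> - ?p j \<omega>)\<^sup>2 \<partial>P)
      + (\<integral>\<omega>. (?e j \<omega> - ?p j \<omega>)\<^sup>2 \<partial>P))"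
    using i by simp
  also have "\<dots> \<le> 3 * (q + q + q)"
  proof -
    have "(1 + b / a)\<^sup>2 * prior B / real n \<le> q"
      unfolding q_def using j by (intro divide_left_mono) auto
    then have 1: "(\<integral>\<omega>. (?e n \<omega> - ?p n \<omega>)\<^sup>2 \<partial>P) \<le> q"
      using expectation_emp_pred_distance[OF B, of n] j by linarith
    have "(b / a)\<^sup>2 \<le> (1 + b / a)\<^sup>2" using a ab by (intro power_mono) auto
    then have "(b / a)\<^sup>2 * prior B / real j \<le> q"
      unfolding q_def by (intro divide_right_mono mult_right_mono) auto
    then have 2: "(\<integral>\<omega>. (?p n \<omega> - ?p j \<omega>)\<^sup>2 \<partial>P) \<le> q"
      using expectation_pred_increment[OF B j] by linarith
    have 3: "(\<integral>\<omega>. (?e j \<omega> - ?p j \<omega>)\<^sup>2 \<partial>P) \<le> q"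
      unfolding q_def by (rule expectation_emp_pred_distance[OF B j(1)])
    show ?thesis by (intro mult_left_mono add_mono 1 2 3) simp
  qed
  finally show ?thesis by (simp add: q_def rate_def)
qed

text \<open>Along the fourth powers the increments have expectations of order \<open>1 / j^2\<close>, so they are almost
  surely summable.\<close>

lemma emp_converges:
  assumes B: "B \<in> sets MY"
  shows "AE \<omega> in P. (\<lambda>n. emp n B \<omega>) \<longlonglongrightarrow> emp_lim B \<omega>"
proof -
  define g where "g j \<omega> = \<bar>emp ((j + 2) ^ 4) B \<omega> - emp ((j + 1) ^ 4) B \<omega>\<bar>" for j \<omega>
  have em: "emp n B \<in> borel_measurable P" for n using B by (rule measurable_emp)
  have gm: "g j \<in> borel_measurable P" for j unfolding g_def using em by (intro borel_measurable_abs borel_measurable_diff)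
  have gi: "integrable P (g j)" for j
    unfolding g_def using emp_bounds by (intro integrable_square_diff(2) em) auto
  have Eg: "(\<integral>\<omega>. g j \<omega> \<partial>P) \<le> (rate + 1) / (real j + 1)\<^sup>2" for j
  proof -
    define r where "r = (real j + 1)\<^sup>2"
    have r: "r > 0" by (simp add: r_def)
    have sq: "integrable P (\<lambda>\<omega>. (g j \<omega>)\<^sup>2)"
      unfolding g_def power2_abs using emp_bounds by (intro integrable_square_diff(1) em) auto
    have "(\<integral>\<omega>. (g j \<omega>)\<^sup>2 \<partial>P) \<le> rate * prior B / real ((j + 1) ^ 4)"
      unfolding g_def power2_abs by (rule expectation_emp_increment[OF B]) (auto intro: power_mono)
    also have "\<dots> \<le> rate * 1 / real ((j + 1) ^ 4)"
      using rate_pos by (intro divide_right_mono mult_left_mono) auto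
    also have "real ((j + 1) ^ 4) = r\<^sup>2" by (simp add: r_def power2_eq_square power4_eq_xxxx algebra_simps)
    finally have E: "(\<integral>\<omega>. (g j \<omega>)\<^sup>2 \<partial>P) \<le> rate / r\<^sup>2" by simp
    \<comment> \<open>passes from second to first moments\<close>
    have "g j \<omega> \<le> r * (g j \<omega>)\<^sup>2 + 1 / r" for \<omega>
    proof -
      have "0 \<le> (r * g j \<omega> - 1)\<^sup>2" by simp
      also have "\<dots> = r * (r * (g j \<omega>)\<^sup>2 + 1 / r - 2 * g j \<omega>)"
        using r by (simp add: power2_eq_square field_simps)
      finally have "2 * g j \<omega> \<le> r * (g j \<omega>)\<^sup>2 + 1 / r" using r by (simp add: zero_le_mult_iff)
      moreover have "0 \<le> g j \<omega>" by (simp add: g_def)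
      ultimately show ?thesis by linarith
    qed
    then have "(\<integral>\<omega>. g j \<omega> \<partial>P) \<le> (\<integral>\<omega>. r * (g j \<omega>)\<^sup>2 + 1 / r \<partial>P)"
      using gi sq by (intro integral_mono) auto
    also have "\<dots> = r * (\<integral>\<omega>. (g j \<omega>)\<^sup>2 \<partial>P) + 1 / r" using sq by (simp add: prob_space)
    also have "\<dots> \<le> r * (rate / r\<^sup>2) + 1 / r" using E r by (intro add_right_mono mult_left_mono) auto
    also have "\<dots> = (rate + 1) / r" using r by (simp add: power2_eq_square field_simps)
    finally show ?thesis by (simp add: r_def)
  qed
  have sm: "summable (\<lambda>j. (rate + 1) / (real j + 1)\<^sup>2)"
  proof -
    have "summable (\<lambda>j. inverse (real (Suc j) ^ 2))"
      using inverse_power_summable[of 2] by (subst summable_Suc_iff) auto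
    then have "summable (\<lambda>j. (rate + 1) * inverse (real (Suc j) ^ 2))" by (rule summable_mult)
    then show ?thesis by (simp add: divide_inverse add.commute)
  qed
  have "(\<integral>\<^sup>+\<omega>. (\<Sum>j. ennreal (g j \<omega>)) \<partial>P) = (\<Sum>j. \<integral>\<^sup>+\<omega>. ennreal (g j \<omega>) \<partial>P)"
    using gm by (intro nn_integral_suminf) auto
  also have "\<dots> = (\<Sum>j. ennreal (\<integral>\<omega>. g j \<omega> \<partial>P))"
    by (intro suminf_cong nn_integral_eq_integral gi) (simp add: g_def)
  also have "\<dots> \<le> (\<Sum>j. ennreal ((rate + 1) / (real j + 1)\<^sup>2))"
    using Eg by (intro suminf_le ennreal_leI) auto
  also have "\<dots> = ennreal (\<Sum>j. (rate + 1) / (real j + 1)\<^sup>2)"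
    using rate_pos by (intro suminf_ennreal2 sm) auto
  also have "\<dots> < \<infinity>" by simp
  finally have "AE \<omega> in P. (\<Sum>j. ennreal (g j \<omega>)) \<noteq> \<infinity>"
    using gm by (intro nn_integral_noteq_infinite) auto
  then show ?thesis
  proof eventually_elim
    case (elim \<omega>)
    have "summable (\<lambda>j. g j \<omega>)"
      using elim by (intro summable_suminf_not_top) (auto simp: g_def)
    then have "summable (\<lambda>j. \<bar>(\<Sum>i=1..(j + 2) ^ 4. hit B i \<omega>) / real ((j + 2) ^ 4)
        - (\<Sum>i=1..(j + 1) ^ 4. hit B i \<omega>) / real ((j + 1) ^ 4)\<bar>)"
      unfolding g_def emp_eq .
    from running_mean_convergent[OF hit_bounds this] have "convergent (\<lambda>n. emp n B \<omega>)"
      unfolding emp_eq .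
    then obtain l where l: "(\<lambda>n. emp n B \<omega>) \<longlonglongrightarrow> l" by (auto simp: convergent_def)
    then have "(\<lambda>n. ereal (emp n B \<omega>)) \<longlonglongrightarrow> ereal l" by simp
    then have "limsup (\<lambda>n. ereal (emp n B \<omega>)) = ereal l" by (intro lim_imp_Limsup) auto
    then show ?case using l by (simp add: emp_lim_def)
  qed
qed

lemma measurable_emp_lim: "B \<in> sets MY \<Longrightarrow> emp_lim B \<in> borel_measurable P"
  unfolding emp_lim_def using measurable_emp
  by (intro borel_measurable_real_of_ereal borel_measurable_limsup borel_measurable_ereal)

lemma emp_lim_bounds:
  fixes B :: "'y set"
  shows "0 \<le> emp_lim B \<omega>" "emp_lim B \<omega> \<le> 1"
proof -
  let ?l = "limsup (\<lambda>n. ereal (emp n B \<omega>))"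
  have "?l \<le> 1" by (rule Limsup_bounded) (simp add: emp_bounds)
  moreover have "0 \<le> ?l" 
    by (rule order_trans[OF _ Liminf_le_Limsup]) (auto intro!: Liminf_bounded simp: emp_bounds)
  ultimately show "0 \<le> emp_lim B \<omega>" "emp_lim B \<omega> \<le> 1"
    unfolding emp_lim_def by (cases ?l; auto simp: one_ereal_def zero_ereal_def)+
qed

lemma expectation_emp_minus_lim:
  assumes B: "B \<in> sets MY" and n: "n \<ge> 1"
  shows "(\<integral>\<omega>. (emp n B \<omega> - emp_lim B \<omega>)\<^sup>2 \<partial>P) \<le> rate * prior B / real n"
proof -
  have em: "emp n B \<in> borel_measurable P" for n using B by (rule measurable_emp)
  have lm: "emp_lim B \<in> borel_measurable P" using B by (rule measurable_emp_lim)
  have "(\<lambda>m. \<integral>\<omega>. (emp n B \<omega> - emp m B \<omega>)\<^sup>2 \<partial>P) \<longlonglongrightarrow> (\<integral>\<omega>. (emp n B \<omega> - emp_lim B \<omega>)\<^sup>2 \<partial>P)"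
  proof (rule integral_dominated_convergence[where w="\<lambda>_. 1"])
    show "AE \<omega> in P. (\<lambda>m. (emp n B \<omega> - emp m B \<omega>)\<^sup>2) \<longlonglongrightarrow> (emp n B \<omega> - emp_lim B \<omega>)\<^sup>2"
      using emp_converges[OF B] by eventually_elim (intro tendsto_intros)
    have "\<bar>emp n B \<omega> - emp m B \<omega>\<bar> \<le> 1" for m \<omega>
      using emp_bounds[of n B \<omega>] emp_bounds[of m B \<omega>] by linarith
    then show "AE \<omega> in P. norm ((emp n B \<omega> - emp m B \<omega>)\<^sup>2) \<le> 1" for m
      by (intro AE_I2) (simp add: abs_square_le_1)
  qed (use em lm in auto)
  moreover have "\<forall>m\<ge>n. (\<integral>\<omega>. (emp n B \<omega> - emp m B \<omega>)\<^sup>2 \<partial>P) \<le> rate * prior B / real n"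
    using expectation_emp_increment[OF B n] by (simp add: power2_commute[of "emp n B _"])
  ultimately show ?thesis by (intro LIMSEQ_le_const2) auto
qed

lemma prior_sums:
  assumes "\<And>k. B k \<in> sets MY" "disjoint_family B"
  shows "(\<lambda>k. prior (B k)) sums measure P {\<omega>\<in>space P. Y 1 \<omega> \<in> (\<Union>k. B k)}"
proof -
  have "{\<omega>\<in>space P. Y 1 \<omega> \<in> B k} \<in> sets P" for k
    using measurable_sets[OF measurable_Y_P[of 1] assms(1)[of k]] by (simp add: vimage_def Int_def conj_commute)
  then have "(\<lambda>k. prior (B k)) sums measure P (\<Union>k. {\<omega>\<in>space P. Y 1 \<omega> \<in> B k})"
    using assms(2) by (intro finite_measure_UNION) (auto simp: disjoint_family_on_def)
  moreover have "(\<Union>k. {\<omega>\<in>space P. Y 1 \<omega> \<in> B k}) = {\<omega>\<in>space P. Y 1 \<omega> \<in> (\<Union>k. B k)}" by auto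
  ultimately show ?thesis by simp
qed

text \<open>The square of a supremum is at most the sum of the squares, so bounds proportional to a summable
  sequence suffice.\<close>

lemma expectation_sup_squared:
  fixes f :: "nat \<Rightarrow> 'y traj \<Rightarrow> real"
  assumes f: "\<And>k. f k \<in> borel_measurable P" "\<And>k \<omega>. \<omega> \<in> space P \<Longrightarrow> \<bar>f k \<omega>\<bar> \<le> d"
    and E: "\<And>k. (\<integral>\<omega>. (f k \<omega>)\<^sup>2 \<partial>P) \<le> c * u k" and u: "summable u" "\<And>k. u k \<ge> 0" and c: "c \<ge> 0"
  shows "(\<integral>\<^sup>+\<omega>. ennreal ((SUP k. \<bar>f k \<omega>\<bar>)\<^sup>2) \<partial>P) \<le> ennreal (c * (\<Sum>k. u k))"
proof -
  have "ennreal ((SUP k. \<bar>f k \<omega>\<bar>)\<^sup>2) \<le> (\<Sum>k. ennreal ((f k \<omega>)\<^sup>2))" if \<omega>: "\<omega> \<in> space P" for \<omega>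
  proof (cases "(\<Sum>k. ennreal ((f k \<omega>)\<^sup>2)) = top")
    case False
    then have sm: "summable (\<lambda>k. (f k \<omega>)\<^sup>2)" by (intro summable_suminf_not_top) auto
    have "\<bar>f k \<omega>\<bar> \<le> sqrt (\<Sum>k. (f k \<omega>)\<^sup>2)" for k
    proof (rule real_le_rsqrt)
      have "(\<Sum>j\<in>{k}. (f j \<omega>)\<^sup>2) \<le> (\<Sum>k. (f k \<omega>)\<^sup>2)" by (intro sum_le_suminf sm) auto
      then show "\<bar>f k \<omega>\<bar>\<^sup>2 \<le> (\<Sum>k. (f k \<omega>)\<^sup>2)" by simp
    qed
    then have "(SUP k. \<bar>f k \<omega>\<bar>) \<le> sqrt (\<Sum>k. (f k \<omega>)\<^sup>2)" by (intro cSUP_least) auto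
    moreover have "0 \<le> (SUP k. \<bar>f k \<omega>\<bar>)"
      using f(2)[OF \<omega>] by (intro cSUP_upper2[of _ _ 0]) (auto intro!: bdd_aboveI2[of _ _ d])
    ultimately have "(SUP k. \<bar>f k \<omega>\<bar>)\<^sup>2 \<le> (sqrt (\<Sum>k. (f k \<omega>)\<^sup>2))\<^sup>2" by (rule power_mono)
    also have "\<dots> = (\<Sum>k. (f k \<omega>)\<^sup>2)" by (intro real_sqrt_pow2 suminf_nonneg sm) auto
    finally have "ennreal ((SUP k. \<bar>f k \<omega>\<bar>)\<^sup>2) \<le> ennreal (\<Sum>k. (f k \<omega>)\<^sup>2)" by (rule ennreal_leI)
    also have "\<dots> = (\<Sum>k. ennreal ((f k \<omega>)\<^sup>2))" by (intro suminf_ennreal2[symmetric] sm) auto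
    finally show ?thesis .
  qed simp
  then have "(\<integral>\<^sup>+\<omega>. ennreal ((SUP k. \<bar>f k \<omega>\<bar>)\<^sup>2) \<partial>P) \<le> (\<integral>\<^sup>+\<omega>. (\<Sum>k. ennreal ((f k \<omega>)\<^sup>2)) \<partial>P)"
    by (intro nn_integral_mono)
  also have "\<dots> = (\<Sum>k. \<integral>\<^sup>+\<omega>. ennreal ((f k \<omega>)\<^sup>2) \<partial>P)"
    using f(1) by (intro nn_integral_suminf) auto
  also have "\<dots> \<le> (\<Sum>k. ennreal (c * u k))"
  proof (intro suminf_le)
    fix k
    have "integrable P (\<lambda>\<omega>. (f k \<omega>)\<^sup>2)"
    proof (rule bounded_integrable[of _ "d\<^sup>2"])
      show "\<bar>(f k \<omega>)\<^sup>2\<bar> \<le> d\<^sup>2" if "\<omega> \<in> space P" for \<omega>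
        using f(2)[OF that, of k] power_mono[of "\<bar>f k \<omega>\<bar>" d 2] by simp
    qed (use f(1) in auto)
    then have "(\<integral>\<^sup>+\<omega>. ennreal ((f k \<omega>)\<^sup>2) \<partial>P) = ennreal (\<integral>\<omega>. (f k \<omega>)\<^sup>2 \<partial>P)"
      by (intro nn_integral_eq_integral) auto
    also have "\<dots> \<le> ennreal (c * u k)" by (rule ennreal_leI[OF E])
    finally show "(\<integral>\<^sup>+\<omega>. ennreal ((f k \<omega>)\<^sup>2) \<partial>P) \<le> ennreal (c * u k)" .
  qed auto
  also have "\<dots> = ennreal (\<Sum>k. c * u k)"
    using u c by (intro suminf_ennreal2 summable_mult) auto
  also have "(\<Sum>k. c * u k) = c * (\<Sum>k. u k)" using u by (intro suminf_mult)
  finally show ?thesis .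
qed

text \<open>The bounds for the individual sets are proportional to their prior probabilities, which for
  disjoint sets add up to the prior probability of the union.\<close>

lemma W_norm_second_moment:
  assumes B: "\<And>k. k \<ge> 1 \<Longrightarrow> B k \<in> sets MY" and disj: "disjoint_family_on B {1..}" and n: "n \<ge> 1"
  shows "(\<integral>\<^sup>+\<omega>. ennreal ((W_norm B n \<omega>)\<^sup>2) \<partial>P)
    \<le> ennreal (rate * measure P {\<omega>\<in>space P. Y 1 \<omega> \<in> (\<Union>k\<in>{1..}. B k)})"
proof -
  define D where "D k = B (Suc k)" for k
  have D: "D k \<in> sets MY" for k unfolding D_def by (rule B) simp
  have dD: "disjoint_family D" using disj by (auto simp: disjoint_family_on_def D_def)
  have img: "{1..} = range Suc" by (auto simp: image_iff Suc_le_eq dest: gr0_implies_Suc)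
  have "(\<integral>\<^sup>+\<omega>. ennreal ((SUP k. \<bar>W n (D k) \<omega>\<bar>)\<^sup>2) \<partial>P) \<le> ennreal (rate * (\<Sum>k. prior (D k)))"
  proof (rule expectation_sup_squared[where d="sqrt (real n)"])
    show "W n (D k) \<in> borel_measurable P" for k
      unfolding W_def using measurable_emp[OF D] measurable_emp_lim[OF D] by auto
    show "\<bar>W n (D k) \<omega>\<bar> \<le> sqrt (real n)" for k \<omega>
    proof -
      have "\<bar>emp n (D k) \<omega> - emp_lim (D k) \<omega>\<bar> \<le> 1"
        using emp_bounds[of n "D k" \<omega>] emp_lim_bounds[of "D k" \<omega>] by linarith
      then have "sqrt (real n) * \<bar>emp n (D k) \<omega> - emp_lim (D k) \<omega>\<bar> \<le> sqrt (real n) * 1"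
        by (intro mult_left_mono) auto
      then show ?thesis by (simp add: W_def abs_mult)
    qed
    show "(\<integral>\<omega>. (W n (D k) \<omega>)\<^sup>2 \<partial>P) \<le> rate * prior (D k)" for k
    proof -
      have "(\<integral>\<omega>. (W n (D k) \<omega>)\<^sup>2 \<partial>P) = real n * (\<integral>\<omega>. (emp n (D k) \<omega> - emp_lim (D k) \<omega>)\<^sup>2 \<partial>P)"
        by (simp add: W_def power_mult_distrib)
      also have "\<dots> \<le> real n * (rate * prior (D k) / real n)"
        by (intro mult_left_mono expectation_emp_minus_lim D n) auto
      finally show ?thesis using n by simp
    qed
    show "summable (\<lambda>k. prior (D k))" using prior_sums[OF D dD] by (rule sums_summable)
  qed (use rate_pos in auto)
  moreover have "(\<Sum>k. prior (D k)) = measure P {\<omega>\<in>space P. Y 1 \<omega> \<in> (\<Union>k\<in>{1..}. B k)}"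
    using sums_unique[OF prior_sums[OF D dD]] unfolding img by (simp add: D_def)
  moreover have "W_norm B n \<omega> = (SUP k. \<bar>W n (D k) \<omega>\<bar>)" for \<omega>
    unfolding W_norm_def img by (simp add: image_image D_def)
  ultimately show ?thesis by simp
qed

end

section \<open>Convergence of integrals from a generator\<close>

text \<open>Interchanges two limits when the approximation is uniform in \<open>n\<close>.\<close>

lemma tendsto_of_uniform_approximation:
  fixes x :: "nat \<Rightarrow> 'a :: real_normed_vector"
  assumes "\<And>e. e > 0 \<Longrightarrow> \<exists>y m. y \<longlonglongrightarrow> m \<and> (\<forall>n. norm (x n - y n) \<le> e) \<and> norm (l - m) \<le> e"
  shows "x \<longlonglongrightarrow> l"
proof (rule LIMSEQ_I)
  fix e :: real assume "e > 0"
  then have e: "e / 4 > 0" by simp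
  from assms[OF e] obtain y m where y: "y \<longlonglongrightarrow> m" "\<And>n. norm (x n - y n) \<le> e / 4" "norm (l - m) \<le> e / 4"
    by blast
  obtain N where N: "\<And>n. n \<ge> N \<Longrightarrow> norm (y n - m) < e / 4" using LIMSEQ_D[OF y(1) e] by blast
  have "norm (x n - l) < e" if "n \<ge> N" for n
  proof -
    have eq: "x n - l = (x n - y n) + (y n - m) - (l - m)" by simp
    have "norm (x n - l) \<le> norm (x n - y n) + norm (y n - m) + norm (l - m)"
      unfolding eq using norm_triangle_ineq4[of "(x n - y n) + (y n - m)" "l - m"]
        norm_triangle_ineq[of "x n - y n" "y n - m"] by linarith
    then show ?thesis using y(2)[of n] y(3) N[OF that] \<open>e > 0\<close> by linarith
  qed
  then show "\<exists>no. \<forall>n\<ge>no. norm (x n - l) < e" by blast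
qed

context prob_space
begin

lemma integrable_scaleR_bounded:
  fixes R :: "'a \<Rightarrow> complex" and V :: "'a \<Rightarrow> real"
  assumes "R \<in> borel_measurable M" "\<And>\<omega>. \<omega> \<in> space M \<Longrightarrow> cmod (R \<omega>) \<le> d"
    "V \<in> borel_measurable M" "\<And>\<omega>. \<omega> \<in> space M \<Longrightarrow> \<bar>V \<omega>\<bar> \<le> c"
  shows "integrable M (\<lambda>\<omega>. V \<omega> *\<^sub>R R \<omega>)"
proof (rule integrable_const_bound[of _ "c * d"])
  have "\<bar>V \<omega>\<bar> * cmod (R \<omega>) \<le> c * d" if "\<omega> \<in> space M" for \<omega>
    using assms(2,4)[OF that] by (intro mult_mono) (auto intro: order_trans[OF abs_ge_zero])
  then show "AE \<omega> in M. norm (V \<omega> *\<^sub>R R \<omega>) \<le> c * d" by (intro AE_I2) simp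
qed (use assms in auto)

lemma norm_integral_scaleR_le:
  fixes R :: "'a \<Rightarrow> complex" and V :: "'a \<Rightarrow> real"
  assumes "R \<in> borel_measurable M" "\<And>\<omega>. \<omega> \<in> space M \<Longrightarrow> cmod (R \<omega>) \<le> d" "integrable M V"
  shows "cmod (\<integral>\<omega>. V \<omega> *\<^sub>R R \<omega> \<partial>M) \<le> d * (\<integral>\<omega>. \<bar>V \<omega>\<bar> \<partial>M)"
proof -
  have "cmod (\<integral>\<omega>. V \<omega> *\<^sub>R R \<omega> \<partial>M) \<le> (\<integral>\<omega>. norm (V \<omega> *\<^sub>R R \<omega>) \<partial>M)" by (rule integral_norm_bound)
  also have "\<dots> \<le> (\<integral>\<omega>. d * \<bar>V \<omega>\<bar> \<partial>M)"
  proof (rule integral_mono')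
    show "integrable M (\<lambda>\<omega>. d * \<bar>V \<omega>\<bar>)" using assms(3) by simp
    show "norm (V \<omega> *\<^sub>R R \<omega>) \<le> d * \<bar>V \<omega>\<bar>" if "\<omega> \<in> space M" for \<omega>
      using mult_left_mono[OF assms(2)[OF that], of "\<bar>V \<omega>\<bar>"] by (simp add: mult.commute)
    show "0 \<le> d * \<bar>V \<omega>\<bar>" if "\<omega> \<in> space M" for \<omega>
      by (intro mult_nonneg_nonneg order_trans[OF norm_ge_zero assms(2)[OF that]]) simp
  qed
  finally show ?thesis by simp
qed

text \<open>The sets with this property form a Dynkin system: the uniform bound on \<open>R\<close> dominates the integrals
  over a disjoint sequence of sets by a summable sequence, so Tannery's theorem gives countable unions.\<close>

lemma tendsto_indicator_of_generator:
  fixes R :: "nat \<Rightarrow> 'a \<Rightarrow> complex"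
  assumes R: "\<And>n. R n \<in> borel_measurable M" "\<And>n \<omega>. \<omega> \<in> space M \<Longrightarrow> cmod (R n \<omega>) \<le> d"
    and G: "Int_stable G" "G \<subseteq> Pow (space M)" "sets M = sigma_sets (space M) G" "space M \<in> G"
    and conv: "\<And>A. A \<in> G \<Longrightarrow> (\<lambda>n. \<integral>\<omega>. indicator A \<omega> *\<^sub>R R n \<omega> \<partial>M) \<longlonglongrightarrow> of_real (measure M A)"
    and H: "H \<in> sets M"
  shows "(\<lambda>n. \<integral>\<omega>. indicator H \<omega> *\<^sub>R R n \<omega> \<partial>M) \<longlonglongrightarrow> of_real (measure M H)"
proof -
  have ind_le: "\<bar>indicator A \<omega> :: real\<bar> \<le> 1" for A :: "'a set" and \<omega>
    by (auto simp: indicator_def)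
  have int: "integrable M (\<lambda>\<omega>. indicator A \<omega> *\<^sub>R R n \<omega>)" if "A \<in> sets M" for A n
    by (rule integrable_scaleR_bounded[OF R borel_measurable_indicator[OF that], where c=1])
       (assumption, rule ind_le)
  from G(1,2) H[unfolded G(3)] show ?thesis
  proof (induct rule: sigma_sets_induct_disjoint)
    case (basic A)
    then show ?case by (rule conv)
  next
    case empty
    show ?case by simp
  next
    case (compl A)
    then have A: "A \<in> sets M" by (simp add: G(3))
    have "indicator (space M - A) \<omega> *\<^sub>R R n \<omega> = indicator (space M) \<omega> *\<^sub>R R n \<omega> - indicator A \<omega> *\<^sub>R R n \<omega>"
      if "\<omega> \<in> space M" for \<omega> n using that by (simp split: split_indicator)
    then have "(\<integral>\<omega>. indicator (space M - A) \<omega> *\<^sub>R R n \<omega> \<partial>M)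
        = (\<integral>\<omega>. indicator (space M) \<omega> *\<^sub>R R n \<omega> - indicator A \<omega> *\<^sub>R R n \<omega> \<partial>M)" for n
      by (intro Bochner_Integration.integral_cong refl)
    then have "(\<integral>\<omega>. indicator (space M - A) \<omega> *\<^sub>R R n \<omega> \<partial>M)
        = (\<integral>\<omega>. indicator (space M) \<omega> *\<^sub>R R n \<omega> \<partial>M) - (\<integral>\<omega>. indicator A \<omega> *\<^sub>R R n \<omega> \<partial>M)" for n
      using Bochner_Integration.integral_diff[OF int[OF sets.top] int[OF A]] by simp
    then show ?case
      using tendsto_diff[OF conv[OF G(4)] compl(2)] A by (simp add: prob_compl prob_space)
  next
    case (union A)
    have A: "A i \<in> sets M" for i using union(2) by (auto simp: G(3))
    have sums: "(\<integral>\<omega>. indicator (\<Union>i. A i) \<omega> *\<^sub>R R n \<omega> \<partial>M) = (\<Sum>i. \<integral>\<omega>. indicator (A i) \<omega> *\<^sub>R R n \<omega> \<partial>M)" for n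
    proof -
      have "set_integrable M (\<Union>i. A i) (R n)"
        unfolding set_integrable_def using A by (intro int) auto
      moreover have "A i \<inter> A j = {}" if "i \<noteq> j" for i j using union(1) that by (auto simp: disjoint_family_on_def)
      ultimately show ?thesis
        using lebesgue_integral_countable_add[of A M "R n", OF A] by (simp add: set_lebesgue_integral_def)
    qed
    have bound: "cmod (\<integral>\<omega>. indicator (A i) \<omega> *\<^sub>R R n \<omega> \<partial>M) \<le> d * measure M (A i)" for i n
    proof -
      have "cmod (\<integral>\<omega>. indicator (A i) \<omega> *\<^sub>R R n \<omega> \<partial>M) \<le> d * (\<integral>\<omega>. \<bar>indicator (A i) \<omega>\<bar> \<partial>M)"
        using A by (intro norm_integral_scaleR_le R integrable_real_indicator) (auto simp: emeasure_eq_measure)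
      then show ?thesis using A by simp
    qed
    have m: "(\<lambda>i. measure M (A i)) sums measure M (\<Union>i. A i)"
      using A union(1) by (intro finite_measure_UNION) auto
    have "\<forall>\<^sub>F (i, n) in at_top \<times>\<^sub>F sequentially.
        cmod (\<integral>\<omega>. indicator (A i) \<omega> *\<^sub>R R n \<omega> \<partial>M) \<le> d * measure M (A i)"
      unfolding case_prod_beta by (intro always_eventually allI bound)
    from tannerys_theorem[OF union(3) this summable_mult[OF sums_summable[OF m]]]
    have "(\<lambda>n. \<Sum>i. \<integral>\<omega>. indicator (A i) \<omega> *\<^sub>R R n \<omega> \<partial>M) \<longlonglongrightarrow> (\<Sum>i. of_real (measure M (A i)))"
      by simp
    moreover have "(\<lambda>i. complex_of_real (measure M (A i))) sums of_real (measure M (\<Union>i. A i))"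
      by (rule sums_of_real[OF m])
    ultimately show ?case unfolding sums by (simp add: sums_iff)
  qed
qed

text \<open>Bounded nonnegative functions are monotone limits of simple ones, and the error of the
  approximation is uniform in \<open>n\<close> as \<open>R\<close> is bounded.\<close>

lemma tendsto_of_generator:
  fixes R :: "nat \<Rightarrow> 'a \<Rightarrow> complex"
  assumes R: "\<And>n. R n \<in> borel_measurable M" "\<And>n \<omega>. \<omega> \<in> space M \<Longrightarrow> cmod (R n \<omega>) \<le> d"
    and G: "Int_stable G" "G \<subseteq> Pow (space M)" "sets M = sigma_sets (space M) G" "space M \<in> G"
    and conv: "\<And>A. A \<in> G \<Longrightarrow> (\<lambda>n. \<integral>\<omega>. indicator A \<omega> *\<^sub>R R n \<omega> \<partial>M) \<longlonglongrightarrow> of_real (measure M A)"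
    and V: "V \<in> borel_measurable M" "\<And>\<omega>. 0 \<le> V \<omega>" "\<And>\<omega>. \<omega> \<in> space M \<Longrightarrow> V \<omega> \<le> c"
  shows "(\<lambda>n. \<integral>\<omega>. V \<omega> *\<^sub>R R n \<omega> \<partial>M) \<longlonglongrightarrow> of_real (\<integral>\<omega>. V \<omega> \<partial>M)"
  using V
proof (induction arbitrary: c rule: borel_measurable_induct_real)
  case (set A)
  then show ?case using tendsto_indicator_of_generator[OF R G conv set(1)] by simp
next
  case (mult u k)
  show ?case
  proof (cases "k = 0")
    case False
    then have "k > 0" using mult.hyps by simp
    then have "(\<lambda>n. \<integral>\<omega>. u \<omega> *\<^sub>R R n \<omega> \<partial>M) \<longlonglongrightarrow> of_real (\<integral>\<omega>. u \<omega> \<partial>M)"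
      using mult.prems by (intro mult.IH[of "c / k"]) (simp add: pos_le_divide_eq mult.commute)
    from tendsto_scaleR[OF tendsto_const this, of k]
    have "(\<lambda>n. k *\<^sub>R (\<integral>\<omega>. u \<omega> *\<^sub>R R n \<omega> \<partial>M)) \<longlonglongrightarrow> of_real (\<integral>\<omega>. k * u \<omega> \<partial>M)"
      by (simp add: scaleR_conv_of_real)
    then show ?thesis by (simp only: scaleR_scaleR[symmetric] integral_scaleR_right)
  qed simp
next
  case (add u v)
  have uv: "u \<omega> \<le> c" "v \<omega> \<le> c" if "\<omega> \<in> space M" for \<omega>
    using add.prems[OF that] add.hyps(2)[of \<omega>] add.hyps(4)[of \<omega>] by linarith+
  have i: "integrable M (\<lambda>\<omega>. u \<omega> *\<^sub>R R n \<omega>)" "integrable M (\<lambda>\<omega>. v \<omega> *\<^sub>R R n \<omega>)" for n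
    by (rule integrable_scaleR_bounded[OF R, where c=c]; use add.hyps uv in simp)+
  have j: "integrable M u" "integrable M v"
    by (rule integrable_const_bound[of _ c]; use add.hyps uv in simp)+
  show ?case
    using tendsto_add[OF add.IH(2)[OF uv(2)] add.IH(1)[OF uv(1)]] i j by (simp add: scaleR_add_left)
next
  case (seq U)
  have le: "U i \<omega> \<le> V \<omega>" "V \<omega> \<le> c" if "\<omega> \<in> space M" for i \<omega>
  proof -
    have "incseq (\<lambda>i. U i \<omega>)" using seq.hyps(3) unfolding incseq_def le_fun_def by blast
    then show "U i \<omega> \<le> V \<omega>" by (rule incseq_le[OF _ seq.hyps(4)[OF that]])
    show "V \<omega> \<le> c" by (rule seq.prems[OF that])
  qed
  have Vm: "V \<in> borel_measurable M"
    by (rule borel_measurable_LIMSEQ_real[OF seq.hyps(4) seq.hyps(1)])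
  have V0: "0 \<le> V \<omega>" if "\<omega> \<in> space M" for \<omega>
    using seq.hyps(2)[of 0 \<omega>] le(1)[OF that, of 0] by linarith
  have iV: "integrable M V" using Vm V0 le by (intro integrable_const_bound[of _ c] AE_I2) auto
  have iU: "integrable M (U i)" for i
  proof (rule integrable_const_bound[of _ c])
    show "AE \<omega> in M. norm (U i \<omega>) \<le> c"
    proof (rule AE_I2)
      fix \<omega> assume "\<omega> \<in> space M"
      from order_trans[OF le[OF this]] show "norm (U i \<omega>) \<le> c" using seq.hyps(2)[of i \<omega>] by simp
    qed
  qed (rule seq.hyps(1))
  have "(\<lambda>i. \<integral>\<omega>. \<bar>V \<omega> - U i \<omega>\<bar> \<partial>M) \<longlonglongrightarrow> (\<integral>\<omega>. 0 \<partial>M)"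
  proof (rule integral_dominated_convergence[where w="\<lambda>_. c"])
    show "AE \<omega> in M. (\<lambda>i. \<bar>V \<omega> - U i \<omega>\<bar>) \<longlonglongrightarrow> 0"
    proof (rule AE_I2)
      fix \<omega> assume "\<omega> \<in> space M"
      then have "(\<lambda>i. \<bar>V \<omega> - U i \<omega>\<bar>) \<longlonglongrightarrow> \<bar>V \<omega> - V \<omega>\<bar>" by (intro tendsto_intros seq.hyps(4))
      then show "(\<lambda>i. \<bar>V \<omega> - U i \<omega>\<bar>) \<longlonglongrightarrow> 0" by simp
    qed
    show "AE \<omega> in M. norm \<bar>V \<omega> - U i \<omega>\<bar> \<le> c" for i
    proof (rule AE_I2)
      fix \<omega> assume "\<omega> \<in> space M"
      then show "norm \<bar>V \<omega> - U i \<omega>\<bar> \<le> c" using le(1)[of \<omega> i] le(2)[of \<omega>] seq.hyps(2)[of i \<omega>] by simp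
    qed
  qed (use Vm seq.hyps(1) in auto)
  then have small: "(\<lambda>i. \<integral>\<omega>. \<bar>V \<omega> - U i \<omega>\<bar> \<partial>M) \<longlonglongrightarrow> 0" by simp
  obtain \<omega>0 where "\<omega>0 \<in> space M" using not_empty by blast
  from order_trans[OF norm_ge_zero R(2)[OF this]] have d0: "d \<ge> 0" .
  show ?case
  proof (rule tendsto_of_uniform_approximation)
    fix e :: real assume e: "e > 0"
    define e' where "e' = e / (d + 1)"
    have e': "e' > 0" using e d0 by (simp add: e'_def)
    have ed: "e' * (d + 1) = e" using d0 by (simp add: e'_def)
    obtain i where i: "(\<integral>\<omega>. \<bar>V \<omega> - U i \<omega>\<bar> \<partial>M) < e'"
      using order_tendstoD(2)[OF small e', THEN eventually_happens'[OF sequentially_bot]] by blast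
    have pos: "0 \<le> (\<integral>\<omega>. \<bar>V \<omega> - U i \<omega>\<bar> \<partial>M)" by simp
    show "\<exists>y m. y \<longlonglongrightarrow> m \<and> (\<forall>n. cmod ((\<integral>\<omega>. V \<omega> *\<^sub>R R n \<omega> \<partial>M) - y n) \<le> e)
        \<and> cmod (of_real (\<integral>\<omega>. V \<omega> \<partial>M) - m) \<le> e"
    proof (intro exI conjI allI)
      show "(\<lambda>n. \<integral>\<omega>. U i \<omega> *\<^sub>R R n \<omega> \<partial>M) \<longlonglongrightarrow> of_real (\<integral>\<omega>. U i \<omega> \<partial>M)"
        by (rule seq.IH) (rule order_trans[OF le])
      fix n
      have "integrable M (\<lambda>\<omega>. V \<omega> *\<^sub>R R n \<omega>)"
        by (rule integrable_scaleR_bounded[OF R Vm, where c=c]) (use V0 le(2) in simp_all)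
      moreover have "integrable M (\<lambda>\<omega>. U i \<omega> *\<^sub>R R n \<omega>)"
        by (rule integrable_scaleR_bounded[OF R seq.hyps(1), where c=c])
           (use seq.hyps(2) order_trans[OF le] in simp_all)
      ultimately have "(\<integral>\<omega>. V \<omega> *\<^sub>R R n \<omega> \<partial>M) - (\<integral>\<omega>. U i \<omega> *\<^sub>R R n \<omega> \<partial>M) = (\<integral>\<omega>. (V \<omega> - U i \<omega>) *\<^sub>R R n \<omega> \<partial>M)"
        by (simp add: scaleR_diff_left)
      also have "cmod \<dots> \<le> d * (\<integral>\<omega>. \<bar>V \<omega> - U i \<omega>\<bar> \<partial>M)"
        using iV iU by (intro norm_integral_scaleR_le R) auto
      also have "\<dots> \<le> d * e'" using i d0 by (intro mult_left_mono) auto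
      also have "\<dots> \<le> e" using ed e' by (simp add: distrib_left mult.commute)
      finally show "cmod ((\<integral>\<omega>. V \<omega> *\<^sub>R R n \<omega> \<partial>M) - (\<integral>\<omega>. U i \<omega> *\<^sub>R R n \<omega> \<partial>M)) \<le> e" .
    next
      have "cmod (of_real (\<integral>\<omega>. V \<omega> \<partial>M) - of_real (\<integral>\<omega>. U i \<omega> \<partial>M)) = \<bar>\<integral>\<omega>. V \<omega> - U i \<omega> \<partial>M\<bar>"
        using iV iU by (simp flip: of_real_diff)
      also have "\<dots> \<le> (\<integral>\<omega>. \<bar>V \<omega> - U i \<omega>\<bar> \<partial>M)" by (rule integral_abs_bound)
      also have "\<dots> \<le> e' * 1" using i by simp
      also have "\<dots> \<le> e' * (d + 1)" using d0 e' by (intro mult_left_mono) auto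
      finally show "cmod (of_real (\<integral>\<omega>. V \<omega> \<partial>M) - of_real (\<integral>\<omega>. U i \<omega> \<partial>M)) \<le> e" by (simp add: ed)
    qed
  qed
qed

end

section \<open>A stable central limit theorem for the weights\<close>

lemma abs_exp_minus_diff_le:
  fixes x y :: real
  assumes "0 \<le> x" "0 \<le> y"
  shows "\<bar>exp (- x) - exp (- y)\<bar> \<le> \<bar>x - y\<bar>"
proof -
  have *: "exp (- x) - exp (- y) \<le> y - x" if "0 \<le> x" "x \<le> y" for x y :: real
  proof -
    have "1 - (y - x) \<le> exp (- (y - x))" using exp_ge_add_one_self[of "- (y - x)"] by linarith
    then have "exp (- x) * (1 - exp (- (y - x))) \<le> 1 * (y - x)"
      using that by (intro mult_mono) auto
    moreover have "exp (- x) * exp (- (y - x)) = exp (- y)" by (simp flip: exp_add)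
    ultimately show ?thesis by (simp add: right_diff_distrib)
  qed
  show ?thesis
  proof (cases "x \<le> y")
    case True
    then have "exp (- y) \<le> exp (- x)" by simp
    then show ?thesis using *[OF assms(1) True] True by linarith
  next
    case False
    then have "exp (- x) \<le> exp (- y)" "y \<le> x" by simp_all
    then show ?thesis using *[OF assms(2) \<open>y \<le> x\<close>] by linarith
  qed
qed

lemma exp_minus_second_order:
  assumes "0 \<le> (y :: real)"
  shows "\<bar>exp (- y) - (1 - y)\<bar> \<le> y\<^sup>2 / 2"
proof -
  have pos: "0 < 1 + y + y\<^sup>2 / 2" using assms by (simp add: add_pos_nonneg)
  have "(1 - y + y\<^sup>2 / 2) * (1 + y + y\<^sup>2 / 2) = 1 + (y\<^sup>2)\<^sup>2 / 4"
    by (simp add: power2_eq_square field_simps)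
  then have "1 \<le> (1 - y + y\<^sup>2 / 2) * (1 + y + y\<^sup>2 / 2)" by simp
  then have "1 / (1 + y + y\<^sup>2 / 2) \<le> 1 - y + y\<^sup>2 / 2" using pos by (simp add: pos_divide_le_eq)
  moreover have "exp (- y) \<le> 1 / (1 + y + y\<^sup>2 / 2)"
    using exp_lower_Taylor_quadratic[OF assms] pos by (simp add: exp_minus inverse_eq_divide frac_le)
  ultimately have "exp (- y) \<le> 1 - y + y\<^sup>2 / 2" by linarith
  moreover have "1 - y \<le> exp (- y)" using exp_ge_add_one_self[of "- y"] by simp
  ultimately show ?thesis by linarith
qed

context reinforced_urn
begin

abbreviation mean_weight :: real where "mean_weight \<equiv> expectation (Z 1)"
abbreviation var_weight :: real where "var_weight \<equiv> variance (Z 1)"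

text \<open>Clipping at \<open>b\<close> changes the weight on a null set only and makes the variable bounded at every
  point, so that integrability never depends on exceptional sets.\<close>

definition centred_weight :: "nat \<Rightarrow> 'y traj \<Rightarrow> real" where
  "centred_weight i \<omega> = min (Z i \<omega>) b - mean_weight"

lemma integrable_weight: "integrable P (Z 1)"
proof (rule integrable_const_bound[of _ b])
  show "AE \<omega> in P. norm (Z 1 \<omega>) \<le> b"
    using weight_bounds by eventually_elim (use a in simp)
qed (use measurable_Z_P(2) in auto)

lemma mean_weight_bounds: "a \<le> mean_weight" "mean_weight \<le> b"
proof -
  have "(\<integral>\<omega>. a \<partial>P) \<le> mean_weight"
    using weight_bounds by (intro integral_mono_AE integrable_weight) auto
  then show "a \<le> mean_weight" by (simp add: prob_space)
  have "mean_weight \<le> (\<integral>\<omega>. b \<partial>P)"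
    using weight_bounds by (intro integral_mono_AE integrable_weight) auto
  then show "mean_weight \<le> b" by (simp add: prob_space)
qed

lemma mean_weight_pos: "mean_weight > 0"
  using mean_weight_bounds(1) a by linarith

lemma centred_weight_bound: "\<omega> \<in> space P \<Longrightarrow> i \<ge> 1 \<Longrightarrow> \<bar>centred_weight i \<omega>\<bar> \<le> b"
  using weight_pos[of \<omega> i] mean_weight_bounds mean_weight_pos a ab by (auto simp: centred_weight_def abs_le_iff min_def)

lemma centred_weight_ordinary: "ordinary \<omega> \<Longrightarrow> centred_weight (Suc n) \<omega> = Z (Suc n) \<omega> - mean_weight"
  by (auto simp: centred_weight_def ordinary_def)

lemma measurable_centred_weight: "1 \<le> i \<Longrightarrow> i \<le> n \<Longrightarrow> centred_weight i \<in> borel_measurable (past MY n)"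
  unfolding centred_weight_def by (intro borel_measurable_diff borel_measurable_min measurable_Z_past(2) borel_measurable_const)

lemma measurable_centred_weight_P: "1 \<le> i \<Longrightarrow> centred_weight i \<in> borel_measurable P"
  by (rule measurable_from_subalg[OF sub_past(1) measurable_centred_weight]) auto

lemma AE_centred_weight_1: "AE \<omega> in P. centred_weight 1 \<omega> = Z 1 \<omega> - mean_weight"
  using weight_bounds by eventually_elim (simp add: centred_weight_def)

lemma expectation_centred_weight: "(\<integral>\<omega>. centred_weight 1 \<omega> \<partial>P) = 0" "(\<integral>\<omega>. (centred_weight 1 \<omega>)\<^sup>2 \<partial>P) = var_weight"
proof -
  have Zm: "Z 1 \<in> borel_measurable P" by (rule measurable_Z_P(2)) simp
  have cm: "centred_weight 1 \<in> borel_measurable P" by (rule measurable_centred_weight_P) simp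
  have "(\<integral>\<omega>. centred_weight 1 \<omega> \<partial>P) = (\<integral>\<omega>. Z 1 \<omega> - mean_weight \<partial>P)"
    using AE_centred_weight_1 cm Zm by (intro integral_cong_AE) auto
  also have "\<dots> = 0" using integrable_weight by (simp add: prob_space)
  finally show "(\<integral>\<omega>. centred_weight 1 \<omega> \<partial>P) = 0" .
  have "AE \<omega> in P. (centred_weight 1 \<omega>)\<^sup>2 = (Z 1 \<omega> - mean_weight)\<^sup>2"
    using AE_centred_weight_1 by eventually_elim simp
  then show "(\<integral>\<omega>. (centred_weight 1 \<omega>)\<^sup>2 \<partial>P) = var_weight"
    using cm Zm by (intro integral_cong_AE) auto
qed

text \<open>The characteristic function of the centred weight.\<close>

definition chi :: "real \<Rightarrow> complex" where
  "chi t = (\<integral>\<omega>. iexp (t * centred_weight 1 \<omega>) \<partial>P)"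

lemma chi_char: "chi t = char (distr P borel (centred_weight 1)) t"
  unfolding chi_def char_def using measurable_centred_weight_P[of 1] by (subst integral_distr) auto

lemma real_distribution_centred_weight: "real_distribution (distr P borel (centred_weight 1))"
  using measurable_centred_weight_P[of 1] by (intro real_distribution_distr) auto

lemma measurable_chi: "chi \<in> borel_measurable borel"
  unfolding chi_char[abs_def] by (rule real_distribution.char_measurable[OF real_distribution_centred_weight])

lemma chi_le_1: "cmod (chi t) \<le> 1"
  unfolding chi_char by (rule real_distribution.cmod_char_le_1[OF real_distribution_centred_weight])

lemma chi_tendsto_1: "u \<longlonglongrightarrow> 0 \<Longrightarrow> (\<lambda>n. chi (u n)) \<longlonglongrightarrow> 1"
proof -
  assume u: "u \<longlonglongrightarrow> 0"
  have "isCont chi 0"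
    unfolding chi_char[abs_def] by (rule real_distribution.isCont_char[OF real_distribution_centred_weight])
  from isCont_tendsto_compose[OF this u] show ?thesis
    by (simp add: chi_def prob_space)
qed

definition chi_err :: real where "chi_err = b ^ 3 / 6 + var_weight\<^sup>2 / 8"

lemma chi_err_nonneg: "chi_err \<ge> 0" using a ab by (simp add: chi_err_def)

text \<open>Both functions agree with \<open>1 - t^2 * var_weight / 2\<close> up to third order in \<open>t\<close>.\<close>

lemma chi_expansion:
  assumes t: "\<bar>t\<bar> \<le> 1"
  shows "cmod (chi t - of_real (exp (- (t\<^sup>2 * var_weight / 2)))) \<le> chi_err * \<bar>t\<bar> ^ 3"
proof -
  have cm: "centred_weight 1 \<in> borel_measurable P" by (rule measurable_centred_weight_P) simp
  have b0: "b \<ge> 0" using a ab by simp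
  have bd: "\<bar>centred_weight 1 \<omega>\<bar> \<le> b" if "\<omega> \<in> space P" for \<omega> using centred_weight_bound[OF that, of 1] by simp
  have bd2: "(centred_weight 1 \<omega>)\<^sup>2 \<le> b\<^sup>2" if "\<omega> \<in> space P" for \<omega>
    using power_mono[OF bd[OF that], of 2] by simp
  have i1: "integrable P (centred_weight 1)" using bd by (intro bounded_integrable[of _ b] cm) auto
  have i2: "integrable P (\<lambda>\<omega>. (centred_weight 1 \<omega>)\<^sup>2)" using bd2 cm by (intro bounded_integrable[of _ "b\<^sup>2"]) auto
  define r where "r = \<bar>t\<bar>"
  have r: "t\<^sup>2 = r\<^sup>2" "0 \<le> r" "r \<le> 1" using t by (auto simp: r_def)
  have var: "expectation (\<lambda>x. (centred_weight 1 x - expectation (centred_weight 1))\<^sup>2) = var_weight"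
    by (simp only: expectation_centred_weight diff_zero)
  have "cmod (chi t - (1 - t\<^sup>2 * var_weight / 2))
      \<le> t\<^sup>2 / 6 * (\<integral>\<omega>. min (6 * (centred_weight 1 \<omega>)\<^sup>2) (\<bar>t\<bar> * \<bar>centred_weight 1 \<omega>\<bar> ^ 3) \<partial>P)"
    using char_approx3'[OF cm i1 i2 expectation_centred_weight(1) var refl, of t] unfolding chi_char .
  also have "\<dots> \<le> t\<^sup>2 / 6 * (\<integral>\<omega>. \<bar>t\<bar> * b ^ 3 \<partial>P)"
  proof (rule mult_left_mono[OF integral_mono'])
    show "min (6 * (centred_weight 1 \<omega>)\<^sup>2) (\<bar>t\<bar> * \<bar>centred_weight 1 \<omega>\<bar> ^ 3) \<le> \<bar>t\<bar> * b ^ 3" if "\<omega> \<in> space P" for \<omega>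
    proof -
      have "\<bar>t\<bar> * \<bar>centred_weight 1 \<omega>\<bar> ^ 3 \<le> \<bar>t\<bar> * b ^ 3" by (intro mult_left_mono power_mono bd that) auto
      then show ?thesis by linarith
    qed
  qed (use b0 in auto)
  also have "\<dots> = b ^ 3 / 6 * \<bar>t\<bar> ^ 3"
    unfolding r(1) r_def[symmetric] by (simp add: prob_space power3_eq_cube power2_eq_square)
  finally have 1: "cmod (chi t - (1 - t\<^sup>2 * var_weight / 2)) \<le> b ^ 3 / 6 * \<bar>t\<bar> ^ 3" .
  have "\<bar>exp (- (t\<^sup>2 * var_weight / 2)) - (1 - t\<^sup>2 * var_weight / 2)\<bar> \<le> (t\<^sup>2 * var_weight / 2)\<^sup>2 / 2"
    by (rule exp_minus_second_order) simp
  also have "\<dots> = var_weight\<^sup>2 / 8 * (\<bar>t\<bar> ^ 3 * \<bar>t\<bar>)"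
    unfolding r(1) r_def[symmetric] by (simp add: power2_eq_square power3_eq_cube)
  also have "\<dots> \<le> var_weight\<^sup>2 / 8 * (\<bar>t\<bar> ^ 3 * 1)"
    using t by (intro mult_left_mono) auto
  finally have 2: "\<bar>exp (- (t\<^sup>2 * var_weight / 2)) - (1 - t\<^sup>2 * var_weight / 2)\<bar> \<le> var_weight\<^sup>2 / 8 * \<bar>t\<bar> ^ 3" by simp
  define x where "x = exp (- (t\<^sup>2 * var_weight / 2))"
  define y where "y = 1 - t\<^sup>2 * var_weight / 2"
  have eq: "chi t - of_real x = (chi t - of_real y) - of_real (x - y)" by simp
  have "cmod (chi t - of_real x) \<le> cmod (chi t - of_real y) + cmod (of_real (x - y))"
    unfolding eq by (rule norm_triangle_ineq4)
  then have "cmod (chi t - of_real x) \<le> b ^ 3 / 6 * \<bar>t\<bar> ^ 3 + var_weight\<^sup>2 / 8 * \<bar>t\<bar> ^ 3"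
    using 1 2 unfolding norm_of_real x_def[symmetric] y_def[symmetric] by (simp add: y_def)
  then show ?thesis unfolding x_def by (simp only: chi_err_def distrib_right)
qed

lemma sets_P_generated:
  "sets P = sigma_sets (space P) (\<Union>k. sets (past MY k))"
proof
  have G: "(\<Union>k. sets (past MY k)) \<subseteq> sets P"
    using sub_past(1) by (auto simp: subalgebra_def)
  then show "sigma_sets (space P) (\<Union>k. sets (past MY k)) \<subseteq> sets P" by (rule sets.sigma_sets_subset)
  define N where "N = sigma (space P) (\<Union>k. sets (past MY k))"
  have Pow: "(\<Union>k. sets (past MY k)) \<subseteq> Pow (space P)" using G sets.space_closed by blast
  have N: "space N = space P" "sets N = sigma_sets (space P) (\<Union>k. sets (past MY k))"
    unfolding N_def using Pow by (auto intro: space_measure_of sets_measure_of)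
  have XN: "X i \<in> N \<rightarrow>\<^sub>M state_space MY" if "i \<in> {1..}" for i
  proof (rule measurable_from_subalg)
    show "subalgebra N (past MY i)"
      unfolding subalgebra_def N by (auto simp: space_P intro: sigma_sets.Basic)
    show "X i \<in> past MY i \<rightarrow>\<^sub>M state_space MY" using that by (intro measurable_X_past(1)) auto
  qed
  have "(\<lambda>\<omega> i. X i \<omega>) \<in> N \<rightarrow>\<^sub>M (\<Pi>\<^sub>M i\<in>{1..}. state_space MY)"
  proof (rule measurable_PiM_single')
    show "(\<lambda>\<omega> i. X i \<omega>) \<in> space N \<rightarrow> (\<Pi>\<^sub>E i\<in>{1..}. space (state_space MY))"
      unfolding N(1) space_P by (auto simp: traj_space_def space_PiM X_def PiE_def)
  qed (rule XN)
  then have id: "(\<lambda>\<omega>. \<omega>) \<in> N \<rightarrow>\<^sub>M traj_space MY" by (simp add: X_def traj_space_def)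
  show "sets P \<subseteq> sigma_sets (space P) (\<Union>k. sets (past MY k))"
  proof
    fix A assume A: "A \<in> sets P"
    then have "(\<lambda>\<omega>. \<omega>) -` A \<inter> space N \<in> sets N" using measurable_sets[OF id] sets_P by blast
    moreover have "(\<lambda>\<omega>. \<omega>) -` A \<inter> space N = A" using sets.sets_into_space[OF A] N(1) by auto
    ultimately show "A \<in> sigma_sets (space P) (\<Union>k. sets (past MY k))" using N(2) by simp
  qed
qed

lemma Int_stable_past: "Int_stable (\<Union>k. sets (past MY k))"
proof (rule Int_stableI)
  fix A B assume "A \<in> (\<Union>k. sets (past MY k))" "B \<in> (\<Union>k. sets (past MY k))"
  then obtain i j where "A \<in> sets (past MY i)" "B \<in> sets (past MY j)" by blast
  then have "A \<in> sets (past MY (max i j))" "B \<in> sets (past MY (max i j))"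
    using sets_past_subset(1)[of i "max i j" MY] sets_past_subset(1)[of j "max i j" MY] by auto
  then show "A \<inter> B \<in> (\<Union>k. sets (past MY k))" by blast
qed

text \<open>A central limit theorem with random variance. The coefficient \<open>h l\<close> is known when the weight
  \<open>l + 1\<close> is drawn, so dividing the partial products \<open>E\<close> of exponentials by the products \<open>F\<close> of
  conditional characteristic functions gives a complex martingale \<open>R n j\<close> in \<open>j\<close>. For fixed \<open>k\<close>,
  \<open>R n k\<close> tends to 1; as the martingale has the same integral at times \<open>k\<close> and \<open>n\<close> over events
  known at time \<open>k\<close>, the integrals of \<open>R n n\<close> over all such events converge to their probabilities.
  These events generate the whole algebra, so \<open>R n n\<close> tends to 1 against every bounded function.
  Finally \<open>F n n\<close> is close to \<open>D n\<close>, whose limit in mean is \<open>exp (- var_weight * \<eta> / 2)\<close>; multiplying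
  by it recovers the exponential of the sum.\<close>

lemma stable_clt:
  assumes h: "\<And>l. h l \<in> borel_measurable (past_Y MY l)" "\<And>l \<omega>. \<omega> \<in> space P \<Longrightarrow> \<bar>h l \<omega>\<bar> \<le> c"
    and \<eta>: "\<eta> \<in> borel_measurable P" "\<And>\<omega>. 0 \<le> \<eta> \<omega>" "\<And>\<omega>. \<omega> \<in> space P \<Longrightarrow> \<eta> \<omega> \<le> d"
    and conv: "(\<lambda>n. \<integral>\<omega>. \<bar>(\<Sum>l<n. (h l \<omega>)\<^sup>2) / real n - \<eta> \<omega>\<bar> \<partial>P) \<longlonglongrightarrow> 0"
    and H: "H \<in> sets P"
  shows "(\<lambda>n. \<integral>\<omega>. indicator H \<omega> *\<^sub>R iexp ((\<Sum>l<n. h l \<omega> * centred_weight (Suc l) \<omega>) / sqrt (real n)) \<partial>P)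
     \<longlonglongrightarrow> of_real (\<integral>\<omega>. indicator H \<omega> * exp (- (var_weight * \<eta> \<omega> / 2)) \<partial>P)"
proof -
  define v where "v = var_weight"
  have v0: "v \<ge> 0" by (simp add: v_def)
  obtain \<omega>0 where "\<omega>0 \<in> space P" using not_empty by blast
  from order_trans[OF abs_ge_zero h(2)[OF this]] have c0: "c \<ge> 0" .
  define s where "s n l \<omega> = h l \<omega> / sqrt (real n)" for n l \<omega>
  define F where "F n j \<omega> = (\<Prod>l<j. chi (s n l \<omega>))" for n j \<omega>
  define E where "E n j \<omega> = (\<Prod>l<j. iexp (s n l \<omega> * centred_weight (Suc l) \<omega>))" for n j \<omega>
  define R where "R n j \<omega> = E n j \<omega> / F n j \<omega>" for n j \<omega>
  define D where "D n \<omega> = exp (- (v * ((\<Sum>l<n. (h l \<omega>)\<^sup>2) / real n) / 2))" for n \<omega>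
  \<comment> \<open>\<open>D\<close> is at least \<open>2 * \<delta>\<close>, hence the denominators \<open>F\<close> have modulus at least \<open>\<delta>\<close> eventually\<close>
  define \<delta> where "\<delta> = exp (- (v * c\<^sup>2 / 2)) / 2"
  have \<delta>: "\<delta> > 0" by (simp add: \<delta>_def)
  have s_le: "\<bar>s n l \<omega>\<bar> \<le> c / sqrt (real n)" if "\<omega> \<in> space P" for n l \<omega>
    unfolding s_def using h(2)[OF that, of l] by (simp add: abs_divide divide_right_mono)
  have F_D: "cmod (F n n \<omega> - of_real (D n \<omega>)) \<le> chi_err * c ^ 3 / sqrt (real n)"
    if \<omega>: "\<omega> \<in> space P" and n: "n \<ge> 1" "c \<le> sqrt (real n)" for n \<omega>
  proof -
    have "(\<Sum>l<n. (s n l \<omega>)\<^sup>2 * v / 2) = v * ((\<Sum>l<n. (h l \<omega>)\<^sup>2) / real n) / 2"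
      by (simp add: s_def power_divide sum_divide_distrib sum_distrib_left mult.commute)
    then have "D n \<omega> = (\<Prod>l<n. exp (- ((s n l \<omega>)\<^sup>2 * v / 2)))"
      unfolding D_def by (simp add: exp_sum[symmetric] sum_negf)
    then have "cmod (F n n \<omega> - of_real (D n \<omega>))
       = cmod ((\<Prod>l<n. chi (s n l \<omega>)) - (\<Prod>l<n. of_real (exp (- ((s n l \<omega>)\<^sup>2 * v / 2)))))"
      by (simp add: F_def)
    also have "\<dots> \<le> (\<Sum>l<n. cmod (chi (s n l \<omega>) - of_real (exp (- ((s n l \<omega>)\<^sup>2 * v / 2)))))"
      using v0 by (intro norm_prod_diff chi_le_1) auto
    also have "\<dots> \<le> (\<Sum>l<n. chi_err * (c / sqrt (real n)) ^ 3)"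
    proof (rule sum_mono)
      fix l
      have "c / sqrt (real n) \<le> 1" using n by simp
      then have "\<bar>s n l \<omega>\<bar> \<le> 1" using s_le[OF \<omega>, of n l] by linarith
      from chi_expansion[OF this]
      have "cmod (chi (s n l \<omega>) - of_real (exp (- ((s n l \<omega>)\<^sup>2 * v / 2)))) \<le> chi_err * \<bar>s n l \<omega>\<bar> ^ 3"
        by (simp add: v_def)
      also have "\<dots> \<le> chi_err * (c / sqrt (real n)) ^ 3"
        by (intro mult_left_mono power_mono s_le \<omega> chi_err_nonneg) auto
      finally show "cmod (chi (s n l \<omega>) - of_real (exp (- ((s n l \<omega>)\<^sup>2 * v / 2)))) \<le> chi_err * (c / sqrt (real n)) ^ 3" .
    qed
    also have "\<dots> = chi_err * c ^ 3 / sqrt (real n)"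
    proof -
      define r where "r = sqrt (real n)"
      have "real n = r * r" "r > 0" using n by (auto simp: r_def)
      then show ?thesis unfolding r_def[symmetric] by (simp add: power_divide power3_eq_cube)
    qed
    finally show ?thesis .
  qed
  have err0: "(\<lambda>n. chi_err * c ^ 3 / sqrt (real n)) \<longlonglongrightarrow> 0"
    by (intro tendsto_divide_0[OF tendsto_const] filterlim_at_top_imp_at_infinity
        filterlim_compose[OF sqrt_at_top filterlim_real_sequentially])
  have "\<forall>\<^sub>F n in sequentially. n \<ge> 1 \<and> c \<le> sqrt (real n) \<and> chi_err * c ^ 3 / sqrt (real n) < \<delta>"
    using eventually_ge_at_top[of 1] order_tendstoD(2)[OF err0 \<delta>]
      filterlim_compose[OF sqrt_at_top filterlim_real_sequentially, unfolded filterlim_at_top, rule_format, of c]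
    by eventually_elim auto
  then obtain N0 where N0: "\<And>n. n \<ge> N0 \<Longrightarrow> n \<ge> 1" "\<And>n. n \<ge> N0 \<Longrightarrow> c \<le> sqrt (real n)"
      "\<And>n. n \<ge> N0 \<Longrightarrow> chi_err * c ^ 3 / sqrt (real n) < \<delta>"
    unfolding eventually_sequentially by blast
  have D_ge: "2 * \<delta> \<le> D n \<omega>" if "\<omega> \<in> space P" for n \<omega>
  proof -
    have "(\<Sum>l<n. (h l \<omega>)\<^sup>2) \<le> (\<Sum>l<n. c\<^sup>2)"
    proof (rule sum_mono)
      fix l show "(h l \<omega>)\<^sup>2 \<le> c\<^sup>2" using power_mono[OF h(2)[OF that, of l], of 2] by simp
    qed
    then have "(\<Sum>l<n. (h l \<omega>)\<^sup>2) / real n \<le> c\<^sup>2" by (cases "n = 0") (auto simp: divide_le_eq mult.commute)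
    then have "v * ((\<Sum>l<n. (h l \<omega>)\<^sup>2) / real n) / 2 \<le> v * c\<^sup>2 / 2"
      using v0 by (intro divide_right_mono mult_left_mono) auto
    then show ?thesis unfolding D_def \<delta>_def by simp
  qed
  have F_ge: "\<delta> \<le> cmod (F n j \<omega>)" if n: "n \<ge> N0" "j \<le> n" and \<omega>: "\<omega> \<in> space P" for n j \<omega>
  proof -
    have "cmod (of_real (D n \<omega>)) - cmod (F n n \<omega>) \<le> cmod (F n n \<omega> - of_real (D n \<omega>))"
      by (metis norm_minus_commute norm_triangle_ineq2)
    moreover have "cmod (F n n \<omega> - of_real (D n \<omega>)) < \<delta>"
      using F_D[OF \<omega> N0(1,2)[OF n(1)]] N0(3)[OF n(1)] by linarith
    moreover have "cmod (of_real (D n \<omega>)) = D n \<omega>" by (simp add: D_def)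
    ultimately have "\<delta> \<le> cmod (F n n \<omega>)" using D_ge[OF \<omega>, of n] by linarith
    also have "cmod (F n n \<omega>) \<le> cmod (F n j \<omega>)"
    proof (rule lift_Suc_antimono_le[OF _ n(2)])
      fix i show "cmod (F n (Suc i) \<omega>) \<le> cmod (F n i \<omega>)"
        unfolding F_def by (simp add: norm_mult mult_left_le chi_le_1)
    qed
    finally show ?thesis .
  qed
  have E1: "cmod (E n j \<omega>) = 1" for n j \<omega> unfolding E_def by (simp add: prod_norm[symmetric])
  have R_le: "cmod (R n j \<omega>) \<le> 1 / \<delta>" if "n \<ge> N0" "j \<le> n" "\<omega> \<in> space P" for n j \<omega>
    using F_ge[OF that] \<delta> unfolding R_def norm_divide E1 by (intro frac_le) auto
  have s_meas: "s n l \<in> borel_measurable (past_Y MY l)" for n l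
    unfolding s_def by (intro borel_measurable_divide h borel_measurable_const)
  have s_past: "s n l \<in> borel_measurable (past MY j)" if "l < j" for n l j
  proof -
    have "s n l \<in> borel_measurable (past MY (Suc l))"
      by (rule measurable_from_subalg[OF subalgebra_past_mono(3) s_meas])
    then show ?thesis using that by (intro measurable_from_subalg[OF subalgebra_past_mono(1)[of "Suc l" j]]) auto
  qed
  have F_meas: "F n j \<in> borel_measurable (past MY j)" for n j
    unfolding F_def by (intro borel_measurable_prod measurable_compose[OF s_past measurable_chi]) simp
  have iexp_meas: "iexp \<in> borel_measurable borel"
    by (intro borel_measurable_continuous_onI continuous_at_imp_continuous_on ballI isCont_iexp)
  have E_meas: "E n j \<in> borel_measurable (past MY j)" for n j
    unfolding E_def
    by (intro borel_measurable_prod measurable_compose[OF _ iexp_meas] borel_measurable_times s_past measurable_centred_weight) auto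
  have R_meas: "R n j \<in> borel_measurable (past MY j)" for n j
    unfolding R_def by (intro borel_measurable_divide E_meas F_meas)
  have R_measP: "R n j \<in> borel_measurable P" for n j
    by (rule measurable_from_subalg[OF sub_past(1) R_meas])
  have one_step: "(\<integral>\<omega>. indicator A \<omega> *\<^sub>R R n (Suc j) \<omega> \<partial>P) = (\<integral>\<omega>. indicator A \<omega> *\<^sub>R R n j \<omega> \<partial>P)"
    if A: "A \<in> sets (past MY j)" and n: "n \<ge> N0" "j < n" for A n j
  proof -
    define K where "K x = indicator A (fst x) *\<^sub>R (R n j (fst x) * iexp (s n j (fst x) * (min (snd x) b - mean_weight)) / chi (s n j (fst x)))"
      for x :: "'y traj \<times> real"
    have RS: "R n (Suc j) \<omega> = R n j \<omega> * iexp (s n j \<omega> * centred_weight (Suc j) \<omega>) / chi (s n j \<omega>)" for \<omega>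
      by (simp add: R_def E_def F_def)
    have sub: "f \<in> borel_measurable (past_Y MY j)" if "f \<in> borel_measurable (past MY j)" for f :: "'y traj \<Rightarrow> 'z :: topological_space"
      using that by (rule measurable_from_subalg[OF subalgebra_past_mono(2)])
    have K_meas: "K \<in> borel_measurable (past_Y MY j \<Otimes>\<^sub>M weights)"
      unfolding K_def
      by (intro borel_measurable_scaleR borel_measurable_divide borel_measurable_times
          measurable_compose[OF measurable_fst sub[OF borel_measurable_indicator[OF A]]]
          measurable_compose[OF measurable_fst sub[OF R_meas]]
          measurable_compose[OF _ iexp_meas] measurable_compose[OF measurable_fst s_meas]
          measurable_compose[OF measurable_compose[OF measurable_fst s_meas] measurable_chi]
          borel_measurable_diff borel_measurable_min measurable_snd_weights borel_measurable_const)
    have FS: "\<delta> \<le> cmod (F n j \<omega>) * cmod (chi (s n j \<omega>))" if "\<omega> \<in> space P" for \<omega>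
      using F_ge[OF n(1) _ that, of "Suc j"] n(2) by (simp add: F_def norm_mult)
    have K_bd: "norm (K (\<omega>, z)) \<le> 1 / \<delta>" if \<omega>: "\<omega> \<in> space P" for \<omega> z
    proof -
      have "norm (K (\<omega>, z)) \<le> 1 / (cmod (F n j \<omega>) * cmod (chi (s n j \<omega>)))"
        by (simp add: K_def R_def norm_mult norm_divide E1 split: split_indicator)
      also have "\<dots> \<le> 1 / \<delta>" using FS[OF \<omega>] \<delta> by (intro frac_le) auto
      finally show ?thesis .
    qed
    have "(\<integral>\<omega>. indicator A \<omega> *\<^sub>R R n (Suc j) \<omega> \<partial>P) = (\<integral>\<omega>. K (\<omega>, Z (Suc j) \<omega>) \<partial>P)"
      by (simp add: K_def RS centred_weight_def)
    also have "\<dots> = (\<integral>\<omega>. (\<integral>\<omega>'. K (\<omega>, Z 1 \<omega>') \<partial>P) \<partial>P)"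
      by (rule integral_over_weight[OF K_meas K_bd])
    also have "\<dots> = (\<integral>\<omega>. indicator A \<omega> *\<^sub>R R n j \<omega> \<partial>P)"
    proof (rule Bochner_Integration.integral_cong[OF refl])
      fix \<omega> assume \<omega>: "\<omega> \<in> space P"
      have nz: "chi (s n j \<omega>) \<noteq> 0" using FS[OF \<omega>] \<delta> by auto
      have "(\<integral>\<omega>'. K (\<omega>, Z 1 \<omega>') \<partial>P)
          = (\<integral>\<omega>'. (indicator A \<omega> *\<^sub>R (R n j \<omega> / chi (s n j \<omega>))) * iexp (s n j \<omega> * centred_weight 1 \<omega>') \<partial>P)"
        by (intro Bochner_Integration.integral_cong refl) (simp add: K_def centred_weight_def)
      also have "\<dots> = (indicator A \<omega> *\<^sub>R (R n j \<omega> / chi (s n j \<omega>))) * chi (s n j \<omega>)"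
        unfolding chi_def by (rule integral_mult_right_zero)
      also have "\<dots> = indicator A \<omega> *\<^sub>R R n j \<omega>" using nz by simp
      finally show "(\<integral>\<omega>'. K (\<omega>, Z 1 \<omega>') \<partial>P) = indicator A \<omega> *\<^sub>R R n j \<omega>" .
    qed
    finally show ?thesis .
  qed
  have mart: "(\<integral>\<omega>. indicator A \<omega> *\<^sub>R R n n \<omega> \<partial>P) = (\<integral>\<omega>. indicator A \<omega> *\<^sub>R R n k \<omega> \<partial>P)"
    if A: "A \<in> sets (past MY k)" and n: "n \<ge> N0" "k \<le> n" for A n k
  proof -
    have "j \<le> n \<Longrightarrow> (\<integral>\<omega>. indicator A \<omega> *\<^sub>R R n j \<omega> \<partial>P) = (\<integral>\<omega>. indicator A \<omega> *\<^sub>R R n k \<omega> \<partial>P)" if "k \<le> j" for j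
      using that
    proof (induction j rule: dec_induct)
      case (step j)
      have "A \<in> sets (past MY j)" using A sets_past_subset(1)[OF step.hyps(1), of MY] by auto
      from one_step[OF this n(1)] show ?case using step.IH step.prems by simp
    qed simp
    from this[OF n(2) order_refl] show ?thesis .
  qed
  have s_0: "(\<lambda>n. s n l \<omega>) \<longlonglongrightarrow> 0" for l \<omega>
    unfolding s_def
    by (intro tendsto_divide_0[OF tendsto_const] filterlim_at_top_imp_at_infinity
        filterlim_compose[OF sqrt_at_top filterlim_real_sequentially])
  have R_1: "(\<lambda>n. R n k \<omega>) \<longlonglongrightarrow> 1" for k \<omega>
  proof -
    have "(\<lambda>n. iexp (s n l \<omega> * centred_weight (Suc l) \<omega>)) \<longlonglongrightarrow> iexp 0" for l
      by (rule isCont_tendsto_compose[OF isCont_iexp tendsto_mult_left_zero[OF s_0]])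
    then have E: "(\<lambda>n. E n k \<omega>) \<longlonglongrightarrow> (\<Prod>l<k. 1)" unfolding E_def by (intro tendsto_prod) simp
    have F: "(\<lambda>n. F n k \<omega>) \<longlonglongrightarrow> (\<Prod>l<k. 1)" unfolding F_def by (intro tendsto_prod chi_tendsto_1 s_0)
    show ?thesis unfolding R_def using tendsto_divide[OF E F] by simp
  qed
  \<comment> \<open>for \<open>n \<ge> N0\<close> the denominators are bounded away from 0\<close>
  define R' where "R' n = R (n + N0) (n + N0)" for n
  have R'_meas: "R' n \<in> borel_measurable P" for n unfolding R'_def by (rule R_measP)
  have R'_le: "cmod (R' n \<omega>) \<le> 1 / \<delta>" if "\<omega> \<in> space P" for n \<omega>
    unfolding R'_def by (rule R_le) (use that in auto)
  have R'_lim: "(\<lambda>n. \<integral>\<omega>. indicator A \<omega> *\<^sub>R R' n \<omega> \<partial>P) \<longlonglongrightarrow> of_real (measure P A)"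
    if A: "A \<in> (\<Union>k. sets (past MY k))" for A
  proof -
    obtain k where k: "A \<in> sets (past MY k)" using A by blast
    then have AP: "A \<in> sets P" using sub_past(1) by (auto simp: subalgebra_def)
    have "(\<lambda>n. \<integral>\<omega>. indicator A \<omega> *\<^sub>R R (n + (k + N0)) k \<omega> \<partial>P) \<longlonglongrightarrow> (\<integral>\<omega>. indicator A \<omega> *\<^sub>R (1 :: complex) \<partial>P)"
    proof (rule integral_dominated_convergence[where w="\<lambda>_. 1 / \<delta>"])
      show "AE \<omega> in P. (\<lambda>n. indicator A \<omega> *\<^sub>R R (n + (k + N0)) k \<omega>) \<longlonglongrightarrow> indicator A \<omega> *\<^sub>R (1 :: complex)"
        by (intro AE_I2 tendsto_scaleR tendsto_const LIMSEQ_ignore_initial_segment R_1)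
      show "AE \<omega> in P. norm (indicator A \<omega> *\<^sub>R R (n + (k + N0)) k \<omega>) \<le> 1 / \<delta>" for n
      proof (rule AE_I2)
        fix \<omega> assume "\<omega> \<in> space P"
        then have "cmod (R (n + (k + N0)) k \<omega>) \<le> 1 / \<delta>" by (intro R_le) auto
        then show "norm (indicator A \<omega> *\<^sub>R R (n + (k + N0)) k \<omega>) \<le> 1 / \<delta>"
          using \<delta> by (auto split: split_indicator)
      qed
    qed (use AP R_measP in auto)
    also have "(\<integral>\<omega>. indicator A \<omega> *\<^sub>R (1 :: complex) \<partial>P) = of_real (measure P A)"
      using AP by (simp add: scaleR_conv_of_real)
    also have "(\<lambda>n. \<integral>\<omega>. indicator A \<omega> *\<^sub>R R (n + (k + N0)) k \<omega> \<partial>P) = (\<lambda>n. \<integral>\<omega>. indicator A \<omega> *\<^sub>R R' (n + k) \<omega> \<partial>P)"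
      unfolding R'_def using mart[OF k, of "_ + k + N0"] by (simp add: add.assoc)
    finally show ?thesis by (rule LIMSEQ_offset)
  qed
  define V where "V \<omega> = indicator H \<omega> * exp (- (v * \<eta> \<omega> / 2))" for \<omega>
  have V: "V \<in> borel_measurable P" "0 \<le> V \<omega>" "V \<omega> \<le> 1" for \<omega>
  proof -
    show "V \<in> borel_measurable P" unfolding V_def using H \<eta>(1) by simp
    show "0 \<le> V \<omega>" by (simp add: V_def)
    show "V \<omega> \<le> 1" using v0 \<eta>(2)[of \<omega>] by (simp add: V_def split: split_indicator)
  qed
  have main: "(\<lambda>n. \<integral>\<omega>. V \<omega> *\<^sub>R R' n \<omega> \<partial>P) \<longlonglongrightarrow> of_real (\<integral>\<omega>. V \<omega> \<partial>P)"
  proof (rule tendsto_of_generator[OF R'_meas R'_le Int_stable_past _ sets_P_generated _ R'_lim V(1) V(2) V(3)])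
    show "(\<Union>k. sets (past MY k)) \<subseteq> Pow (space P)" unfolding space_P using sets.sets_into_space by fastforce
    show "space P \<in> (\<Union>k. sets (past MY k))" unfolding space_P using sets.top[of "past MY 0"] by auto
  qed
  define S where "S n \<omega> = (\<Sum>l<n. h l \<omega> * centred_weight (Suc l) \<omega>) / sqrt (real n)" for n \<omega>
  have E_S: "E n n \<omega> = iexp (S n \<omega>)" for n \<omega>
  proof -
    have "S n \<omega> = (\<Sum>l<n. s n l \<omega> * centred_weight (Suc l) \<omega>)" by (simp add: S_def s_def sum_divide_distrib)
    then show ?thesis unfolding E_def by (simp add: exp_sum[symmetric] sum_distrib_left)
  qed
  \<comment> \<open>the deviation of the quadratic variation, which tends to 0 by assumption\<close>
  define L1 where "L1 n = (\<integral>\<omega>. \<bar>(\<Sum>l<n. (h l \<omega>)\<^sup>2) / real n - \<eta> \<omega>\<bar> \<partial>P)" for n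
  have close: "cmod ((\<integral>\<omega>. indicator H \<omega> *\<^sub>R iexp (S (n + N0) \<omega>) \<partial>P) - (\<integral>\<omega>. V \<omega> *\<^sub>R R' n \<omega> \<partial>P))
      \<le> 1 / \<delta> * (chi_err * c ^ 3 / sqrt (real (n + N0)) + v / 2 * L1 (n + N0))" for n
  proof -
    define m where "m = n + N0"
    have m: "m \<ge> N0" by (simp add: m_def)
    have h2: "(\<lambda>\<omega>. (\<Sum>l<m. (h l \<omega>)\<^sup>2) / real m) \<in> borel_measurable P"
      using measurable_from_subalg[OF sub_past(2) h(1)] by measurable
    have q: "0 \<le> (\<Sum>l<m. (h l \<omega>)\<^sup>2) / real m" for \<omega> by (intro divide_nonneg_nonneg sum_nonneg) auto
    have qc: "(\<Sum>l<m. (h l \<omega>)\<^sup>2) / real m \<le> c\<^sup>2" if "\<omega> \<in> space P" for \<omega>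
    proof -
      have "(\<Sum>l<m. (h l \<omega>)\<^sup>2) \<le> (\<Sum>l<m. c\<^sup>2)"
      proof (rule sum_mono)
        fix l show "(h l \<omega>)\<^sup>2 \<le> c\<^sup>2" using power_mono[OF h(2)[OF that, of l], of 2] by simp
      qed
      then show ?thesis by (cases "m = 0") (auto simp: divide_le_eq mult.commute)
    qed
    have int: "integrable P (\<lambda>\<omega>. \<bar>(\<Sum>l<m. (h l \<omega>)\<^sup>2) / real m - \<eta> \<omega>\<bar>)"
    proof (rule bounded_integrable[of _ "c\<^sup>2 + d"])
      show "(\<lambda>\<omega>. \<bar>(\<Sum>l<m. (h l \<omega>)\<^sup>2) / real m - \<eta> \<omega>\<bar>) \<in> borel_measurable P" using h2 \<eta>(1) by measurable
      show "\<bar>\<bar>(\<Sum>l<m. (h l \<omega>)\<^sup>2) / real m - \<eta> \<omega>\<bar>\<bar> \<le> c\<^sup>2 + d" if "\<omega> \<in> space P" for \<omega>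
        using qc[OF that] q[of \<omega>] \<eta>(2)[of \<omega>] \<eta>(3)[OF that] by linarith
    qed
    have pt: "cmod (indicator H \<omega> *\<^sub>R iexp (S m \<omega>) - V \<omega> *\<^sub>R R m m \<omega>)
        \<le> 1 / \<delta> * (chi_err * c ^ 3 / sqrt (real m) + v / 2 * \<bar>(\<Sum>l<m. (h l \<omega>)\<^sup>2) / real m - \<eta> \<omega>\<bar>)"
      if \<omega>: "\<omega> \<in> space P" for \<omega>
    proof -
      define x where "x = exp (- (v * \<eta> \<omega> / 2))"
      have "F m m \<omega> \<noteq> 0" using F_ge[OF m order_refl \<omega>] \<delta> by auto
      then have "iexp (S m \<omega>) = R m m \<omega> * F m m \<omega>" by (simp add: R_def E_S)
      then have eq: "indicator H \<omega> *\<^sub>R iexp (S m \<omega>) - V \<omega> *\<^sub>R R m m \<omega>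
         = indicator H \<omega> *\<^sub>R (R m m \<omega> * (F m m \<omega> - of_real x))"
        by (simp add: V_def x_def scaleR_conv_of_real algebra_simps)
      have "cmod (indicator H \<omega> *\<^sub>R iexp (S m \<omega>) - V \<omega> *\<^sub>R R m m \<omega>) \<le> cmod (R m m \<omega>) * cmod (F m m \<omega> - of_real x)"
        unfolding eq by (simp add: norm_mult split: split_indicator)
      also have "\<dots> \<le> 1 / \<delta> * (chi_err * c ^ 3 / sqrt (real m) + v / 2 * \<bar>(\<Sum>l<m. (h l \<omega>)\<^sup>2) / real m - \<eta> \<omega>\<bar>)"
      proof (intro mult_mono R_le m order_refl \<omega>)
        have "cmod (F m m \<omega> - of_real x) \<le> cmod (F m m \<omega> - of_real (D m \<omega>)) + cmod (of_real (D m \<omega>) - of_real x)"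
          using norm_triangle_ineq[of "F m m \<omega> - of_real (D m \<omega>)" "of_real (D m \<omega>) - of_real x"] by simp
        moreover have "cmod (of_real (D m \<omega>) - of_real x) \<le> v / 2 * \<bar>(\<Sum>l<m. (h l \<omega>)\<^sup>2) / real m - \<eta> \<omega>\<bar>"
        proof -
          define q where "q = (\<Sum>l<m. (h l \<omega>)\<^sup>2) / real m"
          have q0: "0 \<le> q" unfolding q_def by (intro divide_nonneg_nonneg sum_nonneg) auto
          have "\<bar>D m \<omega> - x\<bar> \<le> \<bar>v * q / 2 - v * \<eta> \<omega> / 2\<bar>"
            unfolding D_def x_def q_def[symmetric]
            using v0 q0 \<eta>(2)[of \<omega>] by (intro abs_exp_minus_diff_le) simp_all
          also have "v * q / 2 - v * \<eta> \<omega> / 2 = v / 2 * (q - \<eta> \<omega>)" by (simp add: algebra_simps)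
          also have "\<bar>v / 2 * (q - \<eta> \<omega>)\<bar> = v / 2 * \<bar>q - \<eta> \<omega>\<bar>" using v0 by (simp add: abs_mult)
          finally show ?thesis unfolding q_def by (simp flip: of_real_diff)
        qed
        ultimately show "cmod (F m m \<omega> - of_real x) \<le> chi_err * c ^ 3 / sqrt (real m) + v / 2 * \<bar>(\<Sum>l<m. (h l \<omega>)\<^sup>2) / real m - \<eta> \<omega>\<bar>"
          using F_D[OF \<omega> N0(1,2)[OF m]] by linarith
      qed (use \<delta> in auto)
      finally show ?thesis .
    qed
    have iV: "integrable P (\<lambda>\<omega>. V \<omega> *\<^sub>R R m m \<omega>)"
      by (rule integrable_scaleR_bounded[where c=1 and d="1 / \<delta>"])
         (use R_measP R_le[OF m order_refl] V in auto)
    have "S m \<in> borel_measurable P"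
      unfolding S_def
      by (intro borel_measurable_divide borel_measurable_sum borel_measurable_times
          measurable_from_subalg[OF sub_past(2) h(1)] measurable_centred_weight_P borel_measurable_const) simp
    then have iS: "integrable P (\<lambda>\<omega>. indicator H \<omega> *\<^sub>R iexp (S m \<omega>))"
      using measurable_compose[OF _ iexp_meas] H
      by (intro integrable_scaleR_bounded[where c=1 and d=1]) (auto split: split_indicator)
    have "cmod ((\<integral>\<omega>. indicator H \<omega> *\<^sub>R iexp (S m \<omega>) \<partial>P) - (\<integral>\<omega>. V \<omega> *\<^sub>R R m m \<omega> \<partial>P))
        = cmod (\<integral>\<omega>. indicator H \<omega> *\<^sub>R iexp (S m \<omega>) - V \<omega> *\<^sub>R R m m \<omega> \<partial>P)"
      using iV iS by simp
    also have "\<dots> \<le> (\<integral>\<omega>. cmod (indicator H \<omega> *\<^sub>R iexp (S m \<omega>) - V \<omega> *\<^sub>R R m m \<omega>) \<partial>P)"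
      by (rule integral_norm_bound)
    also have "\<dots> \<le> (\<integral>\<omega>. 1 / \<delta> * (chi_err * c ^ 3 / sqrt (real m) + v / 2 * \<bar>(\<Sum>l<m. (h l \<omega>)\<^sup>2) / real m - \<eta> \<omega>\<bar>) \<partial>P)"
    proof (rule integral_mono)
      show "integrable P (\<lambda>\<omega>. cmod (indicator H \<omega> *\<^sub>R iexp (S m \<omega>) - V \<omega> *\<^sub>R R m m \<omega>))"
        by (intro integrable_norm Bochner_Integration.integrable_diff iV iS)
      show "integrable P (\<lambda>\<omega>. 1 / \<delta> * (chi_err * c ^ 3 / sqrt (real m) + v / 2 * \<bar>(\<Sum>l<m. (h l \<omega>)\<^sup>2) / real m - \<eta> \<omega>\<bar>))"
        by (intro integrable_mult_right Bochner_Integration.integrable_add int integrable_const)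
    qed (rule pt)
    also have "\<dots> = 1 / \<delta> * (chi_err * c ^ 3 / sqrt (real m) + v / 2 * L1 m)"
      unfolding L1_def using int by (simp add: prob_space)
    finally show ?thesis unfolding m_def R'_def .
  qed
  have "(\<lambda>n. 1 / \<delta> * (chi_err * c ^ 3 / sqrt (real (n + N0)) + v / 2 * L1 (n + N0))) \<longlonglongrightarrow> 1 / \<delta> * (0 + v / 2 * 0)"
    using conv unfolding L1_def
    by (intro tendsto_mult tendsto_add tendsto_const LIMSEQ_ignore_initial_segment[OF err0]
        LIMSEQ_ignore_initial_segment)
  then have "(\<lambda>n. 1 / \<delta> * (chi_err * c ^ 3 / sqrt (real (n + N0)) + v / 2 * L1 (n + N0))) \<longlonglongrightarrow> 0" by simp
  then have "(\<lambda>n. (\<integral>\<omega>. indicator H \<omega> *\<^sub>R iexp (S (n + N0) \<omega>) \<partial>P) - (\<integral>\<omega>. V \<omega> *\<^sub>R R' n \<omega> \<partial>P)) \<longlonglongrightarrow> 0"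
    by (rule Lim_null_comparison[OF always_eventually[OF allI[OF close]]])
  from tendsto_add[OF this main]
  have "(\<lambda>n. \<integral>\<omega>. indicator H \<omega> *\<^sub>R iexp (S (n + N0) \<omega>) \<partial>P) \<longlonglongrightarrow> of_real (\<integral>\<omega>. V \<omega> \<partial>P)" by simp
  then have "(\<lambda>n. \<integral>\<omega>. indicator H \<omega> *\<^sub>R iexp (S n \<omega>) \<partial>P) \<longlonglongrightarrow> of_real (\<integral>\<omega>. V \<omega> \<partial>P)"
    by (rule LIMSEQ_offset)
  then show ?thesis unfolding S_def V_def v_def .
qed

end

section \<open>Linearization\<close>

lemma sum_inverse_le_sqrt: "(\<Sum>l<n. 1 / sqrt (real (Suc l))) \<le> 2 * sqrt (real n)"
proof (induction n)
  case (Suc n)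
  define x y where "x = sqrt (real n)" and "y = sqrt (real (Suc n))"
  have xy: "0 \<le> x" "x \<le> y" "0 < y" "y * y = x * x + 1" by (auto simp: x_def y_def)
  have "2 * (x * y) \<le> x * x + y * y" using zero_le_square[of "x - y"] by (simp add: algebra_simps)
  then have "2 * x * y + 1 \<le> 2 * y * y" using xy by (simp add: algebra_simps)
  then have "(2 * x + 1 / y) * y \<le> 2 * y * y" using xy by (simp add: distrib_right)
  then have "2 * x + 1 / y \<le> 2 * y" using xy(3) by (simp add: mult_le_cancel_right)
  then show ?case using Suc by (simp add: x_def y_def del: of_nat_Suc)
qed simp

lemma cos_lipschitz: "\<bar>cos x - cos y\<bar> \<le> \<bar>x - y\<bar>" for x y :: real
proof -
  have "\<bar>cos x - cos y\<bar> = 2 * (\<bar>sin ((x + y) / 2)\<bar> * \<bar>sin ((y - x) / 2)\<bar>)"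
    by (simp add: cos_diff_cos abs_mult)
  also have "\<dots> \<le> 2 * (1 * \<bar>(y - x) / 2\<bar>)"
    by (intro mult_left_mono mult_mono abs_sin_le_one abs_sin_x_le_abs_x) auto
  finally show ?thesis by simp
qed

lemma abs_diff_le_sum: "0 \<le> x \<Longrightarrow> x \<le> p \<Longrightarrow> 0 \<le> y \<Longrightarrow> y \<le> q \<Longrightarrow> \<bar>x - y\<bar> \<le> p + q" for x y p q :: real
  by linarith

lemma abs_diff_max_0_le: "0 \<le> x \<Longrightarrow> \<bar>x - max 0 y\<bar> \<le> \<bar>x - y\<bar>" for x y :: real
  by (auto simp: max_def)

context prob_space
begin

lemma expectation_abs_le_sqrt:
  fixes f :: "'a \<Rightarrow> real"
  assumes "integrable M f" "integrable M (\<lambda>\<omega>. (f \<omega>)\<^sup>2)" "(\<integral>\<omega>. (f \<omega>)\<^sup>2 \<partial>M) \<le> c"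
  shows "(\<integral>\<omega>. \<bar>f \<omega>\<bar> \<partial>M) \<le> sqrt c"
proof (rule real_le_rsqrt)
  have "0 \<le> variance (\<lambda>\<omega>. \<bar>f \<omega>\<bar>)" by simp
  also have "\<dots> = (\<integral>\<omega>. (\<bar>f \<omega>\<bar>)\<^sup>2 \<partial>M) - (\<integral>\<omega>. \<bar>f \<omega>\<bar> \<partial>M)\<^sup>2"
    using assms by (intro variance_eq) auto
  finally show "(\<integral>\<omega>. \<bar>f \<omega>\<bar> \<partial>M)\<^sup>2 \<le> c" using assms(3) by simp
qed

end

context reinforced_urn
begin

definition centred_weight_sum :: "nat \<Rightarrow> 'y traj \<Rightarrow> real" where
  "centred_weight_sum n \<omega> = (\<Sum>i=1..n. centred_weight i \<omega>)"

lemma centred_weight_sum_bound: "\<omega> \<in> space P \<Longrightarrow> \<bar>centred_weight_sum n \<omega>\<bar> \<le> real n * b"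
proof -
  assume \<omega>: "\<omega> \<in> space P"
  have "\<bar>centred_weight_sum n \<omega>\<bar> \<le> (\<Sum>i=1..n. b)"
    unfolding centred_weight_sum_def by (rule order_trans[OF sum_abs]) (intro sum_mono centred_weight_bound \<omega>, simp)
  then show ?thesis by simp
qed

lemma measurable_centred_weight_sum: "centred_weight_sum n \<in> borel_measurable (past MY n)"
  unfolding centred_weight_sum_def by (intro borel_measurable_sum measurable_centred_weight) auto

lemma measurable_centred_weight_sum_P: "centred_weight_sum n \<in> borel_measurable P"
  by (rule measurable_from_subalg[OF sub_past(1) measurable_centred_weight_sum])

lemma clipped_weight_bound: "z > 0 \<Longrightarrow> \<bar>min z b - mean_weight\<bar> \<le> b"
  using mean_weight_bounds mean_weight_pos a ab by (auto simp: abs_le_iff min_def)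

lemma expectation_centred_weight_sum_squared:
  "integrable P (\<lambda>\<omega>. (centred_weight_sum n \<omega>)\<^sup>2)" "(\<integral>\<omega>. (centred_weight_sum n \<omega>)\<^sup>2 \<partial>P) = real n * var_weight"
proof -
  have b0: "b \<ge> 0" using a ab by simp
  have sq: "integrable P (\<lambda>\<omega>. (centred_weight_sum n \<omega>)\<^sup>2)" for n
  proof (rule bounded_integrable[of _ "(real n * b)\<^sup>2"])
    show "\<bar>(centred_weight_sum n \<omega>)\<^sup>2\<bar> \<le> (real n * b)\<^sup>2" if "\<omega> \<in> space P" for \<omega>
      using power_mono[OF centred_weight_sum_bound[OF that, of n], of 2] by simp
  qed (intro borel_measurable_power measurable_centred_weight_sum_P)
  then show "integrable P (\<lambda>\<omega>. (centred_weight_sum n \<omega>)\<^sup>2)" .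
  have cross: "(\<integral>\<omega>. centred_weight_sum n \<omega> * centred_weight (Suc n) \<omega> \<partial>P) = 0" for n
  proof -
    have "(\<lambda>x. centred_weight_sum n (fst x) * (min (snd x) b - mean_weight)) \<in> borel_measurable (past_Y MY n \<Otimes>\<^sub>M weights)"
      by (intro borel_measurable_times borel_measurable_diff borel_measurable_min measurable_snd_weights
          borel_measurable_const measurable_compose[OF measurable_fst]
          measurable_from_subalg[OF subalgebra_past_mono(2) measurable_centred_weight_sum])
    moreover have "norm (centred_weight_sum n (fst (\<omega>, z)) * (min (snd (\<omega>, z)) b - mean_weight)) \<le> (real n * b) * b"
      if "\<omega> \<in> space P" "z > 0" for \<omega> z
      using mult_mono[OF centred_weight_sum_bound[OF that(1), of n] clipped_weight_bound[OF that(2)]] b0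
      by (simp add: abs_mult)
    ultimately have "(\<integral>\<omega>. centred_weight_sum n (fst (\<omega>, Z (Suc n) \<omega>)) * (min (snd (\<omega>, Z (Suc n) \<omega>)) b - mean_weight) \<partial>P)
        = (\<integral>\<omega>. (\<integral>\<omega>'. centred_weight_sum n (fst (\<omega>, Z 1 \<omega>')) * (min (snd (\<omega>, Z 1 \<omega>')) b - mean_weight) \<partial>P) \<partial>P)"
      by (rule integral_over_weight)
    then have "(\<integral>\<omega>. centred_weight_sum n \<omega> * centred_weight (Suc n) \<omega> \<partial>P) = (\<integral>\<omega>. centred_weight_sum n \<omega> * (\<integral>\<omega>'. centred_weight 1 \<omega>' \<partial>P) \<partial>P)"
      by (simp add: centred_weight_def)
    then show ?thesis by (simp only: expectation_centred_weight mult_zero_right integral_zero)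
  qed
  have own: "(\<integral>\<omega>. (centred_weight (Suc n) \<omega>)\<^sup>2 \<partial>P) = var_weight" for n
  proof -
    have "(\<lambda>z. (min z b - mean_weight)\<^sup>2) \<in> borel_measurable weights"
      by (rule measurable_restrict_space1) measurable
    moreover have "norm ((min z b - mean_weight)\<^sup>2) \<le> b\<^sup>2" if "z > 0" for z
      using power_mono[OF clipped_weight_bound[OF that], of 2] by simp
    ultimately have "(\<integral>\<omega>. (min (Z (Suc n) \<omega>) b - mean_weight)\<^sup>2 \<partial>P) = (\<integral>\<omega>. (min (Z 1 \<omega>) b - mean_weight)\<^sup>2 \<partial>P)"
      by (rule expectation_weight)
    then show ?thesis unfolding centred_weight_def[symmetric] by (simp only: expectation_centred_weight)
  qed
  show "(\<integral>\<omega>. (centred_weight_sum n \<omega>)\<^sup>2 \<partial>P) = real n * var_weight"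
  proof (induction n)
    case 0
    show ?case by (simp add: centred_weight_sum_def)
  next
    case (Suc n)
    define v where "v = var_weight"
    have i1: "integrable P (\<lambda>\<omega>. centred_weight_sum n \<omega> * centred_weight (Suc n) \<omega>)"
    proof (rule bounded_integrable[of _ "(real n * b) * b"])
      show "\<bar>centred_weight_sum n \<omega> * centred_weight (Suc n) \<omega>\<bar> \<le> (real n * b) * b" if "\<omega> \<in> space P" for \<omega>
        using mult_mono[OF centred_weight_sum_bound[OF that, of n] centred_weight_bound[OF that, of "Suc n"]] b0 by (simp add: abs_mult)
    qed (intro borel_measurable_times measurable_centred_weight_sum_P measurable_centred_weight_P, simp)
    have i2: "integrable P (\<lambda>\<omega>. (centred_weight (Suc n) \<omega>)\<^sup>2)"
    proof (rule bounded_integrable[of _ "b\<^sup>2"])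
      show "\<bar>(centred_weight (Suc n) \<omega>)\<^sup>2\<bar> \<le> b\<^sup>2" if "\<omega> \<in> space P" for \<omega>
        using power_mono[OF centred_weight_bound[OF that, of "Suc n"], of 2] by simp
    qed (intro borel_measurable_power measurable_centred_weight_P, simp)
    have "(centred_weight_sum (Suc n) \<omega>)\<^sup>2 = (centred_weight_sum n \<omega>)\<^sup>2 + 2 * (centred_weight_sum n \<omega> * centred_weight (Suc n) \<omega>) + (centred_weight (Suc n) \<omega>)\<^sup>2" for \<omega>
      by (simp add: centred_weight_sum_def power2_sum algebra_simps)
    then have "(\<integral>\<omega>. (centred_weight_sum (Suc n) \<omega>)\<^sup>2 \<partial>P) = (\<integral>\<omega>. (centred_weight_sum n \<omega>)\<^sup>2 \<partial>P) + v"
      using sq[of n] i1 i2 cross[of n] own[of n] by (simp add: v_def)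
    then show ?case unfolding Suc.IH v_def[symmetric] by (simp add: distrib_right)
  qed
qed

definition lin_const :: real where
  "lin_const = (b / (mean_weight * a))\<^sup>2 * (2 * \<alpha>\<^sup>2 + 2 * var_weight)"

lemma lin_const_nonneg: "lin_const \<ge> 0"
  unfolding lin_const_def by (intro mult_nonneg_nonneg add_nonneg_nonneg) auto

text \<open>Up to the factor \<open>- 1 / mean_weight\<close>, the leading term of \<open>C\<close>.\<close>

definition noise :: "'y set \<Rightarrow> nat \<Rightarrow> 'y traj \<Rightarrow> real" where
  "noise B n \<omega> = (\<Sum>l<n. centred_weight (Suc l) \<omega> * (hit B (Suc l) \<omega> - pred \<alpha> P l B \<omega>)) / sqrt (real n)"

lemma measurable_noise: "B \<in> sets MY \<Longrightarrow> noise B n \<in> borel_measurable P"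
  unfolding noise_def
  by (intro borel_measurable_divide borel_measurable_sum borel_measurable_times borel_measurable_diff
      measurable_centred_weight_P measurable_hit_P measurable_pred_P borel_measurable_const) auto

lemma measurable_C: "B \<in> sets MY \<Longrightarrow> C \<alpha> P n B \<in> borel_measurable P"
  unfolding C_def
  by (intro borel_measurable_times borel_measurable_diff measurable_emp measurable_pred_P borel_measurable_const)

lemma C_bound: "\<omega> \<in> space P \<Longrightarrow> \<bar>C \<alpha> P n B \<omega>\<bar> \<le> sqrt (real n)"
proof -
  assume "\<omega> \<in> space P"
  then have "\<bar>emp n B \<omega> - pred \<alpha> P n B \<omega>\<bar> \<le> 1"
    using emp_bounds[of n B \<omega>] pred_bounds[of \<omega> n B] by linarith
  then have "sqrt (real n) * \<bar>emp n B \<omega> - pred \<alpha> P n B \<omega>\<bar> \<le> sqrt (real n) * 1"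
    by (intro mult_left_mono) auto
  then show ?thesis by (simp add: C_def abs_mult)
qed

text \<open>With \<open>r = l + 1\<close>, \<open>s\<close> the total weight after draw \<open>r\<close> and \<open>m\<close> the mean weight, the coefficient of
  a surprise in \<open>C\<close> is \<open>1 - r * z / s\<close> where \<open>z\<close> is the new weight. For typical totals \<open>s\<close> is
  close to \<open>m * r\<close> and the coefficient close to \<open>- (z - m) / m\<close>. The error is \<open>z * (s - m * r) / (m * s)\<close>,
  where \<open>s - m * r\<close> has second moment of order \<open>r\<close>; and since the error is again a combination of
  surprises, the second moments of its terms simply add up.\<close>

lemma C_linearization:
  assumes B: "B \<in> sets MY" and n: "n \<ge> 1"
  shows "integrable P (\<lambda>\<omega>. (C \<alpha> P n B \<omega> + noise B n \<omega> / mean_weight)\<^sup>2)"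
    and "(\<integral>\<omega>. (C \<alpha> P n B \<omega> + noise B n \<omega> / mean_weight)\<^sup>2 \<partial>P) \<le> 2 * lin_const / sqrt (real n)"
proof -
  define m where "m = mean_weight"
  have m: "m > 0" unfolding m_def by (rule mean_weight_pos)
  define v where "v = var_weight"
  have v: "v \<ge> 0" by (simp add: v_def)
  \<comment> \<open>the error in the coefficient of the surprise\<close>
  define \<Psi> where "\<Psi> l x = min (snd x) b / m - real (Suc l) * drift l x" for l and x :: "'y traj \<times> real"
  define D where "D l \<omega> = \<Psi> l (\<omega>, Z (Suc l) \<omega>) * (hit B (Suc l) \<omega> - pred \<alpha> P l B \<omega>)" for l \<omega>
  have b: "b > 0" using a ab by simp
  have \<Psi>m: "\<Psi> l \<in> borel_measurable (past MY l \<Otimes>\<^sub>M weights)" for l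
    unfolding \<Psi>_def by (intro borel_measurable_diff borel_measurable_divide borel_measurable_min
        borel_measurable_times measurable_snd_weights measurable_drift borel_measurable_const)
  have \<Psi>bd: "\<bar>\<Psi> l (\<omega>, z)\<bar> \<le> b / m + real (Suc l)" if "\<omega> \<in> space P" "z > 0" for l \<omega> z
  proof -
    have "0 \<le> real (Suc l) * drift l (\<omega>, z)" "real (Suc l) * drift l (\<omega>, z) \<le> real (Suc l) * 1"
      using drift_bounds[OF that, of l] by (auto intro: mult_left_mono simp del: of_nat_Suc)
    moreover have "0 \<le> min z b / m" "min z b / m \<le> b / m"
      using that m b by (auto intro: divide_right_mono)
    ultimately show ?thesis unfolding \<Psi>_def snd_conv mult_1_right by (intro abs_diff_le_sum)
  qed
  note orth = surprise_sum_orthogonal[where \<Psi>=\<Psi> and n=n, OF B \<Psi>m \<Psi>bd le0, folded D_def]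
  have rep: "sqrt (real n) * (C \<alpha> P n B \<omega> + noise B n \<omega> / m) = (\<Sum>l=0..<n. D l \<omega>)" if \<omega>: "\<omega> \<in> space P" for \<omega>
  proof -
    have "sqrt (real n) * C \<alpha> P n B \<omega> = real n * (emp n B \<omega> - pred \<alpha> P n B \<omega>)"
      by (simp add: C_def)
    also have "\<dots> = (\<Sum>l=0..<n. (1 - real (Suc l) * drift l (\<omega>, Z (Suc l) \<omega>)) * (hit B (Suc l) \<omega> - pred \<alpha> P l B \<omega>))"
      by (rule emp_minus_pred[OF \<omega>])
    finally have 1: "sqrt (real n) * C \<alpha> P n B \<omega> = \<dots>" .
    have cancel: "sqrt (real n) * (x / sqrt (real n) / m) = x / m" for x using n by simp
    have 2: "sqrt (real n) * (noise B n \<omega> / m) = (\<Sum>l=0..<n. centred_weight (Suc l) \<omega> / m * (hit B (Suc l) \<omega> - pred \<alpha> P l B \<omega>))"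
      unfolding noise_def cancel by (simp add: sum_divide_distrib atLeast0LessThan)
    have "D l \<omega> = (1 - real (Suc l) * drift l (\<omega>, Z (Suc l) \<omega>)) * (hit B (Suc l) \<omega> - pred \<alpha> P l B \<omega>)
        + centred_weight (Suc l) \<omega> / m * (hit B (Suc l) \<omega> - pred \<alpha> P l B \<omega>)" for l
    proof -
      have "centred_weight (Suc l) \<omega> / m = min (Z (Suc l) \<omega>) b / m - 1"
        using m by (simp add: centred_weight_def m_def diff_divide_distrib)
      then show ?thesis unfolding D_def \<Psi>_def snd_conv distrib_right[symmetric] by simp
    qed
    then show ?thesis unfolding distrib_left 1 2 by (simp add: sum.distrib)
  qed
  have D2: "(\<integral>\<omega>. (D l \<omega>)\<^sup>2 \<partial>P) \<le> lin_const / sqrt (real (Suc l))" for l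
  proof -
    define r where "r = real (Suc l)"
    have r: "r \<ge> 1" by (simp add: r_def)
    have int: "integrable P (\<lambda>\<omega>. 2 * \<alpha>\<^sup>2 + 2 * (centred_weight_sum (Suc l) \<omega>)\<^sup>2)"
      using expectation_centred_weight_sum_squared(1) by simp
    have "(\<integral>\<omega>. (D l \<omega>)\<^sup>2 \<partial>P) \<le> (\<integral>\<omega>. (b / (m * a * r))\<^sup>2 * (2 * \<alpha>\<^sup>2 + 2 * (centred_weight_sum (Suc l) \<omega>)\<^sup>2) \<partial>P)"
    proof (rule integral_mono_AE[OF orth(1)])
      show "integrable P (\<lambda>\<omega>. (b / (m * a * r))\<^sup>2 * (2 * \<alpha>\<^sup>2 + 2 * (centred_weight_sum (Suc l) \<omega>)\<^sup>2))"
        using int by (rule integrable_mult_right)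
      show "AE \<omega> in P. (D l \<omega>)\<^sup>2 \<le> (b / (m * a * r))\<^sup>2 * (2 * \<alpha>\<^sup>2 + 2 * (centred_weight_sum (Suc l) \<omega>)\<^sup>2)"
        using AE_ordinary AE_space
      proof eventually_elim
        case (elim \<omega>)
        define z where "z = Z (Suc l) \<omega>"
        define s where "s = total l \<omega> + z"
        have z: "0 < z" "z \<le> b" using elim weight_pos[OF elim(2)] by (auto simp: z_def ordinary_def)
        have s: "a * r \<le> s" unfolding s_def z_def r_def
          using total_ordinary[OF elim(1), of "Suc l"] by (simp add: total_Suc)
        have ar: "0 < a * r" using a r by simp
        have s0: "0 < s" using s ar by linarith
        have dev: "s - m * r = \<alpha> + centred_weight_sum (Suc l) \<omega>"
        proof -
          have "centred_weight_sum (Suc l) \<omega> = (\<Sum>i=1..Suc l. Z i \<omega> - m)"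
            unfolding centred_weight_sum_def
          proof (rule sum.cong[OF refl])
            fix i assume "i \<in> {1..Suc l}"
            then obtain i' where "i = Suc i'" by (cases i) auto
            then show "centred_weight i \<omega> = Z i \<omega> - m" using centred_weight_ordinary[OF elim(1)] by (simp add: m_def)
          qed
          also have "\<dots> = (\<Sum>i=1..Suc l. Z i \<omega>) - r * m" by (simp add: sum_subtractf r_def)
          finally have "\<alpha> + centred_weight_sum (Suc l) \<omega> = total (Suc l) \<omega> - r * m" by (simp add: total_def)
          then show ?thesis by (simp add: total_Suc s_def z_def mult.commute)
        qed
        have "\<Psi> l (\<omega>, z) = z / m - r * (z / s)"
          using z by (simp add: \<Psi>_def drift_def r_def s_def)
        also have "\<dots> = z * (s - m * r) / (m * s)" using m s0 by (simp add: field_simps)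
        finally have "\<bar>\<Psi> l (\<omega>, z)\<bar> = z * \<bar>s - m * r\<bar> / (m * s)"
          using z m s0 by (simp add: abs_mult)
        also have "\<dots> \<le> b * \<bar>s - m * r\<bar> / (m * (a * r))"
          using z m s ar by (intro frac_le mult_right_mono mult_left_mono mult_nonneg_nonneg) auto
        also have "\<dots> = b / (m * a * r) * \<bar>s - m * r\<bar>" by (simp add: mult.assoc)
        finally have \<Psi>_le: "\<bar>\<Psi> l (\<omega>, z)\<bar> \<le> b / (m * a * r) * \<bar>s - m * r\<bar>" .
        have "\<bar>hit B (Suc l) \<omega> - pred \<alpha> P l B \<omega>\<bar> \<le> 1"
          using hit_bounds[of B "Suc l" \<omega>] pred_bounds[OF elim(2), of l B] by linarith
        then have "\<bar>D l \<omega>\<bar> \<le> \<bar>\<Psi> l (\<omega>, z)\<bar> * 1"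
          unfolding D_def abs_mult z_def[symmetric] by (intro mult_left_mono) auto
        with \<Psi>_le have "\<bar>D l \<omega>\<bar> \<le> b / (m * a * r) * \<bar>s - m * r\<bar>" by linarith
        then have "\<bar>D l \<omega>\<bar>\<^sup>2 \<le> (b / (m * a * r) * \<bar>s - m * r\<bar>)\<^sup>2" by (rule power_mono) simp
        also have "\<dots> = (b / (m * a * r))\<^sup>2 * (s - m * r)\<^sup>2" by (simp only: power_mult_distrib power2_abs)
        also have "\<dots> \<le> (b / (m * a * r))\<^sup>2 * (2 * \<alpha>\<^sup>2 + 2 * (centred_weight_sum (Suc l) \<omega>)\<^sup>2)"
        proof (rule mult_left_mono)
          have "0 \<le> (\<alpha> - centred_weight_sum (Suc l) \<omega>)\<^sup>2" by simp
          then show "(s - m * r)\<^sup>2 \<le> 2 * \<alpha>\<^sup>2 + 2 * (centred_weight_sum (Suc l) \<omega>)\<^sup>2"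
            unfolding dev power2_sum power2_diff by linarith
        qed simp
        finally show ?case by simp
      qed
    qed simp
    also have "\<dots> = (b / (m * a * r))\<^sup>2 * (2 * \<alpha>\<^sup>2 + 2 * (r * v))"
      using expectation_centred_weight_sum_squared[of "Suc l"] by (simp add: prob_space r_def v_def del: of_nat_Suc)
    also have "\<dots> \<le> (b / (m * a * r))\<^sup>2 * ((2 * \<alpha>\<^sup>2 + 2 * v) * r)"
    proof (rule mult_left_mono)
      have "2 * \<alpha>\<^sup>2 * 1 \<le> 2 * \<alpha>\<^sup>2 * r" using r by (intro mult_left_mono) auto
      then show "2 * \<alpha>\<^sup>2 + 2 * (r * v) \<le> (2 * \<alpha>\<^sup>2 + 2 * v) * r" by (simp add: algebra_simps)
    qed simp
    also have "\<dots> = lin_const / r"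
      unfolding lin_const_def v_def[symmetric] unfolding m_def[symmetric] using r
      by (simp add: power_divide power_mult_distrib power2_eq_square mult_ac)
    also have "\<dots> \<le> lin_const / sqrt r"
    proof (rule divide_left_mono)
      show "sqrt r \<le> r" using r by (simp add: real_sqrt_le_iff' real_le_lsqrt sqrt_le_D self_le_power)
    qed (use r lin_const_nonneg in auto)
    finally show ?thesis by (simp add: r_def)
  qed
  have eq: "(C \<alpha> P n B \<omega> + noise B n \<omega> / m)\<^sup>2 = (\<Sum>l=0..<n. D l \<omega>)\<^sup>2 / real n" if "\<omega> \<in> space P" for \<omega>
    unfolding rep[OF that, symmetric] power_mult_distrib using n by simp
  have "integrable P (\<lambda>\<omega>. (\<Sum>l=0..<n. D l \<omega>)\<^sup>2 / real n)" using orth(2) by simp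
  then show "integrable P (\<lambda>\<omega>. (C \<alpha> P n B \<omega> + noise B n \<omega> / mean_weight)\<^sup>2)"
    unfolding m_def[symmetric] by (subst Bochner_Integration.integrable_cong[OF refl eq])
  have "(\<integral>\<omega>. (C \<alpha> P n B \<omega> + noise B n \<omega> / m)\<^sup>2 \<partial>P) = (\<integral>\<omega>. (\<Sum>l=0..<n. D l \<omega>)\<^sup>2 / real n \<partial>P)"
    by (rule Bochner_Integration.integral_cong[OF refl eq])
  also have "\<dots> = (\<Sum>l=0..<n. \<integral>\<omega>. (D l \<omega>)\<^sup>2 \<partial>P) / real n" using orth(3) by simp
  also have "\<dots> \<le> (\<Sum>l=0..<n. lin_const / sqrt (real (Suc l))) / real n"
    by (intro divide_right_mono sum_mono D2) simp
  also have "(\<Sum>l=0..<n. lin_const / sqrt (real (Suc l))) = lin_const * (\<Sum>l<n. 1 / sqrt (real (Suc l)))"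
    by (simp add: sum_distrib_left atLeast0LessThan)
  also have "lin_const * (\<Sum>l<n. 1 / sqrt (real (Suc l))) / real n \<le> lin_const * (2 * sqrt (real n)) / real n"
    by (intro divide_right_mono mult_left_mono sum_inverse_le_sqrt lin_const_nonneg) simp
  also have "\<dots> = 2 * lin_const / sqrt (real n)"
  proof -
    have "real n = sqrt (real n) * sqrt (real n)" by simp
    then show ?thesis using n by (simp add: field_simps)
  qed
  finally show "(\<integral>\<omega>. (C \<alpha> P n B \<omega> + noise B n \<omega> / mean_weight)\<^sup>2 \<partial>P) \<le> 2 * lin_const / sqrt (real n)"
    unfolding m_def .
qed

lemma C_noise_distance:
  assumes B: "B \<in> sets MY"
  shows "integrable P (\<lambda>\<omega>. \<bar>C \<alpha> P n B \<omega> + noise B n \<omega> / mean_weight\<bar>)"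
    and "(\<lambda>n. \<integral>\<omega>. \<bar>C \<alpha> P n B \<omega> + noise B n \<omega> / mean_weight\<bar> \<partial>P) \<longlonglongrightarrow> 0"
proof -
  define f where "f n \<omega> = C \<alpha> P n B \<omega> + noise B n \<omega> / mean_weight" for n \<omega>
  have fm: "f n \<in> borel_measurable P" for n
    unfolding f_def using measurable_C[OF B] measurable_noise[OF B] by simp
  have fi: "integrable P (f n)" for n
  proof (rule bounded_integrable[OF fm])
    fix \<omega> assume \<omega>: "\<omega> \<in> space P"
    have "\<bar>\<Sum>l<n. centred_weight (Suc l) \<omega> * (hit B (Suc l) \<omega> - pred \<alpha> P l B \<omega>)\<bar> \<le> (\<Sum>l<n. b * 1)"
    proof (rule order_trans[OF sum_abs], rule sum_mono)
      fix l
      have "\<bar>hit B (Suc l) \<omega> - pred \<alpha> P l B \<omega>\<bar> \<le> 1"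
        using hit_bounds[of B "Suc l" \<omega>] pred_bounds[OF \<omega>, of l B] by linarith
      then show "\<bar>centred_weight (Suc l) \<omega> * (hit B (Suc l) \<omega> - pred \<alpha> P l B \<omega>)\<bar> \<le> b * 1"
        unfolding abs_mult using centred_weight_bound[OF \<omega>, of "Suc l"] a ab by (intro mult_mono) auto
    qed
    then have "\<bar>noise B n \<omega>\<bar> \<le> (\<Sum>l<n. b * 1) / sqrt (real n)"
      unfolding noise_def abs_divide by (simp add: divide_right_mono)
    then have "\<bar>noise B n \<omega> / mean_weight\<bar> \<le> (\<Sum>l<n. b * 1) / sqrt (real n) / mean_weight"
      unfolding abs_divide abs_of_pos[OF mean_weight_pos]
      by (rule divide_right_mono) (rule less_imp_le[OF mean_weight_pos])
    then show "\<bar>f n \<omega>\<bar> \<le> sqrt (real n) + (\<Sum>l<n. b * 1) / sqrt (real n) / mean_weight"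
      unfolding f_def using C_bound[OF \<omega>, of n B] by linarith
  qed
  then show "integrable P (\<lambda>\<omega>. \<bar>C \<alpha> P n B \<omega> + noise B n \<omega> / mean_weight\<bar>)"
    unfolding f_def[symmetric] by (rule integrable_abs)
  have "(\<lambda>n. 2 * lin_const / sqrt (real n)) \<longlonglongrightarrow> 0"
    by (intro tendsto_divide_0[OF tendsto_const] filterlim_at_top_imp_at_infinity
        filterlim_compose[OF sqrt_at_top filterlim_real_sequentially])
  from tendsto_real_sqrt[OF this] have lim: "(\<lambda>n. sqrt (2 * lin_const / sqrt (real n))) \<longlonglongrightarrow> 0" by simp
  have "(\<lambda>n. \<integral>\<omega>. \<bar>f n \<omega>\<bar> \<partial>P) \<longlonglongrightarrow> 0"
  proof (rule Lim_null_comparison[OF eventually_sequentiallyI[of 1] lim])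
    fix n :: nat assume n: "n \<ge> 1"
    have "(\<integral>\<omega>. \<bar>f n \<omega>\<bar> \<partial>P) \<le> sqrt (2 * lin_const / sqrt (real n))"
      using expectation_abs_le_sqrt[OF fi] C_linearization[OF B n] unfolding f_def by blast
    then show "norm (\<integral>\<omega>. \<bar>f n \<omega>\<bar> \<partial>P) \<le> sqrt (2 * lin_const / sqrt (real n))" by simp
  qed
  then show "(\<lambda>n. \<integral>\<omega>. \<bar>C \<alpha> P n B \<omega> + noise B n \<omega> / mean_weight\<bar> \<partial>P) \<longlonglongrightarrow> 0"
    by (simp add: f_def)
qed

section \<open>The random limiting variance\<close>

lemma expectation_emp_lim_distance:
  assumes B: "B \<in> sets MY"
  shows "integrable P (\<lambda>\<omega>. \<bar>emp n B \<omega> - emp_lim B \<omega>\<bar>)"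
    and "n \<ge> 1 \<Longrightarrow> (\<integral>\<omega>. \<bar>emp n B \<omega> - emp_lim B \<omega>\<bar> \<partial>P) \<le> sqrt (rate / real n)"
proof -
  have em: "emp n B \<in> borel_measurable P" "emp_lim B \<in> borel_measurable P"
    using B by (auto intro: measurable_emp measurable_emp_lim)
  have bd: "0 \<le> emp n B \<omega> \<and> emp n B \<omega> \<le> 1" "0 \<le> emp_lim B \<omega> \<and> emp_lim B \<omega> \<le> 1" for \<omega>
    using emp_bounds[of n B \<omega>] emp_lim_bounds[of B \<omega>] by auto
  note int = integrable_square_diff[OF em bd]
  show "integrable P (\<lambda>\<omega>. \<bar>emp n B \<omega> - emp_lim B \<omega>\<bar>)" by (rule int(2))
  have i: "integrable P (\<lambda>\<omega>. emp n B \<omega> - emp_lim B \<omega>)"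
    using int(2) em by (subst (asm) integrable_abs_iff) auto
  assume n: "n \<ge> 1"
  have "rate * prior B / real n \<le> rate * 1 / real n"
    using rate_pos by (intro divide_right_mono mult_left_mono) auto
  then show "(\<integral>\<omega>. \<bar>emp n B \<omega> - emp_lim B \<omega>\<bar> \<partial>P) \<le> sqrt (rate / real n)"
    using expectation_emp_minus_lim[OF B n] by (intro expectation_abs_le_sqrt[OF i int(1)]) simp
qed

text \<open>The bound is stated with \<open>l + 1\<close> so that it covers \<open>l = 0\<close>, and with the factor 4 that this
  costs; it holds for all \<open>l\<close> and can be summed.\<close>

lemma expectation_pred_lim_distance:
  assumes B: "B \<in> sets MY"
  shows "integrable P (\<lambda>\<omega>. \<bar>pred \<alpha> P l B \<omega> - emp_lim B \<omega>\<bar>)"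
    and "(\<integral>\<omega>. \<bar>pred \<alpha> P l B \<omega> - emp_lim B \<omega>\<bar> \<partial>P) \<le> 4 * sqrt rate * (1 / sqrt (real (Suc l)))"
proof -
  have m: "pred \<alpha> P l B \<in> borel_measurable P" "emp l B \<in> borel_measurable P" "emp_lim B \<in> borel_measurable P"
    using B by (auto intro: measurable_emp measurable_emp_lim measurable_pred_P)
  have bd: "0 \<le> pred \<alpha> P l B \<omega> \<and> pred \<alpha> P l B \<omega> \<le> 1" if "\<omega> \<in> space P" for \<omega>
    using pred_bounds[OF that, of l B] by auto
  have bd': "0 \<le> emp l B \<omega> \<and> emp l B \<omega> \<le> 1" "0 \<le> emp_lim B \<omega> \<and> emp_lim B \<omega> \<le> 1" for \<omega>
    using emp_bounds[of l B \<omega>] emp_lim_bounds[of B \<omega>] by auto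
  have i1: "integrable P (\<lambda>\<omega>. (pred \<alpha> P l B \<omega> - emp_lim B \<omega>)\<^sup>2)"
      "integrable P (\<lambda>\<omega>. \<bar>pred \<alpha> P l B \<omega> - emp_lim B \<omega>\<bar>)"
    by (rule integrable_square_diff[OF m(1) m(3)]; use bd bd' in blast)+
  have i2: "integrable P (\<lambda>\<omega>. (emp l B \<omega> - pred \<alpha> P l B \<omega>)\<^sup>2)"
      "integrable P (\<lambda>\<omega>. \<bar>emp l B \<omega> - pred \<alpha> P l B \<omega>\<bar>)"
    by (rule integrable_square_diff[OF m(2) m(1)]; use bd bd' in blast)+
  show "integrable P (\<lambda>\<omega>. \<bar>pred \<alpha> P l B \<omega> - emp_lim B \<omega>\<bar>)" by (rule i1(2))
  show "(\<integral>\<omega>. \<bar>pred \<alpha> P l B \<omega> - emp_lim B \<omega>\<bar> \<partial>P) \<le> 4 * sqrt rate * (1 / sqrt (real (Suc l)))"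
  proof (cases "l = 0")
    case True
    have "1 \<le> rate"
    proof -
      have "1 \<le> (1 + b / a)\<^sup>2" using a ab by (intro one_le_power) auto
      then show ?thesis by (simp add: rate_def)
    qed
    then have "1 \<le> 4 * sqrt rate" using real_sqrt_ge_one[of rate] by linarith
    moreover have "(\<integral>\<omega>. \<bar>pred \<alpha> P l B \<omega> - emp_lim B \<omega>\<bar> \<partial>P) \<le> (\<integral>\<omega>. 1 \<partial>P)"
    proof (rule integral_mono[OF i1(2)])
      fix \<omega> assume "\<omega> \<in> space P"
      then show "\<bar>pred \<alpha> P l B \<omega> - emp_lim B \<omega>\<bar> \<le> 1" using bd[of \<omega>] bd'(2)[of \<omega>] by auto
    qed simp
    ultimately show ?thesis using True by (simp add: prob_space)
  next
    case False
    then have l: "l \<ge> 1" by simp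
    have i2': "integrable P (\<lambda>\<omega>. emp l B \<omega> - pred \<alpha> P l B \<omega>)"
      using i2(2) m by (subst (asm) integrable_abs_iff) auto
    have rl: "rate / real l \<le> 4 * rate / real (Suc l)"
      using rate_pos l by (simp add: field_simps)
    have s: "sqrt (rate / real l) \<le> 2 * sqrt rate * (1 / sqrt (real (Suc l)))"
    proof -
      have "sqrt (rate / real l) \<le> sqrt (4 * rate / real (Suc l))" using rl by (rule real_sqrt_le_mono)
      also have "\<dots> = 2 * sqrt rate * (1 / sqrt (real (Suc l)))" by (simp add: real_sqrt_divide real_sqrt_mult)
      finally show ?thesis .
    qed
    have "(\<integral>\<omega>. (emp l B \<omega> - pred \<alpha> P l B \<omega>)\<^sup>2 \<partial>P) \<le> rate / real l"
    proof -
      have "(1 + b / a)\<^sup>2 * prior B \<le> (1 + b / a)\<^sup>2 * 1" by (intro mult_left_mono) auto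
      also have "\<dots> \<le> rate" by (simp add: rate_def)
      finally have "(1 + b / a)\<^sup>2 * prior B / real l \<le> rate / real l" by (intro divide_right_mono) auto
      then show ?thesis using expectation_emp_pred_distance[OF B l] by linarith
    qed
    from expectation_abs_le_sqrt[OF i2' i2(1) this]
    have 1: "(\<integral>\<omega>. \<bar>emp l B \<omega> - pred \<alpha> P l B \<omega>\<bar> \<partial>P) \<le> sqrt (rate / real l)" .
    have "(\<integral>\<omega>. \<bar>pred \<alpha> P l B \<omega> - emp_lim B \<omega>\<bar> \<partial>P)
        \<le> (\<integral>\<omega>. \<bar>emp l B \<omega> - pred \<alpha> P l B \<omega>\<bar> + \<bar>emp l B \<omega> - emp_lim B \<omega>\<bar> \<partial>P)"
      by (intro integral_mono i1(2) Bochner_Integration.integrable_add i2(2) expectation_emp_lim_distance(1) B) linarith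
    also have "\<dots> = (\<integral>\<omega>. \<bar>emp l B \<omega> - pred \<alpha> P l B \<omega>\<bar> \<partial>P) + (\<integral>\<omega>. \<bar>emp l B \<omega> - emp_lim B \<omega>\<bar> \<partial>P)"
      by (intro Bochner_Integration.integral_add i2(2) expectation_emp_lim_distance(1) B)
    also have "\<dots> \<le> sqrt (rate / real l) + sqrt (rate / real l)"
      by (intro add_mono 1 expectation_emp_lim_distance(2) B l)
    also have "\<dots> \<le> 4 * sqrt rate * (1 / sqrt (real (Suc l)))" using s by linarith
    finally show ?thesis .
  qed
qed

text \<open>A draw hits at most one of the disjoint sets.\<close>

lemma hit_combination_squared:
  fixes K :: nat
  assumes "disjoint_family D"
  shows "(\<Sum>k<K. t k * hit (D k) i \<omega>)\<^sup>2 = (\<Sum>k<K. (t k)\<^sup>2 * hit (D k) i \<omega>)"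
proof -
  have "t j * hit (D j) i \<omega> * (t k * hit (D k) i \<omega>) = (if j = k then (t k)\<^sup>2 * hit (D k) i \<omega> else 0)" for j k
    using assms by (auto simp: hit_def disjoint_family_on_def power2_eq_square split: split_indicator)
  then have "(\<Sum>k<K. t k * hit (D k) i \<omega>)\<^sup>2 = (\<Sum>j<K. \<Sum>k<K. if j = k then (t k)\<^sup>2 * hit (D k) i \<omega> else 0)"
    by (simp add: power2_eq_square[of "sum _ _"] sum_product)
  also have "\<dots> = (\<Sum>j<K. (t j)\<^sup>2 * hit (D j) i \<omega>)"
    by (intro sum.cong refl) simp
  finally show ?thesis .
qed

lemma weighted_abs_le:
  fixes x t :: "nat \<Rightarrow> real"
  assumes "\<And>k. 0 \<le> x k \<and> x k \<le> 1"
  shows "\<bar>\<Sum>k<K. t k * x k\<bar> \<le> (\<Sum>k<K. \<bar>t k\<bar>)"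
proof (rule order_trans[OF sum_abs], rule sum_mono)
  fix k show "\<bar>t k * x k\<bar> \<le> \<bar>t k\<bar>" using assms[of k] by (simp add: abs_mult mult_left_le)
qed

text \<open>The variance of the function \<open>\<Sum>k<K. t k * indicator (D k)\<close> under the limiting frequencies.\<close>

definition spread :: "(nat \<Rightarrow> 'y set) \<Rightarrow> (nat \<Rightarrow> real) \<Rightarrow> nat \<Rightarrow> 'y traj \<Rightarrow> real" where
  "spread D t K \<omega> = (\<Sum>k<K. (t k)\<^sup>2 * emp_lim (D k) \<omega>) - (\<Sum>k<K. t k * emp_lim (D k) \<omega>)\<^sup>2"

text \<open>If the predictions are replaced by their limit \<open>\<tau>\<close>, the square expands into indicators of the sets
  \<open>D k\<close>, since a draw hits at most one of them, and the average becomes an expression in the empirical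
  frequencies with limit \<open>spread\<close>. The replacement is harmless because the predictions approach
  \<open>\<tau>\<close> in mean at the rate \<open>1 / sqrt l\<close>, which is small on average over \<open>l\<close>.\<close>

lemma quadratic_variation:
  fixes t :: "nat \<Rightarrow> real" and K :: nat
  assumes D: "\<And>k. D k \<in> sets MY" and disj: "disjoint_family D"
  defines "g \<equiv> \<lambda>i \<omega>. \<Sum>k<K. t k * hit (D k) i \<omega>"
    and "abar \<equiv> \<lambda>l \<omega>. \<Sum>k<K. t k * pred \<alpha> P l (D k) \<omega>"
  shows "integrable P (\<lambda>\<omega>. \<bar>(\<Sum>l<n. (g (Suc l) \<omega> - abar l \<omega>)\<^sup>2) / real n - spread D t K \<omega>\<bar>)"
    and "(\<lambda>n. \<integral>\<omega>. \<bar>(\<Sum>l<n. (g (Suc l) \<omega> - abar l \<omega>)\<^sup>2) / real n - spread D t K \<omega>\<bar> \<partial>P) \<longlonglongrightarrow> 0"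
proof -
  define \<tau> where "\<tau> \<omega> = (\<Sum>k<K. t k * emp_lim (D k) \<omega>)" for \<omega>
  define q where "q = (\<Sum>k<K. \<bar>t k\<bar>)"
  define e where "e n k \<omega> = \<bar>emp n (D k) \<omega> - emp_lim (D k) \<omega>\<bar>" for n k \<omega>
  define p where "p l k \<omega> = \<bar>pred \<alpha> P l (D k) \<omega> - emp_lim (D k) \<omega>\<bar>" for l k \<omega>
  define f where "f n \<omega> = (\<Sum>l<n. (g (Suc l) \<omega> - abar l \<omega>)\<^sup>2) / real n - spread D t K \<omega>" for n \<omega>
  define u where "u n \<omega> = (\<Sum>k<K. ((t k)\<^sup>2 + 2 * q * \<bar>t k\<bar>) * e n k \<omega>)
      + (\<Sum>l<n. \<Sum>k<K. 4 * q * \<bar>t k\<bar> * p l k \<omega>) / real n" for n \<omega>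
  have q0: "q \<ge> 0" by (simp add: q_def sum_nonneg)
  have g_le: "\<bar>g i \<omega>\<bar> \<le> q" for i \<omega>
    unfolding g_def q_def using hit_bounds by (intro weighted_abs_le) auto
  have \<tau>_le: "\<bar>\<tau> \<omega>\<bar> \<le> q" for \<omega>
    unfolding \<tau>_def q_def using emp_lim_bounds by (intro weighted_abs_le) auto
  have abar_le: "\<bar>abar l \<omega>\<bar> \<le> q" if "\<omega> \<in> space P" for l \<omega>
    unfolding abar_def q_def using pred_bounds[OF that] by (intro weighted_abs_le) auto
  have f_le: "\<bar>f n \<omega>\<bar> \<le> u n \<omega>" if n: "n \<ge> 1" and \<omega>: "\<omega> \<in> space P" for n \<omega>
  proof -
    have mean: "(\<Sum>l<n. hit (D k) (Suc l) \<omega>) / real n = emp n (D k) \<omega>" for k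
      by (simp add: emp_eq sum.atLeast1_atMost_eq)
    have lin: "(\<Sum>l<n. \<Sum>k<K. c k * hit (D k) (Suc l) \<omega>) / real n = (\<Sum>k<K. c k * emp n (D k) \<omega>)"
      for c :: "nat \<Rightarrow> real"
    proof -
      have "(\<Sum>l<n. \<Sum>k<K. c k * hit (D k) (Suc l) \<omega>) = (\<Sum>k<K. c k * (\<Sum>l<n. hit (D k) (Suc l) \<omega>))"
        by (subst sum.swap) (simp only: sum_distrib_left)
      then show ?thesis
        unfolding mean[symmetric] by (simp only: sum_divide_distrib[of _ "{..<K}"] times_divide_eq_right)
    qed
    have "(\<Sum>l<n. (g (Suc l) \<omega> - \<tau> \<omega>)\<^sup>2) / real n
       = (\<Sum>l<n. (g (Suc l) \<omega>)\<^sup>2) / real n - 2 * \<tau> \<omega> * ((\<Sum>l<n. g (Suc l) \<omega>) / real n) + (\<tau> \<omega>)\<^sup>2"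
    proof -
      have "(\<Sum>l<n. (g (Suc l) \<omega> - \<tau> \<omega>)\<^sup>2)
        = (\<Sum>l<n. (g (Suc l) \<omega>)\<^sup>2) - 2 * \<tau> \<omega> * (\<Sum>l<n. g (Suc l) \<omega>) + real n * (\<tau> \<omega>)\<^sup>2"
        by (simp add: power2_diff sum.distrib sum_subtractf sum_distrib_left algebra_simps)
      then show ?thesis using n by (simp add: add_divide_distrib diff_divide_distrib)
    qed
    also have "(\<Sum>l<n. (g (Suc l) \<omega>)\<^sup>2) / real n = (\<Sum>k<K. (t k)\<^sup>2 * emp n (D k) \<omega>)"
      unfolding g_def hit_combination_squared[OF disj] by (rule lin)
    also have "(\<Sum>l<n. g (Suc l) \<omega>) / real n = (\<Sum>k<K. t k * emp n (D k) \<omega>)"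
      unfolding g_def by (rule lin)
    finally have fix_centre: "(\<Sum>l<n. (g (Suc l) \<omega> - \<tau> \<omega>)\<^sup>2) / real n - spread D t K \<omega>
       = (\<Sum>k<K. ((t k)\<^sup>2 - 2 * \<tau> \<omega> * t k) * (emp n (D k) \<omega> - emp_lim (D k) \<omega>))"
    proof -
      assume *: "(\<Sum>l<n. (g (Suc l) \<omega> - \<tau> \<omega>)\<^sup>2) / real n
         = (\<Sum>k<K. (t k)\<^sup>2 * emp n (D k) \<omega>) - 2 * \<tau> \<omega> * (\<Sum>k<K. t k * emp n (D k) \<omega>) + (\<tau> \<omega>)\<^sup>2"
      have "(\<Sum>k<K. ((t k)\<^sup>2 - 2 * \<tau> \<omega> * t k) * (emp n (D k) \<omega> - emp_lim (D k) \<omega>))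
         = (\<Sum>k<K. (t k)\<^sup>2 * emp n (D k) \<omega>) - 2 * \<tau> \<omega> * (\<Sum>k<K. t k * emp n (D k) \<omega>)
           - (\<Sum>k<K. (t k)\<^sup>2 * emp_lim (D k) \<omega>) + 2 * \<tau> \<omega> * (\<Sum>k<K. t k * emp_lim (D k) \<omega>)"
        by (simp add: sum_distrib_left sum.distrib[symmetric] sum_subtractf[symmetric] algebra_simps)
      then show ?thesis unfolding * spread_def \<tau>_def[symmetric] by (simp add: power2_eq_square)
    qed
    have 1: "\<bar>(\<Sum>l<n. (g (Suc l) \<omega> - \<tau> \<omega>)\<^sup>2) / real n - spread D t K \<omega>\<bar> \<le> (\<Sum>k<K. ((t k)\<^sup>2 + 2 * q * \<bar>t k\<bar>) * e n k \<omega>)"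
      unfolding fix_centre
    proof (rule order_trans[OF sum_abs], rule sum_mono)
      fix k
      have "\<bar>\<tau> \<omega>\<bar> * \<bar>t k\<bar> \<le> q * \<bar>t k\<bar>" using \<tau>_le by (rule mult_right_mono) simp
      then have "\<bar>(t k)\<^sup>2 - 2 * \<tau> \<omega> * t k\<bar> \<le> (t k)\<^sup>2 + 2 * q * \<bar>t k\<bar>"
        using abs_triangle_ineq4[of "(t k)\<^sup>2" "2 * \<tau> \<omega> * t k"] by (simp add: abs_mult)
      then show "\<bar>((t k)\<^sup>2 - 2 * \<tau> \<omega> * t k) * (emp n (D k) \<omega> - emp_lim (D k) \<omega>)\<bar> \<le> ((t k)\<^sup>2 + 2 * q * \<bar>t k\<bar>) * e n k \<omega>"
        unfolding abs_mult e_def by (rule mult_right_mono) simp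
    qed
    have "\<bar>(\<Sum>l<n. (g (Suc l) \<omega> - abar l \<omega>)\<^sup>2) / real n - (\<Sum>l<n. (g (Suc l) \<omega> - \<tau> \<omega>)\<^sup>2) / real n\<bar>
       = \<bar>\<Sum>l<n. (g (Suc l) \<omega> - abar l \<omega>)\<^sup>2 - (g (Suc l) \<omega> - \<tau> \<omega>)\<^sup>2\<bar> / real n"
      by (simp add: sum_subtractf diff_divide_distrib[symmetric] abs_divide)
    also have "\<dots> \<le> (\<Sum>l<n. \<Sum>k<K. 4 * q * \<bar>t k\<bar> * p l k \<omega>) / real n"
    proof (rule divide_right_mono, rule order_trans[OF sum_abs], rule sum_mono)
      fix l
      define x y z where "x = g (Suc l) \<omega>" and "y = abar l \<omega>" and "z = \<tau> \<omega>"
      have "(x - y)\<^sup>2 - (x - z)\<^sup>2 = (z - y) * (2 * x - y - z)" by (simp add: power2_eq_square algebra_simps)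
      then have "\<bar>(x - y)\<^sup>2 - (x - z)\<^sup>2\<bar> = \<bar>y - z\<bar> * \<bar>2 * x - y - z\<bar>"
        by (simp add: abs_mult abs_minus_commute)
      also have "\<dots> \<le> \<bar>y - z\<bar> * (4 * q)"
        using g_le[of "Suc l" \<omega>] abar_le[OF \<omega>, of l] \<tau>_le[of \<omega>] unfolding x_def y_def z_def
        by (intro mult_left_mono) auto
      also have "\<bar>y - z\<bar> \<le> (\<Sum>k<K. \<bar>t k\<bar> * p l k \<omega>)"
      proof -
        have "y - z = (\<Sum>k<K. t k * (pred \<alpha> P l (D k) \<omega> - emp_lim (D k) \<omega>))"
          by (simp add: y_def z_def abar_def \<tau>_def sum_subtractf right_diff_distrib)
        also have "\<bar>\<dots>\<bar> \<le> (\<Sum>k<K. \<bar>t k * (pred \<alpha> P l (D k) \<omega> - emp_lim (D k) \<omega>)\<bar>)" by (rule sum_abs)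
        finally show ?thesis by (simp add: p_def abs_mult)
      qed
      then have "\<bar>y - z\<bar> * (4 * q) \<le> (\<Sum>k<K. \<bar>t k\<bar> * p l k \<omega>) * (4 * q)"
        using q0 by (intro mult_right_mono) auto
      also have "\<dots> = (\<Sum>k<K. 4 * q * \<bar>t k\<bar> * p l k \<omega>)"
        unfolding sum_distrib_right by (intro sum.cong refl) simp
      finally show "\<bar>(g (Suc l) \<omega> - abar l \<omega>)\<^sup>2 - (g (Suc l) \<omega> - \<tau> \<omega>)\<^sup>2\<bar> \<le> (\<Sum>k<K. 4 * q * \<bar>t k\<bar> * p l k \<omega>)"
        unfolding x_def y_def z_def .
    qed simp
    finally show ?thesis using 1 unfolding f_def u_def by linarith
  qed
  have ei: "integrable P (e n k)" for n k
    unfolding e_def by (rule expectation_emp_lim_distance(1)[OF D])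
  have pi: "integrable P (p l k)" for l k
    unfolding p_def by (rule expectation_pred_lim_distance(1)[OF D])
  have ui: "integrable P (u n)" for n
    unfolding u_def using ei pi
    by (intro Bochner_Integration.integrable_add Bochner_Integration.integrable_sum integrable_mult_right integrable_divide)
  have fm: "f n \<in> borel_measurable P" for n
    unfolding f_def g_def abar_def spread_def
    by (intro borel_measurable_diff borel_measurable_divide borel_measurable_sum borel_measurable_power
        borel_measurable_times borel_measurable_const measurable_hit_P measurable_pred_P measurable_emp_lim D) auto
  have spread_int: "integrable P (f n)" for n
  proof (cases "n = 0")
    case False
    show ?thesis
    proof (rule Bochner_Integration.integrable_bound[OF ui[of n] fm])
      show "AE \<omega> in P. norm (f n \<omega>) \<le> norm (u n \<omega>)"
      proof (rule AE_I2)
        fix \<omega> assume "\<omega> \<in> space P"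
        then have "\<bar>f n \<omega>\<bar> \<le> u n \<omega>" using False by (intro f_le) auto
        then show "norm (f n \<omega>) \<le> norm (u n \<omega>)" by simp
      qed
    qed
  next
    case True
    show ?thesis
    proof (rule bounded_integrable[OF fm])
      fix \<omega>
      have "\<bar>\<Sum>k<K. (t k)\<^sup>2 * emp_lim (D k) \<omega>\<bar> \<le> (\<Sum>k<K. \<bar>(t k)\<^sup>2\<bar>)"
        using emp_lim_bounds by (intro weighted_abs_le) auto
      moreover have "(\<tau> \<omega>)\<^sup>2 \<le> q\<^sup>2" using power_mono[OF \<tau>_le[of \<omega>], of 2] by simp
      moreover have "0 \<le> (\<tau> \<omega>)\<^sup>2" by simp
      moreover have "f n \<omega> = - ((\<Sum>k<K. (t k)\<^sup>2 * emp_lim (D k) \<omega>) - (\<tau> \<omega>)\<^sup>2)"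
        using True by (simp add: f_def spread_def \<tau>_def)
      ultimately show "\<bar>f n \<omega>\<bar> \<le> (\<Sum>k<K. \<bar>(t k)\<^sup>2\<bar>) + q\<^sup>2" by linarith
    qed
  qed
  then show "integrable P (\<lambda>\<omega>. \<bar>(\<Sum>l<n. (g (Suc l) \<omega> - abar l \<omega>)\<^sup>2) / real n - spread D t K \<omega>\<bar>)"
    unfolding f_def by (rule integrable_abs)
  define w where "w n = (\<Sum>k<K. ((t k)\<^sup>2 + 2 * q * \<bar>t k\<bar>) * sqrt (rate / real n))
      + (\<Sum>k<K. 4 * q * \<bar>t k\<bar> * (4 * sqrt rate * (2 / sqrt (real n))))" for n
  have Eu: "(\<integral>\<omega>. u n \<omega> \<partial>P) \<le> w n" if n: "n \<ge> 1" for n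
  proof -
    have "(\<integral>\<omega>. u n \<omega> \<partial>P) = (\<Sum>k<K. ((t k)\<^sup>2 + 2 * q * \<bar>t k\<bar>) * (\<integral>\<omega>. e n k \<omega> \<partial>P))
      + (\<Sum>l<n. \<Sum>k<K. 4 * q * \<bar>t k\<bar> * (\<integral>\<omega>. p l k \<omega> \<partial>P)) / real n"
      unfolding u_def using ei pi by simp
    also have "\<dots> \<le> (\<Sum>k<K. ((t k)\<^sup>2 + 2 * q * \<bar>t k\<bar>) * sqrt (rate / real n))
      + (\<Sum>l<n. \<Sum>k<K. 4 * q * \<bar>t k\<bar> * (4 * sqrt rate * (1 / sqrt (real (Suc l))))) / real n"
      unfolding e_def p_def using q0
      by (intro add_mono sum_mono mult_left_mono divide_right_mono expectation_emp_lim_distance(2)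
          expectation_pred_lim_distance(2) D n) (auto intro!: add_nonneg_nonneg mult_nonneg_nonneg)
    also have "(\<Sum>l<n. \<Sum>k<K. 4 * q * \<bar>t k\<bar> * (4 * sqrt rate * (1 / sqrt (real (Suc l)))))
       = (\<Sum>k<K. 4 * q * \<bar>t k\<bar> * (4 * sqrt rate * (\<Sum>l<n. 1 / sqrt (real (Suc l)))))"
      by (subst sum.swap) (simp only: sum_distrib_left)
    also have "\<dots> / real n = (\<Sum>k<K. 4 * q * \<bar>t k\<bar> * (4 * sqrt rate * ((\<Sum>l<n. 1 / sqrt (real (Suc l))) / real n)))"
      unfolding sum_divide_distrib[of _ "{..<K}"] by (simp only: times_divide_eq_right)
    also have "\<dots> \<le> (\<Sum>k<K. 4 * q * \<bar>t k\<bar> * (4 * sqrt rate * (2 / sqrt (real n))))"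
    proof (intro sum_mono mult_left_mono)
      have "(\<Sum>l<n. 1 / sqrt (real (Suc l))) / real n \<le> 2 * sqrt (real n) / real n"
        by (intro divide_right_mono sum_inverse_le_sqrt) simp
      also have "\<dots> = 2 / sqrt (real n)"
      proof -
        have "real n = sqrt (real n) * sqrt (real n)" by simp
        then show ?thesis using n by (simp add: field_simps)
      qed
      finally show "(\<Sum>l<n. 1 / sqrt (real (Suc l))) / real n \<le> 2 / sqrt (real n)" .
    qed (use q0 rate_pos in auto)
    finally show ?thesis unfolding w_def by simp
  qed
  have "w \<longlonglongrightarrow> (\<Sum>k<K. ((t k)\<^sup>2 + 2 * q * \<bar>t k\<bar>) * sqrt 0) + (\<Sum>k<K. 4 * q * \<bar>t k\<bar> * (4 * sqrt rate * 0))"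
    unfolding w_def
    by (intro tendsto_add tendsto_sum tendsto_mult tendsto_const tendsto_real_sqrt
        tendsto_divide_0[OF tendsto_const] filterlim_at_top_imp_at_infinity filterlim_real_sequentially
        filterlim_compose[OF sqrt_at_top filterlim_real_sequentially])
  then have w0: "w \<longlonglongrightarrow> 0" by simp
  have "(\<lambda>n. \<integral>\<omega>. \<bar>f n \<omega>\<bar> \<partial>P) \<longlonglongrightarrow> 0"
  proof (rule Lim_null_comparison[OF eventually_sequentiallyI[of 1] w0])
    fix n :: nat assume n: "n \<ge> 1"
    have "(\<integral>\<omega>. \<bar>f n \<omega>\<bar> \<partial>P) \<le> (\<integral>\<omega>. u n \<omega> \<partial>P)"
      using f_le[OF n] by (intro integral_mono integrable_abs spread_int ui)
    then show "norm (\<integral>\<omega>. \<bar>f n \<omega>\<bar> \<partial>P) \<le> w n" using Eu[OF n] by simp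
  qed
  then show "(\<lambda>n. \<integral>\<omega>. \<bar>(\<Sum>l<n. (g (Suc l) \<omega> - abar l \<omega>)\<^sup>2) / real n - spread D t K \<omega>\<bar> \<partial>P) \<longlonglongrightarrow> 0"
    unfolding f_def .
qed

lemma measurable_spread: "(\<And>k. D k \<in> sets MY) \<Longrightarrow> spread D t K \<in> borel_measurable P"
  unfolding spread_def
  by (intro borel_measurable_diff borel_measurable_sum borel_measurable_power
      borel_measurable_times borel_measurable_const measurable_emp_lim)

text \<open>The linear combinations of the \<open>C\<close> are close in mean to sums of centred weights whose coefficients
  are known before the weights are drawn. The maximum with 0 makes the limiting variance nonnegative at
  every point; almost surely it changes nothing.\<close>

lemma C_waves:
  assumes D: "\<And>k. D k \<in> sets MY" and disj: "disjoint_family D" and H: "H \<in> sets P"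
  shows "(\<lambda>n. \<integral>\<omega>. indicator H \<omega> * cos ((\<Sum>k<K. t k * C \<alpha> P n (D k) \<omega>) + \<theta>) \<partial>P)
    \<longlonglongrightarrow> (\<integral>\<omega>. indicator H \<omega> *
          (cos \<theta> * exp (- (var_weight * (max 0 (spread D t K \<omega>) / mean_weight\<^sup>2) / 2))) \<partial>P)"
proof -
  define m where "m = mean_weight"
  have m: "m > 0" unfolding m_def by (rule mean_weight_pos)
  define g where "g i \<omega> = (\<Sum>k<K. t k * hit (D k) i \<omega>)" for i \<omega>
  define abar where "abar l \<omega> = (\<Sum>k<K. t k * pred \<alpha> P l (D k) \<omega>)" for l \<omega>
  define h where "h l \<omega> = - (g (Suc l) \<omega> - abar l \<omega>) / m" for l \<omega>
  define \<eta> where "\<eta> \<omega> = max 0 (spread D t K \<omega>) / m\<^sup>2" for \<omega>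
  define q where "q = (\<Sum>k<K. \<bar>t k\<bar>)"
  have g_le: "\<bar>g i \<omega>\<bar> \<le> q" for i \<omega>
    unfolding g_def q_def using hit_bounds by (intro weighted_abs_le) auto
  have abar_le: "\<bar>abar l \<omega>\<bar> \<le> q" if "\<omega> \<in> space P" for l \<omega>
    unfolding abar_def q_def using pred_bounds[OF that] by (intro weighted_abs_le) auto
  note qv = quadratic_variation[OF D disj, where t=t and K=K, folded g_def abar_def]
  have h_meas: "h l \<in> borel_measurable (past_Y MY l)" for l
    unfolding h_def g_def abar_def
    by (intro borel_measurable_divide borel_measurable_uminus borel_measurable_diff borel_measurable_sum
        borel_measurable_times borel_measurable_const measurable_hit[OF measurable_Y_past_Y D]
        measurable_from_subalg[OF subalgebra_past_mono(2) measurable_pred[OF D]])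
  have h_bd: "\<bar>h l \<omega>\<bar> \<le> 2 * q / m" if "\<omega> \<in> space P" for l \<omega>
  proof -
    have "\<bar>g (Suc l) \<omega> - abar l \<omega>\<bar> \<le> 2 * q"
      using g_le[of "Suc l" \<omega>] abar_le[OF that, of l] by linarith
    then show ?thesis unfolding h_def using m by (simp add: divide_right_mono)
  qed
  have \<eta>_meas: "\<eta> \<in> borel_measurable P" unfolding \<eta>_def using measurable_spread[OF D] by simp
  have \<eta>_bd: "\<eta> \<omega> \<le> (\<Sum>k<K. \<bar>(t k)\<^sup>2\<bar>) / m\<^sup>2" for \<omega>
  proof -
    have "\<bar>\<Sum>k<K. (t k)\<^sup>2 * emp_lim (D k) \<omega>\<bar> \<le> (\<Sum>k<K. \<bar>(t k)\<^sup>2\<bar>)"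
      using emp_lim_bounds by (intro weighted_abs_le) auto
    moreover have "0 \<le> (\<Sum>k<K. t k * emp_lim (D k) \<omega>)\<^sup>2" by simp
    ultimately have "max 0 (spread D t K \<omega>) \<le> (\<Sum>k<K. \<bar>(t k)\<^sup>2\<bar>)"
      unfolding spread_def by linarith
    then show ?thesis unfolding \<eta>_def by (rule divide_right_mono) simp
  qed
  have conv: "(\<lambda>n. \<integral>\<omega>. \<bar>(\<Sum>l<n. (h l \<omega>)\<^sup>2) / real n - \<eta> \<omega>\<bar> \<partial>P) \<longlonglongrightarrow> 0"
  proof (rule Lim_null_comparison[OF always_eventually])
    show "(\<lambda>n. (\<integral>\<omega>. \<bar>(\<Sum>l<n. (g (Suc l) \<omega> - abar l \<omega>)\<^sup>2) / real n - spread D t K \<omega>\<bar> \<partial>P) / m\<^sup>2) \<longlonglongrightarrow> 0"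
      using tendsto_divide[OF qv(2) tendsto_const, of "m\<^sup>2"] m by simp
    show "\<forall>n. norm (\<integral>\<omega>. \<bar>(\<Sum>l<n. (h l \<omega>)\<^sup>2) / real n - \<eta> \<omega>\<bar> \<partial>P)
        \<le> (\<integral>\<omega>. \<bar>(\<Sum>l<n. (g (Suc l) \<omega> - abar l \<omega>)\<^sup>2) / real n - spread D t K \<omega>\<bar> \<partial>P) / m\<^sup>2"
    proof
      fix n
      define s where "s \<omega> = (\<Sum>l<n. (g (Suc l) \<omega> - abar l \<omega>)\<^sup>2) / real n" for \<omega>
      have hs: "(\<Sum>l<n. (h l \<omega>)\<^sup>2) / real n = s \<omega> / m\<^sup>2" for \<omega>
        by (simp add: h_def s_def power_divide sum_divide_distrib power2_commute[of "abar _ _"] mult.commute)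
      have s0: "0 \<le> s \<omega>" for \<omega> unfolding s_def by (intro divide_nonneg_nonneg sum_nonneg) auto
      have "(\<integral>\<omega>. \<bar>(\<Sum>l<n. (h l \<omega>)\<^sup>2) / real n - \<eta> \<omega>\<bar> \<partial>P) \<le> (\<integral>\<omega>. \<bar>s \<omega> - spread D t K \<omega>\<bar> / m\<^sup>2 \<partial>P)"
      proof (rule integral_mono')
        show "integrable P (\<lambda>\<omega>. \<bar>s \<omega> - spread D t K \<omega>\<bar> / m\<^sup>2)"
          unfolding s_def by (intro integrable_divide qv(1))
        show "\<bar>(\<Sum>l<n. (h l \<omega>)\<^sup>2) / real n - \<eta> \<omega>\<bar> \<le> \<bar>s \<omega> - spread D t K \<omega>\<bar> / m\<^sup>2" for \<omega>
          unfolding hs \<eta>_def diff_divide_distrib[symmetric] abs_divide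
          using abs_diff_max_0_le[OF s0, of \<omega> "spread D t K \<omega>"] by (simp add: divide_right_mono)
      qed simp
      then show "norm (\<integral>\<omega>. \<bar>(\<Sum>l<n. (h l \<omega>)\<^sup>2) / real n - \<eta> \<omega>\<bar> \<partial>P)
        \<le> (\<integral>\<omega>. \<bar>(\<Sum>l<n. (g (Suc l) \<omega> - abar l \<omega>)\<^sup>2) / real n - spread D t K \<omega>\<bar> \<partial>P) / m\<^sup>2"
        by (simp add: s_def)
    qed
  qed
  define x where "x n \<omega> = (\<Sum>k<K. t k * C \<alpha> P n (D k) \<omega>)" for n \<omega>
  define y where "y n \<omega> = (\<Sum>l<n. h l \<omega> * centred_weight (Suc l) \<omega>) / sqrt (real n)" for n \<omega>
  have y_eq: "y n \<omega> = - (\<Sum>k<K. t k * (noise (D k) n \<omega> / m))" for n \<omega>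
  proof -
    have "(\<Sum>k<K. t k * (noise (D k) n \<omega> / m))
        = (\<Sum>k<K. \<Sum>l<n. t k * (centred_weight (Suc l) \<omega> * (hit (D k) (Suc l) \<omega> - pred \<alpha> P l (D k) \<omega>) / sqrt (real n) / m))"
      unfolding noise_def sum_divide_distrib sum_distrib_left ..
    also have "\<dots> = (\<Sum>l<n. \<Sum>k<K. t k * (centred_weight (Suc l) \<omega> * (hit (D k) (Suc l) \<omega> - pred \<alpha> P l (D k) \<omega>) / sqrt (real n) / m))"
      by (rule sum.swap)
    also have "\<dots> = (\<Sum>l<n. - (h l \<omega> * centred_weight (Suc l) \<omega> / sqrt (real n)))"
    proof (rule sum.cong[OF refl])
      fix l
      have "g (Suc l) \<omega> - abar l \<omega> = (\<Sum>k<K. t k * (hit (D k) (Suc l) \<omega> - pred \<alpha> P l (D k) \<omega>))"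
        by (simp add: g_def abar_def sum_subtractf right_diff_distrib)
      then have "- (h l \<omega> * centred_weight (Suc l) \<omega> / sqrt (real n))
          = (\<Sum>k<K. t k * (hit (D k) (Suc l) \<omega> - pred \<alpha> P l (D k) \<omega>)) * (centred_weight (Suc l) \<omega> / sqrt (real n) / m)"
        by (simp add: h_def)
      also have "\<dots> = (\<Sum>k<K. t k * (centred_weight (Suc l) \<omega> * (hit (D k) (Suc l) \<omega> - pred \<alpha> P l (D k) \<omega>) / sqrt (real n) / m))"
        unfolding sum_distrib_right by (intro sum.cong refl) simp
      finally show "(\<Sum>k<K. t k * (centred_weight (Suc l) \<omega> * (hit (D k) (Suc l) \<omega> - pred \<alpha> P l (D k) \<omega>) / sqrt (real n) / m))
          = - (h l \<omega> * centred_weight (Suc l) \<omega> / sqrt (real n))" by simp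
    qed
    finally show ?thesis by (simp add: y_def sum_negf sum_divide_distrib)
  qed
  have xm: "x n \<in> borel_measurable P" for n
    unfolding x_def by (intro borel_measurable_sum borel_measurable_times borel_measurable_const measurable_C D)
  have ym: "y n \<in> borel_measurable P" for n
    unfolding y_eq using measurable_noise[OF D] by measurable
  have limit_y: "(\<lambda>n. \<integral>\<omega>. indicator H \<omega> *\<^sub>R iexp (y n \<omega>) \<partial>P)
     \<longlonglongrightarrow> of_real (\<integral>\<omega>. indicator H \<omega> * exp (- (var_weight * \<eta> \<omega> / 2)) \<partial>P)"
    unfolding y_def
  proof (rule stable_clt[OF h_meas h_bd \<eta>_meas _ \<eta>_bd conv H])
    show "0 \<le> \<eta> \<omega>" for \<omega> unfolding \<eta>_def by simp
  qed
  have ie: "integrable P (\<lambda>\<omega>. indicator H \<omega> *\<^sub>R iexp (y n \<omega>))" for n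
  proof (rule integrable_scaleR_bounded[where c=1 and d=1])
    have "iexp \<in> borel_measurable borel"
      by (intro borel_measurable_continuous_onI continuous_at_imp_continuous_on ballI isCont_iexp)
    from measurable_compose[OF ym this] show "(\<lambda>\<omega>. iexp (y n \<omega>)) \<in> borel_measurable P" .
    show "indicator H \<in> borel_measurable P" using H by simp
    show "\<bar>indicator H \<omega> :: real\<bar> \<le> 1" for \<omega> by (auto simp: indicator_def)
  qed simp
  have cos_y: "(\<integral>\<omega>. indicator H \<omega> * cos (y n \<omega> + \<theta>) \<partial>P)
      = Re (iexp \<theta> * (\<integral>\<omega>. indicator H \<omega> *\<^sub>R iexp (y n \<omega>) \<partial>P))" for n
  proof -
    have "Re (iexp \<theta> * (\<integral>\<omega>. indicator H \<omega> *\<^sub>R iexp (y n \<omega>) \<partial>P))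
       = (\<integral>\<omega>. Re (iexp \<theta> * (indicator H \<omega> *\<^sub>R iexp (y n \<omega>))) \<partial>P)"
      unfolding integral_mult_right_zero[symmetric] by (rule integral_Re[OF integrable_mult_right[OF ie], symmetric])
    also have "\<dots> = (\<integral>\<omega>. indicator H \<omega> * cos (y n \<omega> + \<theta>) \<partial>P)"
      by (intro Bochner_Integration.integral_cong refl)
         (simp add: cos_add Re_exp Im_exp algebra_simps)
    finally show ?thesis ..
  qed
  have lim2: "(\<lambda>n. \<integral>\<omega>. indicator H \<omega> * cos (y n \<omega> + \<theta>) \<partial>P)
      \<longlonglongrightarrow> Re (iexp \<theta> * of_real (\<integral>\<omega>. indicator H \<omega> * exp (- (var_weight * \<eta> \<omega> / 2)) \<partial>P))"
    unfolding cos_y by (intro tendsto_Re tendsto_mult tendsto_const limit_y)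
  have "Re (iexp \<theta> * of_real (\<integral>\<omega>. indicator H \<omega> * exp (- (var_weight * \<eta> \<omega> / 2)) \<partial>P))
     = cos \<theta> * (\<integral>\<omega>. indicator H \<omega> * exp (- (var_weight * \<eta> \<omega> / 2)) \<partial>P)"
    by (simp add: Re_exp)
  also have "\<dots> = (\<integral>\<omega>. indicator H \<omega> * (cos \<theta> * exp (- (var_weight * \<eta> \<omega> / 2))) \<partial>P)"
    by (subst integral_mult_right_zero[symmetric]) (intro Bochner_Integration.integral_cong refl, simp)
  finally have lim3: "(\<lambda>n. \<integral>\<omega>. indicator H \<omega> * cos (y n \<omega> + \<theta>) \<partial>P)
      \<longlonglongrightarrow> (\<integral>\<omega>. indicator H \<omega> * (cos \<theta> * exp (- (var_weight * \<eta> \<omega> / 2))) \<partial>P)"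
    using lim2 by simp
  define z where "z n \<omega> = (\<Sum>k<K. \<bar>t k\<bar> * \<bar>C \<alpha> P n (D k) \<omega> + noise (D k) n \<omega> / m\<bar>)" for n \<omega>
  have zi: "integrable P (z n)" for n
    unfolding z_def m_def by (intro Bochner_Integration.integrable_sum integrable_mult_right C_noise_distance(1) D)
  have z0: "(\<lambda>n. \<integral>\<omega>. z n \<omega> \<partial>P) \<longlonglongrightarrow> 0"
  proof -
    have "(\<lambda>n. \<Sum>k<K. \<bar>t k\<bar> * (\<integral>\<omega>. \<bar>C \<alpha> P n (D k) \<omega> + noise (D k) n \<omega> / mean_weight\<bar> \<partial>P)) \<longlonglongrightarrow> (\<Sum>k<K. \<bar>t k\<bar> * 0)"
      by (intro tendsto_sum tendsto_mult tendsto_const C_noise_distance(2) D)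
    moreover have "(\<integral>\<omega>. z n \<omega> \<partial>P) = (\<Sum>k<K. \<bar>t k\<bar> * (\<integral>\<omega>. \<bar>C \<alpha> P n (D k) \<omega> + noise (D k) n \<omega> / mean_weight\<bar> \<partial>P))" for n
      unfolding z_def m_def using C_noise_distance(1)[OF D] by simp
    ultimately show ?thesis by simp
  qed
  have xy: "\<bar>x n \<omega> - y n \<omega>\<bar> \<le> z n \<omega>" for n \<omega>
  proof -
    have "x n \<omega> - y n \<omega> = (\<Sum>k<K. t k * (C \<alpha> P n (D k) \<omega> + noise (D k) n \<omega> / m))"
      unfolding x_def y_eq by (simp add: sum.distrib distrib_left)
    also have "\<bar>\<dots>\<bar> \<le> (\<Sum>k<K. \<bar>t k * (C \<alpha> P n (D k) \<omega> + noise (D k) n \<omega> / m)\<bar>)" by (rule sum_abs)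
    finally show ?thesis by (simp add: z_def abs_mult)
  qed
  have ic: "integrable P (\<lambda>\<omega>. indicator H \<omega> * cos (u \<omega> + \<theta>))" if "u \<in> borel_measurable P" for u :: "'y traj \<Rightarrow> real"
  proof (rule bounded_integrable[of _ 1])
    show "(\<lambda>\<omega>. indicator H \<omega> * cos (u \<omega> + \<theta>)) \<in> borel_measurable P" using that H by measurable
    show "\<bar>indicator H \<omega> * cos (u \<omega> + \<theta>)\<bar> \<le> 1" for \<omega> by (auto simp: indicator_def)
  qed
  have "(\<lambda>n. (\<integral>\<omega>. indicator H \<omega> * cos (x n \<omega> + \<theta>) \<partial>P) - (\<integral>\<omega>. indicator H \<omega> * cos (y n \<omega> + \<theta>) \<partial>P)) \<longlonglongrightarrow> 0"
  proof (rule Lim_null_comparison[OF always_eventually z0], rule allI)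
    fix n
    have "norm ((\<integral>\<omega>. indicator H \<omega> * cos (x n \<omega> + \<theta>) \<partial>P) - (\<integral>\<omega>. indicator H \<omega> * cos (y n \<omega> + \<theta>) \<partial>P))
        = \<bar>\<integral>\<omega>. indicator H \<omega> * cos (x n \<omega> + \<theta>) - indicator H \<omega> * cos (y n \<omega> + \<theta>) \<partial>P\<bar>"
      using ic[OF xm] ic[OF ym] by simp
    also have "\<dots> \<le> (\<integral>\<omega>. \<bar>indicator H \<omega> * cos (x n \<omega> + \<theta>) - indicator H \<omega> * cos (y n \<omega> + \<theta>)\<bar> \<partial>P)"
      by (rule integral_abs_bound)
    also have "\<dots> \<le> (\<integral>\<omega>. z n \<omega> \<partial>P)"
    proof (rule integral_mono)
      show "integrable P (\<lambda>\<omega>. \<bar>indicator H \<omega> * cos (x n \<omega> + \<theta>) - indicator H \<omega> * cos (y n \<omega> + \<theta>)\<bar>)"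
        by (intro integrable_abs Bochner_Integration.integrable_diff ic xm ym)
      show "\<bar>indicator H \<omega> * cos (x n \<omega> + \<theta>) - indicator H \<omega> * cos (y n \<omega> + \<theta>)\<bar> \<le> z n \<omega>" for \<omega>
      proof -
        have "\<bar>cos (x n \<omega> + \<theta>) - cos (y n \<omega> + \<theta>)\<bar> \<le> z n \<omega>"
          using cos_lipschitz[of "x n \<omega> + \<theta>" "y n \<omega> + \<theta>"] xy[of n \<omega>] by simp
        then show ?thesis by (auto simp: indicator_def)
      qed
    qed (rule zi)
    finally show "norm ((\<integral>\<omega>. indicator H \<omega> * cos (x n \<omega> + \<theta>) \<partial>P) - (\<integral>\<omega>. indicator H \<omega> * cos (y n \<omega> + \<theta>) \<partial>P))
        \<le> (\<integral>\<omega>. z n \<omega> \<partial>P)" .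
  qed
  from tendsto_add[OF this lim3]
  show ?thesis unfolding x_def \<eta>_def m_def by simp
qed

end

section \<open>The Brownian bridge\<close>

context prob_space
begin

lemma gaussian_square_integrable:
  assumes "gaussian_var M V"
  shows "integrable M (\<lambda>w. (V w)\<^sup>2)" and "integrable M V"
proof -
  have Vm: "V \<in> borel_measurable M" using assms by (simp add: gaussian_var_def)
  from assms consider (const) m where "AE w in M. V w = m"
    | (normal) m s where "s > 0" "distributed M lborel V (\<lambda>x. ennreal (normal_density m s x))"
    unfolding gaussian_var_def by blast
  then show sq: "integrable M (\<lambda>w. (V w)\<^sup>2)"
  proof cases
    case const
    show ?thesis
    proof (rule integrable_const_bound[of _ "m\<^sup>2"])
      show "AE w in M. norm ((V w)\<^sup>2) \<le> m\<^sup>2" using const by eventually_elim simp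
    qed (use Vm in auto)
  next
    case normal
    have "integrable lborel (\<lambda>x. normal_density m s x * (x - m)\<^sup>2)" by (rule integrable_normal_moment[OF normal(1)])
    then have "integrable M (\<lambda>w. (V w - m)\<^sup>2)"
      using distributed_integrable[OF normal(2), of "\<lambda>x. (x - m)\<^sup>2"] by simp
    then have i: "integrable M (\<lambda>w. 2 * (V w - m)\<^sup>2 + 2 * m\<^sup>2)" by simp
    show ?thesis
    proof (rule Bochner_Integration.integrable_bound[OF i])
      have "(V w)\<^sup>2 \<le> 2 * (V w - m)\<^sup>2 + 2 * m\<^sup>2" for w
        using zero_le_power2[of "V w - 2 * m"] by (simp add: power2_eq_square algebra_simps)
      then show "AE w in M. norm ((V w)\<^sup>2) \<le> norm (2 * (V w - m)\<^sup>2 + 2 * m\<^sup>2)" by simp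
    qed (use Vm in measurable)
  qed
  show "integrable M V"
  proof (rule Bochner_Integration.integrable_bound[of M "\<lambda>w. (V w)\<^sup>2 + 1"])
    show "integrable M (\<lambda>w. (V w)\<^sup>2 + 1)" using sq by simp
    have "\<bar>V w\<bar> \<le> (V w)\<^sup>2 + 1" for w
    proof -
      have "0 \<le> (\<bar>V w\<bar> - 1)\<^sup>2" by simp
      then have "2 * \<bar>V w\<bar> \<le> (V w)\<^sup>2 + 1" by (simp add: power2_diff)
      then show ?thesis by linarith
    qed
    then show "AE w in M. norm (V w) \<le> norm ((V w)\<^sup>2 + 1)" by simp
  qed (rule Vm)
qed

lemma centred_gaussian_cosine:
  assumes g: "gaussian_var M V" and mean: "expectation V = 0"
  shows "expectation (\<lambda>w. cos (V w + \<theta>)) = cos \<theta> * exp (- (expectation (\<lambda>w. (V w)\<^sup>2) / 2))"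
proof -
  have Vm: "V \<in> borel_measurable M" using g by (simp add: gaussian_var_def)
  from g consider (const) m where "AE w in M. V w = m"
    | (normal) m s where "s > 0" "distributed M lborel V (\<lambda>x. ennreal (normal_density m s x))"
    unfolding gaussian_var_def by blast
  then show ?thesis
  proof cases
    case const
    have "expectation V = expectation (\<lambda>w. m)"
      using const Vm by (intro integral_cong_AE) auto
    then have m: "m = 0" using mean by (simp add: prob_space)
    have "expectation (\<lambda>w. cos (V w + \<theta>)) = expectation (\<lambda>w. cos \<theta>)"
    proof (rule integral_cong_AE)
      show "AE w in M. cos (V w + \<theta>) = cos \<theta>" using const by eventually_elim (simp add: m)
    qed (use Vm in measurable)
    moreover have "expectation (\<lambda>w. (V w)\<^sup>2) = expectation (\<lambda>w. 0)"
    proof (rule integral_cong_AE)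
      show "AE w in M. (V w)\<^sup>2 = 0" using const by eventually_elim (simp add: m)
    qed (use Vm in measurable)
    ultimately show ?thesis by (simp add: prob_space)
  next
    case normal
    have m: "m = 0" using normal_distributed_expectation[OF normal] mean by simp
    have v: "expectation (\<lambda>w. (V w)\<^sup>2) = s\<^sup>2"
      using normal_distributed_variance[OF normal] by (simp add: mean)
    have "distributed M lborel (\<lambda>w. (V w - m) / s) std_normal_density"
      using normal(2) by (rule iffD1[OF normal_standard_normal_convert[OF normal(1)]])
    then have d: "distr M lborel (\<lambda>w. V w / s) = std_normal_distribution"
      by (simp add: m distributed_distr_eq_density)
    have iexp_meas: "iexp \<in> borel_measurable borel"
      by (intro borel_measurable_continuous_onI continuous_at_imp_continuous_on ballI isCont_iexp)
    have Vs: "(\<lambda>w. V w / s) \<in> M \<rightarrow>\<^sub>M lborel" using Vm by simp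
    have "char (distr M lborel (\<lambda>w. V w / s)) s = expectation (\<lambda>w. iexp (s * (V w / s)))"
      unfolding char_def
      by (rule integral_distr[OF Vs]) (use measurable_compose[OF _ iexp_meas, of "\<lambda>x. s * x"] in simp)
    then have char: "expectation (\<lambda>w. iexp (V w)) = of_real (exp (- (s\<^sup>2 / 2)))"
      using normal(1) unfolding d char_std_normal_distribution by simp
    have int: "complex_integrable M (\<lambda>w. iexp (V w))"
      using measurable_compose[OF Vm iexp_meas] by (intro integrable_const_bound[of _ 1]) auto
    have "expectation (\<lambda>w. cos (V w + \<theta>)) = expectation (\<lambda>w. Re (iexp \<theta> * iexp (V w)))"
      by (intro Bochner_Integration.integral_cong refl) (simp add: cos_add Re_exp Im_exp algebra_simps)
    also have "\<dots> = Re (iexp \<theta> * expectation (\<lambda>w. iexp (V w)))"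
      unfolding integral_mult_right_zero[symmetric] by (rule integral_Re[OF integrable_mult_right[OF int]])
    also have "\<dots> = cos \<theta> * exp (- (s\<^sup>2 / 2))" unfolding char by (simp add: Re_exp)
    finally show ?thesis by (simp add: v)
  qed
qed

end

locale bridge = prob_space Q for Q :: "'w measure" +
  fixes G :: "real \<Rightarrow> 'w \<Rightarrow> real"
  assumes bridge: "brownian_bridge Q G"
begin

lemma measurable_bridge: "s \<in> {0..1} \<Longrightarrow> G s \<in> borel_measurable Q"
  using bridge by (simp add: brownian_bridge_def)

text \<open>A Brownian bridge is defined by combinations over sets of times; equal times have to be collected
  first.\<close>

lemma gaussian_combination:
  assumes I: "finite I" and u: "\<And>p. p \<in> I \<Longrightarrow> u p \<in> {0..1}"
  shows "gaussian_var Q (\<lambda>w. \<Sum>p\<in>I. c p * G (u p) w)"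
proof -
  define d where "d s = (\<Sum>p\<in>{p\<in>I. u p = s}. c p)" for s
  have "(\<Sum>p\<in>I. c p * G (u p) w) = (\<Sum>s\<in>u ` I. d s * G s w)" for w
    unfolding sum.image_gen[OF I, of _ u] d_def sum_distrib_right by (intro sum.cong refl) auto
  moreover have "gaussian_var Q (\<lambda>w. \<Sum>s\<in>u ` I. d s * G s w)"
  proof -
    have "finite (u ` I)" "u ` I \<subseteq> {0..1}" using I u by (blast, blast)
    with bridge show ?thesis unfolding brownian_bridge_def by blast
  qed
  ultimately show ?thesis by simp
qed

lemma bridge_square_integrable: "s \<in> {0..1} \<Longrightarrow> integrable Q (\<lambda>w. (G s w)\<^sup>2)" "s \<in> {0..1} \<Longrightarrow> integrable Q (G s)"
  using gaussian_square_integrable[OF gaussian_combination[of "{s}" "\<lambda>p. p" "\<lambda>_. 1"]] by simp_all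

lemma bridge_product:
  assumes "s \<in> {0..1}" "r \<in> {0..1}"
  shows "integrable Q (\<lambda>w. G s w * G r w)" and "expectation (\<lambda>w. G s w * G r w) = min s r - s * r"
proof -
  show "integrable Q (\<lambda>w. G s w * G r w)"
  proof (rule Bochner_Integration.integrable_bound[of Q "\<lambda>w. (G s w)\<^sup>2 + (G r w)\<^sup>2"])
    show "integrable Q (\<lambda>w. (G s w)\<^sup>2 + (G r w)\<^sup>2)"
      using assms bridge_square_integrable by simp
    have "\<bar>x * y\<bar> \<le> x\<^sup>2 + y\<^sup>2" for x y :: real
    proof -
      have "0 \<le> (\<bar>x\<bar> - \<bar>y\<bar>)\<^sup>2" by simp
      then have "2 * (\<bar>x\<bar> * \<bar>y\<bar>) \<le> x\<^sup>2 + y\<^sup>2" by (simp add: power2_diff)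
      then show ?thesis unfolding abs_mult using mult_nonneg_nonneg[of "\<bar>x\<bar>" "\<bar>y\<bar>"] by linarith
    qed
    then show "AE w in Q. norm (G s w * G r w) \<le> norm ((G s w)\<^sup>2 + (G r w)\<^sup>2)" by simp
  qed (use assms measurable_bridge in simp)
  show "expectation (\<lambda>w. G s w * G r w) = min s r - s * r"
    using bridge assms by (simp add: brownian_bridge_def)
qed

lemma expectation_bridge: "s \<in> {0..1} \<Longrightarrow> expectation (G s) = 0"
  using bridge by (simp add: brownian_bridge_def)

text \<open>The increments have covariances \<open>(if j = k then \<Delta> k else 0) - \<Delta> j * \<Delta> k\<close>, where \<open>\<Delta> k\<close> is the
  length of the time interval, and a combination of them is a centred Gaussian variable.\<close>

lemma increments_cosine:
  assumes s: "\<And>k. s k \<in> {0..1}" "incseq s"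
  shows "expectation (\<lambda>w. cos ((\<Sum>k<K. c k * (G (s (Suc k)) w - G (s k) w)) + \<theta>))
    = cos \<theta> * exp (- (((\<Sum>k<K. (c k)\<^sup>2 * (s (Suc k) - s k)) - (\<Sum>k<K. c k * (s (Suc k) - s k))\<^sup>2) / 2))"
    and "0 \<le> (\<Sum>k<K. (c k)\<^sup>2 * (s (Suc k) - s k)) - (\<Sum>k<K. c k * (s (Suc k) - s k))\<^sup>2"
proof -
  define V where "V w = (\<Sum>k<K. c k * (G (s (Suc k)) w - G (s k) w))" for w
  define D where "D k w = G (s (Suc k)) w - G (s k) w" for k w
  have Di: "integrable Q (D k)" "expectation (D k) = 0" for k
    unfolding D_def using bridge_square_integrable(2)[OF s(1)] expectation_bridge[OF s(1)] by simp_all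
  have pi: "integrable Q (\<lambda>w. G (s i) w * G (s j) w)" for i j by (intro bridge_product s)
  have DD: "D j w * D k w = G (s (Suc j)) w * G (s (Suc k)) w - G (s (Suc j)) w * G (s k) w
      - (G (s j) w * G (s (Suc k)) w - G (s j) w * G (s k) w)" for j k w
    by (simp add: D_def algebra_simps)
  have DDi: "integrable Q (\<lambda>w. D j w * D k w)" for j k
    unfolding DD by (intro Bochner_Integration.integrable_diff pi)
  have mono: "s i \<le> s j" if "i \<le> j" for i j using incseqD[OF s(2) that] .
  have EDD: "expectation (\<lambda>w. D j w * D k w)
      = (if j = k then s (Suc k) - s k else 0) - (s (Suc j) - s j) * (s (Suc k) - s k)" for j k
  proof -
    have "expectation (\<lambda>w. D j w * D k w)
      = (min (s (Suc j)) (s (Suc k)) - s (Suc j) * s (Suc k)) - (min (s (Suc j)) (s k) - s (Suc j) * s k)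
       - ((min (s j) (s (Suc k)) - s j * s (Suc k)) - (min (s j) (s k) - s j * s k))"
      unfolding DD using pi by (simp add: bridge_product(2)[OF s(1) s(1)])
    moreover have "min (s (Suc j)) (s (Suc k)) - min (s (Suc j)) (s k) - (min (s j) (s (Suc k)) - min (s j) (s k))
       = (if j = k then s (Suc k) - s k else 0)"
    proof (cases j k rule: linorder_cases)
      case less
      then show ?thesis using mono[of "Suc j" k] mono[of j k] mono[of k "Suc k"] mono[of j "Suc j"] by auto
    next
      case equal
      then show ?thesis using mono[of k "Suc k"] by auto
    next
      case greater
      then show ?thesis using mono[of "Suc k" j] mono[of k j] mono[of j "Suc j"] mono[of k "Suc k"] by auto
    qed
    ultimately show ?thesis by (simp add: algebra_simps)
  qed
  have VD: "V w = (\<Sum>k<K. c k * D k w)" for w by (simp add: V_def D_def)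
  have EV: "expectation V = 0" unfolding VD[abs_def] using Di by simp
  have V2: "(V w)\<^sup>2 = (\<Sum>j<K. \<Sum>k<K. (c j * c k) * (D j w * D k w))" for w
    unfolding VD power2_eq_square sum_product by (intro sum.cong refl) simp
  have "expectation (\<lambda>w. (V w)\<^sup>2) = (\<Sum>j<K. \<Sum>k<K. (c j * c k) * expectation (\<lambda>w. D j w * D k w))"
    unfolding V2 using DDi by simp
  also have "\<dots> = (\<Sum>j<K. \<Sum>k<K. (if j = k then (c k)\<^sup>2 * (s (Suc k) - s k) else 0))
      - (\<Sum>j<K. \<Sum>k<K. (c j * (s (Suc j) - s j)) * (c k * (s (Suc k) - s k)))"
    unfolding sum_subtractf[symmetric] EDD by (intro sum.cong refl) (simp add: power2_eq_square algebra_simps)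
  also have "(\<Sum>j<K. \<Sum>k<K. (if j = k then (c k)\<^sup>2 * (s (Suc k) - s k) else 0)) = (\<Sum>k<K. (c k)\<^sup>2 * (s (Suc k) - s k))"
    by simp
  also have "(\<Sum>j<K. \<Sum>k<K. (c j * (s (Suc j) - s j)) * (c k * (s (Suc k) - s k))) = (\<Sum>k<K. c k * (s (Suc k) - s k))\<^sup>2"
    by (simp add: power2_eq_square sum_product)
  finally have var: "expectation (\<lambda>w. (V w)\<^sup>2)
      = (\<Sum>k<K. (c k)\<^sup>2 * (s (Suc k) - s k)) - (\<Sum>k<K. c k * (s (Suc k) - s k))\<^sup>2" .
  have "0 \<le> expectation (\<lambda>w. (V w)\<^sup>2)" by simp
  then show "0 \<le> (\<Sum>k<K. (c k)\<^sup>2 * (s (Suc k) - s k)) - (\<Sum>k<K. c k * (s (Suc k) - s k))\<^sup>2"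
    unfolding var .
  have "gaussian_var Q (\<lambda>w. \<Sum>p\<in>{..<K} \<times> {0, 1}. (if snd p = 1 then c (fst p) else - c (fst p)) * G (s (fst p + snd p)) w)"
    by (rule gaussian_combination) (use s in auto)
  also have "(\<lambda>w. \<Sum>p\<in>{..<K} \<times> {0, 1::nat}. (if snd p = 1 then c (fst p) else - c (fst p)) * G (s (fst p + snd p)) w) = V"
  proof
    fix w
    have "(\<Sum>p\<in>{..<K} \<times> {0, 1::nat}. (if snd p = 1 then c (fst p) else - c (fst p)) * G (s (fst p + snd p)) w)
        = (\<Sum>k<K. \<Sum>i\<in>{0, 1::nat}. (if i = 1 then c k else - c k) * G (s (k + i)) w)"
      unfolding sum.cartesian_product by (intro sum.cong refl) (simp add: case_prod_beta)
    also have "\<dots> = V w" unfolding V_def by (intro sum.cong refl) (simp add: algebra_simps)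
    finally show "(\<Sum>p\<in>{..<K} \<times> {0, 1::nat}. (if snd p = 1 then c (fst p) else - c (fst p)) * G (s (fst p + snd p)) w) = V w" .
  qed
  finally have "gaussian_var Q V" .
  from centred_gaussian_cosine[OF this EV, of \<theta>]
  show "expectation (\<lambda>w. cos ((\<Sum>k<K. c k * (G (s (Suc k)) w - G (s k) w)) + \<theta>))
    = cos \<theta> * exp (- (((\<Sum>k<K. (c k)\<^sup>2 * (s (Suc k) - s k)) - (\<Sum>k<K. c k * (s (Suc k) - s k))\<^sup>2) / 2))"
    unfolding var unfolding V_def .
qed

text \<open>Rounding the time down to a multiple of \<open>1 / (n + 1)\<close> leaves finitely many times, for which joint
  measurability is clear; the paths are continuous.\<close>

lemma jointly_measurable_bridge:
  assumes u: "u \<in> borel_measurable N" "\<And>x. x \<in> space N \<Longrightarrow> u x \<in> {0..1}"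
  shows "(\<lambda>x. G (u (fst x)) (snd x)) \<in> borel_measurable (N \<Otimes>\<^sub>M Q)"
proof (rule borel_measurable_LIMSEQ_real)
  define r where "r n x = real_of_int \<lfloor>real (Suc n) * u x\<rfloor> / real (Suc n)" for n x
  have fl: "0 \<le> \<lfloor>real (Suc n) * u x\<rfloor>" "\<lfloor>real (Suc n) * u x\<rfloor> \<le> int (Suc n)" if "x \<in> space N" for n x
  proof -
    have ux: "0 \<le> u x" "u x \<le> 1" using u(2)[OF that] by simp_all
    have "0 \<le> real (Suc n) * u x" using ux(1) by (intro mult_nonneg_nonneg of_nat_0_le_iff)
    then show "0 \<le> \<lfloor>real (Suc n) * u x\<rfloor>" by (simp only: zero_le_floor)
    have "real (Suc n) * u x \<le> real (Suc n) * 1" using ux(2) by (intro mult_left_mono of_nat_0_le_iff)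
    then have "\<lfloor>real (Suc n) * u x\<rfloor> \<le> \<lfloor>real (Suc n)\<rfloor>" unfolding mult_1_right by (rule floor_mono)
    then show "\<lfloor>real (Suc n) * u x\<rfloor> \<le> int (Suc n)" by (simp only: floor_of_nat)
  qed
  have frac01: "real_of_int j / real (Suc n) \<in> {0..1}" if "0 \<le> j" "j \<le> int (Suc n)" for j n
  proof -
    have "real_of_int j \<le> real_of_int (int (Suc n))" using that(2) by (simp only: of_int_le_iff)
    then show ?thesis using that(1) by (simp add: divide_le_eq_1 del: of_nat_Suc)
  qed
  have r01: "r n x \<in> {0..1}" if "x \<in> space N" for n x
    unfolding r_def by (intro frac01 fl that)
  show "(\<lambda>x. G (r n (fst x)) (snd x)) \<in> borel_measurable (N \<Otimes>\<^sub>M Q)" for n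
  proof -
    have "(\<lambda>x. \<Sum>j\<in>{0..int (Suc n)}. indicator {x. \<lfloor>real (Suc n) * x\<rfloor> = j} (u (fst x)) * G (real_of_int j / real (Suc n)) (snd x))
        \<in> borel_measurable (N \<Otimes>\<^sub>M Q)"
    proof (intro borel_measurable_sum borel_measurable_times)
      fix j assume j: "j \<in> {0..int (Suc n)}"
      show "(\<lambda>x. indicator {x. \<lfloor>real (Suc n) * x\<rfloor> = j} (u (fst x)) :: real) \<in> borel_measurable (N \<Otimes>\<^sub>M Q)"
        using u(1) by measurable
      have "real_of_int j / real (Suc n) \<in> {0..1}" using j by (intro frac01) auto
      then show "(\<lambda>x. G (real_of_int j / real (Suc n)) (snd x)) \<in> borel_measurable (N \<Otimes>\<^sub>M Q)"
        by (intro measurable_compose[OF measurable_snd] measurable_bridge)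
    qed
    moreover have "G (r n (fst x)) (snd x) = (\<Sum>j\<in>{0..int (Suc n)}.
        indicator {x. \<lfloor>real (Suc n) * x\<rfloor> = j} (u (fst x)) * G (real_of_int j / real (Suc n)) (snd x))"
      if "x \<in> space (N \<Otimes>\<^sub>M Q)" for x
    proof -
      let ?j = "\<lfloor>real (Suc n) * u (fst x)\<rfloor>"
      have x: "fst x \<in> space N" using that by (auto simp: space_pair_measure)
      have "(\<Sum>j\<in>{0..int (Suc n)}. indicator {x. \<lfloor>real (Suc n) * x\<rfloor> = j} (u (fst x)) * G (real_of_int j / real (Suc n)) (snd x))
         = (\<Sum>j\<in>{?j}. indicator {x. \<lfloor>real (Suc n) * x\<rfloor> = j} (u (fst x)) * G (real_of_int j / real (Suc n)) (snd x))"
        using fl[OF x, of n] by (intro sum.mono_neutral_right) auto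
      then show ?thesis by (simp add: r_def)
    qed
    ultimately show ?thesis by (subst measurable_cong) auto
  qed
  fix x assume x: "x \<in> space (N \<Otimes>\<^sub>M Q)"
  then have xN: "fst x \<in> space N" "snd x \<in> space Q" by (auto simp: space_pair_measure)
  have cont: "continuous_on {0..1} (\<lambda>t. G t (snd x))" using bridge xN by (simp add: brownian_bridge_def)
  have close: "norm (r n (fst x) - u (fst x)) \<le> inverse (real (Suc n))" for n
  proof -
    define y where "y = real (Suc n) * u (fst x)"
    have "r n (fst x) - u (fst x) = (real_of_int \<lfloor>y\<rfloor> - y) / real (Suc n)"
      by (simp add: r_def y_def diff_divide_distrib del: of_nat_Suc)
    moreover have "\<bar>real_of_int \<lfloor>y\<rfloor> - y\<bar> \<le> 1" by linarith
    ultimately show ?thesis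
      by (simp add: abs_divide divide_right_mono inverse_eq_divide del: of_nat_Suc)
  qed
  have "(\<lambda>n. r n (fst x) - u (fst x)) \<longlonglongrightarrow> 0"
    using Lim_null_comparison[OF _ LIMSEQ_inverse_real_of_nat, of "\<lambda>n. r n (fst x) - u (fst x)"] close by simp
  then have "(\<lambda>n. r n (fst x)) \<longlonglongrightarrow> u (fst x)" by (rule LIM_zero_cancel)
  then show "(\<lambda>n. G (r n (fst x)) (snd x)) \<longlonglongrightarrow> G (u (fst x)) (snd x)"
    by (intro continuous_on_tendsto_compose[OF cont]) (use u(2)[OF xN(1)] r01[OF xN(1)] in auto)
qed

end

section \<open>The limit theorem\<close>

lemma stable_conv_cong:
  assumes "stable_conv m P V K"
    and "\<And>n \<omega>. \<omega> \<in> space P \<Longrightarrow> V n \<omega> = V' n \<omega>" and "\<And>\<omega>. \<omega> \<in> space P \<Longrightarrow> K \<omega> = K' \<omega>"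
  shows "stable_conv m P V' K'"
proof -
  have eqs: "(\<lambda>n. distr (uniform_measure P H) (metric_borel m) (V n))
        = (\<lambda>n. distr (uniform_measure P H) (metric_borel m) (V' n))"
      "uniform_measure P H \<bind> K = uniform_measure P H \<bind> K'" for H
  proof -
    show "(\<lambda>n. distr (uniform_measure P H) (metric_borel m) (V n))
        = (\<lambda>n. distr (uniform_measure P H) (metric_borel m) (V' n))"
      by (intro ext distr_cong refl) (simp add: assms(2))
    show "uniform_measure P H \<bind> K = uniform_measure P H \<bind> K'"
      by (intro bind_cong refl) (simp add: assms(3))
  qed
  show ?thesis
    unfolding stable_conv_def
  proof (intro conjI allI ballI impI)
    fix n
    have "V n \<in> P \<rightarrow>\<^sub>M metric_borel m" using assms(1) by (simp add: stable_conv_def)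
    then show "V' n \<in> P \<rightarrow>\<^sub>M metric_borel m" using measurable_cong[of P "V n" "V' n", OF assms(2)] by blast
  next
    have "random_prob P m K" using assms(1) by (simp add: stable_conv_def)
    then show "random_prob P m K'" unfolding random_prob_def using measurable_cong[of P K K', OF assms(3)] by blast
  next
    fix H assume "H \<in> sets P" "0 < measure P H"
    then have "weak_conv_metric m (\<lambda>n. distr (uniform_measure P H) (metric_borel m) (V n)) (uniform_measure P H \<bind> K)"
      using assms(1) unfolding stable_conv_def by blast
    then show "weak_conv_metric m (\<lambda>n. distr (uniform_measure P H) (metric_borel m) (V' n)) (uniform_measure P H \<bind> K')"
      unfolding eqs .
  qed
qed

lemma continuous_map_sup_norm:
  assumes D: "D \<noteq> {}"
  shows "continuous_map (mtopology_of (linf D)) euclideanreal (\<lambda>x. SUP d\<in>D. \<bar>x d\<bar>)"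
proof (rule continuous_map_of_Lipschitz)
  have half: "(SUP d\<in>D. \<bar>x d\<bar>) \<le> (SUP d\<in>D. \<bar>y d\<bar>) + mdist (linf D) x y"
    if x: "x \<in> mspace (linf D)" and y: "y \<in> mspace (linf D)" for x y
  proof (rule cSUP_least[OF D])
    fix d assume d: "d \<in> D"
    obtain p q where p: "\<And>d. d \<in> D \<Longrightarrow> \<bar>x d\<bar> \<le> p" and q: "\<And>d. d \<in> D \<Longrightarrow> \<bar>y d\<bar> \<le> q"
      using x y unfolding mspace_linf bounded_iff by auto
    have "\<bar>x d - y d\<bar> \<le> p + q" if "d \<in> D" for d using p[OF that] q[OF that] by linarith
    then have "\<bar>x d - y d\<bar> \<le> mdist (linf D) x y"
      unfolding mdist_linf[OF x y D] by (intro cSUP_upper d bdd_aboveI2)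
    moreover have "\<bar>y d\<bar> \<le> (SUP d\<in>D. \<bar>y d\<bar>)" using q by (intro cSUP_upper d bdd_aboveI2)
    ultimately show "\<bar>x d\<bar> \<le> (SUP d\<in>D. \<bar>y d\<bar>) + mdist (linf D) x y" by linarith
  qed
  show "\<bar>(SUP d\<in>D. \<bar>x d\<bar>) - (SUP d\<in>D. \<bar>y d\<bar>)\<bar> \<le> 1 * mdist (linf D) x y"
    if "x \<in> mspace (linf D)" "y \<in> mspace (linf D)" for x y
    using half[OF that] half[OF that(2,1)] by (simp add: mdist_commute abs_le_iff)
qed

context reinforced_urn
begin

lemma T_range:
  fixes B :: "nat \<Rightarrow> 'y set"
  shows "T B k \<omega> \<in> {0..1}"
  using emp_lim_bounds by (simp add: T_def sum_nonneg)

lemma incseq_T: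
  fixes B :: "nat \<Rightarrow> 'y set"
  shows "incseq (\<lambda>k. T B k \<omega>)"
  unfolding T_def by (intro incseq_SucI min.mono order_refl) (simp add: emp_lim_bounds)

lemma T_convergent:
  fixes B :: "nat \<Rightarrow> 'y set"
  obtains l where "(\<lambda>k. T B k \<omega>) \<longlonglongrightarrow> l" "l \<in> {0..1}"
proof -
  obtain l where l: "(\<lambda>k. T B k \<omega>) \<longlonglongrightarrow> l"
    using incseq_convergent[OF incseq_T, of B \<omega> 1] T_range by (metis atLeastAtMost_iff)
  moreover have "l \<in> {0..1}" by (rule closed_sequentially[OF closed_atLeastAtMost _ l]) (rule T_range)
  ultimately show thesis by (rule that)
qed

lemma measurable_T: "(\<And>k. 1 \<le> k \<Longrightarrow> B k \<in> sets MY) \<Longrightarrow> T B k \<in> borel_measurable P"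
  unfolding T_def by (intro borel_measurable_min borel_measurable_sum borel_measurable_const measurable_emp_lim) auto

text \<open>An observation lies in at most one of the sets, and the prior probabilities are summable.\<close>

lemma C_null_sequence:
  fixes D :: "nat \<Rightarrow> 'y set"
  assumes D: "\<And>k. D k \<in> sets MY" "disjoint_family D"
  shows "(\<lambda>k. C \<alpha> P n (D k) \<omega>) \<longlonglongrightarrow> 0"
proof -
  have ind: "(\<lambda>k. indicator (D k) y :: real) \<longlonglongrightarrow> 0" for y
  proof -
    have "\<exists>j. \<forall>k\<ge>j. y \<notin> D k"
    proof (cases "\<exists>j. y \<in> D j")
      case True
      then obtain j where j: "y \<in> D j" by blast
      have "y \<notin> D k" if "k \<ge> Suc j" for k
        using disjoint_family_onD[OF D(2), of j k] j that by auto
      then show ?thesis by blast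
    qed blast
    then have "eventually (\<lambda>k. indicator (D k) y = (0::real)) sequentially"
      unfolding eventually_sequentially indicator_eq_0_iff .
    then show ?thesis by (rule tendsto_eventually)
  qed
  have p: "(\<lambda>k. prior (D k)) \<longlonglongrightarrow> 0"
    by (rule summable_LIMSEQ_zero[OF sums_summable[OF prior_sums[OF D]]])
  have "(\<lambda>k. C \<alpha> P n (D k) \<omega>) \<longlonglongrightarrow> sqrt (real n) * ((\<Sum>i=1..n. 0) * inverse (real n)
      - (\<alpha> * 0 + (\<Sum>i=1..n. Z i \<omega> * 0)) * inverse (\<alpha> + (\<Sum>i=1..n. Z i \<omega>)))"
    unfolding C_def emp_def pred_def divide_inverse
    by (intro tendsto_mult tendsto_diff tendsto_add tendsto_sum tendsto_const ind p)
  then show ?thesis by simp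
qed

lemma C_moment:
  assumes "B \<in> sets MY"
  shows "integrable P (C \<alpha> P n B)" and "integrable P (\<lambda>\<omega>. (C \<alpha> P n B \<omega>)\<^sup>2)"
    and "(\<integral>\<omega>. \<bar>C \<alpha> P n B \<omega>\<bar> \<partial>P) \<le> sqrt ((1 + b / a)\<^sup>2 * prior B)"
proof -
  show i: "integrable P (C \<alpha> P n B)"
    by (rule bounded_integrable[OF measurable_C[OF assms] C_bound])
  have "\<bar>(C \<alpha> P n B \<omega>)\<^sup>2\<bar> \<le> real n" if "\<omega> \<in> space P" for \<omega>
    using power_mono[OF C_bound[OF that, of n B], of 2] by simp
  then show i2: "integrable P (\<lambda>\<omega>. (C \<alpha> P n B \<omega>)\<^sup>2)"
    using measurable_C[OF assms] by (intro bounded_integrable borel_measurable_power) auto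
  show "(\<integral>\<omega>. \<bar>C \<alpha> P n B \<omega>\<bar> \<partial>P) \<le> sqrt ((1 + b / a)\<^sup>2 * prior B)"
    by (rule expectation_abs_le_sqrt[OF i i2 expectation_C_squared[OF assms]])
qed

text \<open>The second moments of the \<open>C\<close> are bounded by a multiple of the prior probabilities uniformly in \<open>n\<close>,
  and these are summable.\<close>

lemma C_tails:
  fixes D :: "nat \<Rightarrow> 'y set"
  assumes D: "\<And>k. D k \<in> sets MY" "disjoint_family D" and e: "e > 0"
  shows "\<exists>K. \<forall>n. \<exists>S. integrable P S \<and> (\<integral>\<omega>. S \<omega> \<partial>P) \<le> e
      \<and> (\<forall>\<omega>\<in>space P. \<forall>k\<ge>K. \<bar>C \<alpha> P n (D k) \<omega>\<bar> \<le> S \<omega>)"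
proof -
  define c where "c = (1 + b / a)\<^sup>2"
  have "1 + b / a > 0" using a ab by (intro add_pos_pos divide_pos_pos) auto
  then have c: "c > 0" by (simp add: c_def)
  have sm: "summable (\<lambda>k. prior (D k))" by (rule sums_summable[OF prior_sums[OF D]])
  obtain K where K: "\<And>n. n \<ge> K \<Longrightarrow> norm (\<Sum>i. prior (D (i + n))) < e\<^sup>2 / c"
    using suminf_exist_split[OF _ sm, of "e\<^sup>2 / c"] e c by auto
  define p where "p = (\<Sum>i. prior (D (i + K)))"
  have "p \<le> \<bar>p\<bar>" by simp
  also have "\<dots> < e\<^sup>2 / c" using K[OF order_refl] by (simp add: p_def)
  finally have p: "c * p \<le> e\<^sup>2" using c by (simp add: pos_less_divide_eq mult.commute)
  show ?thesis
  proof (intro exI[of _ K] allI)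
    fix n
    define S where "S \<omega> = (SUP k. \<bar>C \<alpha> P n (D (k + K)) \<omega>\<bar>)" for \<omega>
    have bdd: "bdd_above (range (\<lambda>k. \<bar>C \<alpha> P n (D (k + K)) \<omega>\<bar>))" if "\<omega> \<in> space P" for \<omega>
      using C_bound[OF that] by (intro bdd_aboveI2)
    have S_ge: "\<bar>C \<alpha> P n (D k) \<omega>\<bar> \<le> S \<omega>" if "\<omega> \<in> space P" "k \<ge> K" for \<omega> k
      unfolding S_def using cSUP_upper[OF UNIV_I bdd[OF that(1)], of "k - K"] that(2) by simp
    have S0: "0 \<le> S \<omega>" if "\<omega> \<in> space P" for \<omega>
      using S_ge[OF that order_refl] abs_ge_zero order_trans by blast
    have S_le: "S \<omega> \<le> sqrt (real n)" if "\<omega> \<in> space P" for \<omega>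
      unfolding S_def using C_bound[OF that] by (intro cSUP_least) auto
    have Sm: "S \<in> borel_measurable P"
      unfolding S_def using bdd measurable_C[OF D(1)]
      by (intro borel_measurable_cSUP borel_measurable_abs) auto
    have Si: "integrable P S"
      by (rule bounded_integrable[OF Sm, of "sqrt (real n)"]) (use S0 S_le in auto)
    have "(S \<omega>)\<^sup>2 \<le> real n" if "\<omega> \<in> space P" for \<omega>
      using power_mono[OF S_le[OF that] S0[OF that], of 2] by simp
    then have S2i: "integrable P (\<lambda>\<omega>. (S \<omega>)\<^sup>2)"
      using Sm by (intro bounded_integrable borel_measurable_power) auto
    have "(\<integral>\<^sup>+\<omega>. ennreal ((S \<omega>)\<^sup>2) \<partial>P) \<le> ennreal (c * p)"
      unfolding S_def p_def
    proof (rule expectation_sup_squared)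
      show "\<bar>C \<alpha> P n (D (k + K)) \<omega>\<bar> \<le> sqrt (real n)" if "\<omega> \<in> space P" for k \<omega> by (rule C_bound[OF that])
      show "(\<integral>\<omega>. (C \<alpha> P n (D (k + K)) \<omega>)\<^sup>2 \<partial>P) \<le> c * prior (D (k + K))" for k
        unfolding c_def by (rule expectation_C_squared[OF D(1)])
      show "summable (\<lambda>k. prior (D (k + K)))" using sm by (rule summable_ignore_initial_segment)
    qed (use c measurable_C[OF D(1)] in simp_all)
    then have "ennreal (\<integral>\<omega>. (S \<omega>)\<^sup>2 \<partial>P) \<le> ennreal (c * p)"
      by (subst (asm) nn_integral_eq_integral[OF S2i]) simp_all
    also have "\<dots> \<le> ennreal (e\<^sup>2)" using p by (rule ennreal_leI)
    finally have "(\<integral>\<omega>. (S \<omega>)\<^sup>2 \<partial>P) \<le> e\<^sup>2" by simp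
    then have "(\<integral>\<omega>. \<bar>S \<omega>\<bar> \<partial>P) \<le> sqrt (e\<^sup>2)" by (rule expectation_abs_le_sqrt[OF Si S2i])
    moreover have "(\<integral>\<omega>. \<bar>S \<omega>\<bar> \<partial>P) = (\<integral>\<omega>. S \<omega> \<partial>P)"
      by (intro Bochner_Integration.integral_cong refl) (simp add: S0)
    ultimately show "\<exists>S. integrable P S \<and> (\<integral>\<omega>. S \<omega> \<partial>P) \<le> e
      \<and> (\<forall>\<omega>\<in>space P. \<forall>k\<ge>K. \<bar>C \<alpha> P n (D k) \<omega>\<bar> \<le> S \<omega>)"
      using e Si S_ge by (intro exI[of _ S]) auto
  qed
qed

text \<open>The empirical frequencies of disjoint sets have this property at every time.\<close>

lemma AE_sum_emp_lim_le_1: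
  fixes D :: "nat \<Rightarrow> 'y set"
  assumes D: "\<And>k. D k \<in> sets MY" "disjoint_family D"
  shows "AE \<omega> in P. \<forall>K::nat. (\<Sum>k<K. emp_lim (D k) \<omega>) \<le> 1"
proof -
  have "AE \<omega> in P. \<forall>k. (\<lambda>n. emp n (D k) \<omega>) \<longlonglongrightarrow> emp_lim (D k) \<omega>"
    unfolding AE_all_countable using emp_converges[OF D(1)] by blast
  then show ?thesis
  proof eventually_elim
    case (elim \<omega>)
    show ?case
    proof
      fix K :: nat
      have "(\<lambda>n. \<Sum>k<K. emp n (D k) \<omega>) \<longlonglongrightarrow> (\<Sum>k<K. emp_lim (D k) \<omega>)"
        using elim by (intro tendsto_sum) blast
      moreover have "(\<Sum>k<K. emp n (D k) \<omega>) \<le> 1" for n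
      proof -
        have dj: "disjoint_family_on D {..<K}" using D(2) by (auto simp: disjoint_family_on_def)
        have "(\<Sum>k<K. emp n (D k) \<omega>) = emp n (\<Union>k<K. D k) \<omega>"
          unfolding emp_def sum_divide_distrib[symmetric] indicator_UN_disjoint[OF finite_lessThan dj]
          by (subst sum.swap) (rule refl)
        then show ?thesis using emp_bounds(2) by simp
      qed
      ultimately show "(\<Sum>k<K. emp_lim (D k) \<omega>) \<le> 1" by (intro LIMSEQ_le_const2) auto
    qed
  qed
qed

lemma L_Suc:
  fixes B :: "nat \<Rightarrow> 'y set"
  shows "L P B G \<omega> (Suc k) w = sqrt var_weight / mean_weight * (G (T B (Suc k) \<omega>) w - G (T B k \<omega>) w)"
  by (simp add: L_def)

lemma L_null_sequence:
  fixes B :: "nat \<Rightarrow> 'y set"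
  assumes "brownian_bridge Q G" "w \<in> space Q"
  shows "(\<lambda>k. L P B G \<omega> (Suc k) w) \<longlonglongrightarrow> 0"
proof -
  obtain l where l: "(\<lambda>k. T B k \<omega>) \<longlonglongrightarrow> l" "l \<in> {0..1}" by (rule T_convergent)
  have cont: "continuous_on {0..1} (\<lambda>t. G t w)" using assms by (simp add: brownian_bridge_def)
  have lim: "(\<lambda>k. G (T B k \<omega>) w) \<longlonglongrightarrow> G l w"
    by (rule continuous_on_tendsto_compose[OF cont l(1,2)]) (use T_range in auto)
  have "(\<lambda>k. L P B G \<omega> (Suc k) w) \<longlonglongrightarrow> sqrt var_weight / mean_weight * (G l w - G l w)"
    unfolding L_Suc by (intro tendsto_mult tendsto_const tendsto_diff lim LIMSEQ_Suc[OF lim])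
  then show ?thesis by simp
qed

lemma measurable_L:
  assumes B: "\<And>k. 1 \<le> k \<Longrightarrow> B k \<in> sets MY" and "bridge Q G"
  shows "(\<lambda>x. L P B G (fst x) (Suc k) (snd x)) \<in> borel_measurable (P \<Otimes>\<^sub>M Q)"
proof -
  interpret Q: bridge Q G by fact
  have "(\<lambda>x. G (T B k (fst x)) (snd x)) \<in> borel_measurable (P \<Otimes>\<^sub>M Q)" for k
    by (rule Q.jointly_measurable_bridge[OF measurable_T[OF B] T_range])
  then show ?thesis
    unfolding L_Suc by (intro borel_measurable_times borel_measurable_diff borel_measurable_const)
qed

lemma measurable_L_section:
  fixes B :: "nat \<Rightarrow> 'y set"
  assumes "bridge Q G"
  shows "(\<lambda>w. L P B G \<omega> (Suc k) w) \<in> borel_measurable Q"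
proof -
  interpret Q: bridge Q G by fact
  show ?thesis
    unfolding L_Suc
    by (intro borel_measurable_times borel_measurable_diff borel_measurable_const Q.measurable_bridge T_range)
qed

text \<open>Almost surely the limiting frequencies sum to at most 1, so the truncation in \<open>T\<close> is void, the time
  increments are the limiting frequencies themselves, and the variance of the Gaussian combination is
  the \<open>spread\<close> times \<open>var_weight / mean_weight^2\<close>.\<close>

lemma L_waves:
  fixes t :: "nat \<Rightarrow> real"
  assumes B: "\<And>k. 1 \<le> k \<Longrightarrow> B k \<in> sets MY" "disjoint_family_on B {1..}" and "bridge Q G"
  shows "AE \<omega> in P. (\<integral>w. cos ((\<Sum>k<K. t k * L P B G \<omega> (Suc k) w) + \<theta>) \<partial>Q)
    = cos \<theta> * exp (- (var_weight * (max 0 (spread (\<lambda>k. B (Suc k)) t K \<omega>) / mean_weight\<^sup>2) / 2))"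
proof -
  interpret Q: bridge Q G by fact
  define D where "D k = B (Suc k)" for k
  define r where "r = sqrt var_weight / mean_weight"
  have r2: "r\<^sup>2 = var_weight / mean_weight\<^sup>2" by (simp add: r_def power_divide)
  have D: "D k \<in> sets MY" "disjoint_family D" for k
    using B by (auto simp: D_def disjoint_family_on_def)
  from AE_sum_emp_lim_le_1[OF D] show ?thesis
  proof eventually_elim
    case (elim \<omega>)
    have T_eq: "T B k \<omega> = (\<Sum>j<k. emp_lim (D j) \<omega>)" for k
      using elim by (simp add: T_def sum.atLeast1_atMost_eq D_def)
    have inc: "T B (Suc k) \<omega> - T B k \<omega> = emp_lim (D k) \<omega>" for k by (simp add: T_eq)
    note wave = Q.increments_cosine[where s = "\<lambda>k. T B k \<omega>", OF T_range incseq_T]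
    have spread: "0 \<le> spread D t K \<omega>" using wave(2)[where c = t and K = K] unfolding inc spread_def .
    have "(\<Sum>k<K. (t k * r)\<^sup>2 * emp_lim (D k) \<omega>) - (\<Sum>k<K. t k * r * emp_lim (D k) \<omega>)\<^sup>2 = r\<^sup>2 * spread D t K \<omega>"
    proof -
      have "(\<Sum>k<K. (t k * r)\<^sup>2 * emp_lim (D k) \<omega>) = r\<^sup>2 * (\<Sum>k<K. (t k)\<^sup>2 * emp_lim (D k) \<omega>)"
        unfolding sum_distrib_left by (intro sum.cong refl) (simp add: power_mult_distrib)
      moreover have "(\<Sum>k<K. t k * r * emp_lim (D k) \<omega>) = r * (\<Sum>k<K. t k * emp_lim (D k) \<omega>)"
        unfolding sum_distrib_left by (intro sum.cong refl) simp
      ultimately show ?thesis by (simp add: spread_def power_mult_distrib right_diff_distrib)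
    qed
    moreover have "t k * L P B G \<omega> (Suc k) w = t k * r * (G (T B (Suc k) \<omega>) w - G (T B k \<omega>) w)" for k w
      unfolding L_Suc r_def by simp
    ultimately have "(\<integral>w. cos ((\<Sum>k<K. t k * L P B G \<omega> (Suc k) w) + \<theta>) \<partial>Q)
        = cos \<theta> * exp (- ((r\<^sup>2 * spread D t K \<omega>) / 2))"
      using wave(1)[where c = "\<lambda>k. t k * r" and K = K and \<theta> = \<theta>] by (simp only: inc)
    then show ?case using spread unfolding r2 D_def[abs_def, symmetric] by simp
  qed
qed

lemma cylinder_indexE:
  fixes B :: "nat \<Rightarrow> 'y set"
  assumes "d \<in> cylinders B"
  obtains k where "k \<ge> 1" "inv_into {1..} (\<lambda>k. B k \<times> {0<..}) d = k" "d = B k \<times> {0::real<..}" "fst ` d = B k"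
proof -
  let ?h = "\<lambda>k. B k \<times> {0::real<..}"
  let ?k = "inv_into {1..} ?h d"
  have d: "d \<in> ?h ` {1..}" using assms by (simp add: cylinders_def)
  have k: "?k \<in> {1..}" "?h ?k = d" using inv_into_into[OF d] f_inv_into_f[OF d] by auto
  have "{0::real<..} \<noteq> {}" by (simp add: greaterThan_non_empty)
  then have "fst ` (?h ?k) = B ?k" by simp
  with k show thesis by (intro that[of ?k]) simp_all
qed

text \<open>The sets \<open>B k\<close> are numbered from 1, the coordinates of null sequences from 0.\<close>

abbreviation cylinder_index :: "(nat \<Rightarrow> 'y set) \<Rightarrow> ('y \<times> real) set \<Rightarrow> nat" where
  "cylinder_index B d \<equiv> inv_into {1..} (\<lambda>k. B k \<times> {0<..}) d - 1"

lemma C_proc_eq_reindex: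
  fixes B :: "nat \<Rightarrow> 'y set"
  shows   "C_proc \<alpha> P B n \<omega> = reindex (cylinders B) (cylinder_index B) (\<lambda>k. C \<alpha> P n (B (Suc k)) \<omega>)"
  unfolding C_proc_def reindex_def
proof (rule restrict_ext)
  fix d assume "d \<in> cylinders B"
  then obtain k where "k \<ge> 1" "inv_into {1..} (\<lambda>k. B k \<times> {0<..}) d = k" "fst ` d = B k"
    by (rule cylinder_indexE)
  then show "C \<alpha> P n (fst ` d) \<omega> = C \<alpha> P n (B (Suc (cylinder_index B d))) \<omega>" by simp
qed

lemma L_proc_eq_reindex:
  fixes B :: "nat \<Rightarrow> 'y set"
  shows   "L_proc P B G \<omega> w = reindex (cylinders B) (cylinder_index B) (\<lambda>k. L P B G \<omega> (Suc k) w)"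
  unfolding L_proc_def reindex_def
proof (rule restrict_ext)
  fix d assume "d \<in> cylinders B"
  then obtain k where "k \<ge> 1" "inv_into {1..} (\<lambda>k. B k \<times> {0<..}) d = k"
    by (rule cylinder_indexE)
  then show "L P B G \<omega> (inv_into {1..} (\<lambda>k. B k \<times> {0<..}) d) w
    = L P B G \<omega> (Suc (cylinder_index B d)) w" by simp
qed

lemma cylinders_nonempty:
  fixes B :: "nat \<Rightarrow> 'y set"
  shows "cylinders B \<noteq> {}"
  by (simp add: cylinders_def)

lemma C_proc_stable:
  fixes G :: "real \<Rightarrow> 'w \<Rightarrow> real"
  assumes B: "\<And>k. 1 \<le> k \<Longrightarrow> B k \<in> sets MY" "disjoint_family_on B {1..}" and "bridge Q G"
  shows "stable_conv (linf (cylinders B)) P (C_proc \<alpha> P B) (M_kernel P B Q G)"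
proof -
  interpret Q: bridge Q G by fact
  define D where "D k = B (Suc k)" for k
  define U where "U n \<omega> k = C \<alpha> P n (D k) \<omega>" for n \<omega> k
  define V where "V \<omega> w k = L P B G \<omega> (Suc k) w" for \<omega> w k
  have D: "D k \<in> sets MY" "disjoint_family D" for k
    using B by (auto simp: D_def disjoint_family_on_def)
  have Vm: "(\<lambda>x. V (fst x) (snd x) k) \<in> borel_measurable (P \<Otimes>\<^sub>M Q)" for k
    unfolding V_def by (rule measurable_L[OF B(1) \<open>bridge Q G\<close>])
  have "stable_conv (linf (cylinders B)) P (\<lambda>n \<omega>. reindex (cylinders B) (cylinder_index B) (U n \<omega>))
    (\<lambda>\<omega>. distr Q (metric_borel (linf (cylinders B))) (\<lambda>w. reindex (cylinders B) (cylinder_index B) (V \<omega> w)))"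
  proof (rule stable_conv_linf)
    show "prob_space P" "prob_space Q" by unfold_locales
    show "(\<lambda>\<omega>. U n \<omega> k) \<in> borel_measurable P" for n k
      unfolding U_def by (rule measurable_C[OF D(1)])
    show "U n \<omega> \<longlonglongrightarrow> 0" for n \<omega> unfolding U_def[abs_def] by (rule C_null_sequence[OF D])
    show "V \<omega> w \<longlonglongrightarrow> 0" if "w \<in> space Q" for \<omega> w
      unfolding V_def[abs_def] by (rule L_null_sequence[OF Q.bridge that])
    show "\<exists>c. \<forall>n. integrable P (\<lambda>\<omega>. U n \<omega> k) \<and> (\<integral>\<omega>. \<bar>U n \<omega> k\<bar> \<partial>P) \<le> c" for k
      unfolding U_def using C_moment(1,3)[OF D(1)] by blast
    show "\<exists>K. \<forall>n. \<exists>S. integrable P S \<and> (\<integral>\<omega>. S \<omega> \<partial>P) \<le> e \<and> (\<forall>\<omega>\<in>space P. \<forall>k\<ge>K. \<bar>U n \<omega> k\<bar> \<le> S \<omega>)"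
      if "e > 0" for e
      unfolding U_def by (rule C_tails[OF D that])
    fix H K and t :: "nat \<Rightarrow> real" and \<theta> :: real
    assume H: "H \<in> sets P"
    have "(\<integral>\<omega>. indicator H \<omega> * (\<integral>w. cos ((\<Sum>k<K. t k * V \<omega> w k) + \<theta>) \<partial>Q) \<partial>P)
      = (\<integral>\<omega>. indicator H \<omega> *
          (cos \<theta> * exp (- (var_weight * (max 0 (spread D t K \<omega>) / mean_weight\<^sup>2) / 2))) \<partial>P)"
    proof (rule integral_cong_AE)
      have "(\<lambda>x. cos ((\<Sum>k<K. t k * V (fst x) (snd x) k) + \<theta>)) \<in> borel_measurable (P \<Otimes>\<^sub>M Q)"
        by (rule measurable_compose[OF _ borel_measurable_continuous_onI[OF continuous_on_cos[OF continuous_on_id]]])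
          (intro borel_measurable_add borel_measurable_sum borel_measurable_times borel_measurable_const Vm)
      then have "(\<lambda>\<omega>. \<integral>w. cos ((\<Sum>k<K. t k * V \<omega> w k) + \<theta>) \<partial>Q) \<in> borel_measurable P"
        by (intro Q.borel_measurable_lebesgue_integral) (simp add: case_prod_beta)
      then show "(\<lambda>\<omega>. indicator H \<omega> * (\<integral>w. cos ((\<Sum>k<K. t k * V \<omega> w k) + \<theta>) \<partial>Q)) \<in> borel_measurable P"
        using H by (intro borel_measurable_times borel_measurable_indicator)
      show "(\<lambda>\<omega>. indicator H \<omega> *
          (cos \<theta> * exp (- (var_weight * (max 0 (spread D t K \<omega>) / mean_weight\<^sup>2) / 2)))) \<in> borel_measurable P"
        using H measurable_spread[of D t K, OF D(1)] by simp
      have "AE \<omega> in P. (\<integral>w. cos ((\<Sum>k<K. t k * V \<omega> w k) + \<theta>) \<partial>Q)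
        = cos \<theta> * exp (- (var_weight * (max 0 (spread D t K \<omega>) / mean_weight\<^sup>2) / 2))"
        unfolding V_def D_def[abs_def] by (rule L_waves[OF _ B(2) \<open>bridge Q G\<close>]) (rule B(1))
      then show "AE \<omega> in P. indicator H \<omega> * (\<integral>w. cos ((\<Sum>k<K. t k * V \<omega> w k) + \<theta>) \<partial>Q)
        = indicator H \<omega> *
          (cos \<theta> * exp (- (var_weight * (max 0 (spread D t K \<omega>) / mean_weight\<^sup>2) / 2)))"
        by eventually_elim simp
    qed
    then show "(\<lambda>n. \<integral>\<omega>. indicator H \<omega> * cos ((\<Sum>k<K. t k * U n \<omega> k) + \<theta>) \<partial>P)
        \<longlonglongrightarrow> (\<integral>\<omega>. indicator H \<omega> * (\<integral>w. cos ((\<Sum>k<K. t k * V \<omega> w k) + \<theta>) \<partial>Q) \<partial>P)"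
      unfolding U_def using C_waves[where t = t and K = K and \<theta> = \<theta>, OF D H] by (simp only:)
  qed (rule Vm, rule cylinders_nonempty)
  then show ?thesis
    unfolding U_def V_def D_def C_proc_eq_reindex[symmetric] L_proc_eq_reindex[symmetric] M_kernel_def[abs_def] .
qed

text \<open>The supremum norm is a continuous function of the path, and it maps one kernel to the other.\<close>

lemma C_norm_stable:
  fixes G :: "real \<Rightarrow> 'w \<Rightarrow> real"
  assumes B: "\<And>k. 1 \<le> k \<Longrightarrow> B k \<in> sets MY" "disjoint_family_on B {1..}" and "bridge Q G"
  shows "stable_conv euclidean_metric P (C_norm \<alpha> P B) (N_kernel P B Q G)"
proof -
  interpret Q: bridge Q G by fact
  define \<phi> where "\<phi> x = (SUP d\<in>cylinders B. \<bar>x d\<bar> :: real)" for x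
  have \<phi>: "continuous_map (mtopology_of (linf (cylinders B))) (mtopology_of euclidean_metric) \<phi>"
    unfolding \<phi>_def[abs_def] using continuous_map_sup_norm[OF cylinders_nonempty] by simp
  have \<phi>m: "\<phi> \<in> metric_borel (linf (cylinders B)) \<rightarrow>\<^sub>M borel"
    using \<phi> by (intro borel_measurable_metric_borel) simp
  have Lm: "L_proc P B G \<omega> \<in> Q \<rightarrow>\<^sub>M metric_borel (linf (cylinders B))" for \<omega>
    unfolding L_proc_eq_reindex
    by (rule measurable_reindex)
      (rule measurable_L_section[OF \<open>bridge Q G\<close>], rule L_null_sequence[OF Q.bridge], assumption, rule cylinders_nonempty)
  have fst_cyl: "fst ` (B k \<times> {0::real<..}) = B k" for k
    using greaterThan_non_empty[of "0::real"] by simp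
  have norm_C: "\<phi> (C_proc \<alpha> P B n \<omega>) = C_norm \<alpha> P B n \<omega>" for n \<omega>
    unfolding \<phi>_def C_norm_def cylinders_def image_image
    by (intro SUP_cong refl) (simp add: C_proc_def cylinders_def fst_cyl)
  have "\<phi> (L_proc P B G \<omega> w) = (SUP k\<in>{1..}. \<bar>L P B G \<omega> k w\<bar>)" for \<omega> w
    unfolding \<phi>_def cylinders_def image_image
    by (intro SUP_cong refl) (simp add: L_proc_cylinder[OF B(2)])
  then have kernel: "distr (M_kernel P B Q G \<omega>) (metric_borel euclidean_metric) \<phi> = N_kernel P B Q G \<omega>" for \<omega>
    unfolding M_kernel_def N_kernel_def
    by (subst distr_cong[OF refl sets_metric_borel_euclidean refl], subst distr_distr[OF \<phi>m Lm])
      (simp add: comp_def)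
  show ?thesis
    by (rule stable_conv_cong[OF stable_conv_continuous_image[OF C_proc_stable[OF B \<open>bridge Q G\<close>] prob_space_axioms \<phi>]])
      (assumption, rule norm_C, rule kernel)
qed

end

theorem theorem7:
  fixes MY :: "'y measure" and P :: "(nat \<Rightarrow> 'y \<times> real) measure" and \<alpha> a b :: real
  assumes "prob_space P" and "sets P = sets (traj_space MY)"
    and "\<alpha> > 0"
    and "\<And>n B. n \<ge> 1 \<Longrightarrow> B \<in> sets MY \<Longrightarrow>
      AE \<omega> in P. real_cond_exp P (past MY n) (\<lambda>\<omega>. indicator B (Y (Suc n) \<omega>)) \<omega> = pred \<alpha> P n B \<omega>"
    and "\<And>n A. A \<in> sets (restrict_space borel {0<..}) \<Longrightarrow>
      AE \<omega> in P. real_cond_exp P (past_Y MY n) (\<lambda>\<omega>. indicator A (Z (Suc n) \<omega>)) \<omega>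
                 = measure P {\<omega>\<in>space P. Z 1 \<omega> \<in> A}"
    and "0 < a" and "a < b" and "AE \<omega> in P. a \<le> Z 1 \<omega> \<and> Z 1 \<omega> \<le> b"
  shows "(\<exists>c::real. \<forall>B. (\<forall>k\<ge>1. B k \<in> sets MY) \<and> disjoint_family_on B {1..} \<longrightarrow>
            (SUP n\<in>{1..}. \<integral>\<^sup>+\<omega>. ennreal ((W_norm B n \<omega>)\<^sup>2) \<partial>P)
              \<le> ennreal (c * sqrt (measure P {\<omega>\<in>space P. Y 1 \<omega> \<in> (\<Union>k\<in>{1..}. B k)})))
       \<and> (\<forall>B (P0 :: 'w measure) G. (\<forall>k\<ge>1. B k \<in> sets MY) \<and> disjoint_family_on B {1..} \<and>
            prob_space P0 \<and> brownian_bridge P0 G \<longrightarrow>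
            stable_conv (linf (cylinders B)) P (C_proc \<alpha> P B) (M_kernel P B P0 G) \<and>
            stable_conv euclidean_metric P (C_norm \<alpha> P B) (N_kernel P B P0 G))"
proof -
  interpret reinforced_urn P MY \<alpha> a b
    by (intro reinforced_urn.intro reinforced_urn_axioms.intro assms)
  show ?thesis
  proof (intro conjI exI[of _ rate] allI impI; elim conjE)
    fix B :: "nat \<Rightarrow> 'y set"
    assume B: "\<forall>k\<ge>1. B k \<in> sets MY" "disjoint_family_on B {1..}"
    define p where "p = measure P {\<omega>\<in>space P. Y 1 \<omega> \<in> (\<Union>k\<in>{1..}. B k)}"
    have p: "0 \<le> p" "p \<le> 1" by (simp_all add: p_def)
    \<comment> \<open>the bound proportional to \<open>p\<close> is stronger, since a probability is at most its square root\<close>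
    have "p * p \<le> 1 * p" using p by (intro mult_right_mono)
    then have "p \<le> sqrt p" by (intro real_le_rsqrt) (simp add: power2_eq_square)
    then have le: "rate * p \<le> rate * sqrt p" using rate_pos by (intro mult_left_mono) auto
    show "(SUP n\<in>{1..}. \<integral>\<^sup>+\<omega>. ennreal ((W_norm B n \<omega>)\<^sup>2) \<partial>P)
        \<le> ennreal (rate * sqrt (measure P {\<omega>\<in>space P. Y 1 \<omega> \<in> (\<Union>k\<in>{1..}. B k)}))"
      unfolding p_def[symmetric]
    proof (rule SUP_least)
      fix n :: nat assume n: "n \<in> {1..}"
      have "(\<integral>\<^sup>+\<omega>. ennreal ((W_norm B n \<omega>)\<^sup>2) \<partial>P) \<le> ennreal (rate * p)"
        unfolding p_def using B n by (intro W_norm_second_moment) auto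
      also have "\<dots> \<le> ennreal (rate * sqrt p)" by (rule ennreal_leI[OF le])
      finally show "(\<integral>\<^sup>+\<omega>. ennreal ((W_norm B n \<omega>)\<^sup>2) \<partial>P) \<le> ennreal (rate * sqrt p)" .
    qed
  next
    fix B :: "nat \<Rightarrow> 'y set" and P0 :: "'w measure" and G
    assume B: "\<forall>k\<ge>1. B k \<in> sets MY" "disjoint_family_on B {1..}" and "prob_space P0" "brownian_bridge P0 G"
    then have "bridge P0 G" by (intro bridge.intro bridge_axioms.intro)
    then show "stable_conv (linf (cylinders B)) P (C_proc \<alpha> P B) (M_kernel P B P0 G)"
      using B by (intro C_proc_stable) auto
  next
    fix B :: "nat \<Rightarrow> 'y set" and P0 :: "'w measure" and G
    assume B: "\<forall>k\<ge>1. B k \<in> sets MY" "disjoint_family_on B {1..}" and "prob_space P0" "brownian_bridge P0 G"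
    then have "bridge P0 G" by (intro bridge.intro bridge_axioms.intro)
    then show "stable_conv euclidean_metric P (C_norm \<alpha> P B) (N_kernel P B P0 G)"
      using B by (intro C_norm_stable) auto
  qed
qed

end
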